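(* In any model obtained by adding uncountably many Cohen reals to a model of the Continuum Hypothesis, there is a set $X\subseteq\mathbb R$ such that $X$ satisfies $\mathsf S_1(\mathrm T,\Gamma)$ and $\mathsf S_1(\Omega,\Omega)$, but its square $X^2$ does not satisfy $\mathsf U_{\mathrm{fin}}(\mathrm O,\Gamma)$.
   Context: A cover of $X$ is a family $\mathcal U$ with $X=\bigcup\mathcal U$ such that $X$ is not contained in a single member. $\mathrm O(X)$: open covers; $\Omega(X)$: open $\omega$-covers (every finite subset of $X$ lies in some member); $\Gamma(X)$: open $\gamma$-covers (infinite, each point in all but finitely many members); $\mathrm T(X)$: open $\tau$-covers, i.e., open covers $\mathcal U$ such that each point lies in infinitely many members and for all $x,y\in X$, either $x\in U\Rightarrow y\in U$ for all but finitely many $U\in\mathcal U$, or $y\in U\Rightarrow x\in U$ for all but finitely many $U\in\mathcal U$. $\mathsf S_1(\mathscr A,\mathscr B)$: for every sequence $(\mathcal U_n)$ in $\mathscr A(X)$ there are $U_n\in\mathcal U_n$ with $\{U_n:n\in\mathbb N\}\in\mathscr B(X)$. $\mathsf U_{\mathrm{fin}}(\mathrm O,\Gamma)$: for every sequence $(\mathcal U_n)$ of open covers none of which contains a finite subcover, there are finite $\mathcal F_n\subseteq\mathcal U_n$ with $\{\bigcup\mathcal F_n:n\in\mathbb N\}\in\Gamma(X)$. *)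

theory Defs
  imports "HOL-Algebra.Ring"
begin

section \<open>First-order formulas of set theory\<close>

text \<open>Variables are de Bruijn indices.\<close>

datatype fm = Mem nat nat | Eq nat nat | Neg fm | Conj fm fm | All fm

section \<open>Structures for the language of set theory\<close>

text \<open>
  A structure has carrier \<open>U\<close> and membership relation \<open>E\<close>.  Everything in this locale is relativised
  to \<open>U\<close>: a predicate \<open>P\<close> of this locale, instantiated as \<open>set_structure.P U E\<close>, says that \<open>(U, E)\<close>
  satisfies \<open>P\<close>.  Sets, functions, sequences, families and so on are always elements of \<open>U\<close>.
\<close>

locale set_structure =
  fixes U :: "'a set" and E :: "'a \<Rightarrow> 'a \<Rightarrow> bool"
begin

definition ext :: "'a \<Rightarrow> 'a set" where
  "ext x = {z \<in> U. E z x}"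

text \<open>
  The element of \<open>U\<close> with extension \<open>S\<close>, used for set-builder terms.  It is unspecified if no element
  has this extension; in a model of ZFC all instances below denote.
\<close>

definition set_of :: "'a set \<Rightarrow> 'a" where
  "set_of S = (THE x. x \<in> U \<and> ext x = S)"

subsection \<open>The axioms of ZFC\<close>

primrec sat :: "fm \<Rightarrow> (nat \<Rightarrow> 'a) \<Rightarrow> bool" where
  "sat (Mem i j) e \<longleftrightarrow> E (e i) (e j)"
| "sat (Eq i j) e \<longleftrightarrow> e i = e j"
| "sat (Neg p) e \<longleftrightarrow> \<not> sat p e"
| "sat (Conj p q) e \<longleftrightarrow> sat p e \<and> sat q e"
| "sat (All p) e \<longleftrightarrow> (\<forall>x\<in>U. sat p (case_nat x e))"

definition extensionality :: bool where
  "extensionality \<longleftrightarrow> (\<forall>x\<in>U. \<forall>y\<in>U. ext x = ext y \<longrightarrow> x = y)"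

definition foundation :: bool where
  "foundation \<longleftrightarrow> (\<forall>x\<in>U. ext x \<noteq> {} \<longrightarrow> (\<exists>y\<in>ext x. ext y \<inter> ext x = {}))"

definition pairing :: bool where
  "pairing \<longleftrightarrow> (\<forall>x\<in>U. \<forall>y\<in>U. \<exists>z\<in>U. ext z = {x, y})"

definition union_axiom :: bool where
  "union_axiom \<longleftrightarrow> (\<forall>x\<in>U. \<exists>u\<in>U. ext u = (\<Union>y\<in>ext x. ext y))"

definition powerset :: bool where
  "powerset \<longleftrightarrow> (\<forall>x\<in>U. \<exists>p\<in>U. ext p = {y \<in> U. ext y \<subseteq> ext x})"

definition infinity :: bool where
  "infinity \<longleftrightarrow> (\<exists>w\<in>U. (\<exists>z\<in>ext w. ext z = {}) \<and>
     (\<forall>x\<in>ext w. \<exists>y\<in>ext w. ext y = insert x (ext x)))"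

definition choice :: bool where
  "choice \<longleftrightarrow> (\<forall>x\<in>U.
     (\<forall>y\<in>ext x. ext y \<noteq> {}) \<and> (\<forall>y\<in>ext x. \<forall>z\<in>ext x. y \<noteq> z \<longrightarrow> ext y \<inter> ext z = {}) \<longrightarrow>
     (\<exists>c\<in>U. \<forall>y\<in>ext x. \<exists>!z. z \<in> ext c \<inter> ext y))"

text \<open>In the two schemas, the tail \<open>e\<close> of the environment supplies the parameters.\<close>

definition separation :: bool where
  "separation \<longleftrightarrow> (\<forall>\<phi> e. \<forall>a\<in>U. range e \<subseteq> U \<longrightarrow>
     (\<exists>b\<in>U. ext b = {x \<in> ext a. sat \<phi> (case_nat x e)}))"

definition replacement :: bool where
  "replacement \<longleftrightarrow> (\<forall>\<phi> e. \<forall>a\<in>U. range e \<subseteq> U \<and>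
     (\<forall>x\<in>ext a. \<exists>!y. y \<in> U \<and> sat \<phi> (case_nat x (case_nat y e))) \<longrightarrow>
     (\<exists>b\<in>U. ext b = {y \<in> U. \<exists>x\<in>ext a. sat \<phi> (case_nat x (case_nat y e))}))"

definition ZFC :: bool where
  "ZFC \<longleftrightarrow> extensionality \<and> foundation \<and> pairing \<and> union_axiom \<and> powerset \<and> infinity \<and>
     choice \<and> separation \<and> replacement"

subsection \<open>Functions, natural numbers, cardinality\<close>

definition pair :: "'a \<Rightarrow> 'a \<Rightarrow> 'a" where
  "pair x y = set_of {set_of {x}, set_of {x, y}}"

definition times :: "'a \<Rightarrow> 'a \<Rightarrow> 'a" where
  "times A B = set_of {pair x y | x y. x \<in> ext A \<and> y \<in> ext B}"

definition power :: "'a \<Rightarrow> 'a" where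
  "power A = set_of {B \<in> U. ext B \<subseteq> ext A}"

definition is_fun :: "'a \<Rightarrow> 'a \<Rightarrow> 'a \<Rightarrow> bool" where
  "is_fun f A B \<longleftrightarrow> (\<forall>p\<in>ext f. \<exists>x\<in>ext A. \<exists>y\<in>ext B. p = pair x y) \<and>
     (\<forall>x\<in>ext A. \<exists>!y. y \<in> U \<and> pair x y \<in> ext f)"

definition app :: "'a \<Rightarrow> 'a \<Rightarrow> 'a" where
  "app f x = (THE y. y \<in> U \<and> pair x y \<in> ext f)"

definition empty :: "'a" where
  "empty = set_of {}"

definition succ :: "'a \<Rightarrow> 'a" where
  "succ x = set_of (insert x (ext x))"

definition is_inductive :: "'a \<Rightarrow> bool" where
  "is_inductive v \<longleftrightarrow> empty \<in> ext v \<and> (\<forall>x\<in>ext v. succ x \<in> ext v)"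

definition omega :: "'a" where
  "omega = set_of {n \<in> U. \<forall>v\<in>U. is_inductive v \<longrightarrow> n \<in> ext v}"

definition equipotent :: "'a \<Rightarrow> 'a \<Rightarrow> bool" where
  "equipotent A B \<longleftrightarrow> (\<exists>f\<in>U. is_fun f A B \<and> bij_betw (app f) (ext A) (ext B))"

definition fin :: "'a \<Rightarrow> bool" where
  "fin A \<longleftrightarrow> (\<exists>n\<in>ext omega. equipotent A n)"

definition ctbl :: "'a \<Rightarrow> bool" where
  "ctbl A \<longleftrightarrow> (\<exists>f\<in>U. is_fun f A omega \<and> inj_on (app f) (ext A))"

definition CH :: bool where
  "CH \<longleftrightarrow> (\<forall>A\<in>U. ext A \<subseteq> ext (power omega) \<longrightarrow> ctbl A \<or> equipotent A (power omega))"

subsection \<open>Cohen forcing and genericity\<close>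

definition fin_partial_fun :: "'a \<Rightarrow> 'a \<Rightarrow> 'a \<Rightarrow> bool" where
  "fin_partial_fun p D B \<longleftrightarrow> fin p \<and> (\<exists>C\<in>U. ext C \<subseteq> ext D \<and> is_fun p C B)"

text \<open>
  \<open>Fn(I \<times> \<omega>, 2)\<close>, the forcing adding Cohen reals indexed by \<open>I\<close>; \<open>p\<close> is stronger than \<open>q\<close> iff
  \<open>ext q \<subseteq> ext p\<close>.
\<close>

definition cohen_forcing :: "'a \<Rightarrow> 'a" where
  "cohen_forcing I = set_of {p \<in> U. fin_partial_fun p (times I omega) (succ (succ empty))}"

definition dense_in :: "'a \<Rightarrow> 'a \<Rightarrow> bool" where
  "dense_in P D \<longleftrightarrow> ext D \<subseteq> ext P \<and> (\<forall>p\<in>ext P. \<exists>d\<in>ext D. ext p \<subseteq> ext d)"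

text \<open>Here \<open>G\<close> is a subset of \<open>U\<close> that need not be an element of the structure.\<close>

definition generic_filter :: "'a \<Rightarrow> 'a set \<Rightarrow> bool" where
  "generic_filter P G \<longleftrightarrow> G \<subseteq> ext P \<and> G \<noteq> {} \<and>
     (\<forall>p\<in>G. \<forall>q\<in>ext P. ext q \<subseteq> ext p \<longrightarrow> q \<in> G) \<and>
     (\<forall>p\<in>G. \<forall>q\<in>G. \<exists>r\<in>G. ext p \<subseteq> ext r \<and> ext q \<subseteq> ext r) \<and>
     (\<forall>D\<in>U. dense_in P D \<longrightarrow> G \<inter> ext D \<noteq> {})"

subsection \<open>The real line\<close>

definition app2 :: "'a \<Rightarrow> 'a \<Rightarrow> 'a \<Rightarrow> 'a" where
  "app2 f x y = app f (pair x y)"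

definition le :: "'a \<Rightarrow> 'a \<Rightarrow> 'a \<Rightarrow> bool" where
  "le L x y \<longleftrightarrow> pair x y \<in> ext L"

definition less :: "'a \<Rightarrow> 'a \<Rightarrow> 'a \<Rightarrow> bool" where
  "less L x y \<longleftrightarrow> le L x y \<and> x \<noteq> y"

text \<open>
  \<open>R\<close> with addition \<open>A\<close>, multiplication \<open>T\<close> and order \<open>L\<close> is the field of real numbers, i.e. the
  complete ordered field of the structure.  Completeness is about subsets of \<open>R\<close> in the structure.
\<close>

definition real_field :: "'a \<Rightarrow> 'a \<Rightarrow> 'a \<Rightarrow> 'a \<Rightarrow> bool" where
  "real_field R A T L \<longleftrightarrow>
     is_fun A (times R R) R \<and> is_fun T (times R R) R \<and> ext L \<subseteq> ext (times R R) \<and>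
     (\<forall>x\<in>ext R. \<forall>y\<in>ext R. le L x y \<or> le L y x) \<and>
     (\<forall>x\<in>ext R. \<forall>y\<in>ext R. le L x y \<and> le L y x \<longrightarrow> x = y) \<and>
     (\<forall>x\<in>ext R. \<forall>y\<in>ext R. \<forall>z\<in>ext R. le L x y \<and> le L y z \<longrightarrow> le L x z) \<and>
     (\<exists>o'\<in>ext R. \<exists>z'\<in>ext R.
        field \<lparr>carrier = ext R, monoid.mult = app2 T, one = o', zero = z', add = app2 A\<rparr> \<and>
        (\<forall>x\<in>ext R. \<forall>y\<in>ext R. le L z' x \<and> le L z' y \<longrightarrow> le L z' (app2 T x y))) \<and>
     (\<forall>x\<in>ext R. \<forall>y\<in>ext R. \<forall>z\<in>ext R. le L x y \<longrightarrow> le L (app2 A x z) (app2 A y z)) \<and>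
     (\<forall>S\<in>U. ext S \<subseteq> ext R \<and> ext S \<noteq> {} \<and> (\<exists>b\<in>ext R. \<forall>s\<in>ext S. le L s b) \<longrightarrow>
        (\<exists>b\<in>ext R. (\<forall>s\<in>ext S. le L s b) \<and>
           (\<forall>c\<in>ext R. (\<forall>s\<in>ext S. le L s c) \<longrightarrow> le L b c)))"

subsection \<open>Topologies\<close>

definition real_topology :: "'a \<Rightarrow> 'a \<Rightarrow> 'a" where
  "real_topology R L = set_of {V \<in> U. ext V \<subseteq> ext R \<and>
     (\<forall>x\<in>ext V. \<exists>a\<in>ext R. \<exists>b\<in>ext R. less L a x \<and> less L x b \<and>
        (\<forall>y\<in>ext R. less L a y \<and> less L y b \<longrightarrow> y \<in> ext V))}"

definition subspace_topology :: "'a \<Rightarrow> 'a \<Rightarrow> 'a" where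
  "subspace_topology \<tau> X = set_of {V \<in> U. \<exists>W\<in>ext \<tau>. ext V = ext W \<inter> ext X}"

definition square_topology :: "'a \<Rightarrow> 'a \<Rightarrow> 'a" where
  "square_topology X \<tau> = set_of {W \<in> U. ext W \<subseteq> ext (times X X) \<and>
     (\<forall>x y. pair x y \<in> ext W \<and> x \<in> ext X \<and> y \<in> ext X \<longrightarrow>
        (\<exists>A\<in>ext \<tau>. \<exists>B\<in>ext \<tau>. x \<in> ext A \<and> y \<in> ext B \<and> ext (times A B) \<subseteq> ext W))}"

subsection \<open>Covers of a space \<open>X\<close> with topology \<open>\<tau>\<close>\<close>

definition cover :: "'a \<Rightarrow> 'a \<Rightarrow> bool" where
  "cover X C \<longleftrightarrow> ext X = (\<Union>V\<in>ext C. ext V) \<and> \<not> (\<exists>V\<in>ext C. ext X \<subseteq> ext V)"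

definition Op :: "'a \<Rightarrow> 'a \<Rightarrow> 'a set" where
  "Op X \<tau> = {C \<in> U. ext C \<subseteq> ext \<tau> \<and> cover X C}"

definition Omega :: "'a \<Rightarrow> 'a \<Rightarrow> 'a set" where
  "Omega X \<tau> = {C \<in> Op X \<tau>. \<forall>F\<in>U. ext F \<subseteq> ext X \<and> fin F \<longrightarrow> (\<exists>V\<in>ext C. ext F \<subseteq> ext V)}"

definition Gamma :: "'a \<Rightarrow> 'a \<Rightarrow> 'a set" where
  "Gamma X \<tau> = {C \<in> Op X \<tau>. \<not> fin C \<and> (\<forall>x\<in>ext X. fin (set_of {V \<in> ext C. x \<notin> ext V}))}"

definition Tau :: "'a \<Rightarrow> 'a \<Rightarrow> 'a set" where
  "Tau X \<tau> = {C \<in> Op X \<tau>. (\<forall>x\<in>ext X. \<not> fin (set_of {V \<in> ext C. x \<in> ext V})) \<and>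
     (\<forall>x\<in>ext X. \<forall>y\<in>ext X.
        fin (set_of {V \<in> ext C. \<not> (x \<in> ext V \<longrightarrow> y \<in> ext V)}) \<or>
        fin (set_of {V \<in> ext C. \<not> (y \<in> ext V \<longrightarrow> x \<in> ext V)}))}"

subsection \<open>Selection principles\<close>

definition seqs :: "'a set" where
  "seqs = {s \<in> U. \<exists>Y\<in>U. is_fun s omega Y}"

definition S1 :: "'a set \<Rightarrow> 'a set \<Rightarrow> bool" where
  "S1 \<A> \<B> \<longleftrightarrow> (\<forall>s\<in>seqs. (\<forall>n\<in>ext omega. app s n \<in> \<A>) \<longrightarrow>
     (\<exists>t\<in>seqs. (\<forall>n\<in>ext omega. app t n \<in> ext (app s n)) \<and>
        set_of {app t n | n. n \<in> ext omega} \<in> \<B>))"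

definition Ufin_O_Gamma :: "'a \<Rightarrow> 'a \<Rightarrow> bool" where
  "Ufin_O_Gamma X \<tau> \<longleftrightarrow> (\<forall>s\<in>seqs.
     (\<forall>n\<in>ext omega. app s n \<in> Op X \<tau> \<and>
        \<not> (\<exists>F\<in>U. ext F \<subseteq> ext (app s n) \<and> fin F \<and> cover X F)) \<longrightarrow>
     (\<exists>t\<in>seqs. (\<forall>n\<in>ext omega. fin (app t n) \<and> ext (app t n) \<subseteq> ext (app s n)) \<and>
        set_of {set_of (\<Union>V\<in>ext (app t n). ext V) | n. n \<in> ext omega} \<in> Gamma X \<tau>))"

end

section \<open>Generic extensions\<close>

text \<open>
  \<open>N = M[G]\<close> for transitive models: \<open>(N, E)\<close> is well-founded and extensional, that is, up to
  isomorphism (Mostowski collapse) a transitive set with true membership, and \<open>M\<close> is a transitive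
  subset of it.  The elements of \<open>N\<close> are the values \<open>{val \<sigma> | \<sigma> p. p \<in> G \<and> (\<sigma>, p) \<in> \<tau>}\<close> of the names
  \<open>\<tau>\<close> in \<open>M\<close>.  As in Shoenfield's approach, every element of \<open>M\<close> counts as a name, and members that are
  not pairs are ignored.  By well-foundedness and extensionality the function \<open>val\<close> is unique.
\<close>

definition generic_extension :: "('a \<Rightarrow> 'a \<Rightarrow> bool) \<Rightarrow> 'a set \<Rightarrow> 'a set \<Rightarrow> 'a set \<Rightarrow> bool" where
  "generic_extension E M G N \<longleftrightarrow>
     wfp_on N E \<and> set_structure.extensionality N E \<and>
     M \<subseteq> N \<and> (\<forall>x\<in>M. \<forall>y\<in>N. E y x \<longrightarrow> y \<in> M) \<and>
     (\<exists>val. val ` M = N \<and>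
        (\<forall>\<tau>\<in>M. set_structure.ext N E (val \<tau>) =
           {val \<sigma> | \<sigma> p. \<sigma> \<in> M \<and> p \<in> G \<and>
              set_structure.pair M E \<sigma> p \<in> set_structure.ext M E \<tau>}))"

end

theory Submission
  imports Defs "HOL-Library.Nat_Bijection" Complex_Main
begin

text \<open>Under CH the ground model contains a sequence, of length the first uncountable ordinal, of pairs of
  disjoint sets of natural numbers, increasing modulo finite sets and with co-infinite unions.  The finite
  modifications of the two halves form sets \<open>X\<close> and \<open>Y\<close>; at every stage a further step makes one of
  them a gamma-space with respect to the next cover, and lets the union of the pair swallow infinitely
  many intervals \<open>[n, f n]\<close> for the next function \<open>f\<close>.  Every real of the extension is computed
  in the ground model from one Cohen real, and a second Cohen real over it is left; a genericity argument
  therefore preserves both properties, and the second Cohen real makes \<open>X \<union> Y\<close> a solution of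
  \<open>S1(Omega, Omega)\<close>.  For a tau-cover, one of \<open>X\<close> and \<open>Y\<close> is coinitial in the preorder of
  the points, so that a sequence in the cover that converges on it converges on \<open>X \<union> Y\<close>; this
  gives \<open>S1(T, Gamma)\<close>.  In the square, the sets of all \<open>(x, y)\<close> whose symmetric difference omits
  some \<open>i\<close> in \<open>[n, k]\<close> refute \<open>Ufin(O, Gamma)\<close>.\<close>

text \<open>A single gamma-space cannot serve: all its finite powers are again gamma-spaces and
  hence Hurewicz. The failure in the square has to come from two halves that are good separately,
  and it arises from what they do to each other, since a task for one half is met by enlarging the
  other. Two obstacles shape the proof. Separation and replacement are available for first-order
  formulas only, so every set that is formed must be shown definable; the predicates
  \<open>df\<close>, \<open>dt\<close>, \<open>dn\<close> and \<open>dr\<close> reduce this to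
  introduction rules along the syntax. And the covers of the extension are not in the ground model.
  Open sets are therefore replaced by numbers that code clopen sets, a sequence of covers becomes
  one set of natural numbers, and its name becomes a ground-model set of pairs of a number and a
  finite binary string. Indexing positions by strings lets the ground model treat all possible
  covers at once. The reals of a structure are represented by a subfield of the reals of the
  metatheory, so that ordinary analysis applies to them.\<close>

abbreviation "enc \<equiv> prod_encode"

section \<open>Renaming of variables and interleaved environments\<close>

primrec ren :: "(nat \<Rightarrow> nat) \<Rightarrow> fm \<Rightarrow> fm" where
 "ren f (Mem i j) = Mem (f i) (f j)"
| "ren f (Eq i j) = Eq (f i) (f j)"
| "ren f (Neg p) = Neg (ren f p)"
| "ren f (Conj p q) = Conj (ren f p) (ren f q)"
| "ren f (All p) = All (ren (case_nat 0 (\<lambda>i. Suc (f i))) p)"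

lemma (in set_structure) sat_ren: "sat (ren f p) e \<longleftrightarrow> sat p (\<lambda>i. e (f i))"
proof (induction p arbitrary: f e)
 case (All p)
 have "(\<lambda>i. case_nat x e (case_nat 0 (\<lambda>i. Suc (f i)) i)) = case_nat x (\<lambda>i. e (f i))" for x
  by (auto split: nat.split)
 with All show ?case by simp
qed auto

text \<open>Both halves of the interleaving are infinite, so the parameter lists of two formulas can
  be merged by another \<open>mix\<close> without bookkeeping of free variables.\<close>

definition mix :: "(nat \<Rightarrow> 'a) \<Rightarrow> (nat \<Rightarrow> 'a) \<Rightarrow> nat \<Rightarrow> 'a" where
 "mix e c i = (if even i then e (i div 2) else c (i div 2))"

lemma mix_simps [simp]: "mix e c (2 * i) = e i" "mix e c (Suc (2 * i)) = c i"
 by (auto simp: mix_def)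

lemma range_case_nat: "range (case_nat x e) \<subseteq> U \<longleftrightarrow> x \<in> U \<and> range e \<subseteq> U"
 by (auto simp: image_subset_iff split: nat.splits)

lemma range_mix: "range e \<subseteq> U ==> range c \<subseteq> U ==> range (mix e c) \<subseteq> U"
 by (auto simp: mix_def)

text \<open>The axioms are split by use. The generic extension is shown to satisfy those of
  \<open>zc\<close> and \<open>zcc\<close>; replacement, added in \<open>zfc\<close>, gives
  recursion and the well-ordering theorem in the ground model. Foundation appears as
  well-foundedness in the metatheory, which makes the natural numbers of the structure
  standard.\<close>

locale zc = set_structure U E for U :: "'a set" and E :: "'a \<Rightarrow> 'a \<Rightarrow> bool" +
 assumes wf: "wfp_on U E"
  and ext_ax: extensionality and pairing_ax: pairing and union_ax: union_axiom
  and power_ax: powerset and inf_ax: infinity and sep_ax: separation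
begin

section \<open>Definability with parameters\<close>

text \<open>A predicate on environments is definable if some formula expresses it; the environment
 occupies the even variables and the parameters of the formula the odd ones.\<close>

definition df :: "((nat \<Rightarrow> 'a) \<Rightarrow> bool) \<Rightarrow> bool" where
 "df P \<longleftrightarrow> (\<exists>\<phi> c. range c \<subseteq> U \<and> (\<forall>e. range e \<subseteq> U --> P e = sat \<phi> (mix e c)))"

text \<open>A term is represented by its graph: the value sits in slot 0 and the environment is
  shifted by one. A term is then substituted into a predicate by an existential quantifier, as in
  \<open>df_let\<close>.\<close>

definition dt :: "((nat \<Rightarrow> 'a) \<Rightarrow> 'a) \<Rightarrow> bool" where
 "dt t \<longleftrightarrow> (\<forall>e. range e \<subseteq> U --> t e \<in> U) \<and> df (\<lambda>e. e 0 = t (\<lambda>n. e (Suc n)))"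

lemma U_ne: "\<exists>x. x \<in> U"
 using inf_ax by (auto simp: infinity_def)

lemma dfI: "range c \<subseteq> U ==> (\<And>e. range e \<subseteq> U ==> P e = sat \<phi> (mix e c)) ==> df P"
 unfolding df_def by blast

lemma df_cong: "(\<And>e. range e \<subseteq> U ==> P e = Q e) ==> df P = df Q"
 by (simp add: df_def cong: conj_cong)

lemma dt_cong: assumes "\<And>e. range e \<subseteq> U ==> s e = t e" shows "dt s = dt t"
proof -
 have "df (\<lambda>e. e 0 = s (\<lambda>n. e (Suc n))) = df (\<lambda>e. e 0 = t (\<lambda>n. e (Suc n)))"
  by (rule df_cong) (use assms in \<open>simp add: image_subset_iff\<close>)
 with assms show ?thesis by (simp add: dt_def)
qed

lemma df_mem0: "df (\<lambda>e. E (e i) (e j))"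
proof -
 obtain x where "x \<in> U" using U_ne by blast
 then show ?thesis by (intro dfI[where \<phi>="Mem (2*i) (2*j)" and c="\<lambda>_. x"]) auto
qed

lemma df_eq0: "df (\<lambda>e. e i = e j)"
proof -
 obtain x where "x \<in> U" using U_ne by blast
 then show ?thesis by (intro dfI[where \<phi>="Eq (2*i) (2*j)" and c="\<lambda>_. x"]) auto
qed

lemma df_eqc: "a \<in> U ==> df (\<lambda>e. e i = a)"
 by (intro dfI[where \<phi>="Eq (2*i) (Suc (2 * 0))" and c="\<lambda>_. a"]) (auto simp: mix_def)

lemma df_triv: "df (\<lambda>e. Q)"
proof -
 obtain x where x: "x \<in> U" using U_ne by blast
 show ?thesis
 proof (cases Q)
  case True with x show ?thesis by (intro dfI[where \<phi>="Eq 0 0" and c="\<lambda>_. x"]) auto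
 next
  case False with x show ?thesis by (intro dfI[where \<phi>="Neg (Eq 0 0)" and c="\<lambda>_. x"]) auto
 qed
qed

lemma df_neg: "df P ==> df (\<lambda>e. \<not> P e)"
 unfolding df_def by (metis sat.simps(3))

lemma df_conj:
 assumes "df P" "df Q" shows "df (\<lambda>e. P e \<and> Q e)"
proof -
 from assms(1) obtain p c where p: "range c \<subseteq> U" "\<And>e. range e \<subseteq> U ==> P e = sat p (mix e c)"
  unfolding df_def by blast
 from assms(2) obtain q d where q: "range d \<subseteq> U" "\<And>e. range e \<subseteq> U ==> Q e = sat q (mix e d)"
  unfolding df_def by blast
 \<comment> \<open>Odd variables are parameters: number \<open>i\<close> of the \<open>k\<close>-th
   formula moves to place \<open>2 * i + k\<close> of the merged list
   \<open>mix c d\<close>.\<close>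
 let ?f = "\<lambda>k i. if even i then i else Suc (2 * (2 * (i div 2) + k))"
 have 1: "(\<lambda>i. mix e (mix c d) (?f 0 i)) = mix e c" for e :: "nat \<Rightarrow> 'a"
  by (rule ext) (auto simp: mix_def elim!: oddE)
 have 2: "(\<lambda>i. mix e (mix c d) (?f 1 i)) = mix e d" for e :: "nat \<Rightarrow> 'a"
  by (rule ext) (auto simp: mix_def elim!: oddE)
 show ?thesis
  by (rule dfI[where \<phi>="Conj (ren (?f 0) p) (ren (?f 1) q)" and c="mix c d"])
   (use p q in \<open>auto simp only: sat.simps sat_ren 1 2 range_mix\<close>)
qed

lemma df_ren:
 assumes "df P" shows "df (\<lambda>e. P (\<lambda>i. e (f i)))"
proof -
 from assms(1) obtain p c where p: "range c \<subseteq> U" "\<And>e. range e \<subseteq> U ==> P e = sat p (mix e c)"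
  unfolding df_def by blast
 let ?f = "\<lambda>i. if even i then 2 * f (i div 2) else i"
 have 1: "(\<lambda>i. mix e c (?f i)) = mix (\<lambda>i. e (f i)) c" for e :: "nat \<Rightarrow> 'a"
  by (rule ext) (auto simp: mix_def)
 have "P (\<lambda>i. e (f i)) = sat p (mix (\<lambda>i. e (f i)) c)" if "range e \<subseteq> U" for e
  using that by (intro p(2)) auto
 then show ?thesis
  by (intro dfI[where \<phi>="ren ?f p" and c=c]) (use p in \<open>simp_all only: sat_ren 1\<close>)
qed

lemma df_all:
 assumes "df (\<lambda>e. P (\<lambda>n. e (Suc n)) (e 0))" shows "df (\<lambda>e. \<forall>x\<in>U. P e x)"
proof -
 from assms(1) obtain p c where p: "range c \<subseteq> U"
  "\<And>e. range e \<subseteq> U ==> P (\<lambda>n. e (Suc n)) (e 0) = sat p (mix e c)"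
  unfolding df_def by blast
 \<comment> \<open>In \<open>case_nat x (mix e c)\<close> everything is displaced by one place; in
   \<open>mix (case_nat x e) c\<close> the environment is displaced by two and the parameters by
   none. The difference gives \<open>i - 1\<close> for even and \<open>Suc i\<close> for odd
   \<open>i\<close>.\<close>
 let ?f = "\<lambda>i. if i = 0 then 0 else if even i then i - 1 else Suc i"
 have 1: "(\<lambda>i. case_nat x (mix e c) (?f i)) = mix (case_nat x e) c" for e :: "nat \<Rightarrow> 'a" and x
 proof
  fix i show "case_nat x (mix e c) (?f i) = mix (case_nat x e) c i"
   by (cases i) (auto simp: mix_def elim!: oddE)
 qed
 have 2: "P e x = sat p (mix (case_nat x e) c)" if "range e \<subseteq> U" "x \<in> U" for e x
  using that p(2)[of "case_nat x e"] by (auto split: nat.splits simp: image_subset_iff)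
 show ?thesis
  by (rule dfI[where \<phi>="All (ren ?f p)" and c=c])
   (use p in \<open>auto simp only: sat_ren 1 2 sat.simps\<close>)
qed

lemma df_disj: assumes "df P" "df Q" shows "df (\<lambda>e. P e \<or> Q e)"
 using df_neg[OF df_conj[OF df_neg[OF assms(1)] df_neg[OF assms(2)]]] by (simp only: de_Morgan_conj not_not)
lemma df_imp: assumes "df P" "df Q" shows "df (\<lambda>e. P e --> Q e)"
 using df_disj[OF df_neg[OF assms(1)] assms(2)] by (simp only: imp_conv_disj)
lemma df_iff: assumes "df P" "df Q" shows "df (\<lambda>e. P e \<longleftrightarrow> Q e)"
 using df_conj[OF df_imp[OF assms] df_imp[OF assms(2,1)]] by (simp only: iff_conv_conj_imp)
lemma df_ex: assumes "df (\<lambda>e. P (\<lambda>n. e (Suc n)) (e 0))" shows "df (\<lambda>e. \<exists>x\<in>U. P e x)"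
 using df_neg[OF df_all[OF df_neg[OF assms]]] by simp
lemma df_if: assumes "df P" "df Q" "df R" shows "df (\<lambda>e. if P e then Q e else R e)"
 using df_conj[OF df_imp[OF assms(1,2)] df_imp[OF df_neg[OF assms(1)] assms(3)]] by (simp only: if_bool_eq_conj)

lemma df_let:
 assumes t: "dt t" and P: "df (\<lambda>e. P (\<lambda>n. e (Suc n)) (e 0))" shows "df (\<lambda>e. P e (t e))"
proof -
 have "df (\<lambda>e. \<exists>x\<in>U. x = t e \<and> P e x)"
  using t P by (intro df_ex df_conj) (auto simp: dt_def)
 moreover have "(\<exists>x\<in>U. x = t e \<and> P e x) = P e (t e)" if "range e \<subseteq> U" for e
  using t that by (auto simp: dt_def)
 ultimately show ?thesis using df_cong by (metis (no_types, lifting))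
qed

lemma dt_var: "dt (\<lambda>e. e k)"
 by (auto simp: dt_def intro: df_eq0)

lemma dt_const: "a \<in> U ==> dt (\<lambda>e. a)"
 by (auto simp: dt_def intro: df_eqc)

lemma range_shift: "range e \<subseteq> U ==> range (\<lambda>n. e (Suc n)) \<subseteq> U"
 by auto

lemma dt_shift: assumes "dt t" shows "dt (\<lambda>e. t (\<lambda>n. e (Suc n)))"
proof -
 have "df (\<lambda>e. e 0 = t (\<lambda>n. e (Suc (Suc n))))"
  using df_ren[of "\<lambda>e. e 0 = t (\<lambda>n. e (Suc n))" "case_nat 0 (\<lambda>n. Suc (Suc n))"] assms
  by (simp add: dt_def)
 moreover have "t (\<lambda>n. e (Suc n)) \<in> U" if "range e \<subseteq> U" for e
  using assms range_shift[OF that] unfolding dt_def by (elim conjE allE[of _ "\<lambda>n. e (Suc n)"] impE) assumption+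
 ultimately show ?thesis unfolding dt_def by (intro conjI allI impI) assumption+
qed

lemma dt_U: "dt t ==> range e \<subseteq> U ==> t e \<in> U"
 by (auto simp: dt_def)

text \<open>For a new relation it suffices to prove definability on variables; these rules then
  admit arbitrary definable terms as arguments.\<close>

lemma df_lift1: "(\<And>i. df (\<lambda>e. R (e i))) ==> dt s ==> df (\<lambda>e. R (s e))"
 by (rule df_let) auto
lemma df_lift2: "(\<And>i j. df (\<lambda>e. R (e i) (e j))) ==> dt s ==> dt t ==> df (\<lambda>e. R (s e) (t e))"
 apply (rule df_let[of s "\<lambda>e x. R x (t e)"], assumption)
 apply (rule df_let[of "\<lambda>e. t (\<lambda>n. e (Suc n))" "\<lambda>e x. R (e 0) x"], erule dt_shift)
 apply blast
 done
lemma df_lift3: "(\<And>i j k. df (\<lambda>e. R (e i) (e j) (e k))) ==> dt s ==> dt t ==> dt u ==>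
  df (\<lambda>e. R (s e) (t e) (u e))"
 apply (rule df_let[of s "\<lambda>e x. R x (t e) (u e)"], assumption)
 apply (rule df_let[of "\<lambda>e. t (\<lambda>n. e (Suc n))" "\<lambda>e x. R (e 0) x (u (\<lambda>n. e (Suc n)))"], erule dt_shift)
 apply (rule df_let[of "\<lambda>e. u (\<lambda>n. e (Suc (Suc n)))" "\<lambda>e x. R (e (Suc 0)) (e 0) x"])
 apply (drule dt_shift[of u], drule dt_shift, simp)
 apply blast
 done

lemma df_mem: "dt s ==> dt t ==> df (\<lambda>e. E (s e) (t e))"
 by (rule df_lift2[of E]) (rule df_mem0)
lemma df_eq: "dt s ==> dt t ==> df (\<lambda>e. s e = t e)"
 by (rule df_lift2[of "(=)"]) (rule df_eq0)

lemma dt_lift1: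
 assumes "\<And>i. dt (\<lambda>e. f (e i))" "dt s" shows "dt (\<lambda>e. f (s e))"
proof -
 have "df (\<lambda>e. (e 0) = f (s (\<lambda>n. e (Suc n))))"
  by (rule df_lift2[of "\<lambda>x y. x = f y", OF _ dt_var dt_shift[OF assms(2)]])
   (rule df_eq[OF dt_var assms(1)])
 moreover have "f x \<in> U" if "x \<in> U" for x using dt_U[OF assms(1), of "\<lambda>_. x"] that by auto
 ultimately show ?thesis using assms(2) by (auto simp: dt_def)
qed

lemma dt_lift2:
 assumes "\<And>i j. dt (\<lambda>e. f (e i) (e j))" "dt s" "dt t" shows "dt (\<lambda>e. f (s e) (t e))"
proof -
 have "df (\<lambda>e. (e 0) = f (s (\<lambda>n. e (Suc n))) (t (\<lambda>n. e (Suc n))))"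
  by (rule df_lift3[of "\<lambda>x y z. x = f y z", OF _ dt_var dt_shift[OF assms(2)] dt_shift[OF assms(3)]])
   (rule df_eq[OF dt_var assms(1)])
 moreover have "f x y \<in> U" if "x \<in> U" "y \<in> U" for x y
  using dt_U[OF assms(1)[of 0 1], of "case_nat x (\<lambda>_. y)"] that by (auto simp: range_case_nat)
 ultimately show ?thesis using assms(2,3) by (auto simp: dt_def)
qed

lemma in_ext: "x \<in> ext a \<longleftrightarrow> x \<in> U \<and> E x a"
 by (auto simp: ext_def)
lemma ext_U: "ext a \<subseteq> U" "x \<in> ext a ==> x \<in> U"
 by (auto simp: ext_def)

lemma df_in: assumes "dt s" "dt t" shows "df (\<lambda>e. s e \<in> ext (t e))"
proof -
 have "(s e \<in> ext (t e)) = E (s e) (t e)" if "range e \<subseteq> U" for e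
  using dt_U[OF assms(1) that] by (simp add: in_ext)
 then show ?thesis using df_mem[OF assms] by (subst df_cong) assumption+
qed

lemma df_ball: "dt (\<lambda>e. t (\<lambda>n. e (Suc n))) ==> df (\<lambda>e. P (\<lambda>n. e (Suc n)) (e 0)) ==> df (\<lambda>e. \<forall>x\<in>ext (t e). P e x)"
 using df_all[of "\<lambda>e x. E x (t e) --> P e x"]
 by (simp add: ext_def df_imp df_mem dt_var Ball_def imp_conjL)
lemma df_bex: "dt (\<lambda>e. t (\<lambda>n. e (Suc n))) ==> df (\<lambda>e. P (\<lambda>n. e (Suc n)) (e 0)) ==> df (\<lambda>e. \<exists>x\<in>ext (t e). P e x)"
 using df_ex[of "\<lambda>e x. E x (t e) \<and> P e x"]
 by (simp add: ext_def df_conj df_mem dt_var Bex_def conj_ac)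

lemmas dfs0 = df_triv df_neg df_conj df_disj df_imp df_iff df_if df_all df_ex df_ball df_bex df_in df_mem df_eq dt_var dt_const

lemma df_subset: "dt s ==> dt t ==> df (\<lambda>e. ext (s e) \<subseteq> ext (t e))"
 by (rule df_lift2[of "\<lambda>x y. ext x \<subseteq> ext y"]) (unfold subset_iff Ball_def[symmetric], intro dfs0)

section \<open>Sets of the structure\<close>

definition inU :: "'a set \<Rightarrow> bool" where "inU S \<longleftrightarrow> (\<exists>x\<in>U. ext x = S)"

lemma ext_inj: "x \<in> U ==> y \<in> U ==> ext x = ext y ==> x = y"
 using ext_ax by (auto simp: extensionality_def)

lemma set_of_eq: "x \<in> U ==> ext x = S ==> set_of S = x"
 unfolding set_of_def by (rule the_equality) (auto intro: ext_inj)

lemma set_of_U: "inU S ==> set_of S \<in> U" and ext_set_of: "inU S ==> ext (set_of S) = S"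
 by (auto simp: inU_def set_of_eq)

lemma eq_set_of_iff: "inU S ==> x \<in> U ==> x = set_of S \<longleftrightarrow> ext x = S"
 by (rule iffI) (simp add: ext_set_of, rule set_of_eq[symmetric])

lemma inU_ext: "x \<in> U ==> inU (ext x)" and set_of_ext: "x \<in> U ==> set_of (ext x) = x"
 by (auto simp: inU_def set_of_eq)

lemma inU_sub: "inU S ==> S \<subseteq> U" by (auto simp: inU_def ext_def)

lemma sepI:
 assumes "inU A" "df (\<lambda>e. Q (e 0))" shows "inU {x\<in>A. Q x}"
proof -
 obtain a where a: "a \<in> U" "ext a = A" using assms by (auto simp: inU_def)
 obtain p c where p: "range c \<subseteq> U" "\<And>e. range e \<subseteq> U ==> Q (e 0) = sat p (mix e c)"
  using assms(2) unfolding df_def by blast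
 let ?f = "\<lambda>i. if even i then 0 else Suc (i div 2)"
 have "(\<lambda>i. case_nat x c (?f i)) = mix (\<lambda>_. x) c" for x by (auto simp: mix_def fun_eq_iff)
 then have "sat (ren ?f p) (case_nat x c) = Q x" if "x \<in> U" for x
  using p(2)[of "\<lambda>_. x"] that by (simp only: sat_ren) auto
 moreover obtain b where "b \<in> U" "ext b = {x \<in> ext a. sat (ren ?f p) (case_nat x c)}"
  using sep_ax a(1) p(1) unfolding separation_def by blast
 ultimately show ?thesis unfolding inU_def using a by (intro bexI[of _ b]) (auto simp: in_ext)
qed

lemma inU_subI: "inU A ==> S \<subseteq> A ==> df (\<lambda>e. Q (e 0)) ==> (\<And>x. x \<in> A ==> x \<in> S \<longleftrightarrow> Q x) ==> inU S"
 by (rule back_subst[of inU, OF sepI[of A Q]]) auto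

lemma inU_pair: "x \<in> U ==> y \<in> U ==> inU {x, y}"
 using pairing_ax by (auto simp: pairing_def inU_def)

lemma inU_UN: "inU A ==> inU (\<Union>y\<in>A. ext y)"
 using union_ax by (auto simp: union_axiom_def inU_def)

lemma inU_Un: assumes "inU A" "inU B" shows "inU (A \<union> B)"
 using inU_UN[OF inU_pair[OF set_of_U set_of_U], OF assms] by (simp add: ext_set_of assms)

lemma inU_pow: "inU A ==> inU {y \<in> U. ext y \<subseteq> A}"
 using power_ax by (auto simp: powerset_def inU_def)

lemma inU_insert: "x \<in> U ==> inU A ==> inU (insert x A)"
 using inU_Un[OF inU_pair[of x x], of A] by simp

lemma inU_empty: "inU {}"
proof -
 obtain a where "a \<in> U" using U_ne by blast
 from sepI[OF inU_ext[OF this] df_triv[of False]] show ?thesis by simp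
qed

lemma inU_finite: "finite S ==> S \<subseteq> U ==> inU S"
 by (induction S rule: finite_induct) (auto intro: inU_empty inU_insert)

lemma df_inset: "inU B ==> dt s ==> df (\<lambda>e. s e \<in> B)"
 using df_in[of s "\<lambda>e. set_of B"] by (simp add: dt_const set_of_U ext_set_of)

lemma inU_Int: assumes "inU A" "inU B" shows "inU (A \<inter> B)"
 by (rule inU_subI[of A _ "\<lambda>x. x \<in> B"], (rule assms Int_lower1)+) (auto intro: df_inset assms dt_var)

lemma inU_Diff: assumes "inU A" "inU B" shows "inU (A - B)"
 by (rule inU_subI[of A _ "\<lambda>x. \<not> x \<in> B"], (rule assms Diff_subset)+) (auto intro!: df_neg df_inset assms dt_var)

text \<open>A set-builder term is definable because, by extensionality, being its value is a
  first-order condition on members; existence of the set must be supplied for every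
  environment.\<close>

lemma dt_set_of:
 assumes "\<And>e. range e \<subseteq> U ==> inU {x\<in>U. P e x}" "df (\<lambda>e. P (\<lambda>n. e (Suc n)) (e 0))"
 shows "dt (\<lambda>e. set_of {x\<in>U. P e x})"
proof -
 let ?P = "\<lambda>e. (\<forall>z\<in>U. E z (e 0) \<longleftrightarrow> P (\<lambda>n. e (Suc n)) z)"
 have 1: "(e 0 = set_of {x\<in>U. P (\<lambda>n. e (Suc n)) x}) = ?P e" if e: "range e \<subseteq> U" for e
 proof -
  have i: "inU {x\<in>U. P (\<lambda>n. e (Suc n)) x}" using e by (intro assms(1)) auto
  have "(e 0 = set_of {x\<in>U. P (\<lambda>n. e (Suc n)) x}) \<longleftrightarrow> ext (e 0) = {x\<in>U. P (\<lambda>n. e (Suc n)) x}"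
   using e by (intro eq_set_of_iff i) auto
  then show ?thesis by (auto simp: ext_def)
 qed
 have 2: "df (\<lambda>e. P (\<lambda>n. e (Suc (Suc n))) (e 0))"
  using df_ren[OF assms(2), of "case_nat 0 (\<lambda>n. Suc (Suc n))"] by simp
 have "df ?P" by (intro dfs0 2)
 with df_cong[of _ ?P, OF 1] assms(1) show ?thesis by (auto simp: dt_def set_of_U)
qed

lemma dt_set_of_eq:
 assumes "\<And>e. range e \<subseteq> U ==> inU (S e)" "df (\<lambda>e. e 0 \<in> S (\<lambda>n. e (Suc n)))"
 shows "dt (\<lambda>e. set_of (S e))"
proof -
 have "dt (\<lambda>e. set_of {x\<in>U. x \<in> S e})"
 proof (rule dt_set_of)
  fix e :: "nat \<Rightarrow> 'a" assume "range e \<subseteq> U"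
  note * = assms(1)[OF this]
  have "{x\<in>U. x \<in> S e} = S e" using inU_sub[OF *] by auto
  with * show "inU {x\<in>U. x \<in> S e}" by simp
 qed (rule assms(2))
 then show ?thesis
 proof (rule dt_cong[THEN iffD1, rotated])
  fix e :: "nat \<Rightarrow> 'a" assume "range e \<subseteq> U"
  have "{x\<in>U. x \<in> S e} = S e" using inU_sub[OF assms(1)[OF \<open>range e \<subseteq> U\<close>]] by auto
  then show "set_of {x\<in>U. x \<in> S e} = set_of (S e)" by simp
 qed
qed

lemma dt_upair: "dt s ==> dt t ==> dt (\<lambda>e. set_of {s e, t e})"
 by (rule dt_lift2[of "\<lambda>x y. set_of {x, y}"])
  (auto intro!: dt_set_of_eq inU_pair dfs0)

lemma pair_eq: "pair x y = set_of {set_of {x, x}, set_of {x, y}}"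
 by (simp add: pair_def)

lemma dt_pair: "dt s ==> dt t ==> dt (\<lambda>e. pair (s e) (t e))"
 unfolding pair_eq by (intro dt_upair)

lemma inU_single: "x \<in> U ==> inU {x}"
 using inU_pair[of x x] by simp

lemma upair_simps [simp]: "x \<in> U ==> set_of {x} \<in> U" "x \<in> U ==> ext (set_of {x}) = {x}"
 "x \<in> U ==> y \<in> U ==> set_of {x, y} \<in> U" "x \<in> U ==> y \<in> U ==> ext (set_of {x, y}) = {x, y}"
 by (simp_all add: set_of_U ext_set_of inU_pair inU_single)

lemma pair_U: "x \<in> U ==> y \<in> U ==> pair x y \<in> U"
 by (simp add: pair_def)

lemma pair_iff: assumes "x \<in> U" "y \<in> U" "x' \<in> U" "y' \<in> U"
 shows "pair x y = pair x' y' \<longleftrightarrow> x = x' \<and> y = y'"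
proof
 assume *: "pair x y = pair x' y'"
 have 1: "{a, b} = {c, d}" if "set_of {a, b} = set_of {c, d}" "a \<in> U" "b \<in> U" "c \<in> U" "d \<in> U" for a b c d
  using upair_simps(4) that by metis
 have "{set_of {x, x}, set_of {x, y}} = {set_of {x', x'}, set_of {x', y'}}"
  using * assms unfolding pair_eq by (intro 1) auto
 then have "set_of {x, x} = set_of {x', x'} \<and> set_of {x, y} = set_of {x', y'} \<or>
   set_of {x, x} = set_of {x', y'} \<and> set_of {x, y} = set_of {x', x'}"
  by (metis doubleton_eq_iff)
 then have "{x, x} = {x', x'} \<and> {x, y} = {x', y'} \<or> {x, x} = {x', y'} \<and> {x, y} = {x', x'}"
  using 1 assms by metis
 then show "x = x' \<and> y = y'" by (auto simp: doubleton_eq_iff)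
qed simp

lemma inU_times: assumes "inU A" "inU B" shows "inU {pair x y |x y. x \<in> A \<and> y \<in> B}"
proof -
 obtain a b where ab: "a \<in> U" "b \<in> U" "ext a = A" "ext b = B" using assms by (auto simp: inU_def)
 let ?W = "{z\<in>U. ext z \<subseteq> {z\<in>U. ext z \<subseteq> A \<union> B}}"
 have "inU ?W" by (intro inU_pow inU_Un assms)
 then show ?thesis
 proof (rule inU_subI[where Q = "\<lambda>z. \<exists>x\<in>ext a. \<exists>y\<in>ext b. z = pair x y"])
  have "pair x y \<in> ?W" if "x \<in> A" "y \<in> B" for x y
  proof -
   have xy: "x \<in> U" "y \<in> U" using that ab ext_U by blast+
   show ?thesis unfolding pair_def using that xy by auto
  qed
  then show "{pair x y |x y. x \<in> A \<and> y \<in> B} \<subseteq> ?W" by auto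
  show "df (\<lambda>e. \<exists>x\<in>ext a. \<exists>y\<in>ext b. e 0 = pair x y)" by (intro dfs0 dt_pair ab)
 qed (auto simp: ab)
qed

lemma times_U: "a \<in> U ==> b \<in> U ==> times a b \<in> U"
 and ext_times: "a \<in> U ==> b \<in> U ==> ext (times a b) = {pair x y |x y. x \<in> ext a \<and> y \<in> ext b}"
 unfolding times_def by (simp_all add: set_of_U ext_set_of inU_times inU_ext)

lemma power_U: "a \<in> U ==> power a \<in> U" and ext_power: "a \<in> U ==> ext (power a) = {y\<in>U. ext y \<subseteq> ext a}"
 unfolding power_def by (simp_all add: set_of_U ext_set_of inU_pow inU_ext)

lemma empty_U: "empty \<in> U" and ext_empty: "ext empty = {}"
 unfolding empty_def by (simp_all add: set_of_U ext_set_of inU_empty)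

lemma succ_U: "x \<in> U ==> succ x \<in> U" and ext_succ: "x \<in> U ==> ext (succ x) = insert x (ext x)"
 unfolding succ_def by (simp_all add: set_of_U ext_set_of inU_insert inU_ext)

lemma dt_succ: "dt s ==> dt (\<lambda>e. succ (s e))"
 by (rule dt_lift1[of succ])
  (auto simp: succ_def insert_iff intro!: dt_set_of_eq inU_insert inU_ext dfs0)

lemma wf_induct [consumes 1, case_names step]:
 assumes "x \<in> U" and "\<And>x. x \<in> U ==> (\<And>y. y \<in> ext x ==> P y) ==> P x"
 shows "P x"
 using wf assms(1)
proof (rule wfp_on_induct)
 fix x assume "x \<in> U" and "\<And>y. y \<in> U ==> E y x ==> P y"
 then show "P x" by (elim assms(2)) (simp add: in_ext)
qed

lemma mem_irrefl: "x \<notin> ext x"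
proof
 assume "x \<in> ext x"
 moreover from this have "x \<in> U" by (simp add: in_ext)
 then have "x \<notin> ext x" by (induction rule: wf_induct) blast
 ultimately show False by blast
qed

lemma mem_asym: "x \<in> ext y ==> y \<notin> ext x"
proof
 assume *: "x \<in> ext y" "y \<in> ext x"
 then have "x \<in> U" by (simp add: in_ext)
 then have "\<forall>y. x \<in> ext y --> y \<notin> ext x" by (induction rule: wf_induct) blast
 with * show False by blast
qed

subsection \<open>Natural numbers\<close>

primrec num :: "nat \<Rightarrow> 'a" where
 "num 0 = empty" | "num (Suc n) = succ (num n)"

lemma num_U: "num n \<in> U" by (induction n) (auto intro: empty_U succ_U)
lemma ext_num: "ext (num n) = num ` {..<n}"
 by (induction n) (auto simp: ext_empty ext_succ num_U lessThan_Suc)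
lemma num_less: "m < n ==> num m \<in> ext (num n)" by (auto simp: ext_num)
lemma num_inj [simp]: "num m = num n \<longleftrightarrow> m = n"
 by (metis mem_irrefl nat_neq_iff num_less)
lemma num_mem [simp]: "num m \<in> ext (num n) \<longleftrightarrow> m < n"
 by (auto simp: ext_num)
lemma num_E [simp]: "E (num m) (num n) \<longleftrightarrow> m < n"
 using num_mem[of m n] by (simp add: in_ext num_U del: num_mem)

text \<open>Well-foundedness of \<open>E\<close> leaves no nonstandard natural numbers, so the
  \<open>omega\<close> of the structure is enumerated by the natural numbers of the metatheory. All
  later coding relies on this.\<close>

lemma inU_omega: "inU (range num)" and omega_set: "{n \<in> U. \<forall>v\<in>U. is_inductive v --> n \<in> ext v} = range num"
proof -
 have sub: "range num \<subseteq> ext v" if "is_inductive v" for v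
 proof -
  have "num n \<in> ext v" for n using that by (induction n) (auto simp: is_inductive_def)
  then show ?thesis by auto
 qed
 obtain w z where w: "w \<in> U" "z \<in> ext w" "ext z = {}" "\<And>x. x \<in> ext w ==> \<exists>y\<in>ext w. ext y = insert x (ext x)"
  using inf_ax unfolding infinity_def by blast
 have "is_inductive w"
  unfolding is_inductive_def
 proof
  have "z = empty" using w ext_inj empty_U ext_empty ext_U by metis
  with w show "empty \<in> ext w" by simp
  show "\<forall>x\<in>ext w. succ x \<in> ext w"
   using w(4) ext_inj succ_U ext_succ ext_U by metis
 qed
 note w' = this sub[OF this]
 \<comment> \<open>a minimal nonstandard element of a minimal inductive set would be a successor\<close>
 let ?D = "\<lambda>n. n \<in> ext w \<and> (\<forall>v\<in>U. is_inductive v --> n \<in> ext v)"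
 have dfi: "df (\<lambda>e. is_inductive (e 0))" unfolding is_inductive_def
  by (intro dfs0 dt_succ empty_U)
 have "inU {n \<in> ext w. \<forall>v\<in>U. is_inductive v --> n \<in> ext v}"
  by (rule sepI[OF inU_ext[OF w(1)]]) (intro dfs0 dfi)
 then obtain o' where o': "o' \<in> U" "ext o' = {n \<in> ext w. \<forall>v\<in>U. is_inductive v --> n \<in> ext v}"
  by (auto simp: inU_def)
 have io: "is_inductive o'" using w'(1) unfolding is_inductive_def[of o'] o'(2)
  by (auto simp: is_inductive_def)
 have eq: "ext o' = range num"
 proof
  show "range num \<subseteq> ext o'" using sub[OF io] .
  show "ext o' \<subseteq> range num"
  proof
   fix x assume "x \<in> ext o'"
   then have "x \<in> U" by (simp add: in_ext)
   then show "x \<in> range num" using \<open>x \<in> ext o'\<close>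
   proof (induction rule: wf_induct)
    case (step x)
    show ?case
    proof (rule ccontr)
     assume nx: "x \<notin> range num"
     let ?o = "set_of (ext o' - {x, x})"
     have i: "inU (ext o' - {x, x})" by (intro inU_Diff inU_ext o' inU_pair step)
     have "is_inductive ?o"
      unfolding is_inductive_def ext_set_of[OF i]
     proof
      show "empty \<in> ext o' - {x, x}" using io nx by (auto simp: is_inductive_def) (metis num.simps(1) rangeI)
      show "\<forall>y\<in>ext o' - {x, x}. succ y \<in> ext o' - {x, x}"
      proof
       fix y assume y: "y \<in> ext o' - {x, x}"
       then have "y \<in> U" by (simp add: in_ext)
       have "succ y \<noteq> x"
       proof
        assume "succ y = x"
        then have "y \<in> ext x" using ext_succ[OF \<open>y \<in> U\<close>] by auto
        from step.IH[OF this] y have "y \<in> range num" by auto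
        then have "x \<in> range num" using \<open>succ y = x\<close> by (metis num.simps(2) rangeE rangeI)
        with nx show False ..
       qed
       with y io show "succ y \<in> ext o' - {x, x}" by (auto simp: is_inductive_def)
      qed
     qed
     with set_of_U[OF i] have "x \<in> ext ?o" using step.prems o'(2) by auto
     then show False using ext_set_of[OF i] by auto
    qed
   qed
  qed
 qed
 show "inU (range num)" using o'(1) eq by (auto simp: inU_def)
 have "{n \<in> U. \<forall>v\<in>U. is_inductive v --> n \<in> ext v} = ext o'"
  using o' w' w(1) ext_U by auto
 with eq show "{n \<in> U. \<forall>v\<in>U. is_inductive v --> n \<in> ext v} = range num" by simp
qed

lemma omega_U: "omega \<in> U" and ext_omega: "ext omega = range num"
 unfolding omega_def omega_set using inU_omega by (auto simp: set_of_U ext_set_of)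

end

context zc begin

declare num.simps [simp del]

section \<open>Natural numbers and sets of natural numbers as sorts\<close>

text \<open>Decoding is total: \<open>nn\<close> has the default 0, and \<open>rr\<close> keeps only
  the numbers in a set. Quantifiers over numbers and over \<open>RR\<close> thus become quantifiers
  over \<open>U\<close> without side conditions. \<open>RR\<close> consists of the sets of natural
  numbers that the structure knows.\<close>

definition nn :: "'a \<Rightarrow> nat" where "nn a = (if a \<in> range num then inv_into UNIV num a else 0)"
definition RR :: "nat set set" where "RR = {x. inU (num ` x)}"
definition rs :: "nat set \<Rightarrow> 'a" where "rs x = set_of (num ` x)"
definition rr :: "'a \<Rightarrow> nat set" where "rr a = {n. num n \<in> ext a}"

lemma pair_num [simp]: "pair (num m) (num n) = pair (num m') (num n') \<longleftrightarrow> m = m' \<and> n = n'"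
 by (simp add: pair_iff num_U)

lemma inj_num: "inj num" by (simp add: inj_def)
lemma nn_num [simp]: "nn (num n) = n" by (simp add: nn_def inj_num)

lemma rr_RR: "a \<in> U ==> rr a \<in> RR"
proof -
 assume "a \<in> U"
 have "num ` rr a = range num \<inter> ext a" by (auto simp: rr_def)
 with inU_Int[OF inU_omega inU_ext[OF \<open>a \<in> U\<close>]] show ?thesis by (simp add: RR_def)
qed

lemma rs_U: "x \<in> RR ==> rs x \<in> U" and ext_rs: "x \<in> RR ==> ext (rs x) = num ` x"
 by (simp_all add: RR_def rs_def set_of_U ext_set_of)

lemma rr_rs [simp]: "x \<in> RR ==> rr (rs x) = x"
 by (auto simp: rr_def ext_rs)

lemma rs_inj: "x \<in> RR ==> y \<in> RR ==> rs x = rs y \<longleftrightarrow> x = y"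
 by (metis rr_rs)

lemma rs_rr: "a \<in> U ==> ext a \<subseteq> ext omega ==> rs (rr a) = a"
 unfolding rs_def by (rule set_of_eq) (auto simp: rr_def ext_omega)

definition dn :: "((nat \<Rightarrow> 'a) \<Rightarrow> nat) \<Rightarrow> bool" where "dn t = dt (\<lambda>e. num (t e))"
definition dr :: "((nat \<Rightarrow> 'a) \<Rightarrow> nat set) \<Rightarrow> bool" where
 "dr t = ((\<forall>e. range e \<subseteq> U --> t e \<in> RR) \<and> dt (\<lambda>e. rs (t e)))"

lemma dn_var: "dn (\<lambda>e. nn (e k))"
proof -
 have 1: "(e 0 = num (nn (e (Suc k)))) = (if e (Suc k) \<in> ext omega then e 0 = e (Suc k) else e 0 = empty)" for e
  by (auto simp: ext_omega nn_def f_inv_into_f num.simps)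
 have "df (\<lambda>e. e 0 = num (nn (e (Suc k))))"
  unfolding 1 by (intro dfs0 omega_U empty_U)
 then show ?thesis by (simp add: dn_def dt_def num_U)
qed

lemma dn_const: "dn (\<lambda>e. c)" by (simp add: dn_def dt_const num_U)
lemma dr_const: "x \<in> RR ==> dr (\<lambda>e. x)" by (simp add: dr_def dt_const rs_U)
lemma dn_dt: "dn t ==> dt (\<lambda>e. num (t e))" and dr_dt: "dr u ==> dt (\<lambda>e. rs (u e))"
 by (simp_all add: dn_def dr_def)

lemma dr_var: "dr (\<lambda>e. rr (e k))"
proof -
 have "dt (\<lambda>e. set_of (ext omega \<inter> ext (e k)))"
  by (rule dt_set_of_eq) (auto intro!: inU_Int inU_ext omega_U dfs0)
 moreover have "num ` rr (e k) = ext omega \<inter> ext (e k)" for e by (auto simp: rr_def ext_omega)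
 ultimately have "dt (\<lambda>e. rs (rr (e k)))" by (simp add: rs_def)
 then show ?thesis by (simp add: dr_def rr_RR image_subset_iff)
qed

lemma df_alln: assumes "df (\<lambda>e. P (\<lambda>n. e (Suc n)) (nn (e 0)))" shows "df (\<lambda>e. \<forall>n. P e n)"
proof -
 have "(\<forall>n. P e n) = (\<forall>a\<in>U. P e (nn a))" for e by (metis nn_num num_U)
 moreover have "df (\<lambda>e. \<forall>a\<in>U. P e (nn a))" using assms by (rule df_all)
 ultimately show ?thesis by simp
qed

lemma df_exn: assumes "df (\<lambda>e. P (\<lambda>n. e (Suc n)) (nn (e 0)))" shows "df (\<lambda>e. \<exists>n. P e n)"
 using df_neg[OF df_alln[OF df_neg[OF assms]]] by simp

lemma df_allr: assumes "df (\<lambda>e. P (\<lambda>n. e (Suc n)) (rr (e 0)))" shows "df (\<lambda>e. \<forall>x\<in>RR. P e x)"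
proof -
 have "(\<forall>x\<in>RR. P e x) = (\<forall>a\<in>U. P e (rr a))" for e by (metis rr_RR rr_rs rs_U)
 moreover have "df (\<lambda>e. \<forall>a\<in>U. P e (rr a))" using assms by (rule df_all)
 ultimately show ?thesis by simp
qed

lemma df_exr: assumes "df (\<lambda>e. P (\<lambda>n. e (Suc n)) (rr (e 0)))" shows "df (\<lambda>e. \<exists>x\<in>RR. P e x)"
 using df_neg[OF df_allr[OF df_neg[OF assms]]] by simp

lemma df_eqn: "dn s ==> dn t ==> df (\<lambda>e. s e = t e)"
 using df_eq[OF dn_dt dn_dt, of s t] by simp
lemma df_lessn: "dn s ==> dn t ==> df (\<lambda>e. s e < t e)"
 using df_in[OF dn_dt dn_dt, of s t] by simp
lemma df_leqn: "dn s ==> dn t ==> df (\<lambda>e. s e \<le> t e)"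
 using df_neg[OF df_lessn[of t s]] by (simp add: not_less)
lemma df_inr: assumes "dn s" "dr t" shows "df (\<lambda>e. s e \<in> t e)"
proof -
 have "(s e \<in> t e) = (num (s e) \<in> ext (rs (t e)))" if "range e \<subseteq> U" for e
  using assms(2) that by (auto simp: dr_def ext_rs)
 then show ?thesis using df_in[OF dn_dt[OF assms(1)] dr_dt[OF assms(2)]] by (subst df_cong) assumption+
qed
lemma df_eqr: assumes "dr s" "dr t" shows "df (\<lambda>e. s e = t e)"
proof -
 have "(s e = t e) = (rs (s e) = rs (t e))" if "range e \<subseteq> U" for e
  using assms that by (subst rs_inj) (auto simp: dr_def)
 then show ?thesis using df_eq[OF dr_dt[OF assms(1)] dr_dt[OF assms(2)]] by (subst df_cong) assumption+
qed

lemma df_letn: assumes "dn t" "df (\<lambda>e. P (\<lambda>n. e (Suc n)) (nn (e 0)))" shows "df (\<lambda>e. P e (t e))"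
 using df_let[OF dn_dt[OF assms(1)], of "\<lambda>e x. P e (nn x)"] assms(2) by simp
lemma df_letr: assumes "dr t" "df (\<lambda>e. P (\<lambda>n. e (Suc n)) (rr (e 0)))" shows "df (\<lambda>e. P e (t e))"
proof -
 have "df (\<lambda>e. P e (rr (rs (t e))))"
  using df_let[OF dr_dt[OF assms(1)], of "\<lambda>e x. P e (rr x)"] assms(2) by simp
 moreover have "P e (t e) = P e (rr (rs (t e)))" if "range e \<subseteq> U" for e
  using assms(1) that by (simp add: dr_def)
 ultimately show ?thesis by (subst df_cong) assumption+
qed

lemma dn_shift: "dn t ==> dn (\<lambda>e. t (\<lambda>n. e (Suc n)))"
 unfolding dn_def by (rule dt_shift)
lemma dr_shift: "dr t ==> dr (\<lambda>e. t (\<lambda>n. e (Suc n)))"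
 unfolding dr_def by (intro conjI allI impI) (elim conjE allE impE, erule_tac [2] asm_rl, erule range_shift, elim conjE, erule dt_shift)

lemma dnI: "df (\<lambda>e. nn (e 0) = t (\<lambda>n. e (Suc n))) ==> dn t"
proof -
 assume *: "df (\<lambda>e. nn (e 0) = t (\<lambda>n. e (Suc n)))"
 have 1: "(e 0 = num (t (\<lambda>n. e (Suc n)))) = (e 0 \<in> ext omega \<and> nn (e 0) = t (\<lambda>n. e (Suc n)))" for e
  by (auto simp: ext_omega)
 have "df (\<lambda>e. e 0 = num (t (\<lambda>n. e (Suc n))))" unfolding 1 by (intro dfs0 omega_U *)
 then show ?thesis by (simp add: dn_def dt_def num_U)
qed

lemma dn_graph: "dn t ==> df (\<lambda>e. nn (e 0) = t (\<lambda>n. e (Suc n)))"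
 by (intro df_eqn dn_var dn_shift)

lemma dn_lift1: "(\<And>i. dn (\<lambda>e. f (nn (e i)))) ==> dn s ==> dn (\<lambda>e. f (s e))"
 using dt_lift1[of "\<lambda>x. num (f (nn x))", OF _ dn_dt] by (simp add: dn_def)
lemma dn_lift2: "(\<And>i j. dn (\<lambda>e. f (nn (e i)) (nn (e j)))) ==> dn s ==> dn t ==> dn (\<lambda>e. f (s e) (t e))"
 using dt_lift2[of "\<lambda>x y. num (f (nn x) (nn y))", OF _ dn_dt dn_dt] by (simp add: dn_def)
lemma df_lift2n: "(\<And>i j. df (\<lambda>e. R (nn (e i)) (nn (e j)))) ==> dn s ==> dn t ==> df (\<lambda>e. R (s e) (t e))"
 using df_lift2[of "\<lambda>x y. R (nn x) (nn y)", OF _ dn_dt dn_dt] by simp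
lemma df_lift_nr: assumes "\<And>i j. df (\<lambda>e. R (nn (e i)) (rr (e j)))" "dn s" "dr t" shows "df (\<lambda>e. R (s e) (t e))"
 by (rule df_letn[OF assms(2)], rule df_letr[OF dr_shift[OF assms(3)]]) (rule assms(1))

lemma dn_Suc: "dn s ==> dn (\<lambda>e. Suc (s e))"
 using dt_succ[OF dn_dt, of s] by (simp add: dn_def num.simps)

text \<open>Freezes all slots but the first into parameters; this is the form in which separation
  accepts a predicate that depends on a whole environment.\<close>

lemma df_params:
 assumes "df P" "range d \<subseteq> U" shows "df (\<lambda>e. P (case_nat (e 0) d))"
proof -
 from assms(1) obtain p c where p: "range c \<subseteq> U" "\<And>e. range e \<subseteq> U ==> P e = sat p (mix e c)"
  unfolding df_def by blast
 let ?f = "\<lambda>i. if i = 0 then 0 else if even i then 2 * (2 * (i div 2 - 1) + 1) + 1 else 2 * (2 * (i div 2)) + 1"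
 have 1: "(\<lambda>i. mix e (mix c d) (?f i)) = mix (case_nat (e 0) d) c" for e
 proof
  fix i show "mix e (mix c d) (?f i) = mix (case_nat (e 0) d) c i"
  proof (cases "even i")
   case True then obtain k where "i = 2 * k" by (elim evenE)
   then show ?thesis by (cases k) (auto simp: mix_def)
  next
   case False then obtain k where "i = 2 * k + 1" by (elim oddE)
   then show ?thesis by (auto simp: mix_def)
  qed
 qed
 have "P (case_nat (e 0) d) = sat p (mix (case_nat (e 0) d) c)" if "range e \<subseteq> U" for e
  using that assms(2) by (intro p(2)) (auto simp: range_case_nat)
 then show ?thesis
  by (intro dfI[where \<phi>="ren ?f p" and c="mix c d"])
   (use p assms(2) range_mix in \<open>simp_all only: sat_ren 1\<close>)
qed

lemma sepE:
 assumes "df (\<lambda>e. P (\<lambda>n. e (Suc n)) (e 0))" "range e \<subseteq> U" "inU A" shows "inU {x\<in>A. P e x}"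
 using df_params[OF assms(1,2)] by (intro sepI assms(3)) simp

lemma Collect_RR: assumes "df (\<lambda>e. P (nn (e 0)))" shows "{n. P n} \<in> RR"
proof -
 have "num ` {n. P n} = {z \<in> range num. P (nn z)}" by auto
 with sepI[OF inU_omega assms] show ?thesis by (simp add: RR_def)
qed

lemma dr_Collect: assumes "df (\<lambda>e. P (\<lambda>n. e (Suc n)) (nn (e 0)))" shows "dr (\<lambda>e. {n. P e n})"
proof -
 have 1: "num ` {n. P e n} = {z \<in> range num. P e (nn z)}" for e by auto
 have 2: "inU {z \<in> range num. P e (nn z)}" if "range e \<subseteq> U" for e
  by (rule sepE[OF _ that inU_omega, of "\<lambda>e z. P e (nn z)"]) (rule assms)
 have "dt (\<lambda>e. set_of {z \<in> range num. P e (nn z)})"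
 proof (rule dt_set_of_eq[OF 2])
  show "df (\<lambda>e. e 0 \<in> {z \<in> range num. P (\<lambda>n. e (Suc n)) (nn z)})"
   unfolding mem_Collect_eq by (intro dfs0 df_inset inU_omega assms)
 qed
 with 2 show ?thesis by (simp add: dr_def rs_def 1 RR_def)
qed

lemma dn_Least: assumes P: "df (\<lambda>e. P (\<lambda>n. e (Suc n)) (nn (e 0)))" shows "dn (\<lambda>e. LEAST n. P e n)"
proof (rule dnI)
 let ?c = "LEAST n::nat. False"
 have eq: "(m = (LEAST n. P e n)) = (if (\<exists>n. P e n) then P e m \<and> (\<forall>k. k < m --> \<not> P e k) else m = ?c)" for e m
 proof (cases "\<exists>n. P e n")
  case True
  then have "P e (LEAST n. P e n)" by (rule LeastI_ex)
  moreover have "m = (LEAST n. P e n)" if "P e m" "\<forall>k. k < m --> \<not> P e k"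
   using that by (intro Least_equality[symmetric]) (auto simp: not_less[symmetric])
  moreover have "\<forall>k. k < (LEAST n. P e n) --> \<not> P e k" by (blast dest: not_less_Least)
  ultimately have "(m = (LEAST n. P e n)) = (P e m \<and> (\<forall>k. k < m --> \<not> P e k))" by blast
  with True show ?thesis by simp
 next
  case False
  then have "P e = (\<lambda>_. False)" by auto
  then show ?thesis by simp
 qed
 have P2: "df (\<lambda>e. P (\<lambda>n. e (Suc (Suc n))) (nn (e 0)))"
  using df_ren[OF P, of "case_nat 0 (\<lambda>n. Suc (Suc n))"] by simp
 have P3: "df (\<lambda>e. P (\<lambda>n. e (Suc n)) (nn (e 0)))"
  using P by simp
 show "df (\<lambda>e. nn (e 0) = (LEAST n. P (\<lambda>n. e (Suc n)) n))"
  unfolding eq by (intro df_if df_exn df_alln df_conj df_imp df_neg df_lessn df_eqn dn_var dn_const P2 P3)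
qed

text \<open>The recursion is expressed by a finite graph \<open>f\<close> in the structure.
  \<open>K\<close> asks only that a value at \<open>Suc m\<close> stems from some value at
  \<open>m\<close>; induction then determines all values, single-valuedness included.\<close>

lemma dn_rec:
 assumes a: "dn a" and h: "dn (\<lambda>e. h (\<lambda>n. e (Suc (Suc n))) (nn (e (Suc 0))) (nn (e 0)))" and t: "dn t"
 shows "dn (\<lambda>e. rec_nat (a e) (h e) (t e))"
proof (rule dnI)
 define K where "K a h n y f \<longleftrightarrow> (\<forall>z. pair (num 0) (num z) \<in> ext f --> z = a) \<and>
  (\<forall>m. m < n --> (\<forall>z. pair (num (Suc m)) (num z) \<in> ext f --> (\<exists>u. pair (num m) (num u) \<in> ext f \<and> z = h m u))) \<and>
  pair (num n) (num y) \<in> ext f" for a :: nat and h :: "nat \<Rightarrow> nat \<Rightarrow> nat" and n y f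
 have eq: "(y = rec_nat a h n) = (\<exists>f\<in>U. K a h n y f)" for a h n y
 proof
  assume "y = rec_nat a h n"
  let ?S = "(\<lambda>m. pair (num m) (num (rec_nat a h m))) ` {..n}"
  have i: "inU ?S" by (rule inU_finite) (auto intro: pair_U num_U)
  have "K a h n y (set_of ?S)"
   unfolding K_def ext_set_of[OF i]
  proof (intro conjI allI impI)
   fix m z assume "m < n" "pair (num (Suc m)) (num z) \<in> ?S"
   then have "z = h m (rec_nat a h m)" by auto
   then show "\<exists>u. pair (num m) (num u) \<in> ?S \<and> z = h m u" using \<open>m < n\<close>
    by (intro exI[of _ "rec_nat a h m"] conjI image_eqI[of _ _ m]) auto
  qed (use \<open>y = _\<close> in auto)
  with set_of_U[OF i] show "\<exists>f\<in>U. K a h n y f" ..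
 next
  assume "\<exists>f\<in>U. K a h n y f"
  then obtain f where f: "K a h n y f" ..
  have "\<forall>z. pair (num m) (num z) \<in> ext f --> z = rec_nat a h m" if "m \<le> n" for m
   using that
  proof (induction m)
   case 0 with f show ?case by (simp add: K_def)
  next
   case (Suc m)
   show ?case
   proof (intro allI impI)
    fix z assume "pair (num (Suc m)) (num z) \<in> ext f"
    with f Suc.prems obtain u where "pair (num m) (num u) \<in> ext f" "z = h m u"
     unfolding K_def using Suc_le_lessD by blast
    with Suc show "z = rec_nat a h (Suc m)" by simp
   qed
  qed
  with f show "y = rec_nat a h n" by (simp add: K_def)
 qed
 have h': "df (\<lambda>e. nn (e (Suc 0)) = h (\<lambda>n. e (Suc (Suc (Suc (Suc (Suc n)))))) (nn (e (Suc (Suc 0)))) (nn (e 0)))"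
  using df_ren[OF dn_graph[OF h], of "\<lambda>i. if i = 0 then Suc 0 else if i = Suc 0 then 0 else if i = 2 then Suc (Suc 0) else i + 2"]
  by (simp add: numeral_2_eq_2)
 show "df (\<lambda>e. nn (e 0) = rec_nat (a (\<lambda>n. e (Suc n))) (h (\<lambda>n. e (Suc n))) (t (\<lambda>n. e (Suc n))))"
  unfolding eq unfolding K_def
  by (intro df_ex df_exn df_alln df_conj df_imp df_in dt_pair dn_dt df_lessn df_eqn dn_var dn_const dn_Suc dt_var h' 
   dn_shift[OF dn_shift[OF dn_shift[OF a]]] dn_shift[OF dn_shift[OF t]] dn_shift[OF dn_shift[OF dn_shift[OF t]]])
qed

lemma dn_plus: "dn s ==> dn t ==> dn (\<lambda>e. s e + t e)"
proof (rule dn_lift2[of "(+)"])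
 fix i j
 have 1: "m + n = rec_nat m (\<lambda>_ r. Suc r) n" for m n :: nat by (induction n) auto
 show "dn (\<lambda>e. nn (e i) + nn (e j))" unfolding 1 by (intro dn_rec dn_var dn_Suc)
qed

lemma dn_times: "dn s ==> dn t ==> dn (\<lambda>e. s e * t e)"
proof (rule dn_lift2[of "(*)"])
 fix i j
 have 1: "m * n = rec_nat 0 (\<lambda>_ r. r + m) n" for m n :: nat by (induction n) auto
 show "dn (\<lambda>e. nn (e i) * nn (e j))" unfolding 1 by (intro dn_rec dn_var dn_plus dn_const)
qed

lemma dn_power: "dn s ==> dn t ==> dn (\<lambda>e. s e ^ t e)"
proof (rule dn_lift2[of "(^)"])
 fix i j
 have 1: "m ^ n = rec_nat 1 (\<lambda>_ r. r * m) n" for m n :: nat by (induction n) auto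
 show "dn (\<lambda>e. nn (e i) ^ nn (e j))" unfolding 1 by (intro dn_rec dn_var dn_times dn_const)
qed

lemma dn_pe: "dn s ==> dn t ==> dn (\<lambda>e. enc (s e, t e))"
proof (rule dn_lift2[of "\<lambda>x y. enc (x, y)"])
 fix i j
 have 1: "triangle n = rec_nat 0 (\<lambda>n r. r + Suc n) n" for n :: nat by (induction n) auto
 show "dn (\<lambda>e. enc (nn (e i), nn (e j)))"
  unfolding prod_encode_def prod.case 1 by (intro dn_plus dn_rec dn_var dn_const dn_Suc)
qed

lemma dn_p1: "dn s ==> dn (\<lambda>e. fst (prod_decode (s e)))"
proof (rule dn_lift1[of "\<lambda>x. fst (prod_decode x)"])
 fix i
 have 1: "fst (prod_decode k) = (LEAST a. \<exists>b. enc (a, b) = k)" for k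
  by (rule Least_equality[symmetric]) (metis prod_encode_inverse prod_decode_inverse prod.collapse fst_conv order_refl)+
 show "dn (\<lambda>e. fst (prod_decode (nn (e i))))" unfolding 1
  by (intro dn_Least df_exn df_eqn dn_pe dn_var)
qed

lemma dn_p2: "dn s ==> dn (\<lambda>e. snd (prod_decode (s e)))"
proof (rule dn_lift1[of "\<lambda>x. snd (prod_decode x)"])
 fix i
 have 1: "snd (prod_decode k) = (LEAST b. \<exists>a. enc (a, b) = k)" for k
  by (rule Least_equality[symmetric]) (metis prod_encode_inverse prod_decode_inverse prod.collapse snd_conv order_refl)+
 show "dn (\<lambda>e. snd (prod_decode (nn (e i))))" unfolding 1
  by (intro dn_Least df_exn df_eqn dn_pe dn_var)
qed

lemma df_sd: "dn s ==> dn t ==> df (\<lambda>e. s e \<in> set_decode (t e))"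
proof (rule df_lift2n[of "\<lambda>x y. x \<in> set_decode y"])
 fix i j
 \<comment> \<open>Binary digits are expressed by division with remainder, which reduces them to
   sums, products and powers.\<close>
 have 1: "x \<in> set_decode y \<longleftrightarrow> (\<exists>q r. y = Suc (2 * q) * 2 ^ x + r \<and> r < 2 ^ x)" for x y
 proof
  assume "x \<in> set_decode y"
  then obtain q where "y div 2 ^ x = 2 * q + 1" by (auto simp: set_decode_def elim: oddE)
  then show "\<exists>q r. y = Suc (2 * q) * 2 ^ x + r \<and> r < 2 ^ x"
   using div_mult_mod_eq[of y "2 ^ x"] by (intro exI[of _ q] exI[of _ "y mod 2 ^ x"]) simp
 next
  assume "\<exists>q r. y = Suc (2 * q) * 2 ^ x + r \<and> r < 2 ^ x"
  then obtain q r where "y = Suc (2 * q) * 2 ^ x + r" "r < 2 ^ x" by blast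
  then have "y div 2 ^ x = Suc (2 * q)" by (simp del: mult_Suc)
  then show "x \<in> set_decode y" by (simp add: set_decode_def)
 qed
 show "df (\<lambda>e. nn (e i) \<in> set_decode (nn (e j)))"
  unfolding 1 by (intro df_exn df_conj df_eqn df_lessn dn_plus dn_times dn_power dn_Suc dn_var dn_const)
qed

lemmas dfs = dfs0 dt_pair dt_succ df_alln df_exn df_allr df_exr df_eqn df_lessn df_leqn df_inr df_eqr df_sd
 dn_var dn_const dr_var dr_const dn_Suc dn_plus dn_times dn_power dn_pe dn_p1 dn_p2 dn_Least dr_Collect dn_dt dr_dt

section \<open>Functions and choice\<close>

text \<open>\<open>app\<close> is unspecified off the domain and so does not denote a definable
  term; \<open>ap\<close> agrees with it on functions and has the default \<open>empty\<close>
  elsewhere.\<close>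

definition ap :: "'a \<Rightarrow> 'a \<Rightarrow> 'a" where
 "ap f x = (if \<exists>!y. y \<in> U \<and> pair x y \<in> ext f then THE y. y \<in> U \<and> pair x y \<in> ext f else empty)"

lemma ap_eq: "y \<in> U ==> (y = ap f x) = (if (\<exists>y\<in>U. pair x y \<in> ext f \<and> (\<forall>z\<in>U. pair x z \<in> ext f --> z = y))
 then pair x y \<in> ext f else y = empty)"
proof -
 assume y: "y \<in> U"
 have 1: "(\<exists>y\<in>U. pair x y \<in> ext f \<and> (\<forall>z\<in>U. pair x z \<in> ext f --> z = y)) = (\<exists>!y. y \<in> U \<and> pair x y \<in> ext f)"
  by auto
 show ?thesis unfolding 1 ap_def
  by (cases "\<exists>!y. y \<in> U \<and> pair x y \<in> ext f") (use y theI'[of "\<lambda>y. y \<in> U \<and> pair x y \<in> ext f"] in auto)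
qed

lemma ap_U: "ap f x \<in> U"
 unfolding ap_def by (cases "\<exists>!y. y \<in> U \<and> pair x y \<in> ext f")
  (use theI'[of "\<lambda>y. y \<in> U \<and> pair x y \<in> ext f"] in \<open>auto intro: empty_U\<close>)

lemma dt_ap: "dt s ==> dt t ==> dt (\<lambda>e. ap (s e) (t e))"
proof (rule dt_lift2[of ap])
 fix i j
 have "df (\<lambda>e. e 0 = ap (e (Suc i)) (e (Suc j)))"
  by (subst df_cong[OF ap_eq]) (auto intro!: dfs empty_U)
 then show "dt (\<lambda>e. ap (e i) (e j))" by (simp add: dt_def ap_U)
qed

lemma graph_fun0:
 assumes "b \<in> U" "a \<in> U" "inU {pair x (F x) | x. x \<in> ext b}" "\<And>x. x \<in> ext b ==> F x \<in> ext a"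
 shows "\<exists>t\<in>U. is_fun t b a \<and> ext t = {pair x (F x) | x. x \<in> ext b} \<and> (\<forall>x\<in>ext b. app t x = F x \<and> ap t x = F x)"
proof -
 obtain t where t: "t \<in> U" "ext t = {pair x (F x) | x. x \<in> ext b}" using assms(3) by (auto simp: inU_def)
 have FU: "F x \<in> U" if "x \<in> ext b" for x using assms(4)[OF that] ext_U by blast
 have *: "y \<in> U \<and> pair x y \<in> ext t \<longleftrightarrow> y = F x" if "x \<in> ext b" for x y
  using that FU ext_U unfolding t by (auto simp: pair_iff)
 have "is_fun t b a" unfolding is_fun_def
 proof (intro conjI ballI)
  show "\<exists>x\<in>ext b. \<exists>y\<in>ext a. p = pair x y" if "p \<in> ext t" for p using that t assms(4) by auto
  show "\<exists>!y. y \<in> U \<and> pair x y \<in> ext t" if "x \<in> ext b" for x using *[OF that] by simp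
 qed
 moreover have "app t x = F x \<and> ap t x = F x" if "x \<in> ext b" for x
  unfolding app_def ap_def using *[OF that] by simp
 ultimately show ?thesis using t by blast
qed

lemma graph_fun:
 assumes "b \<in> U" "a \<in> U" "df (\<lambda>e. e 0 = F (e (Suc 0)))" "\<And>x. x \<in> ext b ==> F x \<in> ext a"
 shows "\<exists>t\<in>U. is_fun t b a \<and> ext t = {pair x (F x) | x. x \<in> ext b} \<and> (\<forall>x\<in>ext b. app t x = F x \<and> ap t x = F x)"
proof -
 have i: "inU {pair x (F x) | x. x \<in> ext b}"
 proof (rule inU_subI[OF inU_ext[OF times_U[OF assms(1,2)]], where Q="\<lambda>z. \<exists>x\<in>ext b. \<exists>y\<in>U. y = F x \<and> z = pair x y"])
  show "df (\<lambda>e. \<exists>x\<in>ext b. \<exists>y\<in>U. y = F x \<and> e 0 = pair x y)"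
   by (intro dfs assms(1,3))
 qed (use assms ext_U in \<open>auto simp: ext_times\<close>)
 show ?thesis by (rule graph_fun0[OF assms(1,2) i]) (rule assms(4))
qed

lemma is_fun_ap: "is_fun f a b ==> x \<in> ext a ==> b \<in> U ==> app f x = ap f x \<and> ap f x \<in> ext b \<and> pair x (ap f x) \<in> ext f"
proof -
 assume f: "is_fun f a b" "x \<in> ext a" "b \<in> U"
 then have ex: "\<exists>!y. y \<in> U \<and> pair x y \<in> ext f" by (auto simp: is_fun_def)
 then have 1: "app f x = ap f x" by (simp add: app_def ap_def)
 have 2: "app f x \<in> U \<and> pair x (app f x) \<in> ext f" unfolding app_def by (rule theI'[OF ex])
 then obtain x' y' where "x' \<in> ext a" "y' \<in> ext b" "pair x (app f x) = pair x' y'" using f unfolding is_fun_def by blast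
 moreover have "x \<in> U" using f(2) ext_U by blast
 moreover have "x' \<in> U" "y' \<in> U" using \<open>x' \<in> ext a\<close> \<open>y' \<in> ext b\<close> ext_U by blast+
 ultimately have "app f x = y'" using 2 pair_iff[of x "app f x" x' y'] by blast
 with 1 2 \<open>y' \<in> ext b\<close> show ?thesis by simp
qed

text \<open>Finiteness in the metatheory is first-order here, since finite subsets of
  \<open>U\<close> are extensions and an injection of a finite set into a number is itself
  finite.\<close>

lemma df_finite: "dt s ==> df (\<lambda>e. finite (ext (s e)))"
proof (rule df_lift1[of "\<lambda>x. finite (ext x)"])
 fix i
 have eq: "finite (ext a) = (\<exists>n. \<exists>f\<in>U. \<forall>x\<in>ext a. \<exists>k. k < n \<and> pair x (num k) \<in> ext f \<and>
   (\<forall>y\<in>ext a. pair y (num k) \<in> ext f --> y = x))" for a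
 proof
  assume "finite (ext a)"
  then obtain h :: "'a \<Rightarrow> nat" and n where h: "h ` ext a = {i. i < n}" "inj_on h (ext a)"
   using finite_imp_inj_to_nat_seg[OF \<open>finite (ext a)\<close>] by blast
  let ?S = "(\<lambda>x. pair x (num (h x))) ` ext a"
  have "?S \<subseteq> U" using pair_U num_U ext_U(2) by (simp add: image_subset_iff)
  then have i: "inU ?S" using \<open>finite (ext a)\<close> by (intro inU_finite) simp_all
  show "\<exists>n. \<exists>f\<in>U. \<forall>x\<in>ext a. \<exists>k. k < n \<and> pair x (num k) \<in> ext f \<and>
   (\<forall>y\<in>ext a. pair y (num k) \<in> ext f --> y = x)"
  proof (rule exI[of _ n], rule bexI[OF _ set_of_U[OF i]], rule ballI)
   fix x assume x: "x \<in> ext a"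
   show "\<exists>k. k < n \<and> pair x (num k) \<in> ext (set_of ?S) \<and> (\<forall>y\<in>ext a. pair y (num k) \<in> ext (set_of ?S) --> y = x)"
    unfolding ext_set_of[OF i]
   proof (intro exI[of _ "h x"] conjI ballI impI)
    show "h x < n" using h(1) x by auto
    fix y assume y: "y \<in> ext a" "pair y (num (h x)) \<in> ?S"
    then obtain z where z: "z \<in> ext a" "pair y (num (h x)) = pair z (num (h z))" by blast
    then have "y = z" "h x = h z" using y ext_U by (auto simp: pair_iff num_U subset_iff)
    with inj_onD[OF h(2), of x z] x z show "y = x" by simp
   qed (use x in blast)
  qed
 next
  assume "\<exists>n. \<exists>f\<in>U. \<forall>x\<in>ext a. \<exists>k. k < n \<and> pair x (num k) \<in> ext f \<and>
   (\<forall>y\<in>ext a. pair y (num k) \<in> ext f --> y = x)"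
  then obtain n f where "\<forall>x\<in>ext a. \<exists>k. k < n \<and> pair x (num k) \<in> ext f \<and> (\<forall>y\<in>ext a. pair y (num k) \<in> ext f --> y = x)"
   by blast
  then obtain k where k: "\<And>x. x \<in> ext a ==> k x < n \<and> pair x (num (k x)) \<in> ext f \<and> (\<forall>y\<in>ext a. pair y (num (k x)) \<in> ext f --> y = x)"
   by metis
  then have "inj_on k (ext a)" by (intro inj_onI) metis
  moreover have "k ` ext a \<subseteq> {..<n}" using k by blast
  then have "finite (k ` ext a)" using finite_lessThan finite_subset by blast
  ultimately show "finite (ext a)" by (metis finite_imageD)
 qed
 show "df (\<lambda>e. finite (ext (e i)))" unfolding eq by (intro dfs)
qed

lemma fin_iff: assumes "a \<in> U" shows "fin a \<longleftrightarrow> finite (ext a)"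
proof
 assume "fin a"
 then obtain n f where "bij_betw (app f) (ext a) (ext (num n))" unfolding fin_def equipotent_def ext_omega by blast
 then show "finite (ext a)" using bij_betw_finite by (fastforce simp: ext_num)
next
 assume f: "finite (ext a)"
 then obtain h :: "'a \<Rightarrow> nat" and n where h: "h ` ext a = {i. i < n}" "inj_on h (ext a)"
  using finite_imp_inj_to_nat_seg[OF f] by blast
 have "inU ((\<lambda>x. pair x (num (h x))) ` ext a)"
  using f ext_U by (intro inU_finite) (auto intro!: pair_U num_U)
 then have "inU {pair x (num (h x)) | x. x \<in> ext a}" by (simp add: Setcompr_eq_image)
 note ** = graph_fun0[OF assms num_U this, of n]
 obtain t where t: "t \<in> U" "is_fun t a (num n)" "\<forall>x\<in>ext a. app t x = num (h x)"
 proof -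
  assume *: "\<And>t. t \<in> U ==> is_fun t a (num n) ==> \<forall>x\<in>ext a. app t x = num (h x) ==> thesis"
  have "num (h x) \<in> ext (num n)" if "x \<in> ext a" for x using that h(1) by auto
  with ** obtain t where "t \<in> U" "is_fun t a (num n)" "\<forall>x\<in>ext a. app t x = num (h x) \<and> ap t x = num (h x)" by blast
  then show thesis by (intro *) auto
 qed
 have "bij_betw (\<lambda>x. num (h x)) (ext a) (ext (num n))"
 proof -
  have "(\<lambda>x. num (h x)) ` ext a = num ` h ` ext a" by (simp add: image_image)
  with h show ?thesis unfolding ext_num bij_betw_def lessThan_def by (simp add: inj_on_def)
 qed
 then have "bij_betw (app t) (ext a) (ext (num n))"
  using t(3) by (subst bij_betw_cong[of _ _ "\<lambda>x. num (h x)"]) auto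
 with t show "fin a" unfolding fin_def equipotent_def ext_omega by blast
qed

end

locale zcc = zc U E for U :: "'a set" and E :: "'a \<Rightarrow> 'a \<Rightarrow> bool" +
 assumes choice_ax: choice
begin

text \<open>The choice axiom is stated for disjoint families of nonempty sets. Replacing the fibre
  of \<open>R\<close> over \<open>x\<close> by the set \<open>S x\<close> of pairs with first
  component \<open>x\<close> makes the fibres disjoint, and the selector becomes a function.\<close>

lemma AC:
 assumes b: "b \<in> U" and a: "a \<in> U" and R: "df (\<lambda>e. R (e 0) (e (Suc 0)))"
  and ex: "\<And>x. x \<in> ext b ==> \<exists>y\<in>ext a. R x y"
 shows "\<exists>t\<in>U. is_fun t b a \<and> (\<forall>x\<in>ext b. ap t x \<in> ext a \<and> R x (ap t x) \<and> app t x = ap t x)"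
proof -
 define S where "S x = {pair x y | y. y \<in> ext a \<and> R x y}" for x
 have R1: "df (\<lambda>e. R (e (Suc i)) (e 0))" for i
  using df_ren[OF R, of "case_nat (Suc i) (\<lambda>_. 0)"] by simp
 have Si: "inU (S x)" if "x \<in> ext b" for x
  unfolding S_def
 proof (rule inU_subI[OF inU_ext[OF times_U[OF b a]], where Q="\<lambda>z. \<exists>y\<in>ext a. z = pair x y \<and> R x y"])
  have "x \<in> U" using that ext_U by blast
  have "df (\<lambda>e. R x (e 0))"
   using df_let[OF dt_const[OF \<open>x \<in> U\<close>], of "\<lambda>e z. R z (e 0)"] df_ren[OF R, of "case_nat 0 (\<lambda>_. Suc 0)"] by simp
  then show "df (\<lambda>e. \<exists>y\<in>ext a. e 0 = pair x y \<and> R x y)"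
   by (intro dfs a \<open>x \<in> U\<close>)
 qed (use that b a in \<open>auto simp: ext_times\<close>)
 let ?F = "{z. \<exists>x\<in>ext b. z = set_of (S x)}"
 have "inU ?F"
 proof (rule inU_subI[OF inU_ext[OF power_U[OF times_U[OF b a]]], where Q = "\<lambda>z. \<exists>x\<in>ext b. \<forall>p\<in>U. E p z \<longleftrightarrow> (\<exists>y\<in>ext a. p = pair x y \<and> R x y)"])
  show "?F \<subseteq> ext (power (times b a))"
  proof
   fix z assume "z \<in> ?F"
   then obtain x where x: "x \<in> ext b" "z = set_of (S x)" by blast
   have "S x \<subseteq> ext (times b a)" using x(1) by (auto simp: ext_times b a S_def)
   then show "z \<in> ext (power (times b a))"
    using Si[OF x(1)] by (simp add: x(2) ext_power times_U b a ext_set_of set_of_U)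
  qed
  show "df (\<lambda>e. \<exists>x\<in>ext b. \<forall>p\<in>U. E p (e 0) \<longleftrightarrow> (\<exists>y\<in>ext a. p = pair x y \<and> R x y))"
   by (intro dfs a b R1)
  fix z assume "z \<in> ext (power (times b a))"
  then have z: "z \<in> U" using ext_U by blast
  have "(z = set_of (S x)) = (\<forall>p\<in>U. E p z \<longleftrightarrow> (\<exists>y\<in>ext a. p = pair x y \<and> R x y))" if x: "x \<in> ext b" for x
  proof -
   have "(z = set_of (S x)) = (ext z = S x)" by (rule eq_set_of_iff[OF Si[OF x] z])
   also have "\<dots> = (\<forall>p\<in>U. E p z \<longleftrightarrow> p \<in> S x)" using inU_sub[OF Si[OF x]] by (auto simp: ext_def)
   finally show ?thesis by (auto simp: S_def)
  qed
  then show "(z \<in> ?F) = (\<exists>x\<in>ext b. \<forall>p\<in>U. E p z \<longleftrightarrow> (\<exists>y\<in>ext a. p = pair x y \<and> R x y))" by auto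
 qed
 then obtain f where f: "f \<in> U" "ext f = ?F" by (auto simp: inU_def)
 have SU: "set_of (S x) \<in> U" and eS: "ext (set_of (S x)) = S x" if "x \<in> ext b" for x
  using Si[OF that] by (simp_all add: set_of_U ext_set_of)
 have dj: "S x \<inter> S x' = {}" if "x \<in> ext b" "x' \<in> ext b" "x \<noteq> x'" for x x'
  using that ext_U unfolding S_def by (auto simp: pair_iff)
 have "\<exists>c\<in>U. \<forall>y\<in>ext f. \<exists>!z. z \<in> ext c \<inter> ext y"
 proof -
  have 1: "\<forall>y\<in>ext f. ext y \<noteq> {}" using ex unfolding f by (auto simp: eS) (auto simp: S_def)
  have 2: "ext y \<inter> ext z = {}" if "y \<in> ext f" "z \<in> ext f" "y \<noteq> z" for y z
  proof -
   from that obtain x x' where "x \<in> ext b" "x' \<in> ext b" "y = set_of (S x)" "z = set_of (S x')"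
    unfolding f by blast
   with that dj[of x x'] show ?thesis by (auto simp: eS)
  qed
  from choice_ax f(1) 1 2 show ?thesis unfolding choice_def by blast
 qed
 then obtain c where c: "c \<in> U" "\<And>x. x \<in> ext b ==> \<exists>!z. z \<in> ext c \<inter> S x"
 proof -
  assume *: "\<And>c. c \<in> U ==> (\<And>x. x \<in> ext b ==> \<exists>!z. z \<in> ext c \<inter> S x) ==> thesis"
  from \<open>\<exists>c\<in>U. _\<close> obtain c where c: "c \<in> U" "\<forall>y\<in>ext f. \<exists>!z. z \<in> ext c \<inter> ext y" by blast
  show thesis
  proof (rule *[OF c(1)])
   fix x assume x: "x \<in> ext b"
   then have "set_of (S x) \<in> ext f" using f by blast
   with c(2) have "\<exists>!z. z \<in> ext c \<inter> ext (set_of (S x))" by blast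
   then show "\<exists>!z. z \<in> ext c \<inter> S x" using eS[OF x] by simp
  qed
 qed
 define F where "F x = (THE y. y \<in> ext a \<and> R x y \<and> pair x y \<in> ext c)" for x
 have ex1: "\<exists>!y. y \<in> ext a \<and> R x y \<and> pair x y \<in> ext c" if "x \<in> ext b" for x
 proof -
  from c(2)[OF that] obtain z where z: "z \<in> ext c \<inter> S x" "\<And>z'. z' \<in> ext c \<inter> S x ==> z' = z" by blast
  from z(1) obtain y where y: "z = pair x y" "y \<in> ext a" "R x y" unfolding S_def by blast
  show ?thesis
  proof (rule ex1I[of _ y])
   show "y \<in> ext a \<and> R x y \<and> pair x y \<in> ext c" using y z(1) by auto
   fix y' assume y': "y' \<in> ext a \<and> R x y' \<and> pair x y' \<in> ext c"
   then have "pair x y' \<in> ext c \<inter> S x" unfolding S_def by auto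
   from z(2)[OF this] y y' that ext_U show "y' = y" by (metis pair_iff subsetD)
  qed
 qed
 have F: "F x \<in> ext a" "R x (F x)" "pair x (F x) \<in> ext c" if "x \<in> ext b" for x
  using theI'[OF ex1[OF that]] unfolding F_def by blast+
 have Fu: "y = F x" if "x \<in> ext b" "y \<in> ext a" "R x y" "pair x y \<in> ext c" for x y
  using ex1[OF that(1)] F[OF that(1)] that by blast
 \<comment> \<open>The default value makes the graph of the chosen function definable on all of
   \<open>U\<close>, as \<open>graph_fun\<close> requires.\<close>
 define F' where "F' x = (if x \<in> ext b then F x else empty)" for x
 have dF: "df (\<lambda>e. e 0 = F' (e (Suc 0)))"
 proof -
  have 1: "(y = F' x) = (if x \<in> ext b then y \<in> ext a \<and> R x y \<and> pair x y \<in> ext c else y = empty)" for x y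
   unfolding F'_def using F[of x] Fu[of x y] by (cases "x \<in> ext b") auto
  show ?thesis unfolding 1 by (intro dfs a b empty_U R1 c(1))
 qed
 from graph_fun[OF b a dF] F F'_def obtain t where "t \<in> U" "is_fun t b a" "\<forall>x\<in>ext b. app t x = F' x \<and> ap t x = F' x"
  by auto
 then show ?thesis using F by (auto simp: F'_def intro!: bexI[of _ t])
qed

end

lemma (in zc) df_params2:
 assumes "df (\<lambda>e. Q (e (Suc 0)) (e 0) (\<lambda>n. e (Suc (Suc n))))" "range d \<subseteq> U"
 shows "df (\<lambda>e. Q (e i) (e j) d)"
proof -
 from assms(1) obtain p c where p: "range c \<subseteq> U" "\<And>e. range e \<subseteq> U ==> Q (e (Suc 0)) (e 0) (\<lambda>n. e (Suc (Suc n))) = sat p (mix e c)"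
  unfolding df_def by blast
 let ?d = "\<lambda>x y. case_nat x (case_nat y d)"
 let ?f = "\<lambda>n. if n = 0 then 2 * j else if n = 2 then 2 * i else if even n then 2 * (2 * (n div 2 - 2)) + 1 else 2 * (2 * (n div 2) + 1) + 1"
 have 1: "(\<lambda>n. mix e (mix d c) (?f n)) = mix (?d (e j) (e i)) c" for e
 proof
  fix n show "mix e (mix d c) (?f n) = mix (?d (e j) (e i)) c n"
  proof (cases "even n")
   case True
   then obtain k where "n = 2 * k" by (elim evenE)
   then show ?thesis by (cases k; cases "k - 1") (auto simp: mix_def)
  next
   case False then obtain k where "n = 2 * k + 1" by (elim oddE)
   then show ?thesis by (auto simp: mix_def)
  qed
 qed
 have "Q (e i) (e j) d = sat p (mix (?d (e j) (e i)) c)" if "range e \<subseteq> U" for e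
  using that assms(2) p(2)[of "?d (e j) (e i)"] by (auto simp: range_case_nat)
 then show ?thesis
  by (intro dfI[where \<phi>="ren ?f p" and c="mix d c"])
   (use p assms(2) range_mix in \<open>simp_all only: sat_ren 1\<close>)
qed

locale zfc = zcc U E for U :: "'a set" and E :: "'a \<Rightarrow> 'a \<Rightarrow> bool" +
 assumes repl_ax: replacement
begin

section \<open>Recursion on the membership relation\<close>

lemma replR:
 assumes A: "inU A" and R: "df (\<lambda>e. R (e 0) (e (Suc 0)))" and ex: "\<And>x. x \<in> A ==> \<exists>!y. y \<in> U \<and> R x y"
 shows "inU {y\<in>U. \<exists>x\<in>A. R x y}"
proof -
 obtain a where a: "a \<in> U" "ext a = A" using A by (auto simp: inU_def)
 obtain p c where p: "range c \<subseteq> U" "\<And>e. range e \<subseteq> U ==> R (e 0) (e (Suc 0)) = sat p (mix e c)"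
  using R unfolding df_def by blast
 let ?f = "\<lambda>i. if odd i then i div 2 + 2 else if i = 0 then 0 else 1"
 have 1: "(\<lambda>i. case_nat x (case_nat y c) (?f i)) = mix (case_nat x (\<lambda>_. y)) c" for x y
  by (auto simp: mix_def fun_eq_iff split: nat.split elim!: oddE evenE)
 have 2: "sat (ren ?f p) (case_nat x (case_nat y c)) = R x y" if "x \<in> U" "y \<in> U" for x y
  using p(2)[of "case_nat x (\<lambda>_. y)"] that by (simp only: sat_ren 1) (simp add: range_case_nat)
 have "\<forall>x\<in>ext a. \<exists>!y. y \<in> U \<and> sat (ren ?f p) (case_nat x (case_nat y c))"
 proof
  fix x assume x: "x \<in> ext a"
  then have "x \<in> U" using ext_U by blast
  then have "(y \<in> U \<and> sat (ren ?f p) (case_nat x (case_nat y c))) = (y \<in> U \<and> R x y)" for y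
   using 2 by blast
  then show "\<exists>!y. y \<in> U \<and> sat (ren ?f p) (case_nat x (case_nat y c))" using ex x a by simp
 qed
 from repl_ax[unfolded replacement_def, THEN spec[of _ "ren ?f p"], THEN spec[of _ c], THEN bspec[OF _ a(1)], THEN mp, OF conjI[OF p(1) this]]
 obtain b where b: "b \<in> U" "ext b = {y \<in> U. \<exists>x\<in>ext a. sat (ren ?f p) (case_nat x (case_nat y c))}" ..
 have "ext b = {y\<in>U. \<exists>x\<in>A. R x y}"
  unfolding b(2) a(2) using 2 inU_sub[OF A] by blast
 with b(1) show ?thesis by (auto simp: inU_def)
qed

lemma repl:
 assumes A: "inU A" and F: "df (\<lambda>e. e 0 = F (e (Suc 0)))" and FU: "\<And>x. x \<in> A ==> F x \<in> U"
 shows "inU (F ` A)"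
proof -
 have "inU {y\<in>U. \<exists>x\<in>A. y = F x}"
 proof (rule replR[OF A])
  show "df (\<lambda>e. e (Suc 0) = F (e 0))" using df_ren[OF F, of "\<lambda>i. if i = 0 then Suc 0 else 0"] by simp
 qed (use FU in auto)
 moreover have "{y\<in>U. \<exists>x\<in>A. y = F x} = F ` A" using FU by auto
 ultimately show ?thesis by simp
qed

definition trans :: "'a \<Rightarrow> bool" where "trans t \<longleftrightarrow> (\<forall>y\<in>ext t. ext y \<subseteq> ext t)"

lemma df_trans: "dt s ==> df (\<lambda>e. trans (s e))"
 by (rule df_lift1[of trans]) (unfold trans_def, intro dfs df_subset)

definition istc :: "'a \<Rightarrow> 'a \<Rightarrow> bool" where
 "istc t x \<longleftrightarrow> trans t \<and> x \<in> ext t \<and> (\<forall>t'\<in>U. trans t' \<and> x \<in> ext t' --> ext t \<subseteq> ext t')"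

lemma df_istc: "dt s ==> dt t ==> df (\<lambda>e. istc (s e) (t e))"
 by (rule df_lift2[of istc]) (unfold istc_def, intro dfs df_subset df_trans)

lemma istc_unique: "istc t x ==> istc t' x ==> t \<in> U ==> t' \<in> U ==> t = t'"
 unfolding istc_def by (intro ext_inj subset_antisym) auto

lemma ex_tc: "x \<in> U ==> \<exists>t\<in>U. istc t x"
proof (induction rule: wf_induct)
 case (step x)
 have "inU {t\<in>U. \<exists>y\<in>ext x. istc t y}"
 proof (rule replR[OF inU_ext[OF step(1)]])
  show "df (\<lambda>e. istc (e (Suc 0)) (e 0))" by (intro df_istc dfs)
  show "\<exists>!t. t \<in> U \<and> istc t y" if "y \<in> ext x" for y
   using step(2)[OF that] istc_unique by (metis (no_types, lifting))
 qed
 from inU_insert[OF step(1) inU_UN[OF this]]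
 obtain t where t: "t \<in> U" "ext t = insert x (\<Union>z\<in>{t\<in>U. \<exists>y\<in>ext x. istc t y}. ext z)"
  unfolding inU_def by blast
 have sub: "ext x \<subseteq> ext t" unfolding t(2) using step(2) by (fastforce simp: istc_def)
 have "trans t" unfolding trans_def
 proof
  fix y assume "y \<in> ext t"
  then consider "y = x" | z w where "y \<in> ext z" "z \<in> U" "w \<in> ext x" "istc z w" unfolding t(2) by blast
  then show "ext y \<subseteq> ext t"
  proof cases
   case 2
   then have "ext y \<subseteq> ext z" by (auto simp: istc_def trans_def)
   with 2 show ?thesis unfolding t(2) by blast
  qed (use sub in simp)
 qed
 moreover have "ext t \<subseteq> ext t'" if "t' \<in> U" "trans t'" "x \<in> ext t'" for t'
 proof -
  have "ext z \<subseteq> ext t'" if "y \<in> ext x" "istc z y" for y z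
  proof -
   have "y \<in> ext t'" using that \<open>trans t'\<close> \<open>x \<in> ext t'\<close> by (auto simp: trans_def)
   with that \<open>t' \<in> U\<close> \<open>trans t'\<close> show ?thesis by (auto simp: istc_def)
  qed
  with \<open>x \<in> ext t'\<close> show ?thesis unfolding t(2) by blast
 qed
 ultimately show ?case using t by (intro bexI[of _ t]) (auto simp: istc_def)
qed

text \<open>The recursion is carried out in the metatheory; what needs proof is that the values stay
  in the structure and that the graph is definable. The step function sees the earlier values as an
  element of the structure.\<close>

definition erec :: "('a \<Rightarrow> 'a \<Rightarrow> 'a) \<Rightarrow> 'a \<Rightarrow> 'a" where
 "erec H = wfrec {(y, x). x \<in> U \<and> y \<in> ext x} (\<lambda>f x. H x (set_of {pair y (f y) | y. y \<in> ext x}))"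

lemma erec_eq: "x \<in> U ==> erec H x = H x (set_of {pair y (erec H y) | y. y \<in> ext x})"
proof -
 assume x: "x \<in> U"
 have wf': "Wellfounded.wf {(y, x). x \<in> U \<and> y \<in> ext x}"
 proof (rule wfUNIVI)
  fix P :: "'a \<Rightarrow> bool" and x
  assume *: "\<forall>x. (\<forall>y. (y, x) \<in> {(y, x). x \<in> U \<and> y \<in> ext x} --> P y) --> P x"
  show "P x"
  proof (cases "x \<in> U")
   case True then show ?thesis
   proof (induction rule: wf_induct)
    case (step x) then show ?case using *[rule_format, of x] by auto
   qed
  next
   case False then show ?thesis using *[rule_format, of x] by auto
  qed
 qed
 have "{pair y (cut (erec H) {(y, x). x \<in> U \<and> y \<in> ext x} x y) | y. y \<in> ext x} = {pair y (erec H y) | y. y \<in> ext x}"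
  using x by (auto simp: cut_def)
 then show ?thesis
  unfolding erec_def by (subst wfrec[OF wf']) (simp add: erec_def[symmetric])
qed

context
 fixes H :: "'a \<Rightarrow> 'a \<Rightarrow> 'a"
 assumes HU: "\<And>x g. x \<in> U ==> g \<in> U ==> H x g \<in> U" and Hdf: "df (\<lambda>e. e 0 = H (e (Suc 0)) (e (Suc (Suc 0))))"
begin

text \<open>\<open>g\<close> is a correct computation on \<open>t\<close>, and \<open>k\<close> is
  its restriction to the elements of \<open>w\<close>. For transitive \<open>t\<close> correctness
  propagates upwards (\<open>Rec_sound\<close>), which also gives single-valuedness.\<close>

definition Rec :: "'a \<Rightarrow> 'a \<Rightarrow> bool" where
 "Rec g t \<longleftrightarrow> (\<forall>w\<in>ext t. \<exists>z\<in>U. pair w z \<in> ext g) \<and> (\<forall>w\<in>ext t. \<forall>z\<in>U. pair w z \<in> ext g -->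
  (\<exists>k\<in>U. (\<forall>p\<in>U. E p k \<longleftrightarrow> (\<exists>v\<in>ext w. \<exists>u\<in>U. p = pair v u \<and> E p g)) \<and> z = H w k))"

lemma df_H: "df (\<lambda>e. e i = H (e j) (e k))"
 using df_ren[OF Hdf, of "\<lambda>n. if n = 0 then i else if n = Suc 0 then j else k"] by simp

lemma df_Rec: "dt s ==> dt t ==> df (\<lambda>e. Rec (s e) (t e))"
 by (rule df_lift2[of Rec]) (unfold Rec_def, intro dfs df_H)

lemma Rec_sound:
 assumes "Rec g t" "trans t" "w \<in> U" shows "w \<in> ext t ==> \<forall>z\<in>U. pair w z \<in> ext g --> z = erec H w"
 using assms(3)
proof (induction rule: wf_induct)
 case (step w)
 show ?case
 proof (intro ballI impI)
  fix z assume z: "z \<in> U" "pair w z \<in> ext g"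
  then obtain k where k: "k \<in> U" "\<forall>p\<in>U. E p k \<longleftrightarrow> (\<exists>v\<in>ext w. \<exists>u\<in>U. p = pair v u \<and> E p g)" "z = H w k"
   using \<open>Rec g t\<close> step.prems unfolding Rec_def by blast
  have sub: "v \<in> ext t" if "v \<in> ext w" for v using that step.prems \<open>trans t\<close> by (auto simp: trans_def)
  have "ext k = {pair v (erec H v) | v. v \<in> ext w}"
  proof
   show "ext k \<subseteq> {pair v (erec H v) | v. v \<in> ext w}"
   proof
    fix p assume p: "p \<in> ext k"
    then obtain v u where v: "v \<in> ext w" "u \<in> U" "p = pair v u" "E p g" "p \<in> U" using k(2) by (auto simp: in_ext)
    then have "pair v u \<in> ext g" by (simp add: in_ext)
    with step.IH[OF v(1) sub[OF v(1)]] v(2) have "u = erec H v" by blast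
    with v show "p \<in> {pair v (erec H v) | v. v \<in> ext w}" by blast
   qed
   show "{pair v (erec H v) | v. v \<in> ext w} \<subseteq> ext k"
   proof clarify
    fix v assume v: "v \<in> ext w"
    obtain u where u: "u \<in> U" "pair v u \<in> ext g" using \<open>Rec g t\<close> sub[OF v] unfolding Rec_def by blast
    with step.IH[OF v sub[OF v]] have "u = erec H v" by blast
    with u v k(2) show "pair v (erec H v) \<in> ext k" by (auto simp: in_ext)
   qed
  qed
  then have "set_of {pair v (erec H v) | v. v \<in> ext w} = k" using k(1) by (intro set_of_eq)
  with erec_eq[OF step.hyps(1), of H] k(3) show "z = erec H w" by simp
 qed
qed

lemma Rec_intro:
 assumes t: "trans t" "t \<in> U" and g: "g \<in> U" "ext g = {pair w (erec H w) | w. w \<in> ext t}"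
  and FU: "\<And>w. w \<in> ext t ==> erec H w \<in> U"
 shows "Rec g t"
 unfolding Rec_def
proof (intro conjI ballI impI)
 fix w assume w: "w \<in> ext t"
 then show "\<exists>z\<in>U. pair w z \<in> ext g" using g FU by blast
 fix z assume z: "z \<in> U" "pair w z \<in> ext g"
 then have ze: "z = erec H w" using w g FU ext_U by (auto simp: pair_iff)
 let ?K = "{pair v (erec H v) | v. v \<in> ext w}"
 have sub: "v \<in> ext t" if "v \<in> ext w" for v using that w t by (auto simp: trans_def)
 have "inU ?K"
 proof (rule inU_subI[OF inU_ext[OF g(1)], where Q="\<lambda>p. \<exists>v\<in>ext w. \<exists>u\<in>U. p = pair v u"])
  show "df (\<lambda>e. \<exists>v\<in>ext w. \<exists>u\<in>U. e 0 = pair v u)" using w ext_U by (intro dfs) blast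
  show "?K \<subseteq> ext g" using sub unfolding g(2) by blast
  show "(p \<in> ?K) = (\<exists>v\<in>ext w. \<exists>u\<in>U. p = pair v u)" if "p \<in> ext g" for p
   using that sub FU ext_U unfolding g(2) by (auto simp: pair_iff subset_iff) 
 qed
 then obtain k where k: "k \<in> U" "ext k = ?K" by (auto simp: inU_def)
 have "\<forall>p\<in>U. E p k \<longleftrightarrow> (\<exists>v\<in>ext w. \<exists>u\<in>U. p = pair v u \<and> E p g)"
 proof
  fix p assume "p \<in> U"
  then have "E p k \<longleftrightarrow> p \<in> ?K" "E p g \<longleftrightarrow> p \<in> ext g" using k(2) in_ext[of p k] in_ext[of p g] by simp_all
  moreover have "p \<in> ?K \<longleftrightarrow> (\<exists>v\<in>ext w. \<exists>u\<in>U. p = pair v u \<and> p \<in> ext g)"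
   using sub FU ext_U unfolding g(2) by (auto simp: pair_iff subset_iff)
  ultimately show "E p k \<longleftrightarrow> (\<exists>v\<in>ext w. \<exists>u\<in>U. p = pair v u \<and> E p g)" by simp
 qed
 moreover have "z = H w k" using ze erec_eq[of w H] k set_of_eq[OF k] w ext_U by auto
 ultimately show "\<exists>k\<in>U. (\<forall>p\<in>U. E p k \<longleftrightarrow> (\<exists>v\<in>ext w. \<exists>u\<in>U. p = pair v u \<and> E p g)) \<and> z = H w k"
  using k(1) by blast
qed

text \<open>The induction has to carry the graph on the whole transitive closure: replacement
  collects the computations on the closures of the elements of \<open>x\<close>, and their union is
  what is needed at \<open>x\<close>.\<close>

lemma erec_main:
 "x \<in> U ==> \<forall>t\<in>U. istc t x --> (\<forall>w\<in>ext t. erec H w \<in> U) \<and> inU {pair w (erec H w) | w. w \<in> ext t}"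
proof (induction rule: wf_induct)
 case (step x)
 show ?case
 proof (intro ballI impI)
  fix t assume t: "t \<in> U" "istc t x"
  define T where "T y = (THE t. t \<in> U \<and> istc t y)" for y
  have T: "T y \<in> U" "istc (T y) y" if "y \<in> U" for y
  proof -
   have "\<exists>!t. t \<in> U \<and> istc t y" using ex_tc[OF that] istc_unique by blast
   from theI'[OF this] show "T y \<in> U" "istc (T y) y" unfolding T_def by blast+
  qed
  have xU: "y \<in> U" if "y \<in> ext x" for y using that ext_U by blast
  have IH: "(\<forall>w\<in>ext (T y). erec H w \<in> U) \<and> inU {pair w (erec H w) | w. w \<in> ext (T y)}" if "y \<in> ext x" for y
   using step.IH[OF that] T[OF xU[OF that]] by blast
  \<comment> \<open>The last conjunct excludes junk from \<open>g\<close>; the computation is then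
    unique, as \<open>replR\<close> demands.\<close>
  let ?R = "\<lambda>y g. \<exists>t\<in>U. istc t y \<and> Rec g t \<and> (\<forall>p\<in>ext g. \<exists>w\<in>ext t. \<exists>z\<in>U. p = pair w z)"
  have R: "g \<in> U \<and> ?R y g \<longleftrightarrow> g = set_of {pair w (erec H w) | w. w \<in> ext (T y)}" if y: "y \<in> ext x" for y g
  proof -
   let ?S = "{pair w (erec H w) | w. w \<in> ext (T y)}"
   note Ty = T[OF xU[OF y]] and iS = IH[OF y, THEN conjunct2]
   have FU: "erec H w \<in> U" if "w \<in> ext (T y)" for w using IH[OF y] that by blast
   have tr: "trans (T y)" using Ty by (simp add: istc_def)
   show ?thesis
   proof
    assume "g = set_of ?S"
    then have "g \<in> U" "ext g = ?S" using iS by (simp_all add: set_of_U ext_set_of)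
    moreover have "Rec g (T y)" by (rule Rec_intro) (use tr Ty calculation FU in auto)
    ultimately show "g \<in> U \<and> ?R y g" using Ty FU by blast
   next
    assume "g \<in> U \<and> ?R y g"
    then obtain t' where g: "g \<in> U" "t' \<in> U" "istc t' y" "Rec g t'" "\<forall>p\<in>ext g. \<exists>w\<in>ext t'. \<exists>z\<in>U. p = pair w z" by blast
    have t': "t' = T y" using istc_unique g Ty by blast
    note sound = Rec_sound[OF g(4)[unfolded t'] tr]
    have "ext g = ?S"
    proof
     show "ext g \<subseteq> ?S"
     proof
      fix p assume p: "p \<in> ext g"
      then obtain w z where "w \<in> ext (T y)" "z \<in> U" "p = pair w z" using g(5) t' by blast
      with sound[of w] p ext_U show "p \<in> ?S" by blast
     qed
     show "?S \<subseteq> ext g"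
     proof clarify
      fix w assume w: "w \<in> ext (T y)"
      then obtain z where "z \<in> U" "pair w z \<in> ext g" using g(4) t' unfolding Rec_def by blast
      with sound[of w] w ext_U show "pair w (erec H w) \<in> ext g" by blast
     qed
    qed
    then show "g = set_of ?S" using g(1) by (intro set_of_eq[symmetric])
   qed
  qed
  have "inU {g\<in>U. \<exists>y\<in>ext x. ?R y g}"
  proof (rule replR[OF inU_ext[OF step(1)]])
   show "df (\<lambda>e. ?R (e 0) (e (Suc 0)))" by (intro dfs df_istc df_Rec)
   show "\<exists>!g. g \<in> U \<and> ?R y g" if "y \<in> ext x" for y using R[OF that] by simp
  qed
  from inU_UN[OF this] have "inU (\<Union>g\<in>{g\<in>U. \<exists>y\<in>ext x. ?R y g}. ext g)" .
  moreover have "(\<Union>g\<in>{g\<in>U. \<exists>y\<in>ext x. ?R y g}. ext g) = (\<Union>y\<in>ext x. {pair w (erec H w) | w. w \<in> ext (T y)})"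
  proof -
   have "{g\<in>U. \<exists>y\<in>ext x. ?R y g} = {g. \<exists>y\<in>ext x. g \<in> U \<and> ?R y g}" by blast
   also have "\<dots> = {g. \<exists>y\<in>ext x. g = set_of {pair w (erec H w) | w. w \<in> ext (T y)}}"
    using R by (intro Collect_cong bex_cong) auto
   also have "\<dots> = (\<lambda>y. set_of {pair w (erec H w) | w. w \<in> ext (T y)}) ` ext x" by blast
   finally have "(\<Union>g\<in>{g\<in>U. \<exists>y\<in>ext x. ?R y g}. ext g) = (\<Union>y\<in>ext x. ext (set_of {pair w (erec H w) | w. w \<in> ext (T y)}))"
    by simp
   also have "\<dots> = (\<Union>y\<in>ext x. {pair w (erec H w) | w. w \<in> ext (T y)})"
    using IH by (intro SUP_cong) (auto simp only: ext_set_of)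
   finally show ?thesis .
  qed
  ultimately have i1: "inU (\<Union>y\<in>ext x. {pair w (erec H w) | w. w \<in> ext (T y)})" by simp
  have "inU {pair y (erec H y) | y. y \<in> ext x}"
  proof (rule inU_subI[OF i1, where Q="\<lambda>p. \<exists>y\<in>ext x. \<exists>z\<in>U. p = pair y z"])
   have yT: "y \<in> ext (T y)" if "y \<in> ext x" for y using T[OF xU[OF that]] by (simp add: istc_def)
   then show "{pair y (erec H y) | y. y \<in> ext x} \<subseteq> (\<Union>y\<in>ext x. {pair w (erec H w) | w. w \<in> ext (T y)})"
    by blast
   show "df (\<lambda>e. \<exists>y\<in>ext x. \<exists>z\<in>U. e 0 = pair y z)" by (intro dfs step(1))
   fix p assume "p \<in> (\<Union>y\<in>ext x. {pair w (erec H w) | w. w \<in> ext (T y)})"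
   then obtain y w where yw: "y \<in> ext x" "w \<in> ext (T y)" "p = pair w (erec H w)" by blast
   then have wU: "w \<in> U" "erec H w \<in> U" using IH ext_U by blast+
   show "(p \<in> {pair y (erec H y) | y. y \<in> ext x}) = (\<exists>y\<in>ext x. \<exists>z\<in>U. p = pair y z)"
    using yw wU IH yT xU by (auto simp: pair_iff)
  qed
  then have Fx: "erec H x \<in> U" using erec_eq[OF step(1), of H] HU[OF step(1) set_of_U] by simp
  \<comment> \<open>The least transitive set around \<open>x\<close> is assembled from those around
    its elements, so the graph on it is the union of theirs plus one pair.\<close>
  have te: "ext t = insert x (\<Union>y\<in>ext x. ext (T y))"
  proof
   show "insert x (\<Union>y\<in>ext x. ext (T y)) \<subseteq> ext t"
    using t T xU by (auto simp: istc_def trans_def) (meson subsetD)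
   have "inU {t\<in>U. \<exists>y\<in>ext x. istc t y}"
   proof (rule replR[OF inU_ext[OF step(1)]])
    show "df (\<lambda>e. istc (e (Suc 0)) (e 0))" by (intro df_istc dfs)
    show "\<exists>!t. t \<in> U \<and> istc t y" if "y \<in> ext x" for y
     using T[OF xU[OF that]] istc_unique by blast
   qed
   from inU_insert[OF step(1) inU_UN[OF this]]
   obtain s where s: "s \<in> U" "ext s = insert x (\<Union>z\<in>{t\<in>U. \<exists>y\<in>ext x. istc t y}. ext z)"
    unfolding inU_def by blast
   have "{t\<in>U. \<exists>y\<in>ext x. istc t y} = T ` ext x" using T xU istc_unique by blast
   then have s2: "ext s = insert x (\<Union>y\<in>ext x. ext (T y))" using s(2) by simp
   have "trans s" unfolding trans_def
   proof
    fix y assume "y \<in> ext s"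
    then consider "y = x" | z where "z \<in> ext x" "y \<in> ext (T z)" unfolding s2 by blast
    then show "ext y \<subseteq> ext s"
    proof cases
     case 1 then show ?thesis unfolding s2 using T xU by (auto simp: istc_def)
    next
     case 2 then show ?thesis unfolding s2 using T[OF xU[OF 2(1)]] by (auto simp: istc_def trans_def)
    qed
   qed
   moreover have "x \<in> ext s" using s2 by simp
   ultimately have "ext t \<subseteq> ext s" using t(2) s(1) unfolding istc_def by blast
   then show "ext t \<subseteq> insert x (\<Union>y\<in>ext x. ext (T y))" unfolding s2 .
  qed
  have "{pair w (erec H w) | w. w \<in> ext t} = insert (pair x (erec H x)) (\<Union>y\<in>ext x. {pair w (erec H w) | w. w \<in> ext (T y)})"
   unfolding te by blast
  moreover have "\<forall>w\<in>ext t. erec H w \<in> U" unfolding te using Fx IH by blast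
  ultimately show "(\<forall>w\<in>ext t. erec H w \<in> U) \<and> inU {pair w (erec H w) | w. w \<in> ext t}"
   using inU_insert[OF pair_U[OF step(1) Fx] i1] by simp
 qed
qed

lemma erec_U: "x \<in> U ==> erec H x \<in> U"
 using erec_main[of x] ex_tc[of x] by (auto simp: istc_def)

lemma df_erec: "df (\<lambda>e. e 0 = erec H (e (Suc 0)))"
proof -
 have "(y = erec H x) = (\<exists>g\<in>U. \<exists>t\<in>U. trans t \<and> x \<in> ext t \<and> Rec g t \<and> pair x y \<in> ext g)" if xy: "x \<in> U" "y \<in> U" for x y
 proof
  assume y: "y = erec H x"
  obtain t where t: "t \<in> U" "istc t x" using ex_tc[OF xy(1)] by blast
  then have "(\<forall>w\<in>ext t. erec H w \<in> U)" "inU {pair w (erec H w) | w. w \<in> ext t}" using erec_main[OF xy(1)] by blast+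
  then obtain g where g: "g \<in> U" "ext g = {pair w (erec H w) | w. w \<in> ext t}" "\<forall>w\<in>ext t. erec H w \<in> U"
   unfolding inU_def by blast
  have "Rec g t" using t g by (intro Rec_intro) (auto simp: istc_def)
  with t g y show "\<exists>g\<in>U. \<exists>t\<in>U. trans t \<and> x \<in> ext t \<and> Rec g t \<and> pair x y \<in> ext g"
   by (intro bexI[of _ g] bexI[of _ t]) (auto simp: istc_def)
 next
  assume "\<exists>g\<in>U. \<exists>t\<in>U. trans t \<and> x \<in> ext t \<and> Rec g t \<and> pair x y \<in> ext g"
  with Rec_sound xy show "y = erec H x" by blast
 qed
 then have "(e 0 = erec H (e (Suc 0))) = (\<exists>g\<in>U. \<exists>t\<in>U. trans t \<and> e (Suc 0) \<in> ext t \<and> Rec g t \<and> pair (e (Suc 0)) (e 0) \<in> ext g)"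
  if "range e \<subseteq> U" for e using that by (simp add: image_subset_iff)
 then show ?thesis by (subst df_cong, assumption) (intro dfs df_trans df_Rec)
qed

lemma dt_erec: "dt s ==> dt (\<lambda>e. erec H (s e))"
proof (rule dt_lift1[of "erec H"])
 fix i
 have "df (\<lambda>e. e 0 = erec H (e (Suc i)))" using df_ren[OF df_erec, of "\<lambda>n. if n = 0 then 0 else Suc i"] by simp
 then show "dt (\<lambda>e. erec H (e i))" by (simp add: dt_def erec_U image_subset_iff)
qed

lemma inU_erec: "x \<in> U ==> inU {pair y (erec H y) | y. y \<in> ext x}"
proof -
 assume x: "x \<in> U"
 have "inU ((\<lambda>y. pair y (erec H y)) ` ext x)"
  by (rule repl[OF inU_ext[OF x]]) (use ext_U in \<open>auto intro!: dfs df_eq dt_pair dt_erec pair_U erec_U\<close>)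
 then show ?thesis by (simp add: Setcompr_eq_image)
qed

end

section \<open>Ordinals and the well-ordering theorem\<close>

definition Ord :: "'a \<Rightarrow> bool" where "Ord x \<longleftrightarrow> trans x \<and> (\<forall>y\<in>ext x. trans y)"

lemma df_Ord: "dt s ==> df (\<lambda>e. Ord (s e))"
 by (rule df_lift1[of Ord]) (unfold Ord_def, intro dfs df_trans)

lemma Ord_mem: "Ord x ==> y \<in> ext x ==> Ord y"
 unfolding Ord_def trans_def by blast

lemma Ord_trans: "Ord x ==> y \<in> ext x ==> z \<in> ext y ==> z \<in> ext x"
 unfolding Ord_def trans_def by blast

lemma Ord_linear: "a \<in> U ==> Ord a ==> \<forall>b\<in>U. Ord b --> a \<in> ext b \<or> a = b \<or> b \<in> ext a"
proof (induction rule: wf_induct)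
 case (step a)
 show ?case
 proof
  fix b assume "b \<in> U"
  then show "Ord b --> a \<in> ext b \<or> a = b \<or> b \<in> ext a"
  proof (induction rule: wf_induct)
   case inner: (step b)
   show ?case
   proof (intro impI, rule ccontr)
    assume b: "Ord b" and n: "\<not> (a \<in> ext b \<or> a = b \<or> b \<in> ext a)"
    have "ext a = ext b"
    proof
     show "ext a \<subseteq> ext b"
     proof
      fix c assume c: "c \<in> ext a"
      have "c \<in> ext b \<or> c = b \<or> b \<in> ext c" using step.IH[OF c Ord_mem[OF step.prems c]] inner.hyps b by blast
      then show "c \<in> ext b" using n c Ord_trans[OF step.prems c] by blast
     qed
     show "ext b \<subseteq> ext a"
     proof
      fix c assume c: "c \<in> ext b"
      have "a \<in> ext c \<or> a = c \<or> c \<in> ext a" using inner.IH[OF c] Ord_mem[OF b c] by blast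
      then show "c \<in> ext a" using n c Ord_trans[OF b c] by blast
     qed
    qed
    then show False using ext_inj step.hyps inner.hyps n by blast
   qed
  qed
 qed
qed

lemma Ord_min: assumes "a \<in> U" "Q a" shows "\<exists>b\<in>U. Q b \<and> (\<forall>c\<in>ext b. \<not> Q c)"
proof (rule ccontr)
 assume n: "\<not> ?thesis"
 have "\<not> Q a" using assms(1)
 proof (induction rule: wf_induct)
  case (step x) then show ?case using n by blast
 qed
 with assms show False by simp
qed

lemma Ord_set: "\<not> inU {a\<in>U. Ord a}"
proof
 assume i: "inU {a\<in>U. Ord a}"
 let ?o = "set_of {a\<in>U. Ord a}"
 have e: "ext ?o = {a\<in>U. Ord a}" by (rule ext_set_of[OF i])
 have "trans ?o" unfolding trans_def e using Ord_mem ext_U by blast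
 moreover have "\<forall>y\<in>ext ?o. trans y" unfolding e by (auto simp: Ord_def)
 ultimately have "Ord ?o" unfolding Ord_def ..
 with set_of_U[OF i] have "?o \<in> {a\<in>U. Ord a}" by blast
 then have "?o \<in> ext ?o" unfolding e .
 then show False using mem_irrefl by blast
qed

text \<open>Zermelo's argument: elements of \<open>D\<close> are enumerated along the ordinals by a
  choice function. If this never came to an end, replacement along the inverse of the enumeration
  would make the ordinals a set, contrary to \<open>Ord_set\<close>.\<close>

theorem wellorder: assumes D: "D \<in> U" shows "\<exists>\<kappa>\<in>U. \<exists>f\<in>U. Ord \<kappa> \<and> is_fun f \<kappa> D \<and> bij_betw (ap f) (ext \<kappa>) (ext D)"
proof -
 have "\<exists>c. c \<in> U \<and> (\<forall>B\<in>ext (power D). ext B \<noteq> {} --> ap c B \<in> ext B)"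
 proof (cases "ext D = {}")
  case True
  then show ?thesis using D by (intro exI[of _ D]) (auto simp: ext_power)
 next
  case False
  have "\<exists>t\<in>U. is_fun t (power D) D \<and> (\<forall>x\<in>ext (power D). ap t x \<in> ext D \<and> (ext x \<noteq> {} --> ap t x \<in> ext x) \<and> app t x = ap t x)"
  proof (rule AC[OF power_U[OF D] D, of "\<lambda>x y. ext x \<noteq> {} --> y \<in> ext x"])
   have 1: "(ext x \<noteq> {}) = (\<exists>y\<in>ext x. True)" for x by blast
   show "df (\<lambda>e. ext (e 0) \<noteq> {} --> e (Suc 0) \<in> ext (e 0))" unfolding 1 by (intro dfs)
   show "\<exists>y\<in>ext D. ext x \<noteq> {} --> y \<in> ext x" if "x \<in> ext (power D)" for x
    using that False D by (auto simp: ext_power)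
  qed
  then show ?thesis by blast
 qed
 then obtain c where c: "c \<in> U" "\<And>B. B \<in> ext (power D) ==> ext B \<noteq> {} ==> ap c B \<in> ext B" by blast
 define S where "S g = {d\<in>ext D. \<not> (\<exists>w\<in>U. pair w d \<in> ext g)}" for g
 \<comment> \<open>\<open>D\<close> is not an element of itself and serves as the signal that all
   elements have been used; \<kappa> will be the first ordinal at which it appears.\<close>
 define H where "H x g = (if S g = {} then D else ap c (set_of (S g)))" for x g :: 'a
 have Si: "inU (S g)" if "g \<in> U" for g unfolding S_def
  by (rule sepI[OF inU_ext[OF D]]) (intro dfs that)
 have dS: "dt (\<lambda>e. set_of (S (e i)))" for i
 proof (rule dt_set_of_eq)
  show "inU (S (e i))" if "range e \<subseteq> U" for e using that by (intro Si) auto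
  show "df (\<lambda>e. e 0 \<in> S (e (Suc i)))" unfolding S_def mem_Collect_eq by (intro dfs D)
 qed
 have HU: "H x g \<in> U" for x g unfolding H_def by (simp add: D ap_U)
 have Hdf: "df (\<lambda>e. e 0 = H (e (Suc 0)) (e (Suc (Suc 0))))"
 proof -
  have 1: "(y = H x g) = (if (\<exists>d\<in>ext D. \<not> (\<exists>w\<in>U. pair w d \<in> ext g)) then y = ap c (set_of (S g)) else y = D)" for x y g
   unfolding H_def by (auto simp: S_def)
  show ?thesis unfolding 1 by (intro dfs dS dt_ap c D)
 qed
 define F where "F = erec H"
 have FU: "F x \<in> U" if "x \<in> U" for x unfolding F_def using erec_U[OF HU Hdf that] .
 have dF: "df (\<lambda>e. e 0 = F (e (Suc 0)))" unfolding F_def by (rule df_erec[OF HU Hdf])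
 have dtF: "dt (\<lambda>e. F (e i))" for i unfolding F_def by (rule dt_erec[OF HU Hdf dt_var])
 have FS: "F x = (if ext D \<subseteq> F ` ext x then D else ap c (set_of {d\<in>ext D. d \<notin> F ` ext x}))" if x: "x \<in> U" for x
 proof -
  let ?g = "set_of {pair y (F y) | y. y \<in> ext x}"
  have i: "inU {pair y (F y) | y. y \<in> ext x}" unfolding F_def by (rule inU_erec[OF HU Hdf x])
  have "(\<exists>w\<in>U. pair w d \<in> ext ?g) = (d \<in> F ` ext x)" if "d \<in> ext D" for d
   unfolding ext_set_of[OF i] using that ext_U FU by (auto simp: pair_iff subset_iff)
  then have "S ?g = {d\<in>ext D. d \<notin> F ` ext x}" unfolding S_def by blast
  moreover have "F x = H x ?g" unfolding F_def by (rule erec_eq[OF x])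
  ultimately show ?thesis unfolding H_def by auto
 qed
 have F1: "F x \<in> ext D \<and> F x \<notin> F ` ext x" if x: "x \<in> U" "\<not> ext D \<subseteq> F ` ext x" for x
 proof -
  let ?S = "{d\<in>ext D. d \<notin> F ` ext x}"
  have "inU {d\<in>ext D. \<not> (\<exists>w\<in>ext x. d = F w)}"
   by (rule sepI[OF inU_ext[OF D]])
    (intro dfs x(1) dtF)
  moreover have "{d\<in>ext D. \<not> (\<exists>w\<in>ext x. d = F w)} = ?S" by blast
  ultimately have i: "inU ?S" by simp
  have "set_of ?S \<in> ext (power D)" "ext (set_of ?S) \<noteq> {}" using x i D by (auto simp: ext_power set_of_U ext_set_of)
  from c(2)[OF this] have "ap c (set_of ?S) \<in> ?S" by (simp add: ext_set_of[OF i])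
  with FS[OF x(1)] x show ?thesis by auto
 qed
 have FD: "F x = D \<longleftrightarrow> ext D \<subseteq> F ` ext x" if "x \<in> U" for x
 proof (cases "ext D \<subseteq> F ` ext x")
  case False
  then have "F x \<noteq> D" using F1[OF that] mem_irrefl[of D] by metis
  with False show ?thesis by simp
 qed (use FS[OF that] in simp)
 have inj: "a = b" if ab: "a \<in> U" "b \<in> U" "Ord a" "Ord b" "F a \<noteq> D" "F b \<noteq> D" "F a = F b" for a b
 proof -
  have "\<not> ext D \<subseteq> F ` ext a" "\<not> ext D \<subseteq> F ` ext b" using ab FD by blast+
  from F1[OF ab(1) this(1)] F1[OF ab(2) this(2)] ab(7) have "F b \<notin> F ` ext a" "F a \<notin> F ` ext b" by simp_all
  with Ord_linear[OF ab(1,3)] ab show ?thesis by blast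
 qed
 have "\<exists>a\<in>U. Ord a \<and> F a = D"
 proof (rule ccontr)
  assume n: "\<not> ?thesis"
  have dR: "df (\<lambda>e. Ord (e (Suc 0)) \<and> e 0 = F (e (Suc 0)))" by (intro dfs df_Ord dF)
  have "inU {d\<in>ext D. \<exists>a\<in>U. Ord a \<and> d = F a}"
   by (rule sepI[OF inU_ext[OF D]])
    (intro dfs df_Ord dtF)
  then have "inU {a\<in>U. \<exists>d\<in>{d\<in>ext D. \<exists>a\<in>U. Ord a \<and> d = F a}. Ord a \<and> d = F a}"
   by (rule replR[OF _ dR]) (use inj n in blast)
  moreover have "{a\<in>U. \<exists>d\<in>{d\<in>ext D. \<exists>a\<in>U. Ord a \<and> d = F a}. Ord a \<and> d = F a} = {a\<in>U. Ord a}"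
  proof -
   have "F a \<in> ext D" if "a \<in> U" "Ord a" for a using n that F1[OF that(1)] FD[OF that(1)] by blast
   then show ?thesis by auto
  qed
  ultimately show False using Ord_set by simp
 qed
 then obtain a where "a \<in> U" "Ord a \<and> F a = D" by blast
 from Ord_min[where Q="\<lambda>a. Ord a \<and> F a = D", OF this]
 obtain \<kappa> where k: "\<kappa> \<in> U" "Ord \<kappa>" "F \<kappa> = D" "\<forall>c\<in>ext \<kappa>. \<not> (Ord c \<and> F c = D)" by blast
 have k2: "F c \<in> ext D" "Ord c" "c \<in> U" "F c \<noteq> D" if "c \<in> ext \<kappa>" for c
  using that k Ord_mem[OF k(2) that] F1[of c] FD[of c] ext_U by auto
 from graph_fun[OF k(1) D dF k2(1)] obtain f where f: "f \<in> U" "is_fun f \<kappa> D" "\<And>x. x \<in> ext \<kappa> ==> ap f x = F x" by blast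
 have "bij_betw F (ext \<kappa>) (ext D)"
  unfolding bij_betw_def
 proof
  show "inj_on F (ext \<kappa>)" using inj k2 by (meson inj_onI)
  show "F ` ext \<kappa> = ext D" using k2 FD[OF k(1)] k(3) by blast
 qed
 then have "bij_betw (ap f) (ext \<kappa>) (ext D)" using f(3) by (simp cong: bij_betw_cong)
 with f k show ?thesis by blast
qed

end

section \<open>The forcing relation\<close>

locale forcing = zfc M E for M :: "'a set" and E +
 fixes P :: 'a and G N :: "'a set"
 assumes P_M: "P \<in> M" and one_P: "empty \<in> ext P" and gen: "generic_filter P G" and gext: "generic_extension E M G N"
begin

sublocale N: set_structure N E .

definition vl :: "'a \<Rightarrow> 'a" where
 "vl = (SOME val. val ` M = N \<and> (\<forall>\<tau>\<in>M. N.ext (val \<tau>) = {val \<sigma> |\<sigma> p. \<sigma> \<in> M \<and> p \<in> G \<and> pair \<sigma> p \<in> ext \<tau>}))"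

lemma vl: "vl ` M = N" "\<And>\<tau>. \<tau> \<in> M ==> N.ext (vl \<tau>) = {vl \<sigma> |\<sigma> p. \<sigma> \<in> M \<and> p \<in> G \<and> pair \<sigma> p \<in> ext \<tau>}"
proof -
 have "\<exists>val. val ` M = N \<and> (\<forall>\<tau>\<in>M. N.ext (val \<tau>) = {val \<sigma> |\<sigma> p. \<sigma> \<in> M \<and> p \<in> G \<and> pair \<sigma> p \<in> ext \<tau>})"
  using gext unfolding generic_extension_def by (elim conjE)
 from someI_ex[OF this] show "vl ` M = N" "\<And>\<tau>. \<tau> \<in> M ==> N.ext (vl \<tau>) = {vl \<sigma> |\<sigma> p. \<sigma> \<in> M \<and> p \<in> G \<and> pair \<sigma> p \<in> ext \<tau>}"
  unfolding vl_def by blast+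
qed

lemma vl_N: "\<tau> \<in> M ==> vl \<tau> \<in> N" using vl(1) by blast
lemma name_ex: "x \<in> N ==> \<exists>\<tau>\<in>M. x = vl \<tau>" using vl(1) by blast
lemma vl_mem: "\<tau> \<in> M ==> x \<in> N.ext (vl \<tau>) \<longleftrightarrow> (\<exists>\<sigma>\<in>M. \<exists>p\<in>G. pair \<sigma> p \<in> ext \<tau> \<and> x = vl \<sigma>)"
 using vl(2) by auto

lemma M_N: "M \<subseteq> N" and N_wf: "wfp_on N E" and N_ext: "N.extensionality" and M_trans: "\<And>x y. x \<in> M ==> y \<in> N ==> E y x ==> y \<in> M"
 using gext unfolding generic_extension_def by blast+

lemma ext_abs: "x \<in> M ==> N.ext x = ext x"
 using M_N M_trans by (auto simp: N.ext_def ext_def)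

lemma G_P: "p \<in> G ==> p \<in> ext P" and G_up: "p \<in> G ==> q \<in> ext P ==> ext q \<subseteq> ext p ==> q \<in> G"
 and G_dir: "p \<in> G ==> q \<in> G ==> \<exists>r\<in>G. ext p \<subseteq> ext r \<and> ext q \<subseteq> ext r" and G_ne: "G \<noteq> {}"
 and G_gen: "D \<in> M ==> dense_in P D ==> G \<inter> ext D \<noteq> {}"
 using gen unfolding generic_filter_def by blast+

lemma G_M: "p \<in> G ==> p \<in> M" using G_P ext_U by blast
lemma one_G: "empty \<in> G" using G_ne G_up one_P ext_empty by blast

lemma gen_dense:
 assumes "df (\<lambda>e. Q (e 0))" "\<And>p. p \<in> ext P ==> \<exists>q\<in>ext P. ext p \<subseteq> ext q \<and> Q q"
 shows "\<exists>p\<in>G. Q p"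
proof -
 obtain D where D: "D \<in> M" "ext D = {q \<in> ext P. Q q}"
  using sepI[OF inU_ext[OF P_M] assms(1)] by (auto simp: inU_def)
 then have "dense_in P D" unfolding dense_in_def using assms(2) by blast
 from G_gen[OF D(1) this] D(2) show ?thesis by auto
qed

lemma gen_below:
 assumes p: "p \<in> G" and Q: "df (\<lambda>e. Q (e 0))" and d: "\<And>q. q \<in> ext P ==> ext p \<subseteq> ext q ==> \<exists>r\<in>ext P. ext q \<subseteq> ext r \<and> Q r"
 shows "\<exists>r\<in>G. ext p \<subseteq> ext r \<and> Q r"
proof -
 \<comment> \<open>Density below \<open>p\<close> becomes density everywhere by adding the
   conditions incompatible with \<open>p\<close>; directedness of \<open>G\<close> then excludes
   these.\<close>
 let ?Q = "\<lambda>r. (ext p \<subseteq> ext r \<and> Q r) \<or> \<not> (\<exists>s\<in>ext P. ext p \<subseteq> ext s \<and> ext r \<subseteq> ext s)"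
 have "\<exists>r\<in>G. ?Q r"
 proof (rule gen_dense)
  show "df (\<lambda>e. ?Q (e 0))" by (intro dfs df_subset G_M[OF p] P_M Q)
  fix q assume q: "q \<in> ext P"
  show "\<exists>r\<in>ext P. ext q \<subseteq> ext r \<and> ?Q r"
  proof (cases "\<exists>s\<in>ext P. ext p \<subseteq> ext s \<and> ext q \<subseteq> ext s")
   case True
   then obtain s where s: "s \<in> ext P" "ext p \<subseteq> ext s" "ext q \<subseteq> ext s" by blast
   from d[OF s(1,2)] obtain r where "r \<in> ext P" "ext s \<subseteq> ext r" "Q r" by blast
   with s show ?thesis by blast
  next
   case False
   with q show ?thesis by blast
  qed
 qed
 then obtain r where r: "r \<in> G" "?Q r" by blast
 moreover have "\<exists>s\<in>ext P. ext p \<subseteq> ext s \<and> ext r \<subseteq> ext s" using G_dir[OF p r(1)] G_P by blast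
 ultimately show ?thesis by blast
qed

lemma name_induct [consumes 1, case_names step]:
 assumes "\<sigma> \<in> M" and step: "\<And>\<sigma>. \<sigma> \<in> M ==> (\<And>\<pi> s. \<pi> \<in> M ==> s \<in> M ==> pair \<pi> s \<in> ext \<sigma> ==> Q \<pi>) ==> Q \<sigma>"
 shows "Q \<sigma>"
proof -
 \<comment> \<open>The claim is strengthened by two membership levels because \<pi> is an element of
   an element of \<open>pair \<pi> s\<close>.\<close>
 have "Q x \<and> (\<forall>y\<in>ext x. Q y) \<and> (\<forall>y\<in>ext x. \<forall>z\<in>ext y. Q z)" if "x \<in> M" for x
  using that
 proof (induction rule: wf_induct)
  case (step x)
  have "Q x"
  proof (rule assms(2)[OF step.hyps])
   fix \<pi> s assume a: "\<pi> \<in> M" "s \<in> M" "pair \<pi> s \<in> ext x"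
   then have "set_of {\<pi>} \<in> ext (pair \<pi> s)" "\<pi> \<in> ext (set_of {\<pi>})" by (simp_all add: pair_def)
   with step.IH[OF a(3)] show "Q \<pi>" by blast
  qed
  with step.IH show ?case by blast
 qed
 with assms(1) show ?thesis by blast
qed

definition tri :: "'a \<Rightarrow> 'a \<Rightarrow> 'a \<Rightarrow> 'a" where "tri p \<sigma> \<tau> = pair p (pair \<sigma> \<tau>)"

text \<open>One unfolding of forced equality, with \<open>X\<close> in place of the recursive calls:
  below \<open>p\<close>, a member of either name is densely forced to equal a member of the
  other.\<close>

definition feqc :: "('a \<Rightarrow> 'a \<Rightarrow> 'a \<Rightarrow> bool) \<Rightarrow> 'a \<Rightarrow> 'a \<Rightarrow> 'a \<Rightarrow> bool" where
 "feqc X p \<sigma> \<tau> \<longleftrightarrow>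
  (\<forall>\<pi>\<in>M. \<forall>s\<in>ext P. pair \<pi> s \<in> ext \<sigma> --> (\<forall>q\<in>ext P. ext p \<subseteq> ext q \<and> ext s \<subseteq> ext q -->
   (\<exists>r\<in>ext P. ext q \<subseteq> ext r \<and> (\<exists>\<rho>\<in>M. \<exists>t\<in>ext P. pair \<rho> t \<in> ext \<tau> \<and> ext t \<subseteq> ext r \<and> X r \<pi> \<rho>)))) \<and>
  (\<forall>\<rho>\<in>M. \<forall>t\<in>ext P. pair \<rho> t \<in> ext \<tau> --> (\<forall>q\<in>ext P. ext p \<subseteq> ext q \<and> ext t \<subseteq> ext q -->
   (\<exists>r\<in>ext P. ext q \<subseteq> ext r \<and> (\<exists>\<pi>\<in>M. \<exists>s\<in>ext P. pair \<pi> s \<in> ext \<sigma> \<and> ext s \<subseteq> ext r \<and> X r \<pi> \<rho>))))"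

text \<open>Forcing of equality is the greatest relation that is locally closed under the recursion
 clause; this makes its definability immediate, and no recursion on names is needed.\<close>

definition feq :: "'a \<Rightarrow> 'a \<Rightarrow> 'a \<Rightarrow> bool" where
 "feq p \<sigma> \<tau> \<longleftrightarrow> (\<exists>e\<in>M. (\<forall>p\<in>ext P. \<forall>\<sigma>\<in>M. \<forall>\<tau>\<in>M. tri p \<sigma> \<tau> \<in> ext e --> feqc (\<lambda>r \<pi> \<rho>. tri r \<pi> \<rho> \<in> ext e) p \<sigma> \<tau>) \<and>
  tri p \<sigma> \<tau> \<in> ext e)"

lemma df_feq: "dt s ==> dt t ==> dt u ==> df (\<lambda>e. feq (s e) (t e) (u e))"
 by (rule df_lift3[of feq]) (unfold feq_def feqc_def tri_def, intro dfs df_subset P_M)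

lemma feqc_mono:
 assumes X: "feqc X p \<sigma> \<tau>" and XY: "\<And>r \<pi> \<rho>. r \<in> ext P ==> \<pi> \<in> M ==> \<rho> \<in> M ==>
  (\<exists>s\<in>ext P. pair \<pi> s \<in> ext \<sigma>) ==> (\<exists>s\<in>ext P. pair \<rho> s \<in> ext \<tau>) ==> X r \<pi> \<rho> ==> Y r \<pi> \<rho>"
 shows "feqc Y p \<sigma> \<tau>"
 unfolding feqc_def
proof (intro conjI ballI impI)
 fix \<pi> s q assume a: "\<pi> \<in> M" "s \<in> ext P" "pair \<pi> s \<in> ext \<sigma>" "q \<in> ext P" "ext p \<subseteq> ext q \<and> ext s \<subseteq> ext q"
 with X have "\<exists>r\<in>ext P. ext q \<subseteq> ext r \<and> (\<exists>\<rho>\<in>M. \<exists>t\<in>ext P. pair \<rho> t \<in> ext \<tau> \<and> ext t \<subseteq> ext r \<and> X r \<pi> \<rho>)"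
  unfolding feqc_def by blast
 then obtain r \<rho> t where r: "r \<in> ext P" "ext q \<subseteq> ext r" "\<rho> \<in> M" "t \<in> ext P" "pair \<rho> t \<in> ext \<tau>" "ext t \<subseteq> ext r" "X r \<pi> \<rho>" by blast
 have "Y r \<pi> \<rho>" by (rule XY[OF r(1) a(1) r(3) _ _ r(7)]) (use a r in blast)+
 with r show "\<exists>r\<in>ext P. ext q \<subseteq> ext r \<and> (\<exists>\<rho>\<in>M. \<exists>t\<in>ext P. pair \<rho> t \<in> ext \<tau> \<and> ext t \<subseteq> ext r \<and> Y r \<pi> \<rho>)" by blast
next
 fix \<rho> t q assume a: "\<rho> \<in> M" "t \<in> ext P" "pair \<rho> t \<in> ext \<tau>" "q \<in> ext P" "ext p \<subseteq> ext q \<and> ext t \<subseteq> ext q"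
 with X have "\<exists>r\<in>ext P. ext q \<subseteq> ext r \<and> (\<exists>\<pi>\<in>M. \<exists>s\<in>ext P. pair \<pi> s \<in> ext \<sigma> \<and> ext s \<subseteq> ext r \<and> X r \<pi> \<rho>)"
  unfolding feqc_def by blast
 then obtain r \<pi> s where r: "r \<in> ext P" "ext q \<subseteq> ext r" "\<pi> \<in> M" "s \<in> ext P" "pair \<pi> s \<in> ext \<sigma>" "ext s \<subseteq> ext r" "X r \<pi> \<rho>" by blast
 have "Y r \<pi> \<rho>" by (rule XY[OF r(1) r(3) a(1) _ _ r(7)]) (use a r in blast)+
 with r show "\<exists>r\<in>ext P. ext q \<subseteq> ext r \<and> (\<exists>\<pi>\<in>M. \<exists>s\<in>ext P. pair \<pi> s \<in> ext \<sigma> \<and> ext s \<subseteq> ext r \<and> Y r \<pi> \<rho>)" by blast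
qed

lemma ex_trans: "x \<in> M ==> \<exists>t\<in>M. trans t \<and> x \<in> ext t"
 using ex_tc[of x] unfolding istc_def by blast

lemma trans_name: "trans t ==> \<sigma> \<in> ext t ==> \<pi> \<in> M ==> s \<in> M ==> pair \<pi> s \<in> ext \<sigma> ==> \<pi> \<in> ext t"
proof -
 assume a: "trans t" "\<sigma> \<in> ext t" "\<pi> \<in> M" "s \<in> M" "pair \<pi> s \<in> ext \<sigma>"
 then have "set_of {\<pi>} \<in> ext (pair \<pi> s)" "\<pi> \<in> ext (set_of {\<pi>})" by (simp_all add: pair_def)
 with a show ?thesis unfolding trans_def by blast
qed

lemma PM: "p \<in> ext P ==> p \<in> M" using ext_U by blast

text \<open>From right to left this is coinduction: the new triple together with all forced triples
  over transitive sets \<open>t1\<close> and \<open>t2\<close> around the names is a set satisfying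
  the closure condition.\<close>

lemma feq_iff: assumes p: "p \<in> ext P" and st: "\<sigma> \<in> M" "\<tau> \<in> M" shows "feq p \<sigma> \<tau> \<longleftrightarrow> feqc feq p \<sigma> \<tau>"
proof -
 have 1: "feqc feq p \<sigma> \<tau>" if "feq p \<sigma> \<tau>" "p \<in> ext P" "\<sigma> \<in> M" "\<tau> \<in> M" for p \<sigma> \<tau>
 proof -
  from that(1) obtain e where e: "e \<in> M" "\<forall>p\<in>ext P. \<forall>\<sigma>\<in>M. \<forall>\<tau>\<in>M. tri p \<sigma> \<tau> \<in> ext e --> feqc (\<lambda>r \<pi> \<rho>. tri r \<pi> \<rho> \<in> ext e) p \<sigma> \<tau>"
   "tri p \<sigma> \<tau> \<in> ext e" unfolding feq_def by blast
  with that have "feqc (\<lambda>r \<pi> \<rho>. tri r \<pi> \<rho> \<in> ext e) p \<sigma> \<tau>" by blast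
  then show ?thesis by (rule feqc_mono) (use e in \<open>unfold feq_def, blast\<close>)
 qed
 show ?thesis
 proof
  assume c: "feqc feq p \<sigma> \<tau>"
  obtain t1 t2 where t: "t1 \<in> M" "trans t1" "\<sigma> \<in> ext t1" "t2 \<in> M" "trans t2" "\<tau> \<in> ext t2" using ex_trans st by meson
  let ?A = "ext (times P (times t1 t2))"
  let ?S = "{z \<in> ?A. \<exists>p\<in>ext P. \<exists>\<sigma>\<in>M. \<exists>\<tau>\<in>M. z = tri p \<sigma> \<tau> \<and> feq p \<sigma> \<tau>}"
  have "inU ?S"
   by (rule sepI[OF inU_ext]) (intro times_U P_M t dfs df_feq, unfold tri_def, intro dfs df_feq P_M)
  then have i: "inU (insert (tri p \<sigma> \<tau>) ?S)"
   by (intro inU_insert) (simp_all add: tri_def pair_U PM[OF p] st)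
  then obtain e where e: "e \<in> M" "ext e = insert (tri p \<sigma> \<tau>) ?S" by (auto simp: inU_def)
  have inj: "tri p \<sigma> \<tau> = tri p' \<sigma>' \<tau>' \<longleftrightarrow> p = p' \<and> \<sigma> = \<sigma>' \<and> \<tau> = \<tau>'"
   if "p \<in> M" "\<sigma> \<in> M" "\<tau> \<in> M" "p' \<in> M" "\<sigma>' \<in> M" "\<tau>' \<in> M" for p \<sigma> \<tau> p' \<sigma>' \<tau>'
   using that by (auto simp: tri_def pair_iff pair_U)
  have memA: "tri p \<sigma> \<tau> \<in> ?A" if "p \<in> ext P" "\<sigma> \<in> ext t1" "\<tau> \<in> ext t2" for p \<sigma> \<tau>
   using that t P_M by (auto simp: tri_def ext_times times_U)
  have A_mem: "\<sigma>' \<in> ext t1 \<and> \<tau>' \<in> ext t2" if "tri p' \<sigma>' \<tau>' \<in> ?A" "p' \<in> M" "\<sigma>' \<in> M" "\<tau>' \<in> M" for p' \<sigma>' \<tau>'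
  proof -
   from that(1) t P_M obtain a b c where "a \<in> ext P" "b \<in> ext t1" "c \<in> ext t2" "tri p' \<sigma>' \<tau>' = tri a b c"
    by (auto simp: ext_times times_U tri_def)
   with inj[of p' \<sigma>' \<tau>' a b c] that PM ext_U[of t1] ext_U[of t2] show ?thesis by blast
  qed
  have cl: "feqc (\<lambda>r \<pi> \<rho>. tri r \<pi> \<rho> \<in> ext e) p' \<sigma>' \<tau>'"
   if p': "p' \<in> ext P" "\<sigma>' \<in> M" "\<tau>' \<in> M" "tri p' \<sigma>' \<tau>' \<in> ext e" for p' \<sigma>' \<tau>'
  proof -
   have 2: "feqc feq p' \<sigma>' \<tau>' \<and> \<sigma>' \<in> ext t1 \<and> \<tau>' \<in> ext t2"
   proof (cases "tri p' \<sigma>' \<tau>' = tri p \<sigma> \<tau>")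
    case True
    then have "p' = p \<and> \<sigma>' = \<sigma> \<and> \<tau>' = \<tau>" using inj[of p' \<sigma>' \<tau>' p \<sigma> \<tau>] p' p st PM by blast
    with c t show ?thesis by simp
   next
    case False
    then have A: "tri p' \<sigma>' \<tau>' \<in> ?A" and "\<exists>p\<in>ext P. \<exists>\<sigma>\<in>M. \<exists>\<tau>\<in>M. tri p' \<sigma>' \<tau>' = tri p \<sigma> \<tau> \<and> feq p \<sigma> \<tau>"
     using p'(4) unfolding e(2) by blast+
    then obtain a b d where "a \<in> ext P" "b \<in> M" "d \<in> M" "tri p' \<sigma>' \<tau>' = tri a b d" "feq a b d" by blast
    then have "feq p' \<sigma>' \<tau>'" using inj[of p' \<sigma>' \<tau>' a b d] p' PM by blast
    with 1 p' A_mem[OF A] PM show ?thesis by blast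
   qed
   then have "feqc feq p' \<sigma>' \<tau>'" by blast
   then show ?thesis
   proof (rule feqc_mono)
    fix r \<pi> \<rho> assume a: "r \<in> ext P" "\<pi> \<in> M" "\<rho> \<in> M" "\<exists>s\<in>ext P. pair \<pi> s \<in> ext \<sigma>'" "\<exists>s\<in>ext P. pair \<rho> s \<in> ext \<tau>'" "feq r \<pi> \<rho>"
    have "\<pi> \<in> ext t1" "\<rho> \<in> ext t2" using a 2 trans_name t PM by blast+
    with memA[OF a(1) this] a show "tri r \<pi> \<rho> \<in> ext e" unfolding e(2) by blast
   qed
  qed
  show "feq p \<sigma> \<tau>" unfolding feq_def using e cl by blast
 qed (use 1 assms in blast)
qed

lemma feq_mono: assumes "feq p \<sigma> \<tau>" "p \<in> ext P" "q \<in> ext P" "ext p \<subseteq> ext q" "\<sigma> \<in> M" "\<tau> \<in> M" shows "feq q \<sigma> \<tau>"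
proof -
 have "feqc feq p \<sigma> \<tau>" using feq_iff assms by blast
 then have "feqc feq q \<sigma> \<tau>" using assms(4) unfolding feqc_def by (meson subset_trans)
 with feq_iff assms show ?thesis by blast
qed

lemma feq_dense: assumes "\<And>q. q \<in> ext P ==> ext p \<subseteq> ext q ==> \<exists>r\<in>ext P. ext q \<subseteq> ext r \<and> feq r \<sigma> \<tau>" "p \<in> ext P" "\<sigma> \<in> M" "\<tau> \<in> M" shows "feq p \<sigma> \<tau>"
proof -
 have "feqc feq p \<sigma> \<tau>"
  unfolding feqc_def
 proof (intro conjI ballI impI)
  fix \<pi> s q assume a: "\<pi> \<in> M" "s \<in> ext P" "pair \<pi> s \<in> ext \<sigma>" "q \<in> ext P" "ext p \<subseteq> ext q \<and> ext s \<subseteq> ext q"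
  then obtain r where r: "r \<in> ext P" "ext q \<subseteq> ext r" "feq r \<sigma> \<tau>" using assms(1) by blast
  then have "feqc feq r \<sigma> \<tau>" using feq_iff assms by blast
  with a r have "\<exists>r'\<in>ext P. ext r \<subseteq> ext r' \<and> (\<exists>\<rho>\<in>M. \<exists>t\<in>ext P. pair \<rho> t \<in> ext \<tau> \<and> ext t \<subseteq> ext r' \<and> feq r' \<pi> \<rho>)"
   unfolding feqc_def by blast
  with r show "\<exists>r\<in>ext P. ext q \<subseteq> ext r \<and> (\<exists>\<rho>\<in>M. \<exists>t\<in>ext P. pair \<rho> t \<in> ext \<tau> \<and> ext t \<subseteq> ext r \<and> feq r \<pi> \<rho>)"
   by (meson subset_trans)
 next
  fix \<rho> t q assume a: "\<rho> \<in> M" "t \<in> ext P" "pair \<rho> t \<in> ext \<tau>" "q \<in> ext P" "ext p \<subseteq> ext q \<and> ext t \<subseteq> ext q"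
  then obtain r where r: "r \<in> ext P" "ext q \<subseteq> ext r" "feq r \<sigma> \<tau>" using assms(1) by blast
  then have "feqc feq r \<sigma> \<tau>" using feq_iff assms by blast
  with a r have "\<exists>r'\<in>ext P. ext r \<subseteq> ext r' \<and> (\<exists>\<pi>\<in>M. \<exists>s\<in>ext P. pair \<pi> s \<in> ext \<sigma> \<and> ext s \<subseteq> ext r' \<and> feq r' \<pi> \<rho>)"
   unfolding feqc_def by blast
  with r show "\<exists>r\<in>ext P. ext q \<subseteq> ext r \<and> (\<exists>\<pi>\<in>M. \<exists>s\<in>ext P. pair \<pi> s \<in> ext \<sigma> \<and> ext s \<subseteq> ext r \<and> feq r \<pi> \<rho>)"
   by (meson subset_trans)
 qed
 with feq_iff assms show ?thesis by blast
qed

lemma N_ext_eq: "x \<in> N ==> y \<in> N ==> N.ext x = N.ext y ==> x = y"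
 using N_ext unfolding N.extensionality_def by blast

text \<open>Truth pins the greatest fixed point down. Induction on the first name suffices, because
  each clause of \<open>feqc\<close> passes to a member of it and the second name is
  arbitrary.\<close>

lemma feq_truth: "\<sigma> \<in> M ==> \<forall>\<tau>\<in>M. (vl \<sigma> = vl \<tau>) \<longleftrightarrow> (\<exists>p\<in>G. feq p \<sigma> \<tau>)"
proof (induction \<sigma> rule: name_induct)
 case (step \<sigma>)
 note \<sigma> = step(1)
 have IH: "(vl \<pi> = vl \<rho>) \<longleftrightarrow> (\<exists>p\<in>G. feq p \<pi> \<rho>)" if "\<pi> \<in> M" "s \<in> ext P" "pair \<pi> s \<in> ext \<sigma>" "\<rho> \<in> M" for \<pi> s \<rho>
  using step(2)[of \<pi> s] that PM by blast
 show ?case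
 proof
  fix \<tau> assume \<tau>: "\<tau> \<in> M"
  show "(vl \<sigma> = vl \<tau>) \<longleftrightarrow> (\<exists>p\<in>G. feq p \<sigma> \<tau>)"
  proof
   assume "\<exists>p\<in>G. feq p \<sigma> \<tau>"
   then obtain p where p: "p \<in> G" "feq p \<sigma> \<tau>" by blast
   then have c: "feqc feq p \<sigma> \<tau>" using feq_iff \<sigma> \<tau> G_P by blast
   have "N.ext (vl \<sigma>) = N.ext (vl \<tau>)"
   proof
    show "N.ext (vl \<sigma>) \<subseteq> N.ext (vl \<tau>)"
    proof
     fix x assume "x \<in> N.ext (vl \<sigma>)"
     then obtain \<pi> s where s: "\<pi> \<in> M" "s \<in> G" "pair \<pi> s \<in> ext \<sigma>" "x = vl \<pi>" using vl_mem[OF \<sigma>] by blast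
     obtain q where q: "q \<in> G" "ext p \<subseteq> ext q" "ext s \<subseteq> ext q" using G_dir p(1) s(2) by blast
     have "\<exists>r\<in>G. ext q \<subseteq> ext r \<and> (\<exists>\<rho>\<in>M. \<exists>t\<in>ext P. pair \<rho> t \<in> ext \<tau> \<and> ext t \<subseteq> ext r \<and> feq r \<pi> \<rho>)"
     proof (rule gen_below[OF q(1)])
      show "df (\<lambda>e. \<exists>\<rho>\<in>M. \<exists>t\<in>ext P. pair \<rho> t \<in> ext \<tau> \<and> ext t \<subseteq> ext (e 0) \<and> feq (e 0) \<pi> \<rho>)"
       by (intro dfs df_subset df_feq P_M \<tau> s(1))
      fix q' assume "q' \<in> ext P" "ext q \<subseteq> ext q'"
      then show "\<exists>r\<in>ext P. ext q' \<subseteq> ext r \<and> (\<exists>\<rho>\<in>M. \<exists>t\<in>ext P. pair \<rho> t \<in> ext \<tau> \<and> ext t \<subseteq> ext r \<and> feq r \<pi> \<rho>)"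
       using c s G_P q unfolding feqc_def by (meson subset_trans)
     qed
     then obtain r \<rho> t where r: "r \<in> G" "\<rho> \<in> M" "t \<in> ext P" "pair \<rho> t \<in> ext \<tau>" "ext t \<subseteq> ext r" "feq r \<pi> \<rho>" by blast
     then have "vl \<pi> = vl \<rho>" using IH[of \<pi> s \<rho>] s G_P by blast
     moreover have "t \<in> G" using G_up r by blast
     ultimately show "x \<in> N.ext (vl \<tau>)" using vl_mem[OF \<tau>] r s by blast
    qed
    show "N.ext (vl \<tau>) \<subseteq> N.ext (vl \<sigma>)"
    proof
     fix x assume "x \<in> N.ext (vl \<tau>)"
     then obtain \<rho> s where s: "\<rho> \<in> M" "s \<in> G" "pair \<rho> s \<in> ext \<tau>" "x = vl \<rho>" using vl_mem[OF \<tau>] by blast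
     obtain q where q: "q \<in> G" "ext p \<subseteq> ext q" "ext s \<subseteq> ext q" using G_dir p(1) s(2) by blast
     have "\<exists>r\<in>G. ext q \<subseteq> ext r \<and> (\<exists>\<pi>\<in>M. \<exists>t\<in>ext P. pair \<pi> t \<in> ext \<sigma> \<and> ext t \<subseteq> ext r \<and> feq r \<pi> \<rho>)"
     proof (rule gen_below[OF q(1)])
      show "df (\<lambda>e. \<exists>\<pi>\<in>M. \<exists>t\<in>ext P. pair \<pi> t \<in> ext \<sigma> \<and> ext t \<subseteq> ext (e 0) \<and> feq (e 0) \<pi> \<rho>)"
       by (intro dfs df_subset df_feq P_M \<sigma> s(1))
      fix q' assume "q' \<in> ext P" "ext q \<subseteq> ext q'"
      then show "\<exists>r\<in>ext P. ext q' \<subseteq> ext r \<and> (\<exists>\<pi>\<in>M. \<exists>t\<in>ext P. pair \<pi> t \<in> ext \<sigma> \<and> ext t \<subseteq> ext r \<and> feq r \<pi> \<rho>)"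
       using c s G_P q unfolding feqc_def by (meson subset_trans)
     qed
     then obtain r \<pi> t where r: "r \<in> G" "\<pi> \<in> M" "t \<in> ext P" "pair \<pi> t \<in> ext \<sigma>" "ext t \<subseteq> ext r" "feq r \<pi> \<rho>" by blast
     then have "vl \<pi> = vl \<rho>" using IH[of \<pi> t \<rho>] s by blast
     moreover have "t \<in> G" using G_up r by blast
     ultimately show "x \<in> N.ext (vl \<sigma>)" using vl_mem[OF \<sigma>] r s by metis
    qed
   qed
   then show "vl \<sigma> = vl \<tau>" using N_ext_eq vl_N \<sigma> \<tau> by blast
  next
   assume eq: "vl \<sigma> = vl \<tau>"
   \<comment> \<open>\<open>?A\<close> and \<open>?B\<close> say that the condition refutes one half
     of \<open>feqc\<close>: some member of one name is forced to differ from all members of the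
     other. Such a condition in \<open>G\<close> contradicts equality of the values.\<close>
   let ?A = "\<lambda>p. \<exists>\<pi>\<in>M. \<exists>s\<in>ext P. pair \<pi> s \<in> ext \<sigma> \<and> ext s \<subseteq> ext p \<and> (\<forall>r\<in>ext P. ext p \<subseteq> ext r -->
    \<not> (\<exists>\<rho>\<in>M. \<exists>t\<in>ext P. pair \<rho> t \<in> ext \<tau> \<and> ext t \<subseteq> ext r \<and> feq r \<pi> \<rho>))"
   let ?B = "\<lambda>p. \<exists>\<rho>\<in>M. \<exists>t\<in>ext P. pair \<rho> t \<in> ext \<tau> \<and> ext t \<subseteq> ext p \<and> (\<forall>r\<in>ext P. ext p \<subseteq> ext r -->
    \<not> (\<exists>\<pi>\<in>M. \<exists>s\<in>ext P. pair \<pi> s \<in> ext \<sigma> \<and> ext s \<subseteq> ext r \<and> feq r \<pi> \<rho>))"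
   have "\<exists>p\<in>G. feq p \<sigma> \<tau> \<or> ?A p \<or> ?B p"
   proof (rule gen_dense)
    show "df (\<lambda>e. feq (e 0) \<sigma> \<tau> \<or> ?A (e 0) \<or> ?B (e 0))"
     by (intro dfs df_subset df_feq P_M \<sigma> \<tau>)
    fix p assume p: "p \<in> ext P"
    show "\<exists>q\<in>ext P. ext p \<subseteq> ext q \<and> (feq q \<sigma> \<tau> \<or> ?A q \<or> ?B q)"
    proof (cases "feq p \<sigma> \<tau>")
     case False
     then have "\<not> feqc feq p \<sigma> \<tau>" using feq_iff p \<sigma> \<tau> by blast
     then show ?thesis unfolding feqc_def by meson
    qed (use p in blast)
   qed
   then obtain p where p: "p \<in> G" "feq p \<sigma> \<tau> \<or> ?A p \<or> ?B p" by blast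
   have "\<not> ?A p"
   proof
    assume "?A p"
    then obtain \<pi> s where s: "\<pi> \<in> M" "s \<in> ext P" "pair \<pi> s \<in> ext \<sigma>" "ext s \<subseteq> ext p" 
     "\<And>r. r \<in> ext P ==> ext p \<subseteq> ext r ==> \<not> (\<exists>\<rho>\<in>M. \<exists>t\<in>ext P. pair \<rho> t \<in> ext \<tau> \<and> ext t \<subseteq> ext r \<and> feq r \<pi> \<rho>)" by blast
    have "s \<in> G" using G_up p s by blast
    then have "vl \<pi> \<in> N.ext (vl \<tau>)" unfolding eq[symmetric] using vl_mem[OF \<sigma>] s by blast
    then obtain \<rho> t where t: "\<rho> \<in> M" "t \<in> G" "pair \<rho> t \<in> ext \<tau>" "vl \<pi> = vl \<rho>" using vl_mem[OF \<tau>] by blast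
    then obtain p' where p': "p' \<in> G" "feq p' \<pi> \<rho>" using IH[of \<pi> s \<rho>] s by blast
    obtain r1 where r1: "r1 \<in> G" "ext p \<subseteq> ext r1" "ext p' \<subseteq> ext r1" using G_dir p(1) p'(1) by blast
    obtain r where r: "r \<in> G" "ext r1 \<subseteq> ext r" "ext t \<subseteq> ext r" using G_dir r1(1) t(2) by blast
    have "feq r \<pi> \<rho>" by (rule feq_mono[OF p'(2)]) (use p' r r1 G_P t s in auto)
    with s(5)[of r] r r1 t G_P show False by blast
   qed
   moreover have "\<not> ?B p"
   proof
    assume "?B p"
    then obtain \<rho> s where s: "\<rho> \<in> M" "s \<in> ext P" "pair \<rho> s \<in> ext \<tau>" "ext s \<subseteq> ext p" 
     "\<And>r. r \<in> ext P ==> ext p \<subseteq> ext r ==> \<not> (\<exists>\<pi>\<in>M. \<exists>t\<in>ext P. pair \<pi> t \<in> ext \<sigma> \<and> ext t \<subseteq> ext r \<and> feq r \<pi> \<rho>)" by blast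
    have "s \<in> G" using G_up p s by blast
    then have "vl \<rho> \<in> N.ext (vl \<sigma>)" unfolding eq using vl_mem[OF \<tau>] s by blast
    then obtain \<pi> t where t: "\<pi> \<in> M" "t \<in> G" "pair \<pi> t \<in> ext \<sigma>" "vl \<rho> = vl \<pi>" using vl_mem[OF \<sigma>] by blast
    then obtain p' where p': "p' \<in> G" "feq p' \<pi> \<rho>" using IH[of \<pi> t \<rho>] s G_P by metis
    obtain r1 where r1: "r1 \<in> G" "ext p \<subseteq> ext r1" "ext p' \<subseteq> ext r1" using G_dir p(1) p'(1) by blast
    obtain r where r: "r \<in> G" "ext r1 \<subseteq> ext r" "ext t \<subseteq> ext r" using G_dir r1(1) t(2) by blast
    have "feq r \<pi> \<rho>" by (rule feq_mono[OF p'(2)]) (use p' r r1 G_P t s in auto)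
    with s(5)[of r] r r1 t G_P show False by blast
   qed
   ultimately show "\<exists>p\<in>G. feq p \<sigma> \<tau>" using p by blast
  qed
 qed
qed

definition fmem :: "'a \<Rightarrow> 'a \<Rightarrow> 'a \<Rightarrow> bool" where
 "fmem p \<pi> \<tau> \<longleftrightarrow> (\<forall>q\<in>ext P. ext p \<subseteq> ext q --> (\<exists>r\<in>ext P. ext q \<subseteq> ext r \<and>
  (\<exists>\<rho>\<in>M. \<exists>t\<in>ext P. pair \<rho> t \<in> ext \<tau> \<and> ext t \<subseteq> ext r \<and> feq r \<pi> \<rho>)))"

lemma df_fmem: "dt s ==> dt t ==> dt u ==> df (\<lambda>e. fmem (s e) (t e) (u e))"
 by (rule df_lift3[of fmem]) (unfold fmem_def, intro dfs df_subset df_feq P_M)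

lemma fmem_mono: "fmem p \<sigma> \<tau> ==> ext p \<subseteq> ext q ==> fmem q \<sigma> \<tau>"
 unfolding fmem_def by (meson subset_trans)

lemma fmem_dense: "(\<And>q. q \<in> ext P ==> ext p \<subseteq> ext q ==> \<exists>r\<in>ext P. ext q \<subseteq> ext r \<and> fmem r \<sigma> \<tau>) ==> fmem p \<sigma> \<tau>"
 unfolding fmem_def by (meson subset_trans subset_refl)

lemma fmem_truth: assumes "\<pi> \<in> M" "\<tau> \<in> M" shows "vl \<pi> \<in> N.ext (vl \<tau>) \<longleftrightarrow> (\<exists>p\<in>G. fmem p \<pi> \<tau>)"
proof
 assume "\<exists>p\<in>G. fmem p \<pi> \<tau>"
 then obtain p where p: "p \<in> G" "fmem p \<pi> \<tau>" by blast
 have "\<exists>r\<in>G. ext p \<subseteq> ext r \<and> (\<exists>\<rho>\<in>M. \<exists>t\<in>ext P. pair \<rho> t \<in> ext \<tau> \<and> ext t \<subseteq> ext r \<and> feq r \<pi> \<rho>)"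
  by (rule gen_below[OF p(1)]) (intro dfs df_subset df_feq P_M assms, use p(2) fmem_def in blast)
 then obtain r \<rho> t where r: "r \<in> G" "\<rho> \<in> M" "t \<in> ext P" "pair \<rho> t \<in> ext \<tau>" "ext t \<subseteq> ext r" "feq r \<pi> \<rho>" by blast
 then have "vl \<pi> = vl \<rho>" using feq_truth assms by blast
 moreover have "t \<in> G" using G_up r by blast
 ultimately show "vl \<pi> \<in> N.ext (vl \<tau>)" using vl_mem[OF assms(2)] r by blast
next
 assume "vl \<pi> \<in> N.ext (vl \<tau>)"
 then obtain \<rho> t where t: "\<rho> \<in> M" "t \<in> G" "pair \<rho> t \<in> ext \<tau>" "vl \<pi> = vl \<rho>" using vl_mem[OF assms(2)] by blast
 then obtain p where p: "p \<in> G" "feq p \<pi> \<rho>" using feq_truth assms by blast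
 obtain r where r: "r \<in> G" "ext p \<subseteq> ext r" "ext t \<subseteq> ext r" using G_dir p(1) t(2) by blast
 have "fmem r \<pi> \<tau>" unfolding fmem_def
 proof (intro ballI impI)
  fix q assume q: "q \<in> ext P" "ext r \<subseteq> ext q"
  have "feq q \<pi> \<rho>" by (rule feq_mono[OF p(2)]) (use p r q G_P t assms in auto)
  with q t r G_P show "\<exists>s\<in>ext P. ext q \<subseteq> ext s \<and> (\<exists>\<rho>\<in>M. \<exists>t\<in>ext P. pair \<rho> t \<in> ext \<tau> \<and> ext t \<subseteq> ext s \<and> feq s \<pi> \<rho>)"
   by (meson subset_trans subset_refl)
 qed
 with r show "\<exists>p\<in>G. fmem p \<pi> \<tau>" by blast
qed

text \<open>The quantifier ranges over all of \<open>M\<close>, since every element of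
  \<open>M\<close> counts as a name.\<close>

primrec forces :: "fm \<Rightarrow> 'a \<Rightarrow> (nat \<Rightarrow> 'a) \<Rightarrow> bool" where
 "forces (Mem i j) p e \<longleftrightarrow> fmem p (e i) (e j)"
| "forces (Eq i j) p e \<longleftrightarrow> feq p (e i) (e j)"
| "forces (Neg \<phi>) p e \<longleftrightarrow> (\<forall>q\<in>ext P. ext p \<subseteq> ext q --> \<not> forces \<phi> q e)"
| "forces (Conj \<phi> \<psi>) p e \<longleftrightarrow> forces \<phi> p e \<and> forces \<psi> p e"
| "forces (All \<phi>) p e \<longleftrightarrow> (\<forall>x\<in>M. forces \<phi> p (case_nat x e))"

lemma df_forces: "df (\<lambda>e. forces \<phi> (e 0) (\<lambda>n. e (Suc n)))"
proof (induction \<phi>)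
 case (Neg \<phi>)
 show ?case unfolding forces.simps
  by (intro dfs df_subset P_M) (use df_ren[OF Neg, of "case_nat 0 (\<lambda>n. Suc (Suc n))"] in simp)
next
 case (All \<phi>)
 have 1: "(\<lambda>n. e (case n of 0 \<Rightarrow> 0 | Suc x \<Rightarrow> Suc (Suc x))) = case_nat (e 0) (\<lambda>n. e (Suc (Suc n)))" for e :: "nat \<Rightarrow> 'a"
  by (auto split: nat.split)
 show ?case unfolding forces.simps
  by (intro dfs) (use df_ren[OF All, of "case_nat (Suc 0) (case_nat 0 (\<lambda>n. Suc (Suc n)))"] 1 in simp)
qed (auto intro!: dfs df_fmem df_feq)

lemma forces_mono: "forces \<phi> p e ==> p \<in> ext P ==> q \<in> ext P ==> ext p \<subseteq> ext q ==> range e \<subseteq> M ==> forces \<phi> q e"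
proof (induction \<phi> arbitrary: e)
 case (Mem i j) then show ?case using fmem_mono by (auto simp del: fmem_def)
next
 case (Eq i j) then show ?case using feq_mono by (auto simp: image_subset_iff)
next
 case (All \<phi>) 
 have "forces \<phi> q (case_nat x e)" if "x \<in> M" for x
  by (rule All.IH) (use All that in \<open>auto simp: range_case_nat\<close>)
 then show ?case by simp
qed auto

text \<open>Closure under density is built into the atomic clauses and passes through the
  connectives; \<open>truth\<close> uses it to refute a universal statement at a single
  name.\<close>

lemma forces_dense: "(\<And>q. q \<in> ext P ==> ext p \<subseteq> ext q ==> \<exists>r\<in>ext P. ext q \<subseteq> ext r \<and> forces \<phi> r e) ==> p \<in> ext P ==> range e \<subseteq> M ==> forces \<phi> p e"
proof (induction \<phi> arbitrary: e)
 case (Mem i j) then show ?case using fmem_dense by simp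
next
 case (Eq i j) 
 have "feq p (e i) (e j)" by (rule feq_dense) (use Eq in auto)
 then show ?case by simp
next
 case (Neg \<phi>)
 show ?case unfolding forces.simps
 proof (intro ballI impI notI)
  fix q assume q: "q \<in> ext P" "ext p \<subseteq> ext q" "forces \<phi> q e"
  obtain r where "r \<in> ext P" "ext q \<subseteq> ext r" "forces (Neg \<phi>) r e" using Neg.prems(1)[OF q(1,2)] by blast
  moreover have "forces \<phi> r e" using forces_mono q calculation Neg.prems by blast
  ultimately show False by auto
 qed
next
 case (Conj \<phi> \<psi>)
 have "forces \<phi> p e" by (rule Conj.IH(1)) (use Conj.prems in \<open>simp, blast\<close>)+
 moreover have "forces \<psi> p e" by (rule Conj.IH(2)) (use Conj.prems in \<open>simp, blast\<close>)+
 ultimately show ?case by simp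
next
 case (All \<phi>)
 have "forces \<phi> p (case_nat x e)" if "x \<in> M" for x
 proof (rule All.IH[OF _ All.prems(2)])
  show "range (case_nat x e) \<subseteq> M" using that All.prems by (simp add: range_case_nat)
  show "\<exists>r\<in>ext P. ext q \<subseteq> ext r \<and> forces \<phi> r (case_nat x e)" if "q \<in> ext P" "ext p \<subseteq> ext q" for q
   using All.prems(1)[OF that] \<open>x \<in> M\<close> unfolding forces.simps by blast
 qed
 then show ?case by simp
qed

lemma df_forces_env: "range e \<subseteq> M ==> df (\<lambda>e'. forces \<phi> (e' 0) e)"
 using df_params[OF df_forces, of e \<phi>] by simp

text \<open>The quantifier case carries the weight: if no condition in \<open>G\<close> forces the
  universal statement, then by genericity and \<open>forces_dense\<close> one of them excludes a
  particular name, and the value of that name is a counterexample.\<close>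

lemma truth: "range e \<subseteq> M ==> N.sat \<phi> (\<lambda>i. vl (e i)) \<longleftrightarrow> (\<exists>p\<in>G. forces \<phi> p e)"
proof (induction \<phi> arbitrary: e)
 case (Mem i j)
 then have "e i \<in> M" "e j \<in> M" by auto
 with fmem_truth[OF this] vl_N show ?case by (auto simp: N.ext_def)
next
 case (Eq i j)
 then have "e i \<in> M" "e j \<in> M" by auto
 with feq_truth show ?case by auto
next
 case (Neg \<phi>)
 have "\<exists>p\<in>G. forces \<phi> p e \<or> forces (Neg \<phi>) p e"
 proof (rule gen_dense)
  show "df (\<lambda>e'. forces \<phi> (e' 0) e \<or> forces (Neg \<phi>) (e' 0) e)" by (intro dfs df_forces_env Neg)
 qed auto
 moreover have "\<not> (forces \<phi> p e \<and> forces (Neg \<phi>) q e)" if pq: "p \<in> G" "q \<in> G" for p q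
 proof
  assume f: "forces \<phi> p e \<and> forces (Neg \<phi>) q e"
  obtain r where "r \<in> G" "ext p \<subseteq> ext r" "ext q \<subseteq> ext r" using G_dir pq by blast
  with f forces_mono[of \<phi> p e r] G_P pq Neg.prems show False by auto
 qed
 ultimately show ?case using Neg by (simp only: N.sat.simps) blast
next
 case (Conj \<phi> \<psi>)
 show ?case
 proof
  assume "N.sat (Conj \<phi> \<psi>) (\<lambda>i. vl (e i))"
  then obtain p q where pq: "p \<in> G" "forces \<phi> p e" "q \<in> G" "forces \<psi> q e" using Conj by auto
  obtain r where "r \<in> G" "ext p \<subseteq> ext r" "ext q \<subseteq> ext r" using G_dir pq by blast
  with pq forces_mono[of _ _ e r] G_P Conj.prems show "\<exists>p\<in>G. forces (Conj \<phi> \<psi>) p e" by auto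
 next
  assume "\<exists>p\<in>G. forces (Conj \<phi> \<psi>) p e" with Conj show "N.sat (Conj \<phi> \<psi>) (\<lambda>i. vl (e i))" by auto
 qed
next
 case (All \<phi>)
 have cn: "(\<lambda>i. vl (case_nat y e i)) = case_nat (vl y) (\<lambda>i. vl (e i))" for y by (auto split: nat.split)
 have IH: "N.sat \<phi> (case_nat (vl y) (\<lambda>i. vl (e i))) \<longleftrightarrow> (\<exists>p\<in>G. forces \<phi> p (case_nat y e))" if "y \<in> M" for y
  using All.IH[of "case_nat y e"] that All.prems by (simp add: range_case_nat cn)
 show ?case
 proof
  assume "\<exists>p\<in>G. forces (All \<phi>) p e"
  then have "N.sat \<phi> (case_nat (vl y) (\<lambda>i. vl (e i)))" if "y \<in> M" for y using IH[OF that] that by auto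
  then show "N.sat (All \<phi>) (\<lambda>i. vl (e i))" using name_ex by auto
 next
  assume s: "N.sat (All \<phi>) (\<lambda>i. vl (e i))"
  have dfF: "df (\<lambda>e'. forces \<phi> (e' i) (case_nat (e' j) e))" for i j
  proof -
   have "df (\<lambda>e'. forces \<phi> (e' 0) (case_nat (e' (Suc 0)) (\<lambda>n. e' (Suc (Suc n)))))"
   proof -
    have 1: "(\<lambda>n. e' (Suc n)) = case_nat (e' (Suc 0)) (\<lambda>n. e' (Suc (Suc n)))" for e' :: "nat \<Rightarrow> 'a"
     by (auto split: nat.split)
    show ?thesis using df_forces[of \<phi>] by (subst (asm) 1)
   qed
   from df_ren[OF this, of "\<lambda>n. if n = 0 then 1 else if n = 1 then 0 else n"]
   have "df (\<lambda>e'. forces \<phi> (e' (Suc 0)) (case_nat (e' 0) (\<lambda>n. e' (Suc (Suc n)))))" by simp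
   from df_params2[OF this All.prems] show ?thesis .
  qed
  have "\<exists>p\<in>G. forces (All \<phi>) p e \<or> (\<exists>x\<in>M. \<forall>q\<in>ext P. ext p \<subseteq> ext q --> \<not> forces \<phi> q (case_nat x e))"
  proof (rule gen_dense)
   show "df (\<lambda>e'. forces (All \<phi>) (e' 0) e \<or> (\<exists>x\<in>M. \<forall>q\<in>ext P. ext (e' 0) \<subseteq> ext q --> \<not> forces \<phi> q (case_nat x e)))"
    by (intro dfs df_forces_env All.prems df_subset P_M dfF)
   fix p assume p: "p \<in> ext P"
   show "\<exists>q\<in>ext P. ext p \<subseteq> ext q \<and> (forces (All \<phi>) q e \<or> (\<exists>x\<in>M. \<forall>r\<in>ext P. ext q \<subseteq> ext r --> \<not> forces \<phi> r (case_nat x e)))"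
   proof (cases "forces (All \<phi>) p e")
    case False
    then obtain x where x: "x \<in> M" "\<not> forces \<phi> p (case_nat x e)" by auto
    have "\<exists>q\<in>ext P. ext p \<subseteq> ext q \<and> (\<forall>r\<in>ext P. ext q \<subseteq> ext r --> \<not> forces \<phi> r (case_nat x e))"
    proof (rule ccontr)
     assume "\<not> ?thesis"
     then have "\<exists>r\<in>ext P. ext q \<subseteq> ext r \<and> forces \<phi> r (case_nat x e)" if "q \<in> ext P" "ext p \<subseteq> ext q" for q
      using that by blast
     from forces_dense[OF this p] x All.prems show False by (simp add: range_case_nat)
    qed
    with x(1) show ?thesis by blast
   qed (use p in blast)
  qed
  then obtain p where p: "p \<in> G" "forces (All \<phi>) p e \<or> (\<exists>x\<in>M. \<forall>q\<in>ext P. ext p \<subseteq> ext q --> \<not> forces \<phi> q (case_nat x e))" by blast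
  have "\<not> (\<exists>x\<in>M. \<forall>q\<in>ext P. ext p \<subseteq> ext q --> \<not> forces \<phi> q (case_nat x e))"
  proof
   assume "\<exists>x\<in>M. \<forall>q\<in>ext P. ext p \<subseteq> ext q --> \<not> forces \<phi> q (case_nat x e)"
   then obtain x where x: "x \<in> M" "\<And>q. q \<in> ext P ==> ext p \<subseteq> ext q ==> \<not> forces \<phi> q (case_nat x e)" by blast
   from s x(1) have "N.sat \<phi> (case_nat (vl x) (\<lambda>i. vl (e i)))" by (simp add: vl_N)
   with IH[OF x(1)] obtain q where q: "q \<in> G" "forces \<phi> q (case_nat x e)" by blast
   obtain r where "r \<in> G" "ext p \<subseteq> ext r" "ext q \<subseteq> ext r" using G_dir p q by blast
   with q x forces_mono[of \<phi> q "case_nat x e" r] G_P All.prems show False by (auto simp: range_case_nat)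
  qed
  with p show "\<exists>p\<in>G. forces (All \<phi>) p e" by blast
 qed
qed

end

context forcing begin

section \<open>The axioms in the generic extension\<close>

text \<open>Names are cut out of the product of a set of names with the forcing by a definable
  relation. The statement speaks of pairs only, since \<open>vl\<close> ignores members of a name
  that are not pairs.\<close>

lemma ex_name:
 assumes t: "t \<in> M" and Q: "df (\<lambda>e. Q (e 0) (e (Suc 0)))"
 shows "\<exists>\<nu>\<in>M. \<forall>\<eta>\<in>M. \<forall>p\<in>M. pair \<eta> p \<in> ext \<nu> \<longleftrightarrow> \<eta> \<in> ext t \<and> p \<in> ext P \<and> Q \<eta> p"
proof -
 let ?S = "{z \<in> ext (times t P). \<exists>\<eta>\<in>M. \<exists>p\<in>M. z = pair \<eta> p \<and> Q \<eta> p}"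
 have "inU ?S"
  by (rule sepI[OF inU_ext[OF times_U[OF t P_M]]])
   (intro dfs, use df_ren[OF Q, of "\<lambda>n. if n = 0 then Suc 0 else 0"] in simp)
 then obtain \<nu> where \<nu>: "\<nu> \<in> M" "ext \<nu> = ?S" unfolding inU_def by blast
 have "pair \<eta> p \<in> ext \<nu> \<longleftrightarrow> \<eta> \<in> ext t \<and> p \<in> ext P \<and> Q \<eta> p" if "\<eta> \<in> M" "p \<in> M" for \<eta> p
 proof -
  have "pair \<eta> p \<in> ext (times t P) \<longleftrightarrow> \<eta> \<in> ext t \<and> p \<in> ext P"
   unfolding ext_times[OF t P_M] using that ext_U by (auto simp: pair_iff subset_iff)
  moreover have "(\<exists>\<eta>'\<in>M. \<exists>p'\<in>M. pair \<eta> p = pair \<eta>' p' \<and> Q \<eta>' p') \<longleftrightarrow> Q \<eta> p"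
   using that pair_iff by metis
  ultimately show ?thesis unfolding \<nu>(2) by blast
 qed
 with \<nu>(1) show ?thesis by blast
qed

lemma ex_nameE:
 assumes "t \<in> M" "df (\<lambda>e. Q (e 0) (e (Suc 0)))"
 obtains \<nu> where "\<nu> \<in> M" "\<And>\<eta> p. \<eta> \<in> M ==> p \<in> M ==> pair \<eta> p \<in> ext \<nu> \<longleftrightarrow> \<eta> \<in> ext t \<and> p \<in> ext P \<and> Q \<eta> p"
 using ex_name[of t Q, OF assms] by (elim bexE) blast

lemma N_set_of: "x \<in> N ==> N.ext x = S ==> N.set_of S = x"
 unfolding N.set_of_def using N_ext_eq by (intro the_equality) auto

lemma N_pairing: "x \<in> N ==> y \<in> N ==> \<exists>z\<in>N. N.ext z = {x, y}"
proof -
 assume "x \<in> N" "y \<in> N"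
 then obtain \<sigma> \<tau> where s: "\<sigma> \<in> M" "\<tau> \<in> M" "x = vl \<sigma>" "y = vl \<tau>" using name_ex by blast
 let ?S = "{pair \<sigma> empty, pair \<tau> empty}"
 have i: "inU ?S" using s by (intro inU_pair pair_U empty_U)
 have "N.ext (vl (set_of ?S)) = {x, y}"
 proof (rule Set.set_eqI)
  fix z show "z \<in> N.ext (vl (set_of ?S)) \<longleftrightarrow> z \<in> {x, y}"
   unfolding vl_mem[OF set_of_U[OF i]] ext_set_of[OF i] using s one_G G_M empty_U
   by (auto simp: pair_iff)
 qed
 with vl_N[OF set_of_U[OF i]] show ?thesis by blast
qed

lemma N_sep: "N.separation"
 unfolding N.separation_def
proof (intro allI ballI impI)
 fix \<phi> and e :: "nat \<Rightarrow> 'a" and a assume a: "a \<in> N" and e: "range e \<subseteq> N"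
 obtain \<tau> where \<tau>: "\<tau> \<in> M" "a = vl \<tau>" using name_ex a by blast
 have "\<forall>i::nat. \<exists>\<sigma>. \<sigma> \<in> M \<and> e i = vl \<sigma>" using name_ex e by blast
 then obtain d where d: "\<And>i. d i \<in> M" "\<And>i. e i = vl (d i)" by metis
 have rd: "range d \<subseteq> M" using d(1) by blast
 obtain t where t: "t \<in> M" "trans t" "\<tau> \<in> ext t" using ex_trans \<tau> by blast
 \<comment> \<open>The condition attached to \<eta> must put \<eta> into the given set and force the
   formula. Admitting every extension of a \<open>q\<close> with
   \<open>pair \<eta> q \<in> ext \<tau>\<close> lets one condition achieve both.\<close>
 let ?Q = "\<lambda>\<eta> p. (\<exists>q\<in>ext P. pair \<eta> q \<in> ext \<tau> \<and> ext q \<subseteq> ext p) \<and> forces \<phi> p (case_nat \<eta> d)"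
 have dF: "df (\<lambda>e'. forces \<phi> (e' (Suc 0)) (case_nat (e' 0) d))"
 proof (rule df_params2[OF _ rd, of "\<lambda>p \<eta> d. forces \<phi> p (case_nat \<eta> d)"])
  have 1: "(\<lambda>n. e' (case n of 0 \<Rightarrow> 0 | Suc m \<Rightarrow> Suc (Suc m))) = case_nat (e' 0) (\<lambda>n. e' (Suc (Suc n)))" for e' :: "nat \<Rightarrow> 'a"
   by (auto split: nat.split)
  show "df (\<lambda>e'. forces \<phi> (e' (Suc 0)) (case_nat (e' 0) (\<lambda>n. e' (Suc (Suc n)))))"
   using df_ren[OF df_forces, of \<phi> "case_nat (Suc 0) (case_nat 0 (\<lambda>n. Suc (Suc n)))"] by (simp add: 1)
 qed
 have "df (\<lambda>e. ?Q (e 0) (e (Suc 0)))" by (intro dfs df_subset P_M \<tau> dF)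
 then obtain \<nu> where \<nu>: "\<nu> \<in> M"
  "\<And>\<eta> p. \<eta> \<in> M ==> p \<in> M ==> pair \<eta> p \<in> ext \<nu> \<longleftrightarrow> \<eta> \<in> ext t \<and> p \<in> ext P \<and> ?Q \<eta> p"
  by (rule ex_nameE[of t ?Q, OF t(1)]) (rule that, assumption, simp)
 have tr: "N.sat \<phi> (case_nat (vl \<eta>) e) \<longleftrightarrow> (\<exists>p\<in>G. forces \<phi> p (case_nat \<eta> d))" if "\<eta> \<in> M" for \<eta>
 proof -
  have "(\<lambda>i. vl (case_nat \<eta> d i)) = case_nat (vl \<eta>) e" using d(2) by (auto split: nat.split)
  with truth[of "case_nat \<eta> d" \<phi>] that rd show ?thesis by (simp add: range_case_nat)
 qed
 have "N.ext (vl \<nu>) = {x \<in> N.ext a. N.sat \<phi> (case_nat x e)}"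
 proof
  show "N.ext (vl \<nu>) \<subseteq> {x \<in> N.ext a. N.sat \<phi> (case_nat x e)}"
  proof
   fix x assume "x \<in> N.ext (vl \<nu>)"
   then obtain \<eta> p where \<eta>: "\<eta> \<in> M" "p \<in> G" "pair \<eta> p \<in> ext \<nu>" "x = vl \<eta>" using vl_mem[OF \<nu>(1)] by blast
   then have Q: "?Q \<eta> p" using \<nu>(2) G_M by blast
   then obtain q where q: "q \<in> ext P" "pair \<eta> q \<in> ext \<tau>" "ext q \<subseteq> ext p" by blast
   then have "q \<in> G" using G_up \<eta>(2) by blast
   with q \<eta> \<tau> vl_mem have "x \<in> N.ext a" by blast
   moreover have "N.sat \<phi> (case_nat x e)" using tr[OF \<eta>(1)] Q \<eta> by blast
   ultimately show "x \<in> {x \<in> N.ext a. N.sat \<phi> (case_nat x e)}" by blast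
  qed
  show "{x \<in> N.ext a. N.sat \<phi> (case_nat x e)} \<subseteq> N.ext (vl \<nu>)"
  proof clarify
   fix x assume x: "x \<in> N.ext a" "N.sat \<phi> (case_nat x e)"
   then obtain \<eta> q where \<eta>: "\<eta> \<in> M" "q \<in> G" "pair \<eta> q \<in> ext \<tau>" "x = vl \<eta>" using vl_mem[OF \<tau>(1)] \<tau>(2) by blast
   with x tr obtain p where p: "p \<in> G" "forces \<phi> p (case_nat \<eta> d)" by blast
   obtain r where r: "r \<in> G" "ext p \<subseteq> ext r" "ext q \<subseteq> ext r" using G_dir p(1) \<eta>(2) by blast
   have "forces \<phi> r (case_nat \<eta> d)"
    by (rule forces_mono[OF p(2)]) (use p r G_P \<eta> rd in \<open>auto simp: range_case_nat\<close>)
   moreover have "\<eta> \<in> ext t" using trans_name[OF t(2,3) \<eta>(1) _ \<eta>(3)] G_M \<eta>(2) by blast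
   ultimately have "pair \<eta> r \<in> ext \<nu>" using \<nu>(2)[OF \<eta>(1), of r] r \<eta> G_P G_M by blast
   then show "x \<in> N.ext (vl \<nu>)" using vl_mem[OF \<nu>(1)] \<eta> r by blast
  qed
 qed
 with vl_N[OF \<nu>(1)] show "\<exists>b\<in>N. N.ext b = {x \<in> N.ext a. N.sat \<phi> (case_nat x e)}" by blast
qed

lemma N_union: "N.union_axiom"
 unfolding N.union_axiom_def
proof
 fix x assume "x \<in> N"
 then obtain \<tau> where \<tau>: "\<tau> \<in> M" "x = vl \<tau>" using name_ex by blast
 obtain t where t: "t \<in> M" "trans t" "\<tau> \<in> ext t" using ex_trans \<tau> by blast
 let ?Q = "\<lambda>\<eta> r. \<exists>\<sigma>\<in>M. \<exists>p\<in>ext P. \<exists>q\<in>ext P. pair \<sigma> p \<in> ext \<tau> \<and> pair \<eta> q \<in> ext \<sigma> \<and> ext p \<subseteq> ext r \<and> ext q \<subseteq> ext r"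
 have "df (\<lambda>e. ?Q (e 0) (e (Suc 0)))" by (intro dfs df_subset P_M \<tau>)
 then obtain \<nu> where \<nu>: "\<nu> \<in> M"
  "\<And>\<eta> p. \<eta> \<in> M ==> p \<in> M ==> pair \<eta> p \<in> ext \<nu> \<longleftrightarrow> \<eta> \<in> ext t \<and> p \<in> ext P \<and> ?Q \<eta> p"
  by (rule ex_nameE[of t ?Q, OF t(1)]) (rule that, assumption, simp)
 have "N.ext (vl \<nu>) = (\<Union>y\<in>N.ext x. N.ext y)"
 proof
  show "N.ext (vl \<nu>) \<subseteq> (\<Union>y\<in>N.ext x. N.ext y)"
  proof
   fix z assume "z \<in> N.ext (vl \<nu>)"
   then obtain \<eta> r where \<eta>: "\<eta> \<in> M" "r \<in> G" "pair \<eta> r \<in> ext \<nu>" "z = vl \<eta>" using vl_mem[OF \<nu>(1)] by blast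
   then have "?Q \<eta> r" using \<nu>(2) G_M by blast
   then obtain \<sigma> p q where q: "\<sigma> \<in> M" "p \<in> ext P" "q \<in> ext P" "pair \<sigma> p \<in> ext \<tau>" "pair \<eta> q \<in> ext \<sigma>" "ext p \<subseteq> ext r" "ext q \<subseteq> ext r" by blast
   then have "p \<in> G" "q \<in> G" using G_up \<eta>(2) by blast+
   then have "z \<in> N.ext (vl \<sigma>)" "vl \<sigma> \<in> N.ext x"
    using q \<eta> vl_mem[OF q(1), of z] vl_mem[OF \<tau>(1), of "vl \<sigma>"] \<tau>(2) by blast+
   then show "z \<in> (\<Union>y\<in>N.ext x. N.ext y)" by blast
  qed
  show "(\<Union>y\<in>N.ext x. N.ext y) \<subseteq> N.ext (vl \<nu>)"
  proof
   fix z assume "z \<in> (\<Union>y\<in>N.ext x. N.ext y)"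
   then obtain y where y: "y \<in> N.ext x" "z \<in> N.ext y" by blast
   then obtain \<sigma> p where s: "\<sigma> \<in> M" "p \<in> G" "pair \<sigma> p \<in> ext \<tau>" "y = vl \<sigma>" using vl_mem[OF \<tau>(1)] \<tau>(2) by blast
   with y(2) obtain \<eta> q where \<eta>: "\<eta> \<in> M" "q \<in> G" "pair \<eta> q \<in> ext \<sigma>" "z = vl \<eta>" using vl_mem[OF s(1)] by blast
   obtain r where r: "r \<in> G" "ext p \<subseteq> ext r" "ext q \<subseteq> ext r" using G_dir s(2) \<eta>(2) by blast
   have "\<sigma> \<in> ext t" using trans_name[OF t(2,3) s(1) _ s(3)] G_M s(2) by blast
   then have "\<eta> \<in> ext t" using trans_name[OF t(2) _ \<eta>(1) _ \<eta>(3)] G_M \<eta>(2) by blast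
   then have "pair \<eta> r \<in> ext \<nu>" using \<nu>(2)[OF \<eta>(1), of r] r s \<eta> G_P G_M by blast
   then show "z \<in> N.ext (vl \<nu>)" using vl_mem[OF \<nu>(1)] \<eta> r by blast
  qed
 qed
 with vl_N[OF \<nu>(1)] show "\<exists>u\<in>N. N.ext u = (\<Union>y\<in>N.ext x. N.ext y)" by blast
qed

text \<open>Every subset of \<open>x\<close> has a name inside the product of \<open>t\<close> and
  the forcing: attach to each \<eta> in \<open>t\<close> the conditions that force it into the
  subset. The names of this form make a set, which bounds the power set.\<close>

lemma N_power: "N.powerset"
 unfolding N.powerset_def
proof
 fix x assume x: "x \<in> N"
 then obtain \<tau> where \<tau>: "\<tau> \<in> M" "x = vl \<tau>" using name_ex by blast
 obtain t where t: "t \<in> M" "trans t" "\<tau> \<in> ext t" using ex_trans \<tau> by blast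
 let ?p = "power (times t P)"
 have pM: "?p \<in> M" by (intro power_U times_U t P_M)
 have "df (\<lambda>e. e (Suc 0) = empty)" by (intro dfs empty_U)
 then obtain \<nu> where \<nu>: "\<nu> \<in> M"
  "\<And>\<eta> p. \<eta> \<in> M ==> p \<in> M ==> pair \<eta> p \<in> ext \<nu> \<longleftrightarrow> \<eta> \<in> ext ?p \<and> p \<in> ext P \<and> p = empty"
  by (rule ex_nameE[of ?p "\<lambda>\<eta> p. p = empty", OF pM]) (rule that, assumption, simp)
 have sup: "y \<in> N.ext (vl \<nu>)" if y: "y \<in> N" "N.ext y \<subseteq> N.ext x" for y
 proof -
  obtain \<rho> where \<rho>: "\<rho> \<in> M" "y = vl \<rho>" using name_ex y by blast
  have "df (\<lambda>e. fmem (e (Suc 0)) (e 0) \<rho>)" by (intro df_fmem dfs \<rho>)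
  then obtain \<sigma> where \<sigma>: "\<sigma> \<in> M"
   "\<And>\<eta> p. \<eta> \<in> M ==> p \<in> M ==> pair \<eta> p \<in> ext \<sigma> \<longleftrightarrow> \<eta> \<in> ext t \<and> p \<in> ext P \<and> fmem p \<eta> \<rho>"
   by (rule ex_nameE[of t "\<lambda>\<eta> p. fmem p \<eta> \<rho>", OF t(1)]) (rule that, assumption, simp)
  let ?S = "ext \<sigma> \<inter> ext (times t P)"
  have i: "inU ?S" by (intro inU_Int inU_ext \<sigma> times_U t P_M)
  let ?\<sigma> = "set_of ?S"
  have \<sigma>': "?\<sigma> \<in> M" "\<And>\<eta> p. \<eta> \<in> M ==> p \<in> M ==> pair \<eta> p \<in> ext ?\<sigma> \<longleftrightarrow> \<eta> \<in> ext t \<and> p \<in> ext P \<and> fmem p \<eta> \<rho>"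
   using \<sigma>(2) set_of_U[OF i] unfolding ext_set_of[OF i] by (auto simp: ext_times t P_M)
  have "?\<sigma> \<in> ext ?p" using \<sigma>'(1) i by (simp add: ext_power times_U t P_M ext_set_of)
  then have 1: "vl ?\<sigma> \<in> N.ext (vl \<nu>)" using vl_mem[OF \<nu>(1)] \<nu>(2)[OF \<sigma>'(1) empty_U] \<sigma>'(1) one_G one_P by blast
  have "N.ext (vl ?\<sigma>) = N.ext y"
  proof
   show "N.ext (vl ?\<sigma>) \<subseteq> N.ext y"
   proof
    fix z assume "z \<in> N.ext (vl ?\<sigma>)"
    then obtain \<eta> p where \<eta>: "\<eta> \<in> M" "p \<in> G" "pair \<eta> p \<in> ext ?\<sigma>" "z = vl \<eta>" using vl_mem[OF \<sigma>'(1)] by blast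
    then have "fmem p \<eta> \<rho>" using \<sigma>'(2) G_M by blast
    with fmem_truth[OF \<eta>(1) \<rho>(1)] \<eta> \<rho> show "z \<in> N.ext y" by blast
   qed
   show "N.ext y \<subseteq> N.ext (vl ?\<sigma>)"
   proof
    fix z assume z: "z \<in> N.ext y"
    then have "z \<in> N.ext (vl \<tau>)" using y(2) \<tau>(2) by blast
    then obtain \<eta> q where \<eta>: "\<eta> \<in> M" "q \<in> G" "pair \<eta> q \<in> ext \<tau>" "z = vl \<eta>" using vl_mem[OF \<tau>(1)] by blast
    with z \<rho> fmem_truth[OF \<eta>(1) \<rho>(1)] obtain p where p: "p \<in> G" "fmem p \<eta> \<rho>" by blast
    have "\<eta> \<in> ext t" using trans_name[OF t(2,3) \<eta>(1) _ \<eta>(3)] G_M \<eta>(2) by blast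
    then have "pair \<eta> p \<in> ext ?\<sigma>" using \<sigma>'(2)[OF \<eta>(1), of p] p G_P G_M by blast
    then show "z \<in> N.ext (vl ?\<sigma>)" using vl_mem[OF \<sigma>'(1)] \<eta> p by blast
   qed
  qed
  with N_ext_eq vl_N[OF \<sigma>'(1)] y(1) have "y = vl ?\<sigma>" by metis
  with 1 show ?thesis by simp
 qed
 \<comment> \<open>The value of \<nu> may also contain sets that are not subsets of
   \<open>x\<close>; \<open>?f\<close> expresses inclusion in \<open>x\<close> and cuts them
   off.\<close>
 let ?f = "All (Neg (Conj (Mem 0 1) (Neg (Mem 0 2))))"
 have "\<exists>b\<in>N. N.ext b = {y \<in> N.ext (vl \<nu>). N.sat ?f (case_nat y (\<lambda>_. x))}"
  using N_sep[unfolded N.separation_def, THEN spec[of _ ?f], THEN spec[of _ "\<lambda>_. x"], THEN bspec[OF _ vl_N[OF \<nu>(1)]]] x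
  by (simp add: image_subset_iff)
 then obtain b where b: "b \<in> N" "N.ext b = {y \<in> N.ext (vl \<nu>). N.sat ?f (case_nat y (\<lambda>_. x))}" by blast
 have "N.sat ?f (case_nat y (\<lambda>_. x)) \<longleftrightarrow> N.ext y \<subseteq> N.ext x" for y
  by (auto simp: N.ext_def)
 with b(2) sup have "N.ext b = {y \<in> N. N.ext y \<subseteq> N.ext x}" by (auto simp: N.ext_def)
 with b(1) show "\<exists>p\<in>N. N.ext p = {y \<in> N. N.ext y \<subseteq> N.ext x}" by blast
qed

lemma N_inf: "N.infinity"
 unfolding N.infinity_def
proof (rule bexI[of _ omega], rule conjI, rule_tac [2] ballI)
 show "omega \<in> N" using omega_U M_N by blast
 have o: "N.ext omega = range num" using ext_abs[OF omega_U] ext_omega by simp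
 show "\<exists>z\<in>N.ext omega. N.ext z = {}"
  unfolding o using ext_abs[OF num_U, of 0] ext_num[of 0] by auto
 fix x assume "x \<in> N.ext omega"
 then obtain n where n: "x = num n" unfolding o by blast
 have "N.ext (num (Suc n)) = insert x (N.ext x)"
  unfolding n ext_abs[OF num_U] by (auto simp: ext_num lessThan_Suc)
 then show "\<exists>y\<in>N.ext omega. N.ext y = insert x (N.ext x)" unfolding o by blast
qed

sublocale N: zc N E
proof
 show "N.pairing" unfolding N.pairing_def using N_pairing by blast
qed (use N_wf N_ext N_union N_power N_inf N_sep in auto)

section \<open>Check names and choice in the generic extension\<close>

text \<open>The step function for the canonical names of ground-model elements, which carry the
  weakest condition throughout. The earlier values arrive as a graph, so only its second components
  have to be collected.\<close>

definition Hck :: "'a \<Rightarrow> 'a \<Rightarrow> 'a" where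
 "Hck x g = set_of {w\<in>M. \<exists>z\<in>M. \<exists>y\<in>M. pair z y \<in> ext g \<and> w = pair y empty}"

lemma Hck_inU: "g \<in> M ==> inU {w\<in>M. \<exists>z\<in>M. \<exists>y\<in>M. pair z y \<in> ext g \<and> w = pair y empty}"
proof -
 assume g: "g \<in> M"
 obtain t where t: "t \<in> M" "trans t" "g \<in> ext t" using ex_trans g by blast
 have yt: "y \<in> ext t" if "pair z y \<in> ext g" "z \<in> M" "y \<in> M" for z y
 proof -
  have "set_of {z, y} \<in> ext (pair z y)" "y \<in> ext (set_of {z, y})" using that by (simp_all add: pair_def)
  with t that show ?thesis unfolding trans_def by blast
 qed
 have s: "set_of {empty} \<in> M" "ext (set_of {empty}) = {empty}" using empty_U by simp_all
 show ?thesis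
 proof (rule inU_subI[OF inU_ext[OF times_U[OF t(1) s(1)]], where Q="\<lambda>w. \<exists>z\<in>M. \<exists>y\<in>M. pair z y \<in> ext g \<and> w = pair y empty"])
  show "df (\<lambda>e. \<exists>z\<in>M. \<exists>y\<in>M. pair z y \<in> ext g \<and> e 0 = pair y empty)" by (intro dfs g empty_U)
  show "{w\<in>M. \<exists>z\<in>M. \<exists>y\<in>M. pair z y \<in> ext g \<and> w = pair y empty} \<subseteq> ext (times t (set_of {empty}))"
   using yt unfolding ext_times[OF t(1) s(1)] s(2) by blast
 qed (auto simp: pair_U empty_U)
qed

lemma HckU: "x \<in> M ==> g \<in> M ==> Hck x g \<in> M"
 unfolding Hck_def by (rule set_of_U[OF Hck_inU])

lemma df_Hck: "df (\<lambda>e. e 0 = Hck (e (Suc 0)) (e (Suc (Suc 0))))"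
proof -
 have "dt (\<lambda>e. set_of {w\<in>M. \<exists>z\<in>M. \<exists>y\<in>M. pair z y \<in> ext (e (Suc 0)) \<and> w = pair y empty})"
  by (rule dt_set_of) (rule Hck_inU, blast, intro dfs empty_U)
 then have "dt (\<lambda>e. Hck (e 0) (e (Suc 0)))" unfolding Hck_def .
 then show ?thesis by (simp add: dt_def)
qed

definition ck :: "'a \<Rightarrow> 'a" where "ck = erec Hck"

lemma ck_M: "x \<in> M ==> ck x \<in> M" unfolding ck_def by (rule erec_U[OF HckU df_Hck])
lemma dt_ck: "dt s ==> dt (\<lambda>e. ck (s e))" unfolding ck_def by (rule dt_erec[OF HckU df_Hck])

lemma ext_ck: "x \<in> M ==> ext (ck x) = {pair (ck y) empty | y. y \<in> ext x}"
proof -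
 assume x: "x \<in> M"
 let ?g = "set_of {pair y (ck y) | y. y \<in> ext x}"
 have i: "inU {pair y (ck y) | y. y \<in> ext x}" unfolding ck_def by (rule inU_erec[OF HckU df_Hck x])
 have "ck x = Hck x ?g" unfolding ck_def by (rule erec_eq[OF x])
 then have "ext (ck x) = {w\<in>M. \<exists>z\<in>M. \<exists>y\<in>M. pair z y \<in> ext ?g \<and> w = pair y empty}"
  unfolding Hck_def using ext_set_of[OF Hck_inU[OF set_of_U[OF i]]] by simp
 also have "\<dots> = {pair (ck y) empty | y. y \<in> ext x}"
 proof
  show "{w\<in>M. \<exists>z\<in>M. \<exists>y\<in>M. pair z y \<in> ext ?g \<and> w = pair y empty} \<subseteq> {pair (ck y) empty | y. y \<in> ext x}"
  proof clarify
   fix z y assume zy: "z \<in> M" "y \<in> M" "pair z y \<in> ext ?g"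
   then obtain y' where y': "y' \<in> ext x" "pair z y = pair y' (ck y')" unfolding ext_set_of[OF i] by blast
   then have "y = ck y'" using zy ck_M ext_U pair_iff by (metis subsetD)
   with y' show "\<exists>y'. pair y empty = pair (ck y') empty \<and> y' \<in> ext x" by blast
  qed
  show "{pair (ck y) empty | y. y \<in> ext x} \<subseteq> {w\<in>M. \<exists>z\<in>M. \<exists>y\<in>M. pair z y \<in> ext ?g \<and> w = pair y empty}"
  proof clarify
   fix y assume y: "y \<in> ext x"
   then have "y \<in> M" "ck y \<in> M" using ext_U ck_M by blast+
   with y show "pair (ck y) empty \<in> M \<and> (\<exists>z\<in>M. \<exists>y'\<in>M. pair z y' \<in> ext ?g \<and> pair (ck y) empty = pair y' empty)"
    unfolding ext_set_of[OF i] by (blast intro: pair_U empty_U)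
  qed
 qed
 finally show ?thesis .
qed

lemma vl_ck: "x \<in> M ==> vl (ck x) = x"
proof (induction rule: wf_induct)
 case (step x)
 have "N.ext (vl (ck x)) = ext x"
 proof
  show "N.ext (vl (ck x)) \<subseteq> ext x"
  proof
   fix z assume "z \<in> N.ext (vl (ck x))"
   then obtain \<sigma> p where s: "\<sigma> \<in> M" "p \<in> G" "pair \<sigma> p \<in> ext (ck x)" "z = vl \<sigma>" using vl_mem[OF ck_M[OF step(1)]] by blast
   then obtain y where y: "y \<in> ext x" "pair \<sigma> p = pair (ck y) empty" unfolding ext_ck[OF step(1)] by blast
   then have "\<sigma> = ck y" using s G_M ck_M ext_U empty_U pair_iff by (metis subsetD)
   with step.IH[OF y(1)] y s show "z \<in> ext x" by simp
  qed
  show "ext x \<subseteq> N.ext (vl (ck x))"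
  proof
   fix y assume y: "y \<in> ext x"
   then have "pair (ck y) empty \<in> ext (ck x)" "ck y \<in> M" unfolding ext_ck[OF step(1)] using ck_M ext_U by blast+
   with step.IH[OF y] one_G vl_mem[OF ck_M[OF step(1)]] show "y \<in> N.ext (vl (ck x))" by metis
  qed
 qed
 with ext_abs[OF step(1)] show ?case using N_ext_eq vl_N[OF ck_M[OF step(1)]] M_N step(1) by (metis subsetD)
qed

text \<open>Names for the unordered and the ordered pair of two values.\<close>

definition upn :: "'a \<Rightarrow> 'a \<Rightarrow> 'a" where "upn \<sigma> \<tau> = set_of {pair \<sigma> empty, pair \<tau> empty}"
definition opn :: "'a \<Rightarrow> 'a \<Rightarrow> 'a" where "opn \<sigma> \<tau> = upn (upn \<sigma> \<sigma>) (upn \<sigma> \<tau>)"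

lemma dt_opn: "dt s ==> dt t ==> dt (\<lambda>e. opn (s e) (t e))"
 unfolding opn_def upn_def by (intro dt_upair dt_pair dt_const empty_U)

lemma upn_M: "\<sigma> \<in> M ==> \<tau> \<in> M ==> upn \<sigma> \<tau> \<in> M"
 unfolding upn_def by (simp add: pair_U empty_U)
lemma opn_M: "\<sigma> \<in> M ==> \<tau> \<in> M ==> opn \<sigma> \<tau> \<in> M"
 unfolding opn_def by (simp add: upn_M)

lemma vl_upn: "\<sigma> \<in> M ==> \<tau> \<in> M ==> vl (upn \<sigma> \<tau>) = N.set_of {vl \<sigma>, vl \<tau>}"
proof -
 assume s: "\<sigma> \<in> M" "\<tau> \<in> M"
 have "N.ext (vl (upn \<sigma> \<tau>)) = {vl \<sigma>, vl \<tau>}"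
 proof (rule Set.set_eqI)
  fix z show "z \<in> N.ext (vl (upn \<sigma> \<tau>)) \<longleftrightarrow> z \<in> {vl \<sigma>, vl \<tau>}"
   unfolding vl_mem[OF upn_M[OF s]] using s one_G G_M empty_U
   by (auto simp: upn_def pair_iff pair_U)
 qed
 then show ?thesis using N_set_of[OF vl_N[OF upn_M[OF s]]] by metis
qed

lemma vl_opn: "\<sigma> \<in> M ==> \<tau> \<in> M ==> vl (opn \<sigma> \<tau>) = N.pair (vl \<sigma>) (vl \<tau>)"
 unfolding opn_def N.pair_def by (simp add: vl_upn upn_M)

text \<open>A well-order of a transitive set of names, taken from the ground model, is carried over
  to the values: \<open>v\<close> is the map from the ordinal \<kappa> to the values, and the
  selector takes from every member the element of least index.\<close>

lemma N_choice: "N.choice"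
 unfolding N.choice_def
proof (intro ballI impI)
 fix x assume x: "x \<in> N" and
  dj: "(\<forall>y\<in>N.ext x. N.ext y \<noteq> {}) \<and> (\<forall>y\<in>N.ext x. \<forall>z\<in>N.ext x. y \<noteq> z --> N.ext y \<inter> N.ext z = {})"
 obtain u where u: "u \<in> N" "N.ext u = (\<Union>y\<in>N.ext x. N.ext y)" using N_union x unfolding N.union_axiom_def by blast
 then obtain \<upsilon> where \<upsilon>: "\<upsilon> \<in> M" "u = vl \<upsilon>" using name_ex by blast
 obtain t where t: "t \<in> M" "trans t" "\<upsilon> \<in> ext t" using ex_trans \<upsilon> by blast
 obtain \<kappa> f where \<kappa>: "\<kappa> \<in> M" "f \<in> M" "Ord \<kappa>" "bij_betw (ap f) (ext \<kappa>) (ext t)" using wellorder[OF t(1)] by blast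
 have fM: "ap f a \<in> M" for a by (rule ap_U)
 have surj: "\<exists>a\<in>ext \<kappa>. z = vl (ap f a)" if z: "z \<in> N.ext u" for z
 proof -
  from z obtain \<eta> p where \<eta>: "\<eta> \<in> M" "p \<in> G" "pair \<eta> p \<in> ext \<upsilon>" "z = vl \<eta>" using vl_mem[OF \<upsilon>(1)] \<upsilon>(2) by blast
  have "\<eta> \<in> ext t" using trans_name[OF t(2,3) \<eta>(1) _ \<eta>(3)] G_M \<eta>(2) by blast
  moreover have "ap f ` ext \<kappa> = ext t" using \<kappa>(4) by (simp add: bij_betw_def)
  ultimately have "\<eta> \<in> ap f ` ext \<kappa>" by simp
  then show ?thesis using \<eta>(4) by blast
 qed
 have kM: "a \<in> M" if "a \<in> ext \<kappa>" for a using that ext_U by blast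
 let ?V = "(\<lambda>a. pair (opn (ck a) (ap f a)) empty) ` ext \<kappa>"
 have dV: "dt (\<lambda>e. pair (opn (ck (e (Suc 0))) (ap f (e (Suc 0)))) empty)"
  by (intro dfs dt_opn dt_ck dt_ap \<kappa> empty_U)
 have i: "inU ?V"
  by (rule repl[OF inU_ext[OF \<kappa>(1)] df_eq[OF dt_var dV]]) (intro pair_U opn_M ck_M fM empty_U kM)
 define v where "v = vl (set_of ?V)"
 have v: "v \<in> N" unfolding v_def by (rule vl_N[OF set_of_U[OF i]])
 have v_mem: "N.pair a z \<in> N.ext v \<longleftrightarrow> z = vl (ap f a)" if a: "a \<in> ext \<kappa>" and z: "z \<in> N" for a z
 proof -
  have aN: "b \<in> N" if "b \<in> ext \<kappa>" for b using kM[OF that] M_N by blast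
  have "N.pair a z \<in> N.ext v \<longleftrightarrow> (\<exists>b\<in>ext \<kappa>. N.pair a z = vl (opn (ck b) (ap f b)))"
   unfolding v_def vl_mem[OF set_of_U[OF i]] ext_set_of[OF i]
  proof
   assume "\<exists>\<sigma>\<in>M. \<exists>p\<in>G. pair \<sigma> p \<in> ?V \<and> N.pair a z = vl \<sigma>"
   then obtain \<sigma> p b where "\<sigma> \<in> M" "p \<in> G" "b \<in> ext \<kappa>" "pair \<sigma> p = pair (opn (ck b) (ap f b)) empty" "N.pair a z = vl \<sigma>" by blast
   moreover from this have "\<sigma> = opn (ck b) (ap f b)" using G_M kM ck_M fM opn_M empty_U by (simp add: pair_iff)
   ultimately show "\<exists>b\<in>ext \<kappa>. N.pair a z = vl (opn (ck b) (ap f b))" by blast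
  next
   assume "\<exists>b\<in>ext \<kappa>. N.pair a z = vl (opn (ck b) (ap f b))"
   then obtain b where b: "b \<in> ext \<kappa>" "N.pair a z = vl (opn (ck b) (ap f b))" by blast
   have "opn (ck b) (ap f b) \<in> M" by (intro opn_M ck_M fM kM b)
   with b one_G show "\<exists>\<sigma>\<in>M. \<exists>p\<in>G. pair \<sigma> p \<in> ?V \<and> N.pair a z = vl \<sigma>" by blast
  qed
  also have "\<dots> \<longleftrightarrow> (\<exists>b\<in>ext \<kappa>. N.pair a z = N.pair b (vl (ap f b)))"
   using vl_opn[OF ck_M[OF kM] fM] vl_ck[OF kM] by simp
  also have "\<dots> \<longleftrightarrow> z = vl (ap f a)"
   using a z aN vl_N[OF fM] by (auto simp: N.pair_iff)
  finally show ?thesis .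
 qed
 have kN: "\<kappa> \<in> N" "N.ext \<kappa> = ext \<kappa>" using \<kappa>(1) M_N ext_abs by auto
 let ?C = "\<lambda>z. \<exists>y\<in>N.ext x. z \<in> N.ext y \<and> (\<exists>a\<in>N.ext \<kappa>. N.pair a z \<in> N.ext v \<and>
  (\<forall>b\<in>N.ext \<kappa>. \<forall>z'\<in>N. N.pair b z' \<in> N.ext v \<and> z' \<in> N.ext y --> a = b \<or> E a b))"
 have "N.inU {z \<in> N.ext u. ?C z}"
  by (rule N.sepI[OF N.inU_ext[OF u(1)]]) (intro N.dfs x v kN)
 then obtain c where c: "c \<in> N" "N.ext c = {z \<in> N.ext u. ?C z}" unfolding N.inU_def by blast
 have C: "?C z \<longleftrightarrow> (\<exists>y\<in>N.ext x. z \<in> N.ext y \<and> (\<exists>a\<in>ext \<kappa>. z = vl (ap f a) \<and>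
  (\<forall>b\<in>ext \<kappa>. vl (ap f b) \<in> N.ext y --> a = b \<or> a \<in> ext b)))" if z: "z \<in> N" for z
 proof -
  have "N.pair a z \<in> N.ext v \<and> (\<forall>b\<in>ext \<kappa>. \<forall>z'\<in>N. N.pair b z' \<in> N.ext v \<and> z' \<in> N.ext y --> a = b \<or> E a b) \<longleftrightarrow>
   z = vl (ap f a) \<and> (\<forall>b\<in>ext \<kappa>. vl (ap f b) \<in> N.ext y --> a = b \<or> a \<in> ext b)" if a: "a \<in> ext \<kappa>" for a y
  proof -
   have "(\<forall>z'\<in>N. N.pair b z' \<in> N.ext v \<and> z' \<in> N.ext y --> a = b \<or> E a b) = (vl (ap f b) \<in> N.ext y --> a = b \<or> a \<in> ext b)"
    if "b \<in> ext \<kappa>" for b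
    using v_mem[OF that] vl_N[OF fM] kM[OF a] by (auto simp: in_ext)
   with v_mem[OF a z] show ?thesis by simp
  qed
  then show ?thesis unfolding kN(2) by (simp cong: bex_cong)
 qed
 show "\<exists>c\<in>N. \<forall>y\<in>N.ext x. \<exists>!z. z \<in> N.ext c \<inter> N.ext y"
 proof (intro bexI[OF _ c(1)] ballI)
  fix y assume y: "y \<in> N.ext x"
  obtain z0 where "z0 \<in> N.ext y" using dj y by blast
  then have "z0 \<in> N.ext u" using u y by blast
  then obtain a0 where a0: "a0 \<in> ext \<kappa>" "vl (ap f a0) \<in> N.ext y" using surj \<open>z0 \<in> N.ext y\<close> by blast
  obtain a where a: "a \<in> M" "a \<in> ext \<kappa> \<and> vl (ap f a) \<in> N.ext y" "\<forall>c\<in>ext a. \<not> (c \<in> ext \<kappa> \<and> vl (ap f c) \<in> N.ext y)"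
   using Ord_min[of a0 "\<lambda>a. a \<in> ext \<kappa> \<and> vl (ap f a) \<in> N.ext y"] a0 kM by blast
  have min: "a = b \<or> a \<in> ext b" if "b \<in> ext \<kappa>" "vl (ap f b) \<in> N.ext y" for b
  proof -
   have "a \<in> ext b \<or> a = b \<or> b \<in> ext a"
    using Ord_linear[of a] a that Ord_mem[OF \<kappa>(3)] kM by blast
   with a(3) that show ?thesis by blast
  qed
  show "\<exists>!z. z \<in> N.ext c \<inter> N.ext y"
  proof (rule ex1I[of _ "vl (ap f a)"])
   have "?C (vl (ap f a))" unfolding C[OF vl_N[OF fM]] using y a min by blast
   moreover have "vl (ap f a) \<in> N.ext u" using a y u by blast
   ultimately show "vl (ap f a) \<in> N.ext c \<inter> N.ext y" using a c by blast
   fix z assume z: "z \<in> N.ext c \<inter> N.ext y"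
   then have "z \<in> N" "?C z" using c by (auto simp: N.ext_def)
   then obtain y' a' where a': "y' \<in> N.ext x" "z \<in> N.ext y'" "a' \<in> ext \<kappa>" "z = vl (ap f a')"
    "\<forall>b\<in>ext \<kappa>. vl (ap f b) \<in> N.ext y' --> a' = b \<or> a' \<in> ext b" using C[OF \<open>z \<in> N\<close>] by blast
   have "y' = y" using dj y a' z by blast
   then have "a' = a \<or> a' \<in> ext a" "a = a' \<or> a \<in> ext a'" using a' a min z by blast+
   then have "a' = a" using mem_asym by blast
   with a' show "z = vl (ap f a)" by simp
  qed
 qed
qed

sublocale N: zcc N E
 by standard (rule N_choice)

end

section \<open>Cohen reals\<close>

text \<open>A number \<open>q\<close> codes the finite binary string of length \<open>qn q\<close> that is the characteristic
 function of \<open>qs q\<close>.\<close>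

definition qn :: "nat \<Rightarrow> nat" where "qn q = fst (prod_decode q)"
definition qs :: "nat \<Rightarrow> nat set" where "qs q = set_decode (snd (prod_decode q))"
definition mkq :: "nat \<Rightarrow> nat set \<Rightarrow> nat" where "mkq n S = enc (n, set_encode (S \<inter> {..<n}))"
text \<open>\<open>agr q r\<close> says that the string is an initial segment of \<open>r\<close>;
  \<open>ql q' q\<close> says that \<open>q'\<close> extends \<open>q\<close>, the stronger
  condition standing on the left.\<close>

definition agr :: "nat \<Rightarrow> nat set \<Rightarrow> bool" where "agr q r \<longleftrightarrow> (\<forall>k. k < qn q --> (k \<in> r \<longleftrightarrow> k \<in> qs q))"
definition ql :: "nat \<Rightarrow> nat \<Rightarrow> bool" where
 "ql q' q \<longleftrightarrow> qn q \<le> qn q' \<and> (\<forall>k. k < qn q --> (k \<in> qs q' \<longleftrightarrow> k \<in> qs q))"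

lemma mkq [simp]: "qn (mkq n S) = n" "qs (mkq n S) = S \<inter> {..<n}"
 by (simp_all add: qn_def qs_def mkq_def set_encode_inverse)

lemma ql_refl [simp]: "ql q q" and ql_trans: "ql a b ==> ql b c ==> ql a c"
 by (auto simp: ql_def)

lemma qn_le: "qn q \<le> q"
 unfolding qn_def by (metis le_prod_encode_1 prod.collapse prod_decode_inverse)

lemma p1_le: "fst (prod_decode q) \<le> q" and p2_le: "snd (prod_decode q) \<le> q"
 by (metis le_prod_encode_1 prod.collapse prod_decode_inverse, metis le_prod_encode_2 prod.collapse prod_decode_inverse)

text \<open>Density in the product of two Cohen forcings. Genericity of a pair of reals over the
  ground model will mean that strings along them meet every such \<open>D\<close> in
  \<open>RR\<close>.\<close>

definition dense2 :: "nat set \<Rightarrow> bool" where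
 "dense2 D \<longleftrightarrow> (\<forall>q1 q2. \<exists>q1' q2'. ql q1' q1 \<and> ql q2' q2 \<and> enc (q1', q2') \<in> D)"

definition bit :: "nat \<Rightarrow> nat \<Rightarrow> nat" where "bit q k = (if k \<in> qs q then 1 else 0)"

context zc begin

lemma dn_qn: "dn s ==> dn (\<lambda>e. qn (s e))" unfolding qn_def by (rule dn_p1)
lemma df_qs: "dn s ==> dn t ==> df (\<lambda>e. s e \<in> qs (t e))" unfolding qs_def by (intro dfs)
lemma df_ql: "dn s ==> dn t ==> df (\<lambda>e. ql (s e) (t e))"
 by (rule df_lift2n[of ql]) (unfold ql_def, intro dfs dn_qn df_qs)
lemma df_agr: "dn s ==> dr t ==> df (\<lambda>e. agr (s e) (t e))"
 by (rule df_lift_nr[of agr]) (unfold agr_def, intro dfs dn_qn df_qs)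
lemma dn_bit: "dn s ==> dn t ==> dn (\<lambda>e. bit (s e) (t e))"
proof (rule dn_lift2[of bit], rule dnI)
 fix i j
 have 1: "(m = bit a b) = (if b \<in> qs a then m = 1 else m = 0)" for m a b by (simp add: bit_def)
 show "df (\<lambda>e. nn (e 0) = bit (nn (e (Suc i))) (nn (e (Suc j))))" unfolding 1 by (intro dfs df_qs)
qed

definition atm :: "'a \<Rightarrow> nat \<Rightarrow> nat \<Rightarrow> 'a" where "atm i n b = pair (pair i (num n)) (num b)"

lemma atm_U: "i \<in> U ==> atm i n b \<in> U" by (simp add: atm_def pair_U num_U)
lemma atm_iff: "i \<in> U ==> i' \<in> U ==> atm i n b = atm i' n' b' \<longleftrightarrow> i = i' \<and> n = n' \<and> b = b'"
 by (simp add: atm_def pair_iff pair_U num_U)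
lemma dt_atm: "dt s ==> dn t ==> dn u ==> dt (\<lambda>e. atm (s e) (t e) (u e))"
 unfolding atm_def by (intro dfs)

text \<open>The conditions of the Cohen forcing, with their formal definition unravelled.\<close>

definition cond :: "'a \<Rightarrow> 'a set \<Rightarrow> bool" where
 "cond I S \<longleftrightarrow> finite S \<and> (\<forall>z\<in>S. \<exists>i\<in>ext I. \<exists>n b. b < 2 \<and> z = atm i n b) \<and>
  (\<forall>i\<in>ext I. \<forall>n b b'. atm i n b \<in> S \<and> atm i n b' \<in> S --> b = b')"

lemma cohen_cond: assumes I: "I \<in> U" 
 shows "cohen_forcing I \<in> U" "p \<in> ext (cohen_forcing I) \<longleftrightarrow> p \<in> U \<and> cond I (ext p)"
proof -
 let ?D = "times I omega"
 have D: "?D \<in> U" by (intro times_U I omega_U)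
 have iU: "i \<in> U" if "i \<in> ext I" for i using that ext_U by blast
 have two: "succ (succ empty) = num 2" by (simp add: numeral_2_eq_2 num.simps)
 have extD: "ext ?D = {pair i (num n) | i n. i \<in> ext I}"
  unfolding ext_times[OF I omega_U] ext_omega by blast
 have sub: "p \<subseteq> ext (times ?D (num 2))" if "cond I p" for p
 proof
  fix z assume "z \<in> p"
  with that obtain i n b where "i \<in> ext I" "b < 2" "z = atm i n b" unfolding cond_def by blast
  moreover have "pair i (num n) \<in> ext ?D" "num b \<in> ext (num 2)" using calculation extD by auto
  ultimately show "z \<in> ext (times ?D (num 2))" unfolding ext_times[OF D num_U] atm_def by blast
 qed
 have eq: "fin_partial_fun p ?D (succ (succ empty)) \<longleftrightarrow> cond I (ext p)" if p: "p \<in> U" for p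
 proof
  assume "fin_partial_fun p ?D (succ (succ empty))"
  then obtain C where C: "finite (ext p)" "C \<in> U" "ext C \<subseteq> ext ?D" "is_fun p C (num 2)"
   unfolding fin_partial_fun_def two using fin_iff[OF p] by blast
  show "cond I (ext p)" unfolding cond_def
  proof (intro conjI ballI allI impI)
   show "\<exists>i\<in>ext I. \<exists>n b. b < 2 \<and> z = atm i n b" if "z \<in> ext p" for z
   proof -
    obtain x y where xy: "x \<in> ext C" "y \<in> ext (num 2)" "z = pair x y" using C(4) \<open>z \<in> ext p\<close> unfolding is_fun_def by blast
    then obtain i n where "i \<in> ext I" "x = pair i (num n)" using C(3) extD by blast
    moreover obtain b where "b < 2" "y = num b" using xy(2) by (auto simp: ext_num)
    ultimately show ?thesis using xy(3) unfolding atm_def by blast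
   qed
   fix i n b b' assume i: "i \<in> ext I" and a: "atm i n b \<in> ext p \<and> atm i n b' \<in> ext p"
   obtain x y where xy: "x \<in> ext C" "y \<in> ext (num 2)" "atm i n b = pair x y" using C(4) a unfolding is_fun_def by blast
   then have "x = pair i (num n)" using pair_iff[of "pair i (num n)" "num b" x y] iU[OF i] ext_U num_U pair_U unfolding atm_def by blast
   then have "\<exists>!y. y \<in> U \<and> pair (pair i (num n)) y \<in> ext p" using C(4) xy(1) unfolding is_fun_def by blast
   then have "num b = num b'" using a num_U unfolding atm_def by blast
   then show "b = b'" by simp
  qed (rule C(1))
 next
  assume c: "cond I (ext p)"
  let ?S = "{x \<in> ext ?D. \<exists>y\<in>U. pair x y \<in> ext p}"
  have "inU ?S" by (rule sepI[OF inU_ext[OF D]]) (intro dfs p)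
  then obtain C where C: "C \<in> U" "ext C = ?S" by (auto simp: inU_def)
  have "is_fun p C (num 2)" unfolding is_fun_def
  proof (intro conjI ballI)
   fix z assume z: "z \<in> ext p"
   then obtain i n b where b: "i \<in> ext I" "b < 2" "z = atm i n b" using c unfolding cond_def by blast
   show "\<exists>x\<in>ext C. \<exists>y\<in>ext (num 2). z = pair x y"
   proof (rule bexI[of _ "pair i (num n)"], rule bexI[of _ "num b"])
    have "pair i (num n) \<in> ext ?D" using b extD by blast
    then show "pair i (num n) \<in> ext C" using z b num_U unfolding C(2) atm_def by blast
   qed (use b in \<open>simp_all add: atm_def\<close>)
  next
   fix x assume "x \<in> ext C"
   then obtain i n y where x: "i \<in> ext I" "x = pair i (num n)" "y \<in> U" "pair x y \<in> ext p" unfolding C(2) extD by blast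
   have val: "\<exists>b. y' = num b \<and> atm i n b \<in> ext p" if y': "y' \<in> U" "pair x y' \<in> ext p" for y'
   proof -
    obtain i' n' b' where b': "i' \<in> ext I" "b' < 2" "pair x y' = atm i' n' b'" using c y'(2) unfolding cond_def by blast
    then have "pair i (num n) = pair i' (num n') \<and> y' = num b'"
     using pair_iff[of x y' "pair i' (num n')" "num b'"] x y' iU num_U pair_U unfolding atm_def by metis
    with b' x show ?thesis unfolding atm_def using y'(2) by metis
   qed
   show "\<exists>!y. y \<in> U \<and> pair x y \<in> ext p"
   proof (rule ex1I[of _ y])
    fix y' assume "y' \<in> U \<and> pair x y' \<in> ext p"
    with val[of y'] val[OF x(3,4)] c x(1) show "y' = y" unfolding cond_def by blast
   qed (use x in simp)
  qed
  moreover have "ext C \<subseteq> ext ?D" unfolding C(2) by blast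
  ultimately show "fin_partial_fun p ?D (succ (succ empty))"
   unfolding fin_partial_fun_def two using fin_iff[OF p] c C(1) unfolding cond_def by blast
 qed
 have "{p \<in> U. fin_partial_fun p ?D (succ (succ empty))} = {p \<in> U. cond I (ext p)}" using eq by blast
 moreover have i: "inU {p \<in> U. cond I (ext p)}"
 proof (rule inU_subI[OF inU_pow[OF inU_ext[OF times_U[OF D num_U]], of 2], where Q="\<lambda>p. cond I (ext p)"])
  show "{p \<in> U. cond I (ext p)} \<subseteq> {y \<in> U. ext y \<subseteq> ext (times ?D (num 2))}" using sub by blast
  show "df (\<lambda>e. cond I (ext (e 0)))" unfolding cond_def by (intro dfs df_finite dt_atm I)
 qed simp
 ultimately have ce: "cohen_forcing I = set_of {p \<in> U. cond I (ext p)}" unfolding cohen_forcing_def by simp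
 show "cohen_forcing I \<in> U" "p \<in> ext (cohen_forcing I) \<longleftrightarrow> p \<in> U \<and> cond I (ext p)"
  unfolding ce using set_of_U[OF i] ext_set_of[OF i] by blast+
qed

end

locale cohen = zfc M E for M :: "'a set" and E +
 fixes I :: 'a and G N :: "'a set"
 assumes I_M: "I \<in> M" and I_unc: "\<not> ctbl I" and gen0: "generic_filter (cohen_forcing I) G" and gext0: "generic_extension E M G N"

sublocale cohen \<subseteq> forcing M E "cohen_forcing I" G N
proof
 show "cohen_forcing I \<in> M" by (rule cohen_cond[OF I_M])
 show "empty \<in> ext (cohen_forcing I)" unfolding cohen_cond(2)[OF I_M] by (simp add: empty_U ext_empty cond_def)
qed (rule gen0 gext0)+

context cohen begin

lemma iM: "i \<in> ext I ==> i \<in> M" using ext_U by blast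

lemma P_cond: "p \<in> ext (cohen_forcing I) \<longleftrightarrow> p \<in> M \<and> cond I (ext p)" by (rule cohen_cond(2)[OF I_M])

lemma cond_P: "cond I S ==> set_of S \<in> ext (cohen_forcing I) \<and> ext (set_of S) = S"
proof -
 assume c: "cond I S"
 then have "inU S" using iM atm_U by (intro inU_finite) (auto simp: cond_def)
 with c show ?thesis unfolding P_cond by (simp add: set_of_U ext_set_of)
qed

definition gb :: "'a \<Rightarrow> nat \<Rightarrow> bool" where "gb i n \<longleftrightarrow> (\<exists>p\<in>G. atm i n 1 \<in> ext p)"

lemma gb_ex: assumes i: "i \<in> ext I" shows "\<exists>p\<in>G. atm i n (if gb i n then 1 else 0) \<in> ext p"
proof -
 have "\<exists>p\<in>G. \<exists>b. b < 2 \<and> atm i n b \<in> ext p"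
 proof (rule gen_dense)
  show "df (\<lambda>e. \<exists>b. b < 2 \<and> atm i n b \<in> ext (e 0))" by (intro dfs dt_atm iM i)
  fix p assume p: "p \<in> ext (cohen_forcing I)"
  show "\<exists>q\<in>ext (cohen_forcing I). ext p \<subseteq> ext q \<and> (\<exists>b. b < 2 \<and> atm i n b \<in> ext q)"
  proof (cases "\<exists>b. atm i n b \<in> ext p")
   case True
   then obtain b where b: "atm i n b \<in> ext p" by blast
   then obtain i' n' b' where b': "i' \<in> ext I" "b' < 2" "atm i n b = atm i' n' b'" using p unfolding P_cond cond_def by blast
   then have "b < 2" using atm_iff[OF iM[OF i] iM[OF b'(1)], of n b n' b'] by simp
   with b p show ?thesis by blast
  next
   case False
   have "cond I (insert (atm i n 0) (ext p))"
    using p i False iM unfolding P_cond cond_def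
   proof (intro conjI ballI allI impI)
    assume *: "p \<in> M \<and> finite (ext p) \<and> (\<forall>z\<in>ext p. \<exists>i\<in>ext I. \<exists>n b. b < 2 \<and> z = atm i n b) \<and>
     (\<forall>i\<in>ext I. \<forall>n b b'. atm i n b \<in> ext p \<and> atm i n b' \<in> ext p --> b = b')"
    then show "finite (insert (atm i n 0) (ext p))" by simp
    show "\<exists>i\<in>ext I. \<exists>n b. b < 2 \<and> z = atm i n b" if "z \<in> insert (atm i n 0) (ext p)" for z
     using that * i zero_less_numeral by blast
    fix k m b b' assume k: "k \<in> ext I" and a: "atm k m b \<in> insert (atm i n 0) (ext p) \<and> atm k m b' \<in> insert (atm i n 0) (ext p)"
    have "atm k m c = atm i n 0 \<longleftrightarrow> k = i \<and> m = n \<and> c = 0" for c using atm_iff[OF iM[OF k] iM[OF i]] .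
    with a k * False show "b = b'" by (cases "k = i \<and> m = n") auto
   qed
   from cond_P[OF this] show ?thesis by (intro bexI[of _ "set_of (insert (atm i n 0) (ext p))"] conjI exI[of _ 0]) auto
  qed
 qed
 then obtain p b where p: "p \<in> G" "b < 2" "atm i n b \<in> ext p" by blast
 show ?thesis
 proof (cases "gb i n")
  case False
  then have "b \<noteq> 1" using p unfolding gb_def by blast
  then have "b = 0" using p(2) by simp
  with p False show ?thesis by auto
 qed (auto simp: gb_def)
qed

lemma gb_iff: assumes "p \<in> G" "i \<in> ext I" "atm i n b \<in> ext p" shows "b = (if gb i n then 1 else 0)"
proof -
 obtain q where q: "q \<in> G" "atm i n (if gb i n then 1 else 0) \<in> ext q" using gb_ex[OF assms(2)] by blast
 obtain r where r: "r \<in> G" "ext p \<subseteq> ext r" "ext q \<subseteq> ext r" using G_dir assms(1) q(1) by blast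
 then have "cond I (ext r)" using G_P P_cond by blast
 with r q assms show ?thesis unfolding cond_def by blast
qed

text \<open>Each atom of the condition occurs in some member of \<open>G\<close>; the condition is
  finite, so directedness yields a single member of \<open>G\<close> containing all of them.\<close>

lemma in_G: assumes p: "p \<in> ext (cohen_forcing I)" and b: "\<And>i n b. i \<in> ext I ==> atm i n b \<in> ext p ==> b = (if gb i n then 1 else 0)"
 shows "p \<in> G"
proof -
 have "\<exists>r\<in>G. S \<subseteq> ext r" if "finite S" "S \<subseteq> ext p" for S
  using that
 proof (induction S rule: finite_induct)
  case empty then show ?case using one_G by auto
 next
  case (insert z S)
  then obtain r where r: "r \<in> G" "S \<subseteq> ext r" by blast
  obtain i n c where z: "i \<in> ext I" "z = atm i n c" using insert p unfolding P_cond cond_def by blast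
  with b[of i n c] insert have "z = atm i n (if gb i n then 1 else 0)" by blast
  then obtain q where q: "q \<in> G" "z \<in> ext q" using gb_ex[OF z(1)] by metis
  obtain s where "s \<in> G" "ext r \<subseteq> ext s" "ext q \<subseteq> ext s" using G_dir r q by blast
  with r q show ?case by blast
 qed
 from this[of "ext p"] p obtain r where "r \<in> G" "ext p \<subseteq> ext r" unfolding P_cond cond_def by blast
 with G_up p show ?thesis by blast
qed

text \<open>The condition that the string \<open>q\<close> describes along an enumeration \<open>\<iota>\<close> of some of the
 coordinates.\<close>

definition pc :: "(nat \<Rightarrow> 'a) \<Rightarrow> (nat \<Rightarrow> nat) \<Rightarrow> nat \<Rightarrow> 'a set" where
 "pc j m q = {atm (j k) (m k) (bit q k) | k. k < qn q}"

lemma pc_cond: assumes "\<And>k. j k \<in> ext I" "\<And>k k'. j k = j k' ==> m k = m k' ==> k = k'" shows "cond I (pc j m q)"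
 unfolding cond_def
proof (intro conjI ballI allI impI)
 have "pc j m q = (\<lambda>k. atm (j k) (m k) (bit q k)) ` {..<qn q}" unfolding pc_def by auto
 then show "finite (pc j m q)" by simp
 show "\<exists>i\<in>ext I. \<exists>n b. b < 2 \<and> z = atm i n b" if "z \<in> pc j m q" for z
 proof -
  have "bit q k < 2" for k by (simp add: bit_def)
  with that assms(1) show ?thesis unfolding pc_def by blast
 qed
 fix i n b b' assume i: "i \<in> ext I" and "atm i n b \<in> pc j m q \<and> atm i n b' \<in> pc j m q"
 then obtain k k' where "atm i n b = atm (j k) (m k) (bit q k)" "atm i n b' = atm (j k') (m k') (bit q k')"
  unfolding pc_def by blast
 with atm_iff[of i "j k"] atm_iff[of i "j k'"] iM[OF i] iM[OF assms(1)] have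
  "i = j k" "n = m k" "b = bit q k" "i = j k'" "n = m k'" "b' = bit q k'" by blast+
 with assms(2)[of k k'] show "b = b'" by simp
qed

lemma pc_mono: "ql q' q ==> pc j m q \<subseteq> pc j m q'"
proof
 fix z assume l: "ql q' q" and "z \<in> pc j m q"
 then obtain k where k: "k < qn q" "z = atm (j k) (m k) (bit q k)" unfolding pc_def by blast
 with l have "k < qn q'" "bit q k = bit q' k" unfolding ql_def bit_def by auto
 with k show "z \<in> pc j m q'" unfolding pc_def mem_Collect_eq by (intro exI[of _ k]) simp
qed

lemma pc_G: assumes "\<And>k. j k \<in> ext I" "\<And>k k'. j k = j k' ==> m k = m k' ==> k = k'" "agr q {k. gb (j k) (m k)}"
 shows "set_of (pc j m q) \<in> G"
proof (rule in_G)
 have "cond I (pc j m q)" by (rule pc_cond) (use assms(1,2) in blast)+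
 note c = cond_P[OF this]
 show "set_of (pc j m q) \<in> ext (cohen_forcing I)" using c by blast
 fix i n b assume i: "i \<in> ext I" and "atm i n b \<in> ext (set_of (pc j m q))"
 then obtain k where k: "k < qn q" "atm i n b = atm (j k) (m k) (bit q k)" using c unfolding pc_def by blast
 then have "i = j k" "n = m k" "b = bit q k" using atm_iff[of i "j k"] iM[OF i] iM[OF assms(1)] by blast+
 with assms(3) k show "b = (if gb i n then 1 else 0)" unfolding agr_def bit_def by auto
qed

lemma pc_agr: assumes "\<And>k. j k \<in> ext I" "p \<in> G" "pc j m q \<subseteq> ext p" shows "agr q {k. gb (j k) (m k)}"
 unfolding agr_def
proof (intro allI impI)
 fix k assume "k < qn q"
 then have "atm (j k) (m k) (bit q k) \<in> ext p" using assms(3) unfolding pc_def by blast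
 from gb_iff[OF assms(2) assms(1) this] show "k \<in> {k. gb (j k) (m k)} \<longleftrightarrow> k \<in> qs q"
  by (auto simp: bit_def split: if_splits)
qed

end

context zcc begin

lemma ctbl_finite: "a \<in> U ==> finite (ext a) ==> ctbl a"
proof -
 assume a: "a \<in> U" "finite (ext a)"
 then have "fin a" using fin_iff by blast
 then obtain n f where f: "f \<in> U" "is_fun f a (num n)" "bij_betw (app f) (ext a) (ext (num n))"
  unfolding fin_def equipotent_def ext_omega by blast
 have "is_fun f a omega" using f(2) unfolding is_fun_def ext_num ext_omega by blast
 with f show ?thesis unfolding ctbl_def bij_betw_def by blast
qed

lemma ctblI:
 assumes a: "a \<in> U" and F: "dt (\<lambda>e. num (F (e 0)))" and inj: "inj_on F (ext a)" shows "ctbl a"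
proof -
 have "df (\<lambda>e. e 0 = num (F (e (Suc 0))))" using dt_shift[OF F] df_eq[OF dt_var] by blast
 from graph_fun[OF a omega_U this] obtain t where t: "t \<in> U" "is_fun t a omega" "\<forall>x\<in>ext a. app t x = num (F x)"
  by (auto simp: ext_omega)
 have "inj_on (app t) (ext a)" using inj t(3) by (auto simp: inj_on_def)
 with t show ?thesis unfolding ctbl_def by blast
qed

end

abbreviation "p1 k \<equiv> fst (prod_decode k)"
abbreviation "p2 k \<equiv> snd (prod_decode k)"

section \<open>Deciding a name for a real by countably many coordinates\<close>

context cohen begin

lemma I_inf: "infinite (ext I)" using ctbl_finite[OF I_M] I_unc by blast

context
 fixes h0 :: "nat \<Rightarrow> 'a \<Rightarrow> bool"
 assumes dh: "df (\<lambda>e. h0 (nn (e 0)) (e (Suc 0)))"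
  and h0_mono: "\<And>b p p'. h0 b p ==> p \<in> ext (cohen_forcing I) ==> p' \<in> ext (cohen_forcing I) ==> ext p \<subseteq> ext p' ==> h0 b p'"
begin

lemma df_h0: "dn s ==> dt t ==> df (\<lambda>e. h0 (s e) (t e))"
proof (rule df_lift2[of "\<lambda>x y. h0 (nn x) y", of "\<lambda>e. num (s e)", simplified])
 show "df (\<lambda>e. h0 (nn (e i)) (e j))" for i j
  using df_ren[OF dh, of "\<lambda>n. if n = 0 then i else j"] by simp
qed (simp_all add: dn_dt)

text \<open>A countable set of coordinates, enumerated injectively by \<open>j\<close>, such that \<open>h0\<close> can be
 decided by conditions on these coordinates only.  The value \<open>j k\<close> is, if possible, the \<open>l\<close>-th
 coordinate of a witness for \<open>h0 b\<close> below the condition coded by \<open>q\<close>, where \<open>k\<close> codes \<open>(b, q, l)\<close>.\<close>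

lemma closed_coordinates:
 "\<exists>j. (\<forall>k. j k \<in> ext I) \<and> inj j \<and> (\<forall>i. dt (\<lambda>e. j (nn (e i)))) \<and>
  (\<forall>b q. (\<exists>p\<in>ext (cohen_forcing I). pc (\<lambda>k. j (p1 k)) p2 q \<subseteq> ext p \<and> h0 b p) -->
   (\<exists>q'. ql q' q \<and> h0 b (set_of (pc (\<lambda>k. j (p1 k)) p2 q'))))"
proof -
 let ?P = "cohen_forcing I"
 have PM: "?P \<in> M" by (rule P_M)
 \<comment> \<open>A choice function \<open>w\<close> for witnesses: given \<open>n\<close> and
   \<open>p\<close> it finds an extension of \<open>p\<close> satisfying \<open>h0 n\<close>
   whenever there is one. When there is none any condition will do, which keeps \<open>Rw\<close>
   total.\<close>
 define Rw where "Rw x y \<longleftrightarrow> (\<forall>n. \<forall>p\<in>ext ?P. x = pair (num n) p --> (\<exists>p'\<in>ext ?P. ext p \<subseteq> ext p' \<and> h0 n p') -->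
  ext p \<subseteq> ext y \<and> h0 n y)" for x y
 have "\<exists>t\<in>M. is_fun t (times omega ?P) ?P \<and> (\<forall>x\<in>ext (times omega ?P). ap t x \<in> ext ?P \<and> Rw x (ap t x) \<and> app t x = ap t x)"
 proof (rule AC[OF times_U[OF omega_U PM] PM])
  show "df (\<lambda>e. Rw (e 0) (e (Suc 0)))" unfolding Rw_def by (intro dfs df_subset df_h0 PM)
  fix x assume "x \<in> ext (times omega ?P)"
  then obtain n p where x: "p \<in> ext ?P" "x = pair (num n) p" unfolding ext_times[OF omega_U PM] ext_omega by blast
  have "n' = n \<and> p' = p" if "x = pair (num n') p'" "p' \<in> ext ?P" for n' p'
   using x that ext_U pair_iff[of "num n" p "num n'" p'] num_U by auto
  then show "\<exists>y\<in>ext ?P. Rw x y" unfolding Rw_def using x(1) by (cases "\<exists>p'\<in>ext ?P. ext p \<subseteq> ext p' \<and> h0 n p'") metis+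
 qed
 then obtain w where w: "w \<in> M" "\<And>x. x \<in> ext (times omega ?P) ==> ap w x \<in> ext ?P \<and> Rw x (ap w x)" by blast
 have w': "ap w (pair (num n) p) \<in> ext ?P" "(\<exists>p'\<in>ext ?P. ext p \<subseteq> ext p' \<and> h0 n p') ==> ext p \<subseteq> ext (ap w (pair (num n) p)) \<and> h0 n (ap w (pair (num n) p))"
  if "p \<in> ext ?P" for n p
 proof -
  have "pair (num n) p \<in> ext (times omega ?P)" using that unfolding ext_times[OF omega_U PM] ext_omega by blast
  from w(2)[OF this] show "ap w (pair (num n) p) \<in> ext ?P" "(\<exists>p'\<in>ext ?P. ext p \<subseteq> ext p' \<and> h0 n p') ==> ext p \<subseteq> ext (ap w (pair (num n) p)) \<and> h0 n (ap w (pair (num n) p))"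
   using that unfolding Rw_def by blast+
 qed
 \<comment> \<open>\<open>s\<close> will assign to a condition a numbering of its finitely many
   coordinates, in which every coordinate has a label and no label has two. The recursion can then
   name a coordinate of a witness by a number.\<close>
 define Rs where "Rs p S \<longleftrightarrow> (\<forall>i\<in>ext I. (\<exists>n b. atm i n b \<in> ext p) --> (\<exists>l. pair (num l) i \<in> ext S)) \<and>
  (\<forall>l. \<forall>i\<in>ext I. \<forall>i'\<in>ext I. pair (num l) i \<in> ext S \<and> pair (num l) i' \<in> ext S --> i = i')" for p S
 have oI: "times omega I \<in> M" by (intro times_U omega_U I_M)
 have "\<exists>t\<in>M. is_fun t ?P (power (times omega I)) \<and> (\<forall>x\<in>ext ?P. ap t x \<in> ext (power (times omega I)) \<and> Rs x (ap t x) \<and> app t x = ap t x)"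
 proof (rule AC[OF PM power_U[OF oI]])
  show "df (\<lambda>e. Rs (e 0) (e (Suc 0)))" unfolding Rs_def by (intro dfs dt_atm I_M)
  fix p assume "p \<in> ext ?P"
  then have p: "p \<in> M" "cond I (ext p)" unfolding P_cond by blast+
  let ?s = "{i\<in>ext I. \<exists>n b. atm i n b \<in> ext p}"
  let ?h = "\<lambda>z. SOME i. i \<in> ext I \<and> (\<exists>n b. z = atm i n b)"
  have "?s \<subseteq> ?h ` ext p"
  proof clarify
   fix i n b assume i: "i \<in> ext I" "atm i n b \<in> ext p"
   have "?h (atm i n b) = i"
   proof (rule some_equality)
    fix i' assume "i' \<in> ext I \<and> (\<exists>n' b'. atm i n b = atm i' n' b')"
    then show "i' = i" using atm_iff[of i i'] iM i(1) by blast
   qed (use i in blast)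
   from image_eqI[of i ?h, OF this[symmetric] i(2)] show "i \<in> ?h ` ext p" .
  qed
  then have fs: "finite ?s" using p(2) unfolding cond_def by (meson finite_imageI finite_subset)
  from finite_imp_inj_to_nat_seg[OF fs] obtain f :: "'a \<Rightarrow> nat" where f: "inj_on f ?s" by blast
  let ?S = "(\<lambda>i. pair (num (f i)) i) ` ?s"
  have "?S \<subseteq> M" using iM pair_U num_U by blast
  then have i: "inU ?S" using fs by (intro inU_finite) auto
  have mem: "pair (num l) i \<in> ?S \<longleftrightarrow> i \<in> ?s \<and> l = f i" if "i \<in> ext I" for l i
  proof
   assume "pair (num l) i \<in> ?S"
   then obtain i' where i': "i' \<in> ?s" "pair (num l) i = pair (num (f i')) i'" by blast
   then have "num l = num (f i') \<and> i = i'" using pair_iff[of "num l" i "num (f i')" i'] iM that num_U by blast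
   with i' show "i \<in> ?s \<and> l = f i" by simp
  qed blast
  have "?S \<subseteq> ext (times omega I)" unfolding ext_times[OF omega_U I_M] ext_omega by blast
  then have "set_of ?S \<in> ext (power (times omega I))" using i by (simp add: ext_power oI set_of_U ext_set_of)
  moreover have "Rs p (set_of ?S)"
   unfolding Rs_def ext_set_of[OF i]
  proof (intro conjI ballI allI impI)
   fix i assume "i \<in> ext I" "\<exists>n b. atm i n b \<in> ext p"
   then show "\<exists>l. pair (num l) i \<in> ?S" using mem by blast
  next
   fix l i i' assume "i \<in> ext I" "i' \<in> ext I" "pair (num l) i \<in> ?S \<and> pair (num l) i' \<in> ?S"
   then have "i \<in> ?s" "i' \<in> ?s" "f i = f i'" using mem by auto
   then show "i = i'" using f by (meson inj_onD)
  qed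
  ultimately show "\<exists>y\<in>ext (power (times omega I)). Rs p y" by blast
 qed
 then obtain s where s: "s \<in> M" "\<And>p. p \<in> ext ?P ==> Rs p (ap s p)" by blast
 \<comment> \<open>\<open>fr\<close> supplies a coordinate outside any given finite set, for the
   stages that have nothing to add.\<close>
 have "\<exists>t\<in>M. is_fun t (power I) I \<and> (\<forall>x\<in>ext (power I). ap t x \<in> ext I \<and> (finite (ext x) --> ap t x \<notin> ext x) \<and> app t x = ap t x)"
 proof (rule AC[OF power_U[OF I_M] I_M, of "\<lambda>x y. finite (ext x) --> y \<notin> ext x"])
  show "df (\<lambda>e. finite (ext (e 0)) --> e (Suc 0) \<notin> ext (e 0))" by (intro dfs df_finite)
  show "\<exists>y\<in>ext I. finite (ext x) --> y \<notin> ext x" for x using I_inf by (meson finite_subset subsetI infinite_imp_nonempty ex_in_conv)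
 qed
 then obtain fr where fr: "fr \<in> M" "\<And>x. x \<in> ext (power I) ==> finite (ext x) ==> ap fr x \<in> ext I \<and> ap fr x \<notin> ext x" by blast
 have BM: "times (times I omega) (num 2) \<in> M" by (intro times_U omega_U I_M num_U)
 \<comment> \<open>The condition coded by \<open>q\<close>, as far as it can be read off from the
   values of \<open>j\<close> so far, which the recursion hands over as the graph
   \<open>g\<close>.\<close>
 define pqs where "pqs g q = {z\<in>ext (times (times I omega) (num 2)). \<exists>k. k < qn q \<and> (\<exists>i\<in>ext I. pair (num (p1 k)) i \<in> ext g \<and> z = atm i (p2 k) (bit q k))}" for g q
 have dpq: "dt (\<lambda>e. set_of (pqs (e i) (nn (e j))))" for i j
 proof (rule dt_set_of_eq)
  fix e :: "nat \<Rightarrow> 'a" assume "range e \<subseteq> M"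
  then have "e i \<in> M" by blast
  then show "inU (pqs (e i) (nn (e j)))" unfolding pqs_def
   by (intro sepI[OF inU_ext[OF BM]] dfs dn_qn dt_atm dn_bit I_M)
 qed (unfold pqs_def mem_Collect_eq, intro dfs dn_qn dt_atm dn_bit I_M BM)
 have dpq': "dn t ==> dt (\<lambda>e. set_of (pqs (e i) (t e)))" for i t
  using dt_lift2[of "\<lambda>x y. set_of (pqs x (nn y))" "\<lambda>e. e i" "\<lambda>e. num (t e)"] dpq dn_dt dt_var by simp
 define rng where "rng g = {i\<in>ext I. \<exists>y\<in>M. pair y i \<in> ext g}" for g
 have drng: "dt (\<lambda>e. set_of (rng (e i)))" for i
 proof (rule dt_set_of_eq)
  fix e :: "nat \<Rightarrow> 'a" assume "range e \<subseteq> M"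
  then have "e i \<in> M" by blast
  then show "inU (rng (e i))" unfolding rng_def by (intro sepI[OF inU_ext[OF I_M]] dfs)
 qed (unfold rng_def mem_Collect_eq, intro dfs I_M)
 \<comment> \<open>At stage \<open>enc (b, enc (q, l))\<close> the candidate is the coordinate with
   label \<open>l\<close> in the witness for \<open>h0 b\<close> below the condition of
   \<open>q\<close>, provided that it has not been enumerated before.\<close>
 define cand where "cand x g i \<longleftrightarrow> pair (num (p2 (p2 (nn x)))) i \<in> ext (ap s (ap w (pair (num (p1 (nn x))) (set_of (pqs g (p1 (p2 (nn x)))))))) \<and>
  \<not> (\<exists>y\<in>M. pair y i \<in> ext g)" for x g i
 have dcand: "df (\<lambda>e. cand (e a) (e b) (e c))" for a b c
  unfolding cand_def by (intro dfs dt_ap s(1) w(1) dpq')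
 \<comment> \<open>Uniqueness of the candidate is part of the test so that \<open>H\<close> is total
   and definable; in all other cases a fresh coordinate keeps \<open>j\<close> injective.\<close>
 define H where "H x g = (if \<exists>!i. i \<in> ext I \<and> cand x g i then THE i. i \<in> ext I \<and> cand x g i else ap fr (set_of (rng g)))" for x g
 have HI: "(y = H x g) = (if (\<exists>i\<in>ext I. cand x g i \<and> (\<forall>i'\<in>ext I. cand x g i' --> i' = i)) then y \<in> ext I \<and> cand x g y else y = ap fr (set_of (rng g)))" for x y g
 proof -
  have 1: "(\<exists>i\<in>ext I. cand x g i \<and> (\<forall>i'\<in>ext I. cand x g i' --> i' = i)) = (\<exists>!i. i \<in> ext I \<and> cand x g i)" by blast
  show ?thesis
  proof (cases "\<exists>!i. i \<in> ext I \<and> cand x g i")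
   case True
   note t = theI'[OF True]
   with True show ?thesis unfolding 1 H_def by auto
  qed (simp add: 1 H_def)
 qed
 have HI2: "H x g = i" if "cand x g i" "\<And>i'. i' \<in> ext I ==> cand x g i' ==> i' = i" "i \<in> ext I" for x g i
 proof -
  have "\<exists>!i. i \<in> ext I \<and> cand x g i" using that by blast
  moreover from this have "(THE i. i \<in> ext I \<and> cand x g i) = i" by (rule the1_equality) (use that(1,3) in blast)
  ultimately show ?thesis unfolding H_def by simp
 qed
 have Hdf: "df (\<lambda>e. e 0 = H (e (Suc 0)) (e (Suc (Suc 0))))"
  unfolding HI by (intro dfs dcand I_M dt_ap fr(1) drng)
 have HU: "H x g \<in> M" for x g
  using HI[of "H x g" x g] iM ap_U[of fr "set_of (rng g)"] by (metis (full_types))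
 define j where "j m = erec H (num m)" for m
 have dj: "dt (\<lambda>e. j (nn (e i)))" for i unfolding j_def by (intro dt_erec[OF HU Hdf] dfs)
 have jM: "j m \<in> M" for m unfolding j_def by (rule erec_U[OF HU Hdf num_U])
 define g where "g m = set_of {pair y (erec H y) | y. y \<in> ext (num m)}" for m
 have gi: "inU {pair y (erec H y) | y. y \<in> ext (num m)}" for m by (rule inU_erec[OF HU Hdf num_U])
 have gM: "g m \<in> M" for m unfolding g_def by (rule set_of_U[OF gi])
 have g_mem: "pair y i \<in> ext (g m) \<longleftrightarrow> (\<exists>a. a < m \<and> y = num a \<and> i = j a)" if "y \<in> M" "i \<in> M" for y i m
 proof -
  have "pair y i \<in> ext (g m) \<longleftrightarrow> (\<exists>a. a < m \<and> pair y i = pair (num a) (j a))"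
  proof -
   have "ext (g m) = {pair y (erec H y) | y. y \<in> ext (num m)}" unfolding g_def by (rule ext_set_of[OF gi])
   then show ?thesis unfolding ext_num j_def by blast
  qed
  also have "\<dots> \<longleftrightarrow> (\<exists>a. a < m \<and> y = num a \<and> i = j a)"
   using pair_iff[OF that num_U jM] by blast
  finally show ?thesis .
 qed
 have j_eq: "j m = H (num m) (g m)" for m
  unfolding j_def g_def by (rule erec_eq[OF num_U])
 have j_step: "j m \<in> ext I \<and> j m \<notin> j ` {..<m}" for m
 proof (induction m rule: less_induct)
  case (less m)
  have rg: "rng (g m) = j ` {..<m}"
   unfolding rng_def using less g_mem num_U jM iM by blast
  from HI[of "j m" "num m" "g m"] j_eq[of m]
  consider "j m \<in> ext I" "cand (num m) (g m) (j m)" | "j m = ap fr (set_of (rng (g m)))" by (auto split: if_splits)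
  then show ?case
  proof cases
   case 1
   then have "\<not> (\<exists>y\<in>M. pair y (j m) \<in> ext (g m))" unfolding cand_def by blast
   then have "j m \<noteq> j a" if "a < m" for a using g_mem[OF num_U jM, of a m m] that num_U by auto
   with 1 show ?thesis by auto
  next
   case 2
   have "j ` {..<m} \<subseteq> ext I" using less by blast
   moreover have i: "inU (j ` {..<m})" by (rule inU_finite) (use jM in auto)
   ultimately have "set_of (rng (g m)) \<in> ext (power I)" "finite (ext (set_of (rng (g m))))"
    unfolding rg ext_power[OF I_M] by (simp_all add: set_of_U ext_set_of)
   from fr(2)[OF this] 2 rg ext_set_of[OF i] show ?thesis by simp
  qed
 qed
 have jI: "j k \<in> ext I" for k using j_step by blast
 have jinj: "inj j"
 proof (rule injI)
  fix a b assume e: "j a = j b"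
  show "a = b"
  proof (rule ccontr)
   assume "a \<noteq> b"
   then have "a < b \<or> b < a" by auto
   then have "j b \<in> j ` {..<b} \<or> j a \<in> j ` {..<a}" using e by (metis imageI lessThan_iff)
   then show False using j_step by blast
  qed
 qed
 have jj: "k = k'" if "j (p1 k) = j (p1 k')" "p2 k = p2 k'" for k k'
  using that jinj by (metis injD prod.collapse prod_decode_inverse)
 let ?pc = "\<lambda>q. set_of (pc (\<lambda>k. j (p1 k)) p2 q)"
 have pcc: "cond I (pc (\<lambda>k. j (p1 k)) p2 q)" for q by (rule pc_cond) (rule jI, rule jj)
 have "\<exists>q'. ql q' q \<and> h0 b (?pc q')" if ex: "\<exists>p\<in>ext ?P. pc (\<lambda>k. j (p1 k)) p2 q \<subseteq> ext p \<and> h0 b p" for b q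
 proof -
  note pcq = cond_P[OF pcc[of q]]
  define y where "y = ap w (pair (num b) (?pc q))"
  have y: "y \<in> ext ?P" "ext (?pc q) \<subseteq> ext y" "h0 b y"
   unfolding y_def using w'[of "?pc q" b] pcq ex by auto
  then have yc: "cond I (ext y)" unfolding P_cond by blast
  have supp: "i \<in> range j" if i: "i \<in> ext I" "atm i n c \<in> ext y" for i n c
  proof (rule ccontr)
   assume nr: "i \<notin> range j"
   obtain l where l: "pair (num l) i \<in> ext (ap s y)" using s(2)[OF y(1)] i unfolding Rs_def by blast
   \<comment> \<open>This stage would have put \<open>i\<close> into the range of \<open>j\<close>.
     It comes late enough: a position \<open>k\<close> of \<open>q\<close> uses the value of
     \<open>j\<close> at \<open>p1 k\<close>, and
     \<open>p1 k \<le> k < qn q \<le> q \<le> ?k\<close>, so the condition coded by \<open>q\<close>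
     is already visible in \<open>g ?k\<close>.\<close>
   let ?k = "enc (b, enc (q, l))"
   have "q \<le> ?k" by (meson le_prod_encode_1 le_prod_encode_2 le_trans)
   then have small: "p1 k < ?k" if "k < qn q" for k using p1_le[of k] qn_le[of q] that by linarith
   have "pqs (g ?k) q = pc (\<lambda>k. j (p1 k)) p2 q"
   proof
    show "pqs (g ?k) q \<subseteq> pc (\<lambda>k. j (p1 k)) p2 q"
     unfolding pqs_def pc_def using g_mem[OF num_U] iM by auto
    show "pc (\<lambda>k. j (p1 k)) p2 q \<subseteq> pqs (g ?k) q"
    proof
     fix z assume "z \<in> pc (\<lambda>k. j (p1 k)) p2 q"
     then obtain k where k: "k < qn q" "z = atm (j (p1 k)) (p2 k) (bit q k)" unfolding pc_def by blast
     have "pair (num (p1 k)) (j (p1 k)) \<in> ext (g ?k)" using g_mem[OF num_U jM] small[OF k(1)] by blast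
     moreover have "z \<in> ext (times (times I omega) (num 2))"
     proof -
      have "pair (j (p1 k)) (num (p2 k)) \<in> ext (times I omega)" unfolding ext_times[OF I_M omega_U] ext_omega using jI by blast
      moreover have "num (bit q k) \<in> ext (num 2)" by (simp add: bit_def)
      ultimately show ?thesis unfolding ext_times[OF times_U[OF I_M omega_U] num_U] k(2) atm_def by blast
     qed
     ultimately show "z \<in> pqs (g ?k) q" unfolding pqs_def using k jI by blast
    qed
   qed
   then have cd: "cand (num ?k) (g ?k) i' \<longleftrightarrow> pair (num l) i' \<in> ext (ap s y) \<and> \<not> (\<exists>y\<in>M. pair y i' \<in> ext (g ?k))" for i'
    unfolding cand_def y_def by simp
   have "\<not> (\<exists>y\<in>M. pair y i \<in> ext (g ?k))" using g_mem[OF _ iM[OF i(1)]] nr by blast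
   then have "cand (num ?k) (g ?k) i" using cd l by blast
   moreover have "i' = i" if "i' \<in> ext I" "cand (num ?k) (g ?k) i'" for i'
    using s(2)[OF y(1)] cd that l i(1) unfolding Rs_def by blast
   ultimately have "H (num ?k) (g ?k) = i" using i(1) by (intro HI2)
   then show False using nr j_eq by (metis rangeI)
  qed
  have "\<exists>k c. z = atm (j (p1 k)) (p2 k) c" if z: "z \<in> ext y" for z
  proof -
   obtain i n c where i: "i \<in> ext I" "z = atm i n c" using yc z unfolding cond_def by blast
   with supp z obtain a where "i = j a" by blast
   with i have "z = atm (j (p1 (enc (a, n)))) (p2 (enc (a, n))) c" by simp
   then show ?thesis by blast
  qed
  then obtain K where K: "\<And>z. z \<in> ext y ==> \<exists>c. z = atm (j (p1 (K z))) (p2 (K z)) c" by metis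
  have "finite (K ` ext y)" using yc unfolding cond_def by blast
  then obtain n0 where n0: "\<And>z. z \<in> ext y ==> K z < n0" by (metis finite_nat_set_iff_bounded imageI)
  let ?A = "\<lambda>k. atm (j (p1 k)) (p2 k)"
  \<comment> \<open>\<open>y\<close> read as a string along \<open>j\<close>: long enough for all
    atoms of \<open>y\<close> and for \<open>q\<close>, with 0 at positions where neither says
    anything.\<close>
  define q' where "q' = mkq (max n0 (qn q)) {k. (k < qn q \<and> k \<in> qs q) \<or> ?A k 1 \<in> ext y}"
  have fnl: "c = c'" if "?A k c \<in> ext y" "?A k c' \<in> ext y" for k c c'
   using yc that jI unfolding cond_def by blast
  have qy: "?A k (bit q k) \<in> ext y" if "k < qn q" for k
   using y(2) pcq that unfolding pc_def by blast
  have "ql q' q" unfolding ql_def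
  proof (intro conjI allI impI)
   fix k assume k: "k < qn q"
   have 1: "k \<in> qs q" if "?A k 1 \<in> ext y" using fnl[OF qy[OF k] that] by (simp add: bit_def split: if_splits)
   have "k \<in> qs q' \<longleftrightarrow> (k < qn q \<and> k \<in> qs q) \<or> ?A k 1 \<in> ext y"
    unfolding q'_def using k by (simp add: less_max_iff_disj)
   with k 1 show "k \<in> qs q' \<longleftrightarrow> k \<in> qs q" by blast
  qed (simp add: q'_def)
  moreover have "ext y \<subseteq> pc (\<lambda>k. j (p1 k)) p2 q'"
  proof
   fix z assume z: "z \<in> ext y"
   obtain c where c: "z = ?A (K z) c" using K[OF z] by blast
   obtain i n c' where "i \<in> ext I" "c' < 2" "z = atm i n c'" using yc z unfolding cond_def by blast
   then have c2: "c < 2" using c atm_iff[of i "j (p1 (K z))"] iM jM by metis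
   have "K z \<in> qs q' \<longleftrightarrow> c = 1"
   proof
    assume "K z \<in> qs q'"
    then have "(K z < qn q \<and> K z \<in> qs q) \<or> ?A (K z) 1 \<in> ext y" unfolding q'_def by simp
    moreover have "?A (K z) 1 \<in> ext y" if "K z < qn q \<and> K z \<in> qs q" using qy[of "K z"] that by (simp add: bit_def)
    ultimately have "?A (K z) 1 \<in> ext y" by blast
    moreover have "?A (K z) c \<in> ext y" using c z by simp
    ultimately show "c = 1" using fnl by blast
   next
    assume "c = 1"
    with c z have "?A (K z) 1 \<in> ext y" by simp
    then show "K z \<in> qs q'" unfolding q'_def using n0[OF z] by (simp add: less_max_iff_disj)
   qed
   with c2 have "bit q' (K z) = c" by (simp add: bit_def)
   moreover have "K z < qn q'" using n0[OF z] by (simp add: q'_def)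
   ultimately show "z \<in> pc (\<lambda>k. j (p1 k)) p2 q'" unfolding pc_def using c by blast
  qed
  then have "h0 b (?pc q')" using h0_mono[OF y(3,1)] cond_P[OF pcc[of q']] by simp
  ultimately show ?thesis by blast
 qed
 with jI jinj dj show ?thesis by blast
qed

end

lemma N_num: "N.num n = num n"
proof (induction n)
 case 0
 have "N.ext empty = {}" using ext_abs[OF empty_U] ext_empty by simp
 then have "N.set_of {} = empty" using empty_U M_N by (intro N_set_of) auto
 then show ?case by (simp add: N.num.simps num.simps N.empty_def)
next
 case (Suc n)
 have "N.ext (succ (num n)) = insert (num n) (N.ext (num n))"
  using ext_abs[OF succ_U[OF num_U]] ext_abs[OF num_U] ext_succ[OF num_U] by simp
 then have "N.set_of (insert (num n) (N.ext (num n))) = succ (num n)"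
  using succ_U[OF num_U] M_N by (intro N_set_of) auto
 with Suc show ?case by (simp add: N.num.simps num.simps N.succ_def)
qed

text \<open>Every set of natural numbers of the extension is recursively enumerable in a Cohen real,
 relative to the ground model, and a further Cohen real is left over.\<close>

theorem cohen_name:
 assumes B: "B \<in> N.RR"
 shows "\<exists>H\<in>RR. \<exists>r c. c \<in> N.RR \<and> (\<forall>D\<in>RR. dense2 D --> (\<exists>q1 q2. enc (q1, q2) \<in> D \<and> agr q1 r \<and> agr q2 c)) \<and>
  (\<forall>b. b \<in> B \<longleftrightarrow> (\<exists>q. agr q r \<and> enc (b, q) \<in> H)) \<and>
  (\<forall>b q q'. enc (b, q) \<in> H \<and> ql q' q --> enc (b, q') \<in> H)"
proof -
 let ?P = "cohen_forcing I"
 obtain \<tau> where \<tau>: "\<tau> \<in> M" "N.rs B = vl \<tau>" using name_ex N.rs_U[OF B] by blast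
 define h0 where "h0 n p \<longleftrightarrow> fmem p (ck (num n)) \<tau>" for n p
 have dh: "df (\<lambda>e. h0 (nn (e 0)) (e (Suc 0)))" unfolding h0_def by (intro df_fmem dfs dt_ck \<tau>)
 have mono: "h0 b p'" if "h0 b p" "ext p \<subseteq> ext p'" for b p p' using that fmem_mono unfolding h0_def by blast
 have hB: "b \<in> B \<longleftrightarrow> (\<exists>p\<in>G. h0 b p)" for b
 proof -
  have "num b \<in> N.ext (vl \<tau>) \<longleftrightarrow> b \<in> B" unfolding \<tau>(2)[symmetric] N.ext_rs[OF B] by (auto simp: N_num)
  with fmem_truth[OF ck_M[OF num_U[of b]] \<tau>(1)] vl_ck[OF num_U] show ?thesis unfolding h0_def by simp
 qed
 have mono': "h0 b p'" if "h0 b p" "p \<in> ext ?P" "p' \<in> ext ?P" "ext p \<subseteq> ext p'" for b p p' using that(1,4) by (rule mono)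
 have CL: "\<exists>j. (\<forall>k. j k \<in> ext I) \<and> inj j \<and> (\<forall>i. dt (\<lambda>e. j (nn (e i)))) \<and>
  (\<forall>b q. (\<exists>p\<in>ext ?P. pc (\<lambda>k. j (p1 k)) p2 q \<subseteq> ext p \<and> h0 b p) -->
   (\<exists>q'. ql q' q \<and> h0 b (set_of (pc (\<lambda>k. j (p1 k)) p2 q'))))"
  by (rule closed_coordinates[of h0, OF dh]) (rule mono')
 obtain j where jI: "\<And>k. j k \<in> ext I" and jinj: "inj j" and dj: "\<And>i. dt (\<lambda>e. j (nn (e i)))" and
  cl: "\<And>b q. (\<exists>p\<in>ext ?P. pc (\<lambda>k. j (p1 k)) p2 q \<subseteq> ext p \<and> h0 b p) ==> (\<exists>q'. ql q' q \<and> h0 b (set_of (pc (\<lambda>k. j (p1 k)) p2 q')))"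
  using CL by blast
 have jj: "k = k'" if "j (p1 k) = j (p1 k')" "p2 k = p2 k'" for k k'
  using that jinj by (metis injD prod.collapse prod_decode_inverse)
 \<comment> \<open>The enumeration \<open>j\<close> is definable in the ground model, so a range
   exhausting \<open>I\<close> would make \<open>I\<close> countable there. The coordinate outside
   carries the left-over Cohen real \<open>c\<close>.\<close>
 have "\<exists>i\<in>ext I. i \<notin> range j"
 proof (rule ccontr)
  assume n: "\<not> ?thesis"
  have "dt (\<lambda>e. num (LEAST m. j m = e 0))" by (intro dfs dj)
  moreover have "inj_on (\<lambda>i. LEAST m. j m = i) (ext I)"
  proof (rule inj_onI)
   fix x y assume "x \<in> ext I" "y \<in> ext I" and e: "(LEAST m. j m = x) = (LEAST m. j m = y)"
   then have "x \<in> range j" "y \<in> range j" using n by blast+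
   then obtain a b where "j a = x" "j b = y" by auto
   then have "j (LEAST m. j m = x) = x" "j (LEAST m. j m = y) = y"
    using LeastI[of "\<lambda>m. j m = x" a] LeastI[of "\<lambda>m. j m = y" b] by blast+
   with e show "x = y" by metis
  qed
  ultimately show False using ctblI[OF I_M, of "\<lambda>i. LEAST m. j m = i"] I_unc by simp
 qed
 then obtain i where i: "i \<in> ext I" "i \<notin> range j" by blast
 let ?a = "\<lambda>q. pc (\<lambda>k. j (p1 k)) p2 q" and ?c = "\<lambda>q. pc (\<lambda>k. i) (\<lambda>k. k) q"
 have ca: "cond I (?a q)" for q by (rule pc_cond) (rule jI, rule jj)
 have cc: "cond I (?c q)" for q by (rule pc_cond) (rule i(1), simp)
 note a_P = cond_P[OF ca] and c_P = cond_P[OF cc]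
 define r where "r = {k. gb (j (p1 k)) (p2 k)}"
 define c where "c = {k. gb i k}"
 \<comment> \<open>The name of \<open>B\<close> reduced to numbers: \<open>enc (b, q)\<close> is in
   \<open>H\<close> if the condition coded by \<open>q\<close> forces \<open>b\<close> into
   \<open>B\<close>.\<close>
 define H where "H = {x. h0 (p1 x) (set_of (?a (p2 x)))}"
 have djt: "dn t ==> dt (\<lambda>e. j (t e))" for t
  using dt_lift1[of "\<lambda>x. j (nn x)" "\<lambda>e. num (t e)"] dj dn_dt by simp
 have da: "dt (\<lambda>e. set_of (?a (nn (e k))))" for k
 proof (rule dt_set_of_eq)
  show "inU (?a (nn (e k)))" for e using a_P P_M ext_U inU_ext by (metis subsetD)
  show "df (\<lambda>e. e 0 \<in> ?a (nn (e (Suc k))))" unfolding pc_def mem_Collect_eq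
   by (intro dfs dn_qn dt_atm dn_bit djt)
 qed
 have da': "dn t ==> dt (\<lambda>e. set_of (?a (t e)))" for t
  using dt_lift1[of "\<lambda>x. set_of (?a (nn x))" "\<lambda>e. num (t e)"] da dn_dt by simp
 have dh0: "dn s ==> dt t ==> df (\<lambda>e. h0 (s e) (t e))" for s t
  unfolding h0_def by (intro df_fmem dfs dt_ck \<tau>)
 have H: "H \<in> RR" unfolding H_def by (intro Collect_RR dh0 dfs da')
 \<comment> \<open>A name for \<open>c\<close> attaches to the canonical name of \<open>k\<close>
   all conditions that have the value 1 at place \<open>k\<close> of coordinate
   \<open>i\<close>.\<close>
 have c: "c \<in> N.RR"
 proof -
  have "inU (ck ` ext omega)" by (rule repl[OF inU_ext[OF omega_U]]) (intro dfs dt_ck, use ck_M ext_U in blast)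
  then obtain t where t: "t \<in> M" "ext t = ck ` ext omega" unfolding inU_def by blast
  have "df (\<lambda>e. \<exists>k. e 0 = ck (num k) \<and> atm i k 1 \<in> ext (e (Suc 0)))" by (intro dfs dt_ck dt_atm iM i)
  then obtain \<nu> where \<nu>: "\<nu> \<in> M" "\<And>\<eta> p. \<eta> \<in> M ==> p \<in> M ==> pair \<eta> p \<in> ext \<nu> \<longleftrightarrow> \<eta> \<in> ext t \<and> p \<in> ext ?P \<and> (\<exists>k. \<eta> = ck (num k) \<and> atm i k 1 \<in> ext p)"
   by (rule ex_nameE[of t "\<lambda>\<eta> p. \<exists>k. \<eta> = ck (num k) \<and> atm i k 1 \<in> ext p", OF t(1)]) (rule that, assumption, simp)
  have "N.ext (vl \<nu>) = num ` c"
  proof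
   show "N.ext (vl \<nu>) \<subseteq> num ` c"
   proof
    fix x assume "x \<in> N.ext (vl \<nu>)"
    then obtain \<eta> p where \<eta>: "\<eta> \<in> M" "p \<in> G" "pair \<eta> p \<in> ext \<nu>" "x = vl \<eta>" using vl_mem[OF \<nu>(1)] by blast
    then obtain k where "\<eta> = ck (num k)" "atm i k 1 \<in> ext p" using \<nu>(2)[OF \<eta>(1) G_M[OF \<eta>(2)]] by blast
    with \<eta> vl_ck[OF num_U] show "x \<in> num ` c" unfolding c_def gb_def by auto
   qed
   show "num ` c \<subseteq> N.ext (vl \<nu>)"
   proof clarify
    fix k assume "k \<in> c"
    then obtain p where p: "p \<in> G" "atm i k 1 \<in> ext p" unfolding c_def gb_def by blast
    have "ck (num k) \<in> ext t" unfolding t(2) ext_omega by blast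
    then have "pair (ck (num k)) p \<in> ext \<nu>" using \<nu>(2)[OF ck_M[OF num_U] G_M[OF p(1)]] p G_P by blast
    then show "num k \<in> N.ext (vl \<nu>)" using vl_mem[OF \<nu>(1)] p(1) vl_ck[OF num_U] ck_M[OF num_U] by metis
   qed
  qed
  moreover have "N.num ` c = num ` c" by (simp add: N_num)
  ultimately show ?thesis unfolding N.RR_def N.inU_def using vl_N[OF \<nu>(1)] by auto
 qed
 have gen: "\<exists>q1 q2. enc (q1, q2) \<in> D \<and> agr q1 r \<and> agr q2 c" if D: "D \<in> RR" "dense2 D" for D
 proof -
  have dc': "dn t ==> dt (\<lambda>e. set_of (?c (t e)))" for t
  proof -
   have "dt (\<lambda>e. set_of (?c (nn (e k))))" for k
   proof (rule dt_set_of_eq)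
    show "inU (?c (nn (e k)))" for e using c_P P_M ext_U inU_ext by (metis subsetD)
    show "df (\<lambda>e. e 0 \<in> ?c (nn (e (Suc k))))" unfolding pc_def mem_Collect_eq
     by (intro dfs dn_qn dt_atm dn_bit iM i)
   qed
   then show "dn t ==> dt (\<lambda>e. set_of (?c (t e)))"
    using dt_lift1[of "\<lambda>x. set_of (?c (nn x))" "\<lambda>e. num (t e)"] dn_dt by simp
  qed
  have "\<exists>p\<in>G. \<exists>q1 q2. enc (q1, q2) \<in> D \<and> ext (set_of (?a q1)) \<subseteq> ext p \<and> ext (set_of (?c q2)) \<subseteq> ext p"
  proof (rule gen_dense)
   show "df (\<lambda>e. \<exists>q1 q2. enc (q1, q2) \<in> D \<and> ext (set_of (?a q1)) \<subseteq> ext (e 0) \<and> ext (set_of (?c q2)) \<subseteq> ext (e 0))"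
    by (intro dfs df_subset da' dc' D(1))
   fix p assume "p \<in> ext ?P"
   then have pc0: "cond I (ext p)" unfolding P_cond by blast
   let ?A = "\<lambda>k. atm (j (p1 k)) (p2 k)" and ?C = "\<lambda>k. atm i k"
   have jM: "j k \<in> M" for k using jI iM by blast
   have fa: "finite {k. \<exists>b. ?A k b \<in> ext p}"
   proof (rule finite_subset)
    let ?f = "\<lambda>z. SOME k. \<exists>b. z = ?A k b"
    show "{k. \<exists>b. ?A k b \<in> ext p} \<subseteq> ?f ` ext p"
    proof clarify
     fix k b assume b: "?A k b \<in> ext p"
     have "?f (?A k b) = k"
     proof (rule some_equality)
      fix k' assume "\<exists>b'. ?A k b = ?A k' b'"
      then obtain b' where "?A k b = ?A k' b'" by blast
      then have "j (p1 k) = j (p1 k')" "p2 k = p2 k'"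
       using atm_iff[OF jM[of "p1 k"] jM[of "p1 k'"], of "p2 k" b "p2 k'" b'] by simp_all
      then show "k' = k" using jj[of k k'] by simp
     qed blast
     from image_eqI[of k ?f, OF this[symmetric] b] show "k \<in> ?f ` ext p" .
    qed
    show "finite (?f ` ext p)" using pc0 unfolding cond_def by blast
   qed
   have fc: "finite {k. \<exists>b. ?C k b \<in> ext p}"
   proof (rule finite_subset)
    let ?f = "\<lambda>z. SOME k. \<exists>b. z = ?C k b"
    show "{k. \<exists>b. ?C k b \<in> ext p} \<subseteq> ?f ` ext p"
    proof clarify
     fix k b assume b: "?C k b \<in> ext p"
     have "?f (?C k b) = k"
     proof (rule some_equality)
      fix k' assume "\<exists>b'. ?C k b = ?C k' b'"
      then obtain b' where "?C k b = ?C k' b'" by blast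
      then show "k' = k" using atm_iff[OF iM[OF i(1)] iM[OF i(1)], of k b k' b'] by simp
     qed blast
     from image_eqI[of k ?f, OF this[symmetric] b] show "k \<in> ?f ` ext p" .
    qed
    show "finite (?f ` ext p)" using pc0 unfolding cond_def by blast
   qed
   obtain n1 where n1: "\<And>k b. ?A k b \<in> ext p ==> k < n1" using fa unfolding finite_nat_set_iff_bounded by blast
   obtain n2 where n2: "\<And>k b. ?C k b \<in> ext p ==> k < n2" using fc unfolding finite_nat_set_iff_bounded by blast
   \<comment> \<open>The strings first copy what \<open>p\<close> says along \<open>j\<close> and
     along \<open>i\<close>; the density hypothesis then moves them into \<open>D\<close>.\<close>
   obtain q1 q2 where q: "ql q1 (mkq n1 {k. ?A k 1 \<in> ext p})" "ql q2 (mkq n2 {k. ?C k 1 \<in> ext p})" "enc (q1, q2) \<in> D"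
    using D(2) unfolding dense2_def by blast
   have two: "b < 2" if a: "i' \<in> ext I" "atm i' n b \<in> ext p" for i' n b
   proof -
    obtain i'' n' b' where b': "i'' \<in> ext I" "b' < 2" "atm i' n b = atm i'' n' b'" using pc0 a(2) unfolding cond_def by blast
    with atm_iff[OF iM[OF a(1)] iM[OF b'(1)], of n b n' b'] show ?thesis by simp
   qed
   have fnl: "b = b'" if "i' \<in> ext I" "atm i' n b \<in> ext p" "atm i' n b' \<in> ext p" for i' n b b'
    using pc0 that unfolding cond_def by blast
   have A: "b = bit q1 k" if "?A k b \<in> ext p" for k b
   proof -
    have "k \<in> qs q1 \<longleftrightarrow> ?A k 1 \<in> ext p" using q(1) n1[OF that] unfolding ql_def by auto
    moreover have "b = 1" if "?A k 1 \<in> ext p" using fnl[OF jI \<open>?A k b \<in> ext p\<close> that] .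
    moreover have "b = 0 \<or> b = 1" using two[OF jI that] by auto
    ultimately show ?thesis using that unfolding bit_def by metis
   qed
   have C: "b = bit q2 k" if "?C k b \<in> ext p" for k b
   proof -
    have "k \<in> qs q2 \<longleftrightarrow> ?C k 1 \<in> ext p" using q(2) n2[OF that] unfolding ql_def by auto
    moreover have "b = 1" if "?C k 1 \<in> ext p" using fnl[OF i(1) \<open>?C k b \<in> ext p\<close> that] .
    moreover have "b = 0 \<or> b = 1" using two[OF i(1) that] by auto
    ultimately show ?thesis using that unfolding bit_def by metis
   qed
   \<comment> \<open>The three parts can be united: \<open>i\<close> is outside the range of
     \<open>j\<close>, so the strings speak of different atoms, and on the atoms of \<open>p\<close>
     they repeat \<open>p\<close>.\<close>
   let ?S = "ext p \<union> ?a q1 \<union> ?c q2"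
   have "cond I ?S" unfolding cond_def
   proof (intro conjI ballI allI impI)
    show "finite ?S" using pc0 ca cc unfolding cond_def by blast
    show "\<exists>i\<in>ext I. \<exists>n b. b < 2 \<and> z = atm i n b" if "z \<in> ?S" for z using that pc0 ca cc unfolding cond_def by blast
    fix i' n b b' assume i': "i' \<in> ext I" and ab: "atm i' n b \<in> ?S \<and> atm i' n b' \<in> ?S"
    have a1: "\<exists>k. i' = j (p1 k) \<and> n = p2 k \<and> b = bit q1 k" if "atm i' n b \<in> ?a q1" for b
    proof -
     from that obtain k where "atm i' n b = atm (j (p1 k)) (p2 k) (bit q1 k)" unfolding pc_def by blast
     then show ?thesis using atm_iff[OF iM[OF i'] jM[of "p1 k"], of n b "p2 k" "bit q1 k"] by blast
    qed
    have c1: "i' = i \<and> b = bit q2 n" if "atm i' n b \<in> ?c q2" for b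
    proof -
     from that obtain k where "atm i' n b = atm i k (bit q2 k)" unfolding pc_def by blast
     then show ?thesis using atm_iff[OF iM[OF i'] iM[OF i(1)], of n b k "bit q2 k"] by blast
    qed
    have key: "b = (if i' = i then bit q2 n else bit q1 (enc (inv_into UNIV j i', n)))"
     if h: "atm i' n b \<in> ?S" "i' = i \<or> i' \<in> range j" for b
    proof (cases "i' = i")
     case True
     then have "atm i' n b \<notin> ?a q1" using a1[of b] i(2) by blast
     with h True C[of n b] c1[of b] show ?thesis by auto
    next
     case False
     then obtain a where a: "i' = j a" using h by blast
     have "atm i' n b \<notin> ?c q2" using c1[of b] False by blast
     then consider "atm i' n b \<in> ext p" | "atm i' n b \<in> ?a q1" using h by blast
     then have "b = bit q1 (enc (a, n))"
     proof cases
      case 1 then show ?thesis using A[of "enc (a, n)" b] a by simp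
     next
      case 2
      from a1[OF this] obtain k where k: "i' = j (p1 k)" "n = p2 k" "b = bit q1 k" by blast
      have "a = p1 k" by (rule injD[OF jinj]) (use a k in simp)
      then have "enc (a, n) = k" using k(2) by simp
      then show ?thesis using k(3) by simp
     qed
     then show ?thesis using False a jinj by (simp add: inv_into_f_f)
    qed
    show "b = b'"
    proof (cases "i' = i \<or> i' \<in> range j")
     case True then show ?thesis using key ab by metis
    next
     case False
     then have "atm i' n b \<in> ext p" "atm i' n b' \<in> ext p" using ab a1 c1 by blast+
     with fnl i' show ?thesis by blast
    qed
   qed
   note S = cond_P[OF this]
   show "\<exists>p'\<in>ext ?P. ext p \<subseteq> ext p' \<and> (\<exists>q1 q2. enc (q1, q2) \<in> D \<and> ext (set_of (?a q1)) \<subseteq> ext p' \<and> ext (set_of (?c q2)) \<subseteq> ext p')"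
   proof -
    have "ext p \<subseteq> ext (set_of ?S)" "ext (set_of (?a q1)) \<subseteq> ext (set_of ?S)" "ext (set_of (?c q2)) \<subseteq> ext (set_of ?S)"
     using S a_P[of q1] c_P[of q2] by auto
    with S q(3) show ?thesis by blast
   qed
  qed
  then obtain p q1 q2 where p: "p \<in> G" "enc (q1, q2) \<in> D" "?a q1 \<subseteq> ext p" "?c q2 \<subseteq> ext p" using a_P c_P by auto
  have "agr q1 r" unfolding r_def using pc_agr[OF jI p(1,3)] .
  moreover have "agr q2 c" unfolding c_def using pc_agr[OF i(1) p(1,4)] .
  ultimately show ?thesis using p(2) by blast
 qed
 have ce: "b \<in> B \<longleftrightarrow> (\<exists>q. agr q r \<and> enc (b, q) \<in> H)" for b
 proof
  assume "\<exists>q. agr q r \<and> enc (b, q) \<in> H"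
  then obtain q where q: "agr q r" "h0 b (set_of (?a q))" unfolding H_def by auto
  have "set_of (?a q) \<in> G" by (rule pc_G) (use jI jj q(1) r_def in blast)+
  with q hB show "b \<in> B" by blast
 next
  assume "b \<in> B"
  then obtain p where p: "p \<in> G" "h0 b p" using hB by blast
  \<comment> \<open>Every string extends to one that forces \<open>b\<close> or has no extension
    forcing \<open>b\<close>. Along \<open>r\<close> the second alternative fails: the string is
    compatible with \<open>p\<close>, and by \<open>cl\<close> a common extension can be replaced by
    a string.\<close>
  let ?D = "{x. h0 b (set_of (?a (p1 x))) \<or> \<not> (\<exists>q'. ql q' (p1 x) \<and> h0 b (set_of (?a q')))}"
  have "?D \<in> RR" by (intro Collect_RR dh0 dfs da' df_ql)
  moreover have "dense2 ?D" unfolding dense2_def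
  proof (intro allI)
   fix q1 q2
   show "\<exists>q1' q2'. ql q1' q1 \<and> ql q2' q2 \<and> enc (q1', q2') \<in> ?D"
   proof (cases "\<exists>q'. ql q' q1 \<and> h0 b (set_of (?a q'))")
    case True
    then obtain q' where "ql q' q1" "h0 b (set_of (?a q'))" by blast
    then show ?thesis by (intro exI[of _ q'] exI[of _ q2]) simp
   next
    case False
    then show ?thesis by (intro exI[of _ q1] exI[of _ q2]) simp
   qed
  qed
  ultimately obtain q1 where q1: "agr q1 r" "h0 b (set_of (?a q1)) \<or> \<not> (\<exists>q'. ql q' q1 \<and> h0 b (set_of (?a q')))"
   using gen[of ?D] by auto
  have "set_of (?a q1) \<in> G" by (rule pc_G) (use jI jj q1(1) r_def in blast)+
  then obtain s where s: "s \<in> G" "ext p \<subseteq> ext s" "ext (set_of (?a q1)) \<subseteq> ext s" using G_dir p(1) by blast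
  have "\<exists>p\<in>ext ?P. ?a q1 \<subseteq> ext p \<and> h0 b p"
   using s mono[OF p(2) s(2)] G_P a_P by blast
  from cl[OF this] q1 have "h0 b (set_of (?a q1))" by blast
  with q1 show "\<exists>q. agr q r \<and> enc (b, q) \<in> H" unfolding H_def by auto
 qed
 have "enc (b, q') \<in> H" if "enc (b, q) \<in> H" "ql q' q" for b q q'
 proof -
  have "ext (set_of (?a q)) \<subseteq> ext (set_of (?a q'))" using pc_mono[OF that(2)] a_P by simp
  with mono that(1) show ?thesis unfolding H_def by auto
 qed
 with H c gen ce show ?thesis by blast
qed

end

section \<open>Two gamma-spaces with a non-Hurewicz product\<close>

text \<open>\<open>fs\<close>, \<open>fmod\<close> and \<open>fdj\<close> are inclusion, equality
  and disjointness modulo finite sets; \<open>coi\<close> says that the complement of the union is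
  infinite.\<close>

definition fs :: "nat set \<Rightarrow> nat set \<Rightarrow> bool" where "fs x y \<longleftrightarrow> (\<exists>B. \<forall>i. B \<le> i --> i \<in> x --> i \<in> y)"
definition fmod :: "nat set \<Rightarrow> nat set \<Rightarrow> bool" where "fmod z x \<longleftrightarrow> (\<exists>B. \<forall>i. B \<le> i --> (i \<in> z \<longleftrightarrow> i \<in> x))"
definition fdj :: "nat set \<Rightarrow> nat set \<Rightarrow> bool" where "fdj x y \<longleftrightarrow> (\<exists>B. \<forall>i. B \<le> i --> i \<in> x --> i \<notin> y)"
definition coi :: "nat set \<Rightarrow> nat set \<Rightarrow> bool" where "coi x y \<longleftrightarrow> (\<forall>B. \<exists>i. B \<le> i \<and> i \<notin> x \<and> i \<notin> y)"
text \<open>Any set of pairs with nonempty rows codes a function, its least uniformization. One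
  function therefore has many codes.\<close>

definition fn :: "nat set \<Rightarrow> nat \<Rightarrow> nat" where "fn e n = (LEAST m. enc (n, m) \<in> e)"
definition sec :: "nat \<Rightarrow> nat set \<Rightarrow> nat set" where "sec a z = {m. enc (a, m) \<in> z}"
definition gap :: "nat set \<Rightarrow> nat set \<Rightarrow> nat set \<Rightarrow> bool" where
 "gap e x y \<longleftrightarrow> (\<forall>B. \<exists>n. B \<le> n \<and> (\<forall>i. n \<le> i \<and> i \<le> fn e n --> i \<in> x \<or> i \<in> y))"

text \<open>The clopen subset of the Cantor space coded by \<open>v\<close>.\<close>

definition cl :: "nat \<Rightarrow> nat set \<Rightarrow> bool" where "cl v x \<longleftrightarrow> (\<exists>q. q \<in> set_decode v \<and> agr q x)"
definition ev :: "(nat \<Rightarrow> bool) \<Rightarrow> bool" where "ev P \<longleftrightarrow> (\<exists>K. \<forall>k. K \<le> k --> P k)"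
definition tl1 :: "nat set \<Rightarrow> nat set" where "tl1 e = {i. Suc i \<in> e}"

text \<open>\<open>W\<close> codes a sequence of clopen omega-covers: row \<open>n\<close> consists
  of the codes of the members of the n-th cover, and a member may be the whole space here.
  Selections are the \<open>V\<close> with \<open>enc (k, fn V k) \<in> W\<close>.\<close>

definition ocov :: "nat set \<Rightarrow> nat set set \<Rightarrow> bool" where
 "ocov W X \<longleftrightarrow> (\<forall>n. \<forall>F. finite F \<and> F \<subseteq> X --> (\<exists>v. enc (n, v) \<in> W \<and> (\<forall>x\<in>F. cl v x)))"

lemma sd_le: assumes "q \<in> set_decode v" shows "q < v"
proof (rule ccontr)
 assume "\<not> q < v"
 moreover have "q < 2 ^ q" by (rule less_exp)
 ultimately have "v < 2 ^ q" by linarith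
 then have "v div 2 ^ q = 0" by simp
 with assms show False by (simp add: set_decode_def)
qed

text \<open>A code bounds its own support: a string in \<open>set_decode v\<close> is smaller than
  \<open>v\<close>, and its length is at most its code. So \<open>cl v\<close> depends on the bits
  below \<open>v\<close> only.\<close>

lemma cl_cong: "(\<And>i. i < v ==> i \<in> x \<longleftrightarrow> i \<in> y) ==> cl v x ==> cl v y"
proof -
 assume *: "\<And>i. i < v ==> i \<in> x \<longleftrightarrow> i \<in> y" and "cl v x"
 then obtain q where q: "q \<in> set_decode v" "agr q x" unfolding cl_def by blast
 have "i < v" if "i < qn q" for i using that sd_le[OF q(1)] qn_le[of q] by linarith
 with * q(2) have "agr q y" unfolding agr_def by blast
 with q(1) show ?thesis unfolding cl_def by blast
qed

lemma fn_graph: "fn {j. \<exists>k. j = enc (k, f k)} k = f k"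
 unfolding fn_def by (rule Least_equality) auto

lemma fs_trans: "fs x y ==> fs y z ==> fs x z"
 unfolding fs_def by (metis le_trans nat_le_linear)
lemma fs_refl: "fs x x" and fs_sub: "x \<subseteq> y ==> fs x y" by (auto simp: fs_def)
lemma fmod_fs: "fmod z x ==> fs z x" "fmod z x ==> fs x z" unfolding fmod_def fs_def by blast+
lemma fdj_mono: "fdj x y ==> fs x' x ==> fs y' y ==> fdj x' y'"
 unfolding fs_def fdj_def by (metis le_trans nat_le_linear)
lemma fdj_dj: "x \<inter> y = {} ==> fdj x y" by (auto simp: fdj_def)

context zc begin

lemma df_fs: "dr s ==> dr t ==> df (\<lambda>e. fs (s e) (t e))"
 by (rule df_letr[of s "\<lambda>e x. fs x (t e)"], assumption, rule df_letr[of "\<lambda>e. t (\<lambda>n. e (Suc n))" "\<lambda>e y. fs (rr (e 0)) y"], erule dr_shift)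
  (unfold fs_def, intro dfs)
lemma df_fmod: "dr s ==> dr t ==> df (\<lambda>e. fmod (s e) (t e))"
 by (rule df_letr[of s "\<lambda>e x. fmod x (t e)"], assumption, rule df_letr[of "\<lambda>e. t (\<lambda>n. e (Suc n))" "\<lambda>e y. fmod (rr (e 0)) y"], erule dr_shift)
  (unfold fmod_def, intro dfs)
lemma df_fdj: "dr s ==> dr t ==> df (\<lambda>e. fdj (s e) (t e))"
 by (rule df_letr[of s "\<lambda>e x. fdj x (t e)"], assumption, rule df_letr[of "\<lambda>e. t (\<lambda>n. e (Suc n))" "\<lambda>e y. fdj (rr (e 0)) y"], erule dr_shift)
  (unfold fdj_def, intro dfs)
lemma df_coi: "dr s ==> dr t ==> df (\<lambda>e. coi (s e) (t e))"
 by (rule df_letr[of s "\<lambda>e x. coi x (t e)"], assumption, rule df_letr[of "\<lambda>e. t (\<lambda>n. e (Suc n))" "\<lambda>e y. coi (rr (e 0)) y"], erule dr_shift)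
  (unfold coi_def, intro dfs)

lemma df_cl: "dn s ==> dr t ==> df (\<lambda>e. cl (s e) (t e))"
 by (rule df_lift_nr[of cl]) (unfold cl_def, intro dfs df_agr)
lemma df_ev: "df (\<lambda>e. P (\<lambda>n. e (Suc (Suc n))) (nn (e 0))) ==> df (\<lambda>e. ev (P e))"
 unfolding ev_def by (intro dfs)

lemma dn_fn: assumes "dr s" "dn t" shows "dn (\<lambda>e. fn (s e) (t e))"
proof -
 have "dn (\<lambda>e. fn (rr (e i)) (nn (e j)))" for i j unfolding fn_def by (intro dfs)
 from dt_lift2[of "\<lambda>x y. num (fn (rr x) (nn y))" "\<lambda>e. rs (s e)" "\<lambda>e. num (t e)"] this assms
 have 1: "dt (\<lambda>e. num (fn (rr (rs (s e))) (t e)))" by (simp add: dn_def dr_def)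
 have "dt (\<lambda>e. num (fn (s e) (t e)))"
  by (rule dt_cong[THEN iffD1, OF _ 1]) (use assms(1) in \<open>simp add: dr_def\<close>)
 then show ?thesis by (simp add: dn_def)
qed

lemma dr_lift1: assumes "\<And>i. dr (\<lambda>e. f (rr (e i)))" "dr s" shows "dr (\<lambda>e. f (s e))"
proof -
 have f: "f x \<in> RR" if "x \<in> RR" for x
  using assms(1)[of 0, unfolded dr_def, THEN conjunct1, THEN spec[of _ "\<lambda>_. rs x"]] rs_U[OF that] rr_rs[OF that]
  by (simp add: image_subset_iff)
 from dt_lift1[of "\<lambda>x. rs (f (rr x))" "\<lambda>e. rs (s e)"] assms
 have 1: "dt (\<lambda>e. rs (f (rr (rs (s e)))))" by (simp add: dr_def)
 have "dt (\<lambda>e. rs (f (s e)))"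
  by (rule dt_cong[THEN iffD1, OF _ 1]) (use assms(2) in \<open>simp add: dr_def\<close>)
 then show ?thesis using assms(2) f by (simp add: dr_def)
qed

lemma dr_sec: assumes "dn s" "dr t" shows "dr (\<lambda>e. sec (s e) (t e))"
 unfolding sec_def by (intro dfs dn_shift dr_shift assms)
lemma dr_tl1: "dr s ==> dr (\<lambda>e. tl1 (s e))"
 by (rule dr_lift1[of tl1]) (unfold tl1_def, intro dfs)
lemma df_gap: assumes "dr s" "dr t" "dr u" shows "df (\<lambda>e. gap (s e) (t e) (u e))"
 unfolding gap_def
 by (intro dfs dn_fn dr_shift[OF dr_shift[OF dr_shift[OF assms(2)]]] dr_shift[OF dr_shift[OF dr_shift[OF assms(3)]]]
   dr_shift[OF dr_shift[OF dr_shift[OF assms(1)]]])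

lemma sec_RR: "z \<in> RR ==> sec a z \<in> RR" unfolding sec_def by (rule Collect_RR) (intro dfs)

lemma fmod_RR: assumes "x \<in> RR" "fmod z x" shows "z \<in> RR"
proof -
 obtain B where B: "\<forall>i. B \<le> i --> (i \<in> z \<longleftrightarrow> i \<in> x)" using assms(2) unfolding fmod_def by blast
 have "z = {i. (i \<in> set_decode (set_encode (z \<inter> {..<B})) \<and> i < B) \<or> (B \<le> i \<and> i \<in> x)}"
  using B by (auto simp: set_encode_inverse not_le)
 also have "\<dots> \<in> RR" by (rule Collect_RR) (intro dfs assms(1))
 finally show ?thesis .
qed

definition mixs :: "nat set \<Rightarrow> nat \<Rightarrow> nat \<Rightarrow> nat set" where
 "mixs x m t = {i. (i < m \<and> i \<in> set_decode t) \<or> (m \<le> i \<and> i \<in> x)}"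

text \<open>At \<open>mm k\<close> a clopen set is chosen that contains every modification of
  \<open>x\<close> below \<open>mm k\<close>, and \<open>y'\<close> receives everything from
  \<open>mm k\<close> up to \<open>U' k\<close> outside \<open>x\<close>. A set that almost contains
  \<open>x\<close> and almost avoids \<open>y'\<close> agrees with \<open>x\<close> on almost all
  these intervals, hence belongs to almost all chosen clopen sets. The same intervals produce the
  gaps, and a hole is left between consecutive ones. The sections of \<open>S\<close> with index in
  \<open>Vd\<close> list the points of earlier stages.\<close>

lemma stage:
 assumes R: "x \<in> RR" "y \<in> RR" "S \<in> RR" "Vd \<in> RR" "W \<in> RR" "e \<in> RR" and dj: "x \<inter> y = {}" and co: "coi x y"
 shows "\<exists>y'\<in>RR. \<exists>V\<in>RR. y \<subseteq> y' \<and> x \<inter> y' = {} \<and> coi x y' \<and> gap e x y' \<and>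
  ((\<forall>k m. \<exists>v. enc (k, v) \<in> W \<and> (\<forall>t. cl v (mixs x m t)) \<and> (\<forall>i. i \<le> k \<and> i \<in> Vd --> cl v (sec i S))) -->
   (\<forall>k. enc (k, fn V k) \<in> W) \<and> (\<forall>i\<in>Vd. ev (\<lambda>k. cl (fn V k) (sec i S))) \<and>
   (\<forall>z. fs x z \<and> fdj y' z --> ev (\<lambda>k. cl (fn V k) z)))"
proof -
 define ok where "ok k m v \<longleftrightarrow> enc (k, v) \<in> W \<and> (\<forall>t. cl v (mixs x m t)) \<and> (\<forall>i. i \<le> k \<and> i \<in> Vd --> cl v (sec i S))" for k m v
 define vk where "vk k m = (LEAST v. ok k m v)" for k m
 \<comment> \<open>The interval must pass \<open>fn e m\<close> to produce the gap and
   \<open>vk k m\<close> to contain the support of the clopen set; \<open>Suc\<close> makes the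
   inequalities strict.\<close>
 define uu where "uu k m = Suc (m + fn e m + vk k m)" for k m
 \<comment> \<open>A point that stays outside both sets. The next interval starts right after it, so
   the union remains co-infinite.\<close>
 define cc where "cc k m = (LEAST c. uu k m \<le> c \<and> c \<notin> x \<and> c \<notin> y)" for k m
 define nx where "nx k m = Suc (cc k m)" for k m
 define mm where "mm k = rec_nat 0 nx k" for k
 have dvk: "dn s ==> dn t ==> dn (\<lambda>e. vk (s e) (t e))" for s t
  by (rule dn_lift2[of vk]) (unfold vk_def ok_def mixs_def, intro dfs df_cl dr_sec R)
 have duu: "dn s ==> dn t ==> dn (\<lambda>e. uu (s e) (t e))" for s t
  unfolding uu_def by (intro dfs dvk dn_fn R)
 have dnx: "dn s ==> dn t ==> dn (\<lambda>e. nx (s e) (t e))" for s t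
  by (rule dn_lift2[of nx]) (unfold nx_def cc_def, intro dfs duu R)
 have dmm: "dn s ==> dn (\<lambda>e. mm (s e))" for s
  by (rule dn_lift1[of mm]) (unfold mm_def, intro dn_rec dfs dnx)
 define U' where "U' k = uu k (mm k)" for k
 define V where "V = {j. \<exists>k. j = enc (k, vk k (mm k))}"
 define y' where "y' = {i. i \<in> y \<or> (i \<notin> x \<and> (\<exists>k. mm k \<le> i \<and> i < U' k))}"
 have V: "V \<in> RR" unfolding V_def by (rule Collect_RR) (intro dfs dvk dmm)
 have y': "y' \<in> RR" unfolding y'_def U'_def by (rule Collect_RR) (intro dfs duu dmm R)
 have fV: "fn V k = vk k (mm k)" for k unfolding V_def by (rule fn_graph)
 have c: "U' k \<le> cc k (mm k) \<and> cc k (mm k) \<notin> x \<and> cc k (mm k) \<notin> y" for k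
  unfolding cc_def U'_def by (rule LeastI_ex) (use co in \<open>simp add: coi_def\<close>)
 have mS: "mm (Suc k) = Suc (cc k (mm k))" for k unfolding mm_def nx_def by simp
 have mU: "mm k < U' k" "fn e (mm k) < U' k" "vk k (mm k) < U' k" for k unfolding U'_def uu_def by auto
 have step: "U' k < mm (Suc k)" for k using c[of k] mS[of k] by linarith
 have mono: "k < l ==> U' k < mm l" for k l
 proof (induction l)
  case (Suc l)
  then show ?case using step[of l] step[of k] mU(1)[of l] by (cases "k = l") auto
 qed simp
 have mk: "k \<le> mm k" for k
 proof (induction k)
  case (Suc k) then show ?case using step[of k] mU(1)[of k] by linarith
 qed simp
 have "coi x y'" unfolding coi_def
 proof
  fix B
  let ?c = "cc B (mm B)"
  have "\<not> (mm k \<le> ?c \<and> ?c < U' k)" for k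
  proof (cases "k \<le> B")
   case True
   then have "U' k \<le> U' B" using mono[of k B] mU(1)[of B] by (cases "k = B") auto
   then show ?thesis using c[of B] by linarith
  next
   case False
   then have "mm (Suc B) \<le> mm k" using mono[of "Suc B" k] mU(1)[of "Suc B"] by (cases "k = Suc B") auto
   then show ?thesis using mS[of B] by linarith
  qed
  then have "?c \<notin> y'" using c[of B] unfolding y'_def by blast
  moreover have "B \<le> ?c" using mk[of B] mU(1)[of B] c[of B] by linarith
  ultimately show "\<exists>i. B \<le> i \<and> i \<notin> x \<and> i \<notin> y'" using c[of B] by blast
 qed
 moreover have "gap e x y'" unfolding gap_def
 proof
  fix B
  have "i \<in> x \<or> i \<in> y'" if "mm B \<le> i \<and> i \<le> fn e (mm B)" for i
  proof -
   have "i < U' B" using that mU(2)[of B] by linarith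
   then show ?thesis unfolding y'_def using that by blast
  qed
  then show "\<exists>n. B \<le> n \<and> (\<forall>i. n \<le> i \<and> i \<le> fn e n --> i \<in> x \<or> i \<in> y')" using mk[of B] by blast
 qed
 moreover have "y \<subseteq> y'" "x \<inter> y' = {}" using dj unfolding y'_def by auto
 moreover have "(\<forall>k. enc (k, fn V k) \<in> W) \<and> (\<forall>i\<in>Vd. ev (\<lambda>k. cl (fn V k) (sec i S))) \<and>
   (\<forall>z. fs x z \<and> fdj y' z --> ev (\<lambda>k. cl (fn V k) z))" if "\<forall>k m. \<exists>v. ok k m v"
 proof -
  have ok: "ok k (mm k) (fn V k)" for k unfolding fV vk_def by (rule LeastI_ex) (use that in blast)
  have "ev (\<lambda>k. cl (fn V k) (sec i S))" if "i \<in> Vd" for i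
   unfolding ev_def using ok that unfolding ok_def by blast
  moreover have "ev (\<lambda>k. cl (fn V k) z)" if z: "fs x z" "fdj y' z" for z
  proof -
   obtain B1 B2 where B: "\<And>i. B1 \<le> i ==> i \<in> x ==> i \<in> z" "\<And>i. B2 \<le> i ==> i \<in> y' ==> i \<notin> z"
    using z unfolding fs_def fdj_def by blast
   have "cl (fn V k) z" if k: "B1 + B2 \<le> k" for k
   proof (rule cl_cong)
    \<comment> \<open>The initial part of \<open>z\<close> is taken as the modification of
      \<open>x\<close>; the result agrees with \<open>z\<close> on the whole support of the clopen
      set.\<close>
    show "cl (fn V k) (mixs x (mm k) (set_encode (z \<inter> {..<mm k})))" using ok[of k] unfolding ok_def by blast
    fix i assume "i < fn V k"
    then have i: "i < U' k" using mU(3)[of k] fV[of k] by simp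
    show "i \<in> mixs x (mm k) (set_encode (z \<inter> {..<mm k})) \<longleftrightarrow> i \<in> z"
    proof (cases "i < mm k")
     case True then show ?thesis by (simp add: mixs_def set_encode_inverse)
    next
     case False
     then have "B1 \<le> i" "B2 \<le> i" using k mk[of k] by linarith+
     moreover have "i \<in> y'" if "i \<notin> x"
      unfolding y'_def using that False i by (auto simp: not_less)
     ultimately have "i \<in> x \<longleftrightarrow> i \<in> z" using B by blast
     with False show ?thesis unfolding mixs_def by simp
    qed
   qed
   then show ?thesis unfolding ev_def by blast
  qed
  ultimately show ?thesis using ok unfolding ok_def by blast
 qed
 ultimately show ?thesis using V y' unfolding ok_def by blast
qed

text \<open>A countable directed system of pairs has an upper bound. By directedness finitely many
  pairs are almost below a single one, hence their two sides are almost disjoint and have infinitely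
  many common holes. Admitting section \<open>i\<close> only from \<open>mm i\<close> on makes the
  bound disjoint and spares a hole for each \<open>n\<close>.\<close>

lemma base:
 assumes R: "A \<in> RR" "B \<in> RR"
  and dir: "\<And>i j. \<exists>g. fs (sec i A) (sec g A) \<and> fs (sec j A) (sec g A) \<and> fs (sec i B) (sec g B) \<and> fs (sec j B) (sec g B)"
  and dj: "\<And>i. sec i A \<inter> sec i B = {}" and co: "\<And>i. coi (sec i A) (sec i B)"
 shows "\<exists>x\<in>RR. \<exists>y\<in>RR. x \<inter> y = {} \<and> coi x y \<and> (\<forall>i. fs (sec i A) x \<and> fs (sec i B) y)"
proof -
 have dirn: "\<exists>g. \<forall>i. i \<le> n --> fs (sec i A) (sec g A) \<and> fs (sec i B) (sec g B)" for n
 proof (induction n)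
  case 0 show ?case using fs_refl by (intro exI[of _ 0]) simp
 next
  case (Suc n)
  then obtain g where g: "\<forall>i. i \<le> n --> fs (sec i A) (sec g A) \<and> fs (sec i B) (sec g B)" by blast
  obtain g' where g': "fs (sec g A) (sec g' A) \<and> fs (sec (Suc n) A) (sec g' A) \<and> fs (sec g B) (sec g' B) \<and> fs (sec (Suc n) B) (sec g' B)"
   using dir by blast
  show ?case
  proof (intro exI[of _ g'] allI impI)
   fix i assume "i \<le> Suc n"
   then consider "i \<le> n" | "i = Suc n" by linarith
   then show "fs (sec i A) (sec g' A) \<and> fs (sec i B) (sec g' B)"
    using g g' fs_trans by cases blast+
  qed
 qed
 \<comment> \<open>Past \<open>bb n\<close> the sections of \<open>A\<close> up to \<open>n\<close>
   are disjoint from those of \<open>B\<close>; \<open>cc n m\<close> is a hole in all of them, at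
   \<open>m\<close> or later.\<close>
 define bb where "bb n = (LEAST b. \<forall>i j. i \<le> n --> j \<le> n --> (\<forall>l. b \<le> l --> \<not> (l \<in> sec i A \<and> l \<in> sec j B)))" for n
 define cc where "cc n m = (LEAST c. m \<le> c \<and> (\<forall>i. i \<le> n --> c \<notin> sec i A \<and> c \<notin> sec i B))" for n m
 \<comment> \<open>\<open>mm (Suc n)\<close> exceeds the hole \<open>cc n (mm n)\<close>, so later
   sections cannot fill it, and also \<open>bb (Suc n)\<close>, so they avoid the other
   side.\<close>
 define mm where "mm n = rec_nat (bb 0) (\<lambda>n m. Suc (cc n m + bb (Suc n))) n" for n
 have dbb: "dn s ==> dn (\<lambda>e. bb (s e))" for s
  by (rule dn_lift1[of bb]) (unfold bb_def, intro dfs dr_sec R)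
 have dcc: "dn s ==> dn t ==> dn (\<lambda>e. cc (s e) (t e))" for s t
  by (rule dn_lift2[of cc]) (unfold cc_def, intro dfs dr_sec R)
 have dmm: "dn s ==> dn (\<lambda>e. mm (s e))" for s
  by (rule dn_lift1[of mm]) (unfold mm_def, intro dn_rec dfs dbb dcc)
 have bb: "\<not> (l \<in> sec i A \<and> l \<in> sec j B)" if "i \<le> n" "j \<le> n" "bb n \<le> l" for n i j l
 proof -
  obtain g where g: "\<forall>i. i \<le> n --> fs (sec i A) (sec g A) \<and> fs (sec i B) (sec g B)" using dirn by blast
  have "\<forall>i. \<exists>b. i \<le> n --> (\<forall>l. b \<le> l --> (l \<in> sec i A --> l \<in> sec g A) \<and> (l \<in> sec i B --> l \<in> sec g B))"
  proof
   fix i show "\<exists>b. i \<le> n --> (\<forall>l. b \<le> l --> (l \<in> sec i A --> l \<in> sec g A) \<and> (l \<in> sec i B --> l \<in> sec g B))"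
   proof (cases "i \<le> n")
    case True
    then obtain b1 b2 where "\<forall>l. b1 \<le> l --> l \<in> sec i A --> l \<in> sec g A" "\<forall>l. b2 \<le> l --> l \<in> sec i B --> l \<in> sec g B"
     using g unfolding fs_def by blast
    then show ?thesis by (intro exI[of _ "b1 + b2"]) simp
   qed simp
  qed
  then obtain f where f: "\<And>i l. i \<le> n ==> f i \<le> l ==> (l \<in> sec i A --> l \<in> sec g A) \<and> (l \<in> sec i B --> l \<in> sec g B)" by metis
  let ?b = "Max (f ` {..n})"
  have "f i \<le> ?b" if "i \<le> n" for i using that by simp
  then have "\<not> (l \<in> sec i A \<and> l \<in> sec j B)" if "i \<le> n" "j \<le> n" "?b \<le> l" for i j l
   using f[OF that(1), of l] f[OF that(2), of l] dj[of g] that le_trans[of _ ?b l] by blast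
  then have "\<exists>b. \<forall>i j. i \<le> n --> j \<le> n --> (\<forall>l. b \<le> l --> \<not> (l \<in> sec i A \<and> l \<in> sec j B))" by blast
  from LeastI_ex[OF this] show ?thesis using that unfolding bb_def by blast
 qed
 have cc: "m \<le> cc n m \<and> (\<forall>i. i \<le> n --> cc n m \<notin> sec i A \<and> cc n m \<notin> sec i B)" for n m
 proof -
  obtain g where g: "\<forall>i. i \<le> n --> fs (sec i A) (sec g A) \<and> fs (sec i B) (sec g B)" using dirn by blast
  have "\<exists>b. \<forall>i l. i \<le> k --> b \<le> l --> (l \<in> sec i A --> l \<in> sec g A) \<and> (l \<in> sec i B --> l \<in> sec g B)" if "k \<le> n" for k
   using that
  proof (induction k)
   case 0
   then obtain b1 b2 where "\<forall>l. b1 \<le> l --> l \<in> sec 0 A --> l \<in> sec g A" "\<forall>l. b2 \<le> l --> l \<in> sec 0 B --> l \<in> sec g B"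
    using g unfolding fs_def by blast
   then show ?case by (intro exI[of _ "b1 + b2"]) simp
  next
   case (Suc k)
   then obtain b where b: "\<forall>i l. i \<le> k --> b \<le> l --> (l \<in> sec i A --> l \<in> sec g A) \<and> (l \<in> sec i B --> l \<in> sec g B)" by auto
   obtain b1 b2 where "\<forall>l. b1 \<le> l --> l \<in> sec (Suc k) A --> l \<in> sec g A" "\<forall>l. b2 \<le> l --> l \<in> sec (Suc k) B --> l \<in> sec g B"
    using g Suc.prems unfolding fs_def by blast
   with b show ?case by (intro exI[of _ "b + b1 + b2"]) (auto simp: le_Suc_eq)
  qed
  then obtain b where b: "\<forall>i l. i \<le> n --> b \<le> l --> (l \<in> sec i A --> l \<in> sec g A) \<and> (l \<in> sec i B --> l \<in> sec g B)" by blast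
  obtain c where c: "m + b \<le> c" "c \<notin> sec g A" "c \<notin> sec g B" using co[of g] unfolding coi_def by blast
  then have "m \<le> c \<and> (\<forall>i. i \<le> n --> c \<notin> sec i A \<and> c \<notin> sec i B)" using b by auto
  then show ?thesis unfolding cc_def by (rule LeastI)
 qed
 have mS: "mm (Suc n) = Suc (cc n (mm n) + bb (Suc n))" and m0: "mm 0 = bb 0" for n unfolding mm_def by simp_all
 have mb: "bb n \<le> mm n" for n by (cases n) (simp_all add: m0 mS)
 have mlt: "mm n < mm (Suc n)" for n using cc[where n=n and m="mm n"] by (simp add: mS)
 have mono: "n \<le> k ==> mm n \<le> mm k" for n k by (rule lift_Suc_mono_le[of mm]) (use mlt less_imp_le in auto)
 have mk: "n \<le> mm n" for n
 proof (induction n) case (Suc n) then show ?case using mlt[of n] by linarith qed simp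
 define x where "x = {l. \<exists>i. l \<in> sec i A \<and> mm i \<le> l}"
 define y where "y = {l. \<exists>i. l \<in> sec i B \<and> mm i \<le> l}"
 have "x \<in> RR" "y \<in> RR" unfolding x_def y_def by (rule Collect_RR, intro dfs dr_sec R dmm)+
 moreover have "x \<inter> y = {}"
 proof (rule equals0I)
  fix l assume "l \<in> x \<inter> y"
  then obtain i j where ij: "l \<in> sec i A" "mm i \<le> l" "l \<in> sec j B" "mm j \<le> l" unfolding x_def y_def by blast
  have "mm (max i j) \<le> l" using ij by (simp add: max_def)
  then have "bb (max i j) \<le> l" using mb[of "max i j"] by linarith
  with bb[of i "max i j" j l] ij show False by simp
 qed
 moreover have "coi x y" unfolding coi_def
 proof
  fix n
  let ?c = "cc n (mm n)"
  have c: "mm n \<le> ?c" "\<forall>i. i \<le> n --> ?c \<notin> sec i A \<and> ?c \<notin> sec i B" using cc by blast+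
  have "\<not> mm i \<le> ?c" if "n < i" for i using mono[of "Suc n" i] that mS[of n] by simp
  then have "?c \<notin> x" "?c \<notin> y" unfolding x_def y_def using c(2) by (auto simp: not_le) (metis not_le)+
  then show "\<exists>i. n \<le> i \<and> i \<notin> x \<and> i \<notin> y" using c(1) mk[of n] by (intro exI[of _ ?c]) simp
 qed
 moreover have "fs (sec i A) x \<and> fs (sec i B) y" for i unfolding fs_def x_def y_def by blast
 ultimately show ?thesis by blast
qed

end

context zfc begin

text \<open>If the well-order of the reals has an uncountable proper initial segment, the least one
  is kept: its image is an uncountable set of reals, by \<open>CH\<close> equipotent to all of them,
  and composition gives an enumeration with countable initial segments.\<close>

lemma CH_enum:
 assumes CH
 shows "\<exists>\<kappa>\<in>U. \<exists>b\<in>U. Ord \<kappa> \<and> (\<forall>a\<in>ext \<kappa>. ctbl a) \<and> (\<forall>x\<in>RR. \<exists>a\<in>ext \<kappa>. ap b a = rs x)"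
proof -
 let ?p = "power omega"
 have p: "?p \<in> U" by (intro power_U omega_U)
 have rsp: "rs x \<in> ext ?p" if "x \<in> RR" for x using that by (auto simp: ext_power omega_U rs_U ext_rs ext_omega)
 obtain \<theta> f where f: "\<theta> \<in> U" "f \<in> U" "Ord \<theta>" "is_fun f \<theta> ?p" "bij_betw (ap f) (ext \<theta>) (ext ?p)" using wellorder[OF p] by blast
 show ?thesis
 proof (cases "\<forall>a\<in>ext \<theta>. ctbl a")
  case True
  have "\<exists>a\<in>ext \<theta>. ap f a = rs x" if "x \<in> RR" for x
  proof -
   have "rs x \<in> ap f ` ext \<theta>" using f(5) rsp[OF that] unfolding bij_betw_def by simp
   then show ?thesis by auto
  qed
  with True f show ?thesis by blast
 next
  case False
  then obtain a0 where "a0 \<in> U" "a0 \<in> ext \<theta> \<and> \<not> ctbl a0" using ext_U by blast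
  from Ord_min[where Q="\<lambda>a. a \<in> ext \<theta> \<and> \<not> ctbl a", OF this]
  obtain \<kappa> where k: "\<kappa> \<in> U" "\<kappa> \<in> ext \<theta>" "\<not> ctbl \<kappa>" "\<forall>c\<in>ext \<kappa>. \<not> (c \<in> ext \<theta> \<and> \<not> ctbl c)" by blast
  have sub: "c \<in> ext \<theta>" if "c \<in> ext \<kappa>" for c using Ord_trans[OF f(3) k(2) that] .
  have fp: "ap f c \<in> ext ?p" if "c \<in> ext \<kappa>" for c using is_fun_ap[OF f(4) sub[OF that] p] by blast
  have inj: "inj_on (ap f) (ext \<kappa>)" using f(5) sub unfolding bij_betw_def by (meson inj_on_subset subsetI)
  have "inU (ap f ` ext \<kappa>)" by (rule repl[OF inU_ext[OF k(1)]]) (intro dfs dt_ap f, rule ap_U)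
  then obtain A where A: "A \<in> U" "ext A = ap f ` ext \<kappa>" unfolding inU_def by blast
  have dff: "df (\<lambda>e. e 0 = ap h (ap f (e (Suc 0))))" if "h \<in> U" for h by (intro dfs dt_ap f that)
  have "\<not> ctbl A"
  proof
   assume "ctbl A"
   then obtain h where h: "h \<in> U" "is_fun h A omega" "inj_on (app h) (ext A)" unfolding ctbl_def by blast
   have hA: "ap h z \<in> range num" "app h z = ap h z" if "z \<in> ext A" for z
    using is_fun_ap[OF h(2) that omega_U] ext_omega by auto
   have "ctbl \<kappa>"
   proof (rule ctblI[OF k(1)])
    show "dt (\<lambda>e. num (nn (ap h (ap f (e 0)))))"
     using dt_lift1[of "\<lambda>x. num (nn x)" "\<lambda>e. ap h (ap f (e 0))"] dn_var[unfolded dn_def] dt_ap[OF dt_const[OF h(1)] dt_ap[OF dt_const[OF f(2)] dt_var]] by blast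
    show "inj_on (\<lambda>c. nn (ap h (ap f c))) (ext \<kappa>)"
    proof (rule inj_onI)
     fix c d assume cd: "c \<in> ext \<kappa>" "d \<in> ext \<kappa>" "nn (ap h (ap f c)) = nn (ap h (ap f d))"
     have fA: "ap f c \<in> ext A" "ap f d \<in> ext A" using cd A by blast+
     obtain m n where "ap h (ap f c) = num m" "ap h (ap f d) = num n" using hA(1) fA by blast
     then have "app h (ap f c) = app h (ap f d)" using cd(3) hA(2) fA by simp
     then have "ap f c = ap f d" using inj_onD[OF h(3)] fA by blast
     then show "c = d" using inj_onD[OF inj] cd by blast
    qed
   qed
   with k(3) show False by blast
  qed
  moreover have "ext A \<subseteq> ext ?p" unfolding A(2) using fp by (simp add: image_subset_iff)
  then have "ctbl A \<or> equipotent A ?p" using assms[unfolded CH_def, THEN bspec[OF _ A(1)]] by simp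
  ultimately have "equipotent A ?p" by simp
  then obtain h where h: "h \<in> U" "is_fun h A ?p" "bij_betw (app h) (ext A) (ext ?p)" unfolding equipotent_def by blast
  have hA: "ap h z \<in> ext ?p" "app h z = ap h z" if "z \<in> ext A" for z
   using is_fun_ap[OF h(2) that p] by blast+
  have "ap h (ap f c) \<in> ext ?p" if "c \<in> ext \<kappa>" for c using hA(1) that A by blast
  from graph_fun[OF k(1) p dff[OF h(1)] this]
  obtain b where b: "b \<in> U" "\<And>c. c \<in> ext \<kappa> ==> ap b c = ap h (ap f c)" by blast
  have "\<exists>a\<in>ext \<kappa>. ap b a = rs x" if "x \<in> RR" for x
  proof -
   have "rs x \<in> app h ` ext A" using h(3) rsp[OF that] unfolding bij_betw_def by simp
   then obtain z where z: "z \<in> ext A" "rs x = app h z" by blast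
   then obtain c where "c \<in> ext \<kappa>" "z = ap f c" using A by blast
   with z hA(2)[OF z(1)] b(2) show ?thesis by auto
  qed
  moreover have "Ord \<kappa>" using Ord_mem f(3) k(2) by blast
  ultimately show ?thesis using k b sub by blast
 qed
qed

text \<open>The coded form of S1(Omega, Gamma) for clopen covers known to the structure.\<close>

definition gammaC :: "nat set set \<Rightarrow> bool" where
 "gammaC X \<longleftrightarrow> (\<forall>W\<in>RR. ocov W X --> (\<exists>V\<in>RR. (\<forall>k. enc (k, fn V k) \<in> W) \<and> (\<forall>z\<in>X. ev (\<lambda>k. cl (fn V k) z))))"

text \<open>What stage \<alpha> has to achieve for the cover sequence \<open>W\<close> of half
  \<open>p\<close>. The hypothesis mentions only points existing by then, namely finite
  modifications of \<open>x\<close> and of earlier sections; the conclusion also binds all later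
  points, which will almost contain \<open>x\<close> and almost avoid \<open>y'\<close>. Finite sets
  of points are quantified as elements of the structure to keep the predicate first-order.\<close>

definition Task :: "nat \<Rightarrow> nat set \<Rightarrow> 'a \<Rightarrow> 'a \<Rightarrow> nat set \<Rightarrow> nat set \<Rightarrow> bool" where
 "Task p W \<alpha> g x y' \<longleftrightarrow>
  (\<forall>n. \<forall>F\<in>U. finite (ext F) \<and> (\<forall>f\<in>ext F. fmod (rr f) x \<or> (\<exists>\<beta>\<in>ext \<alpha>. fmod (rr f) (sec p (rr (ap g \<beta>))))) -->
   (\<exists>v. enc (n, v) \<in> W \<and> (\<forall>f\<in>ext F. cl v (rr f)))) -->
  (\<exists>V\<in>RR. (\<forall>k. enc (k, fn V k) \<in> W) \<and>
   (\<forall>\<beta>\<in>ext \<alpha>. \<forall>z\<in>RR. fmod z (sec p (rr (ap g \<beta>))) --> ev (\<lambda>k. cl (fn V k) z)) \<and>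
   (\<forall>z\<in>RR. fs x z \<and> fdj y' z --> ev (\<lambda>k. cl (fn V k) z)))"

definition Good0 :: "'a \<Rightarrow> 'a \<Rightarrow> 'a \<Rightarrow> nat set \<Rightarrow> bool" where
 "Good0 b \<alpha> g v \<longleftrightarrow> sec 0 v \<inter> sec 1 v = {} \<and> sec 2 v \<inter> sec 3 v = {} \<and> sec 0 v \<subseteq> sec 2 v \<and> sec 1 v \<subseteq> sec 3 v \<and>
  coi (sec 2 v) (sec 3 v) \<and>
  (\<forall>\<beta>\<in>ext \<alpha>. fs (sec 2 (rr (ap g \<beta>))) (sec 0 v) \<and> fs (sec 3 (rr (ap g \<beta>))) (sec 1 v)) \<and>
  gap (rr (ap b \<alpha>)) (sec 2 v) (sec 3 v) \<and>
  (if 0 \<in> rr (ap b \<alpha>) then Task 0 (tl1 (rr (ap b \<alpha>))) \<alpha> g (sec 0 v) (sec 3 v)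
  else Task 1 (tl1 (rr (ap b \<alpha>))) \<alpha> g (sec 1 v) (sec 2 v))"

context
 fixes \<kappa> b :: 'a
 assumes kb: "\<kappa> \<in> U" "b \<in> U" "Ord \<kappa>" "\<And>a. a \<in> ext \<kappa> ==> ctbl a" "\<And>x. x \<in> RR ==> \<exists>a\<in>ext \<kappa>. ap b a = rs x"
begin

abbreviation "Good \<equiv> Good0 b"

lemma dr_rr: "dt s ==> dr (\<lambda>e. rr (s e))"
proof -
 assume s: "dt s"
 from dt_lift1[of "\<lambda>x. rs (rr x)", OF _ s] dr_var have "dt (\<lambda>e. rs (rr (s e)))" by (simp add: dr_def)
 with s show ?thesis by (simp add: dr_def rr_RR dt_U)
qed

lemma df_Good: "df (\<lambda>e. Good (e i) (e j) (rr (e k)))"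
proof -
 have 1: "(x \<inter> y = {}) = (\<forall>i. i \<in> x --> i \<notin> y)" "(x \<subseteq> y) = (\<forall>i. i \<in> x --> i \<in> y)" for x y :: "nat set" by auto
 show ?thesis unfolding Good0_def Task_def 1
  by (intro dfs df_coi df_fs df_gap dr_sec dr_rr dt_ap kb df_finite df_fmod dr_tl1 df_cl df_ev dn_fn df_fdj)
qed

definition gf :: "('a \<Rightarrow> 'a) \<Rightarrow> 'a \<Rightarrow> 'a" where "gf F \<alpha> = set_of {pair \<beta> (F \<beta>) | \<beta>. \<beta> \<in> ext \<alpha>}"

text \<open>The stage is countable, so the earlier pairs can be listed by numbers through
  \<open>nf\<close>, and \<open>base\<close> bounds them; \<open>half\<close> then treats the
  current task.\<close>

lemma Good_ex:
 assumes a: "\<alpha> \<in> ext \<kappa>" and g: "g \<in> U" and val: "\<And>\<beta>. \<beta> \<in> ext \<alpha> ==> ap g \<beta> = F \<beta>" and FU: "\<And>\<beta>. \<beta> \<in> ext \<alpha> ==> F \<beta> \<in> U"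
  and IH: "\<And>\<beta>. \<beta> \<in> ext \<alpha> ==> Good \<beta> (gf F \<beta>) (rr (F \<beta>)) \<and> (\<forall>\<gamma>\<in>ext \<beta>. ap (gf F \<beta>) \<gamma> = F \<gamma>)"
 shows "\<exists>v\<in>RR. Good \<alpha> g v"
proof -
 have aU: "\<alpha> \<in> U" using a ext_U by blast
 obtain f where f: "f \<in> U" "is_fun f \<alpha> omega" "inj_on (app f) (ext \<alpha>)" using kb(4)[OF a] unfolding ctbl_def by blast
 define nf where "nf \<beta> = nn (ap f \<beta>)" for \<beta>
 have nf: "ap f \<beta> = num (nf \<beta>)" if "\<beta> \<in> ext \<alpha>" for \<beta>
  using is_fun_ap[OF f(2) that omega_U] unfolding ext_omega nf_def by auto
 have nfinj: "\<beta> = \<gamma>" if "\<beta> \<in> ext \<alpha>" "\<gamma> \<in> ext \<alpha>" "nf \<beta> = nf \<gamma>" for \<beta> \<gamma>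
  using inj_onD[OF f(3), of \<beta> \<gamma>] that is_fun_ap[OF f(2) _ omega_U] nf by metis
 let ?v = "\<lambda>\<beta>. rr (F \<beta>)"
 \<comment> \<open>Rows with numbers not in the range of \<open>nf\<close> are empty, which disturbs
   neither directedness nor co-infiniteness.\<close>
 define SS where "SS p = {j. \<exists>\<beta>\<in>ext \<alpha>. num (p1 j) = ap f \<beta> \<and> p2 j \<in> sec p (rr (ap g \<beta>))}" for p
 have SSR: "SS p \<in> RR" for p unfolding SS_def by (rule Collect_RR) (intro dfs dr_sec dr_rr dt_ap aU f g)
 have SSs: "sec (nf \<beta>) (SS p) = sec p (?v \<beta>)" if "\<beta> \<in> ext \<alpha>" for \<beta> p
 proof -
  have "(num (nf \<beta>) = ap f \<gamma>) = (\<gamma> = \<beta>)" if "\<gamma> \<in> ext \<alpha>" for \<gamma>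
   using nf[OF that] nf[OF \<open>\<beta> \<in> ext \<alpha>\<close>] nfinj[OF that \<open>\<beta> \<in> ext \<alpha>\<close>] by auto
  then show ?thesis using that val[OF that] unfolding SS_def sec_def[of "nf \<beta>"] by auto
 qed
 have SSe: "sec i (SS p) = {}" if "i \<notin> nf ` ext \<alpha>" for i p
  using that nf unfolding SS_def sec_def[of i] by auto
 have Gd: "Good \<beta> (gf F \<beta>) (?v \<beta>)" and gfv: "\<And>\<gamma>. \<gamma> \<in> ext \<beta> ==> ap (gf F \<beta>) \<gamma> = F \<gamma>" if "\<beta> \<in> ext \<alpha>" for \<beta> using IH[OF that] by blast+
 have inc: "fs (sec 2 (?v \<beta>)) (sec 2 (?v \<gamma>)) \<and> fs (sec 3 (?v \<beta>)) (sec 3 (?v \<gamma>))" if bg: "\<beta> \<in> ext \<gamma>" "\<gamma> \<in> ext \<alpha>" for \<beta> \<gamma>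
 proof -
  have "fs (sec 2 (?v \<beta>)) (sec 0 (?v \<gamma>)) \<and> fs (sec 3 (?v \<beta>)) (sec 1 (?v \<gamma>))" "sec 0 (?v \<gamma>) \<subseteq> sec 2 (?v \<gamma>)" "sec 1 (?v \<gamma>) \<subseteq> sec 3 (?v \<gamma>)"
   using Gd[OF bg(2)] gfv[OF bg(2) bg(1)] bg(1) unfolding Good0_def by auto
  then show ?thesis using fs_trans fs_sub by blast
 qed
 have Oa: "Ord \<alpha>" using Ord_mem kb(3) a by blast
 have "\<exists>x\<in>RR. \<exists>y\<in>RR. x \<inter> y = {} \<and> coi x y \<and> (\<forall>i. fs (sec i (SS 2)) x \<and> fs (sec i (SS 3)) y)"
 proof (rule base[OF SSR SSR])
  fix i j
  have emp: "fs {} x" for x by (simp add: fs_def)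
  show "\<exists>g. fs (sec i (SS 2)) (sec g (SS 2)) \<and> fs (sec j (SS 2)) (sec g (SS 2)) \<and> fs (sec i (SS 3)) (sec g (SS 3)) \<and> fs (sec j (SS 3)) (sec g (SS 3))"
  proof (cases "i \<in> nf ` ext \<alpha> \<and> j \<in> nf ` ext \<alpha>")
   case True
   then obtain \<beta> \<gamma> where bg: "\<beta> \<in> ext \<alpha>" "\<gamma> \<in> ext \<alpha>" "i = nf \<beta>" "j = nf \<gamma>" by blast
   have "\<beta> \<in> ext \<gamma> \<or> \<beta> = \<gamma> \<or> \<gamma> \<in> ext \<beta>" using Ord_linear[of \<beta>] Ord_mem[OF Oa] bg ext_U by blast
   then show ?thesis
    using inc[OF _ bg(1), of \<gamma>] inc[OF _ bg(2), of \<beta>] fs_refl unfolding bg(3,4) by (metis SSs bg(1,2))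
  next
   case False
   then show ?thesis using SSe emp fs_refl by metis
  qed
  show "sec i (SS 2) \<inter> sec i (SS 3) = {}" "coi (sec i (SS 2)) (sec i (SS 3))"
  proof -
   have "sec i (SS 2) \<inter> sec i (SS 3) = {} \<and> coi (sec i (SS 2)) (sec i (SS 3))"
   proof (cases "i \<in> nf ` ext \<alpha>")
    case True
    then obtain \<beta> where "\<beta> \<in> ext \<alpha>" "i = nf \<beta>" by blast
    with Gd SSs show ?thesis unfolding Good0_def by simp
   next
    case False then show ?thesis using SSe by (auto simp: coi_def)
   qed
   then show "sec i (SS 2) \<inter> sec i (SS 3) = {}" "coi (sec i (SS 2)) (sec i (SS 3))" by blast+
  qed
 qed
 then obtain x y where xy: "x \<in> RR" "y \<in> RR" "x \<inter> y = {}" "coi x y" "\<And>i. fs (sec i (SS 2)) x \<and> fs (sec i (SS 3)) y" by blast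
 have pre: "fs (sec 2 (?v \<beta>)) x \<and> fs (sec 3 (?v \<beta>)) y" if "\<beta> \<in> ext \<alpha>" for \<beta> using xy(5)[of "nf \<beta>"] SSs[OF that] by simp
 define e where "e = rr (ap b \<alpha>)"
 have eR: "e \<in> RR" "tl1 e \<in> RR" unfolding e_def tl1_def by (rule rr_RR[OF ap_U], rule Collect_RR, intro dfs dr_rr dt_ap kb aU)
 text \<open>One half of the stage: a task for the first set of the pair \<open>(x, y)\<close> enlarges the second.\<close>
 have half: "\<exists>y'\<in>RR. y \<subseteq> y' \<and> x \<inter> y' = {} \<and> coi x y' \<and> gap e x y' \<and> Task p (tl1 e) \<alpha> g x y'"
  if x: "x \<in> RR" and y: "y \<in> RR" and dj: "x \<inter> y = {}" and co: "coi x y" for x y p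
 proof -
  \<comment> \<open>The stage must care for all finite modifications of the earlier points: row
    \<open>enc (nf \<beta>, t)\<close> is the symmetric difference of section \<open>p\<close> at
    stage \<beta> with the finite set coded by \<open>t\<close>.\<close>
  define S where "S = {j. \<exists>\<beta>\<in>ext \<alpha>. num (p1 (p1 j)) = ap f \<beta> \<and> \<not> (p2 j \<in> sec p (rr (ap g \<beta>)) \<longleftrightarrow> p2 j \<in> set_decode (p2 (p1 j)))}"
  define Vd where "Vd = {i. \<exists>\<beta>\<in>ext \<alpha>. num (p1 i) = ap f \<beta>}"
  have SR: "S \<in> RR" unfolding S_def by (rule Collect_RR) (intro dfs dr_sec dr_rr dt_ap aU f g)
  have VR: "Vd \<in> RR" unfolding Vd_def by (rule Collect_RR) (intro dfs dt_ap aU f)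
  have Ss: "sec (enc (nf \<beta>, t)) S = {m. \<not> (m \<in> sec p (?v \<beta>) \<longleftrightarrow> m \<in> set_decode t)}" if "\<beta> \<in> ext \<alpha>" for \<beta> t
  proof -
   have "(num (nf \<beta>) = ap f \<gamma>) = (\<gamma> = \<beta>)" if "\<gamma> \<in> ext \<alpha>" for \<gamma>
    using nf[OF that] nf[OF \<open>\<beta> \<in> ext \<alpha>\<close>] nfinj[OF that \<open>\<beta> \<in> ext \<alpha>\<close>] by auto
   then show ?thesis using that val[OF that] unfolding S_def sec_def[of "enc (nf \<beta>, t)"] by auto
  qed
  have Vs: "i \<in> Vd \<longleftrightarrow> (\<exists>\<beta>\<in>ext \<alpha>. p1 i = nf \<beta>)" for i unfolding Vd_def using nf by auto
  have fmS: "fmod {m. \<not> (m \<in> z \<longleftrightarrow> m \<in> set_decode t)} z" for z t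
   unfolding fmod_def using sd_le by (intro exI[of _ t]) (auto simp: not_le[symmetric])
  obtain y' V where y': "y' \<in> RR" "V \<in> RR" "y \<subseteq> y'" "x \<inter> y' = {}" "coi x y'" "gap e x y'"
   "(\<forall>k m. \<exists>v. enc (k, v) \<in> tl1 e \<and> (\<forall>t. cl v (mixs x m t)) \<and> (\<forall>i. i \<le> k \<and> i \<in> Vd --> cl v (sec i S))) -->
   (\<forall>k. enc (k, fn V k) \<in> tl1 e) \<and> (\<forall>i\<in>Vd. ev (\<lambda>k. cl (fn V k) (sec i S))) \<and>
   (\<forall>z. fs x z \<and> fdj y' z --> ev (\<lambda>k. cl (fn V k) z))"
   using stage[OF x y SR VR eR(2) eR(1) dj co] by blast
  have "Task p (tl1 e) \<alpha> g x y'" unfolding Task_def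
  proof (rule impI)
   assume hyp: "\<forall>n. \<forall>F\<in>U. finite (ext F) \<and> (\<forall>f\<in>ext F. fmod (rr f) x \<or> (\<exists>\<beta>\<in>ext \<alpha>. fmod (rr f) (sec p (rr (ap g \<beta>))))) -->
   (\<exists>v. enc (n, v) \<in> tl1 e \<and> (\<forall>f\<in>ext F. cl v (rr f)))"
   have "\<exists>v. enc (k, v) \<in> tl1 e \<and> (\<forall>t. cl v (mixs x m t)) \<and> (\<forall>i. i \<le> k \<and> i \<in> Vd --> cl v (sec i S))" for k m
   proof -
    \<comment> \<open>The finitely many points that the k-th clopen set has to contain: all
      modifications of \<open>x\<close> below \<open>m\<close>, and the valid rows of
      \<open>S\<close> up to \<open>k\<close>.\<close>
    let ?A1 = "(\<lambda>t. mixs x m (set_encode t)) ` Pow {..<m}" and ?A2 = "(\<lambda>i. sec i S) ` ({..k} \<inter> Vd)"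
    let ?A = "?A1 \<union> ?A2"
    have fm1: "fmod z x" if "z \<in> ?A1" for z using that unfolding fmod_def mixs_def by (auto intro!: exI[of _ m])
    have fm2: "\<exists>\<beta>\<in>ext \<alpha>. fmod z (sec p (rr (ap g \<beta>)))" if z: "z \<in> ?A2" for z
    proof -
     obtain i \<beta> where i: "z = sec i S" "\<beta> \<in> ext \<alpha>" "p1 i = nf \<beta>" using z Vs by blast
     then have "i = enc (nf \<beta>, p2 i)" by (metis prod.collapse prod_decode_inverse)
     then have "z = {m. \<not> (m \<in> sec p (?v \<beta>) \<longleftrightarrow> m \<in> set_decode (p2 i))}" using Ss[OF i(2), of "p2 i"] i(1) by simp
     with fmS val[OF i(2)] i(2) show ?thesis by metis
    qed
    have AR: "z \<in> RR" if "z \<in> ?A" for z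
     using that fm1 fm2 fmod_RR x sec_RR rr_RR ap_U by (metis Un_iff)
    have i: "inU (rs ` ?A)" by (rule inU_finite) (use AR rs_U in auto)
    let ?F = "set_of (rs ` ?A)"
    have "finite (ext ?F) \<and> (\<forall>f\<in>ext ?F. fmod (rr f) x \<or> (\<exists>\<beta>\<in>ext \<alpha>. fmod (rr f) (sec p (rr (ap g \<beta>)))))"
     unfolding ext_set_of[OF i]
    proof (intro conjI ballI)
     fix f assume "f \<in> rs ` ?A"
     then obtain z where z: "z \<in> ?A" "f = rs z" by blast
     then have "rr f = z" using AR by simp
     with z fm1 fm2 show "fmod (rr f) x \<or> (\<exists>\<beta>\<in>ext \<alpha>. fmod (rr f) (sec p (rr (ap g \<beta>))))" by blast
    qed simp
    from hyp[THEN spec[of _ k], THEN bspec[OF _ set_of_U[OF i]], THEN mp, OF this]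
    obtain v where v: "enc (k, v) \<in> tl1 e" "\<forall>f\<in>ext ?F. cl v (rr f)" by (elim exE conjE)
    have clA: "cl v z" if "z \<in> ?A" for z
    proof -
     have "rs z \<in> ext ?F" unfolding ext_set_of[OF i] using that by (rule imageI)
     with v(2) have "cl v (rr (rs z))" by (rule bspec)
     then show ?thesis using AR[OF that] by simp
    qed
    have "cl v (mixs x m t)" for t
    proof -
     have 1: "mixs x m t = mixs x m (set_encode (set_decode t \<inter> {..<m}))" unfolding mixs_def by (auto simp: set_encode_inverse)
     have "set_decode t \<inter> {..<m} \<in> Pow {..<m}" by simp
     then have "mixs x m (set_encode (set_decode t \<inter> {..<m})) \<in> ?A" by (intro UnI1) (rule imageI)
     from clA[OF this] show ?thesis unfolding 1[symmetric] .
    qed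
    moreover have "cl v (sec i S)" if "i \<le> k \<and> i \<in> Vd" for i using clA that by blast
    ultimately show ?thesis using v(1) by blast
   qed
   with y'(7) have V: "\<forall>k. enc (k, fn V k) \<in> tl1 e" "\<forall>i\<in>Vd. ev (\<lambda>k. cl (fn V k) (sec i S))"
    "\<forall>z. fs x z \<and> fdj y' z --> ev (\<lambda>k. cl (fn V k) z)" by blast+
   have "ev (\<lambda>k. cl (fn V k) z)" if bz: "\<beta> \<in> ext \<alpha>" "fmod z (sec p (rr (ap g \<beta>)))" for \<beta> z
   proof -
    obtain B where B: "\<forall>i. B \<le> i --> (i \<in> z \<longleftrightarrow> i \<in> sec p (?v \<beta>))" using bz val unfolding fmod_def by auto
    \<comment> \<open>The code of the finite difference between \<open>z\<close> and section
      \<open>p\<close> of stage \<beta>; the corresponding row of \<open>S\<close> is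
      \<open>z\<close> itself.\<close>
    let ?t = "set_encode ({m. \<not> (m \<in> z \<longleftrightarrow> m \<in> sec p (?v \<beta>))} \<inter> {..<B})"
    have sd: "set_decode ?t = {m. \<not> (m \<in> z \<longleftrightarrow> m \<in> sec p (?v \<beta>))}" using B by (auto simp: set_encode_inverse not_le)
    have "sec (enc (nf \<beta>, ?t)) S = {m. \<not> (m \<in> sec p (?v \<beta>) \<longleftrightarrow> m \<in> set_decode ?t)}" by (rule Ss[OF bz(1)])
    also have "\<dots> = {m. \<not> (m \<in> sec p (?v \<beta>) \<longleftrightarrow> m \<in> {m. \<not> (m \<in> z \<longleftrightarrow> m \<in> sec p (?v \<beta>))})}" by (simp only: sd)
    also have "\<dots> = z" by blast
    finally have zs: "sec (enc (nf \<beta>, ?t)) S = z" .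
    have "enc (nf \<beta>, ?t) \<in> Vd" using Vs bz(1) by auto
    with V(2) have "ev (\<lambda>k. cl (fn V k) (sec (enc (nf \<beta>, ?t)) S))" by (rule bspec)
    then show ?thesis unfolding zs .
   qed
   with V y'(2) show "\<exists>V\<in>RR. (\<forall>k. enc (k, fn V k) \<in> tl1 e) \<and>
   (\<forall>\<beta>\<in>ext \<alpha>. \<forall>z\<in>RR. fmod z (sec p (rr (ap g \<beta>))) --> ev (\<lambda>k. cl (fn V k) z)) \<and>
   (\<forall>z\<in>RR. fs x z \<and> fdj y' z --> ev (\<lambda>k. cl (fn V k) z))" by blast
  qed
  with y' show ?thesis by blast
 qed
 define mk where "mk x y x' y' = {j. (p1 j = 0 \<and> p2 j \<in> x) \<or> (p1 j = 1 \<and> p2 j \<in> y) \<or> (p1 j = 2 \<and> p2 j \<in> x') \<or> (p1 j = 3 \<and> p2 j \<in> y')}" for x y x' y' :: "nat set"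
 have mkR: "mk x y x' y' \<in> RR" if "x \<in> RR" "y \<in> RR" "x' \<in> RR" "y' \<in> RR" for x y x' y'
  unfolding mk_def by (rule Collect_RR) (intro dfs that)
 have mks: "sec 0 (mk x y x' y') = x" "sec 1 (mk x y x' y') = y" "sec (Suc 0) (mk x y x' y') = y" "sec 2 (mk x y x' y') = x'" "sec 3 (mk x y x' y') = y'" for x y x' y'
  unfolding mk_def sec_def by auto
 have gapc: "gap e u w ==> gap e w u" "coi u w ==> coi w u" for u w unfolding gap_def coi_def by blast+
 show ?thesis
 proof (cases "0 \<in> e")
  case True
  obtain y' where y': "y' \<in> RR" "y \<subseteq> y'" "x \<inter> y' = {}" "coi x y'" "gap e x y'" "Task 0 (tl1 e) \<alpha> g x y'"
   using half[OF xy(1-4)] by blast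
  have "Good \<alpha> g (mk x y x y')" unfolding Good0_def e_def[symmetric] mks using True y' xy pre val by simp
  then show ?thesis using mkR xy y' by blast
 next
  case False
  have "y \<inter> x = {}" "coi y x" using xy gapc by blast+
  then obtain x' where x': "x' \<in> RR" "x \<subseteq> x'" "y \<inter> x' = {}" "coi y x'" "gap e y x'" "Task 1 (tl1 e) \<alpha> g y x'"
   using half[OF xy(2,1)] by blast
  then have "x' \<inter> y = {}" "coi x' y" "gap e x' y" using gapc by blast+
  then have "Good \<alpha> g (mk x y x' y)" unfolding Good0_def e_def[symmetric] mks using False x' xy pre val by simp
  then show ?thesis using mkR xy x' by blast
 qed
qed

text \<open>A choice function on sets of reals selects the value at each stage, so that the
  recursion step is a definable function. Definability of the resulting sequence is what later makes
  the two spaces elements of the structure.\<close>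

lemma construction:
 "\<exists>F. (\<forall>\<alpha>\<in>ext \<kappa>. F \<alpha> \<in> RR \<and> (\<exists>g. (\<forall>\<beta>\<in>ext \<alpha>. rr (ap g \<beta>) = F \<beta>) \<and> Good \<alpha> g (F \<alpha>))) \<and> (\<forall>i. dr (\<lambda>e. F (e i)))"
proof -
 let ?p = "power omega"
 have p: "?p \<in> U" by (intro power_U omega_U)
 have rsp: "rs x \<in> ext ?p" if "x \<in> RR" for x using that by (auto simp: ext_power omega_U rs_U ext_rs ext_omega)
 have "\<exists>t\<in>U. is_fun t (power ?p) ?p \<and> (\<forall>B\<in>ext (power ?p). ap t B \<in> ext ?p \<and> (ext B \<noteq> {} --> ap t B \<in> ext B) \<and> app t B = ap t B)"
 proof (rule AC[OF power_U[OF p] p, of "\<lambda>x y. ext x \<noteq> {} --> y \<in> ext x"])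
  have 1: "(ext x \<noteq> {}) = (\<exists>y\<in>ext x. True)" for x by blast
  show "df (\<lambda>e. ext (e 0) \<noteq> {} --> e (Suc 0) \<in> ext (e 0))" unfolding 1 by (intro dfs)
  have "empty \<in> ext ?p" by (simp add: ext_power omega_U empty_U ext_empty)
  then show "\<exists>y\<in>ext ?p. ext x \<noteq> {} --> y \<in> ext x" if "x \<in> ext (power ?p)" for x
   using that p by (cases "ext x = {}") (auto simp: ext_power)
 qed
 then obtain c where c: "c \<in> U" "\<And>B. B \<in> ext (power ?p) ==> ext B \<noteq> {} ==> ap c B \<in> ext B" by blast
 define C where "C \<alpha> g = {v\<in>ext ?p. Good \<alpha> g (rr v)}" for \<alpha> g
 define H where "H \<alpha> g = ap c (set_of (C \<alpha> g))" for \<alpha> g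
 have iC: "inU (C (e i) (e j))" if "range e \<subseteq> U" for e :: "nat \<Rightarrow> 'a" and i j
  unfolding C_def
  by (rule sepE[OF _ that inU_ext[OF p], of "\<lambda>e v. Good (e i) (e j) (rr v)"]) (rule df_Good)
 have iC': "inU (C \<alpha> g)" if "\<alpha> \<in> U" "g \<in> U" for \<alpha> g
  proof -
  have "range (case_nat \<alpha> (\<lambda>_::nat. g)) \<subseteq> U" using that by (auto simp: range_case_nat)
  from iC[OF this, of 0 "Suc 0"] show ?thesis by simp
 qed
 have dC: "dt (\<lambda>e. set_of (C (e i) (e j)))" for i j
  by (rule dt_set_of_eq[OF iC], assumption, unfold C_def mem_Collect_eq, intro dfs p df_Good)
 have HU: "H \<alpha> g \<in> U" for \<alpha> g unfolding H_def by (rule ap_U)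
 have Hdf: "df (\<lambda>e. e 0 = H (e (Suc 0)) (e (Suc (Suc 0))))" unfolding H_def by (intro dfs dt_ap c dC)
 define F0 where "F0 = erec H"
 have F0U: "F0 \<alpha> \<in> U" if "\<alpha> \<in> U" for \<alpha> unfolding F0_def by (rule erec_U[OF HU Hdf that])
 have gfi: "inU {pair \<beta> (F0 \<beta>) | \<beta>. \<beta> \<in> ext \<alpha>}" if "\<alpha> \<in> U" for \<alpha> unfolding F0_def by (rule inU_erec[OF HU Hdf that])
 have gfU: "gf F0 \<alpha> \<in> U" if "\<alpha> \<in> U" for \<alpha> unfolding gf_def by (rule set_of_U[OF gfi[OF that]])
 have F0e: "F0 \<alpha> = H \<alpha> (gf F0 \<alpha>)" if "\<alpha> \<in> U" for \<alpha> unfolding F0_def gf_def by (rule erec_eq[OF that])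
 have gfa: "ap (gf F0 \<alpha>) \<beta> = F0 \<beta>" if ab: "\<alpha> \<in> U" "\<beta> \<in> ext \<alpha>" for \<alpha> \<beta>
 proof -
  have bU: "\<beta> \<in> U" using ab ext_U by blast
  have e: "pair \<beta> y \<in> ext (gf F0 \<alpha>) \<longleftrightarrow> y = F0 \<beta>" if "y \<in> U" for y
   unfolding gf_def ext_set_of[OF gfi[OF ab(1)]] using ab(2) that bU F0U ext_U by (auto simp: pair_iff subset_iff)
  have "F0 \<beta> = ap (gf F0 \<alpha>) \<beta>" unfolding ap_eq[OF F0U[OF bU]] using e F0U[OF bU] by auto
  then show ?thesis by simp
 qed
 have main: "Good \<alpha> (gf F0 \<alpha>) (rr (F0 \<alpha>))" if "\<alpha> \<in> U" "\<alpha> \<in> ext \<kappa>" for \<alpha>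
  using that
 proof (induction rule: wf_induct)
  case (step \<alpha>)
  have "\<exists>v\<in>RR. Good \<alpha> (gf F0 \<alpha>) v"
  proof (rule Good_ex[OF step.prems gfU[OF step.hyps] gfa[OF step.hyps]])
   fix \<beta> assume b: "\<beta> \<in> ext \<alpha>"
   then have bU: "\<beta> \<in> U" using ext_U by blast
   show "F0 \<beta> \<in> U" by (rule F0U[OF bU])
   have "\<beta> \<in> ext \<kappa>" using Ord_trans[OF kb(3) step.prems b] .
   with step.IH[OF b] gfa[OF bU] show "Good \<beta> (gf F0 \<beta>) (rr (F0 \<beta>)) \<and> (\<forall>\<gamma>\<in>ext \<beta>. ap (gf F0 \<beta>) \<gamma> = F0 \<gamma>)" by blast
  qed
  then obtain v where v: "v \<in> RR" "Good \<alpha> (gf F0 \<alpha>) v" by blast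
  have i: "inU (C \<alpha> (gf F0 \<alpha>))" by (rule iC'[OF step.hyps gfU[OF step.hyps]])
  have "rs v \<in> C \<alpha> (gf F0 \<alpha>)" unfolding C_def using v rsp by simp
  then have "ext (set_of (C \<alpha> (gf F0 \<alpha>))) \<noteq> {}" unfolding ext_set_of[OF i] by blast
  moreover have "set_of (C \<alpha> (gf F0 \<alpha>)) \<in> ext (power ?p)"
   unfolding ext_power[OF p] using set_of_U[OF i] ext_set_of[OF i] unfolding C_def by auto
  ultimately have "H \<alpha> (gf F0 \<alpha>) \<in> C \<alpha> (gf F0 \<alpha>)" unfolding H_def using c(2) ext_set_of[OF i] by blast
  then show ?case unfolding F0e[OF step.hyps] C_def by blast
 qed
 have kU: "\<alpha> \<in> U" if "\<alpha> \<in> ext \<kappa>" for \<alpha> using that ext_U by blast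
 have "rr (F0 \<alpha>) \<in> RR \<and> (\<exists>g. (\<forall>\<beta>\<in>ext \<alpha>. rr (ap g \<beta>) = rr (F0 \<beta>)) \<and> Good \<alpha> g (rr (F0 \<alpha>)))" if a: "\<alpha> \<in> ext \<kappa>" for \<alpha>
  using main[OF kU[OF a] a] rr_RR[OF F0U[OF kU[OF a]]] gfa[OF kU[OF a]] by (auto intro!: exI[of _ "gf F0 \<alpha>"])
 moreover have "dr (\<lambda>e. rr (F0 (e i)))" for i
  unfolding F0_def by (intro dr_rr dt_erec[OF HU Hdf] dfs)
 ultimately show ?thesis by (intro exI[of _ "\<lambda>\<alpha>. rr (F0 \<alpha>)"]) blast
qed

end

theorem CH_pair:
 assumes CH
 shows "\<exists>X Y. X \<subseteq> RR \<and> Y \<subseteq> RR \<and> inU (rs ` X) \<and> inU (rs ` Y) \<and> gammaC X \<and> gammaC Y \<and>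
  (\<forall>x\<in>X \<union> Y. \<forall>y\<in>X \<union> Y. \<forall>B. \<exists>i. B \<le> i \<and> i \<notin> x \<and> i \<notin> y) \<and>
  (\<forall>e\<in>RR. (\<forall>n. \<exists>m. enc (n, m) \<in> e) --> (\<exists>x\<in>X. \<exists>y\<in>Y. x \<inter> y = {} \<and> gap e x y))"
proof -
 obtain \<kappa> b where kb: "\<kappa> \<in> U" "b \<in> U" "Ord \<kappa>" "\<And>a. a \<in> ext \<kappa> ==> ctbl a" "\<And>x. x \<in> RR ==> \<exists>a\<in>ext \<kappa>. ap b a = rs x"
  using CH_enum[OF assms] by blast
 obtain F where F: "\<And>\<alpha>. \<alpha> \<in> ext \<kappa> ==> F \<alpha> \<in> RR" and dF: "\<And>i. dr (\<lambda>e. F (e i))"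
  and FG: "\<And>\<alpha>. \<alpha> \<in> ext \<kappa> ==> \<exists>g. (\<forall>\<beta>\<in>ext \<alpha>. rr (ap g \<beta>) = F \<beta>) \<and> Good0 b \<alpha> g (F \<alpha>)"
  using construction[OF kb] by blast
 define PS where "PS p = {z. \<exists>\<alpha>\<in>ext \<kappa>. fmod z (sec p (F \<alpha>))}" for p
 have sR: "sec p (F \<alpha>) \<in> RR" if "\<alpha> \<in> ext \<kappa>" for p \<alpha> using sec_RR[OF F[OF that]] .
 have PSR: "PS p \<subseteq> RR" for p unfolding PS_def using fmod_RR sR by blast
 have PSi: "inU (rs ` PS p)" for p
 proof (rule inU_subI[OF inU_ext[OF power_U[OF omega_U]], where Q="\<lambda>z. \<exists>\<alpha>\<in>ext \<kappa>. fmod (rr z) (sec p (F \<alpha>))"])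
  have "rs z \<in> ext (power omega)" if "z \<in> RR" for z using that by (auto simp: ext_power omega_U rs_U ext_rs ext_omega)
  then show "rs ` PS p \<subseteq> ext (power omega)" using PSR[of p] by blast
  show "df (\<lambda>e. \<exists>\<alpha>\<in>ext \<kappa>. fmod (rr (e 0)) (sec p (F \<alpha>)))" by (intro dfs df_fmod dr_sec dF kb(1))
  fix z assume z: "z \<in> ext (power omega)"
  then have "z \<in> U" "ext z \<subseteq> ext omega" by (simp_all add: ext_power omega_U)
  then have "rs (rr z) = z" by (rule rs_rr)
  show "(z \<in> rs ` PS p) = (\<exists>\<alpha>\<in>ext \<kappa>. fmod (rr z) (sec p (F \<alpha>)))"
  proof
   assume "z \<in> rs ` PS p"
   then obtain w where w: "w \<in> PS p" "z = rs w" by blast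
   then have "rr z = w" using PSR[of p] by auto
   with w(1) show "\<exists>\<alpha>\<in>ext \<kappa>. fmod (rr z) (sec p (F \<alpha>))" unfolding PS_def by simp
  next
   assume "\<exists>\<alpha>\<in>ext \<kappa>. fmod (rr z) (sec p (F \<alpha>))"
   then have "rr z \<in> PS p" unfolding PS_def by blast
   with \<open>rs (rr z) = z\<close> show "z \<in> rs ` PS p" by (metis imageI)
  qed
 qed
 have dj: "sec 0 (F \<alpha>) \<inter> sec 1 (F \<alpha>) = {}" "sec 2 (F \<alpha>) \<inter> sec 3 (F \<alpha>) = {}" "sec 0 (F \<alpha>) \<subseteq> sec 2 (F \<alpha>)" "sec 1 (F \<alpha>) \<subseteq> sec 3 (F \<alpha>)"
  "coi (sec 2 (F \<alpha>)) (sec 3 (F \<alpha>))" "gap (rr (ap b \<alpha>)) (sec 2 (F \<alpha>)) (sec 3 (F \<alpha>))" if h: "\<alpha> \<in> ext \<kappa>" for \<alpha>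
 proof -
  obtain g where "Good0 b \<alpha> g (F \<alpha>)" using FG[OF h] by blast
  then show "sec 0 (F \<alpha>) \<inter> sec 1 (F \<alpha>) = {}" "sec 2 (F \<alpha>) \<inter> sec 3 (F \<alpha>) = {}" "sec 0 (F \<alpha>) \<subseteq> sec 2 (F \<alpha>)" "sec 1 (F \<alpha>) \<subseteq> sec 3 (F \<alpha>)"
   "coi (sec 2 (F \<alpha>)) (sec 3 (F \<alpha>))" "gap (rr (ap b \<alpha>)) (sec 2 (F \<alpha>)) (sec 3 (F \<alpha>))"
   unfolding Good0_def by simp_all
 qed
 have inc: "fs (sec 2 (F \<beta>)) (sec 0 (F \<alpha>))" "fs (sec 3 (F \<beta>)) (sec 1 (F \<alpha>))" if h: "\<alpha> \<in> ext \<kappa>" "\<beta> \<in> ext \<alpha>" for \<alpha> \<beta>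
 proof -
  obtain g where "\<forall>\<beta>\<in>ext \<alpha>. rr (ap g \<beta>) = F \<beta>" "Good0 b \<alpha> g (F \<alpha>)" using FG[OF h(1)] by blast
  then show "fs (sec 2 (F \<beta>)) (sec 0 (F \<alpha>))" "fs (sec 3 (F \<beta>)) (sec 1 (F \<alpha>))"
   using h(2) unfolding Good0_def by simp_all
 qed
 have lin: "\<beta> \<in> ext \<alpha> \<or> \<beta> = \<alpha> \<or> \<alpha> \<in> ext \<beta>" if "\<alpha> \<in> ext \<kappa>" "\<beta> \<in> ext \<kappa>" for \<alpha> \<beta>
 proof -
  have "\<beta> \<in> U" "\<alpha> \<in> U" using that ext_U by blast+
  with Ord_linear[of \<beta>] Ord_mem[OF kb(3)] that show ?thesis by blast
 qed
 \<comment> \<open>\<open>W\<close> together with the bit for \<open>p\<close> is a real, hence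
   treated at some stage \<alpha>; \<open>p'\<close> is the enlarged section of the opposite half.
   Points from stages before \<alpha> are covered by the second part of the conclusion of
   \<open>Task\<close>, those from \<alpha> on by the last part: they almost contain section
   \<open>p\<close> and almost avoid section \<open>p'\<close>.\<close>
 have gam: "gammaC (PS p)" if p: "p = 0 \<and> p' = 3 \<or> p = 1 \<and> p' = 2" for p p' :: nat
  unfolding gammaC_def
 proof (intro ballI impI)
  fix W assume W: "W \<in> RR" "ocov W (PS p)"
  define e where "e = {i. (i = 0 \<and> p = 0) \<or> (\<exists>j. i = Suc j \<and> j \<in> W)}"
  have eR: "e \<in> RR" unfolding e_def by (rule Collect_RR) (intro dfs W)
  have te: "tl1 e = W" "0 \<in> e \<longleftrightarrow> p = 0" unfolding tl1_def e_def by auto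
  obtain \<alpha> where a: "\<alpha> \<in> ext \<kappa>" "ap b \<alpha> = rs e" using kb(5)[OF eR] by blast
  obtain g where g: "\<And>\<beta>. \<beta> \<in> ext \<alpha> ==> rr (ap g \<beta>) = F \<beta>" "Good0 b \<alpha> g (F \<alpha>)" using FG[OF a(1)] by blast
  have T: "Task p W \<alpha> g (sec p (F \<alpha>)) (sec p' (F \<alpha>))"
   using g(2) p te unfolding Good0_def a(2) rr_rs[OF eR] by auto
  have sub: "\<beta> \<in> ext \<kappa>" if "\<beta> \<in> ext \<alpha>" for \<beta> using Ord_trans[OF kb(3) a(1) that] .
  have "\<exists>v. enc (n, v) \<in> W \<and> (\<forall>f\<in>ext Fs. cl v (rr f))"
   if h: "Fs \<in> U" "finite (ext Fs)" "\<forall>f\<in>ext Fs. fmod (rr f) (sec p (F \<alpha>)) \<or> (\<exists>\<beta>\<in>ext \<alpha>. fmod (rr f) (sec p (rr (ap g \<beta>))))" for n Fs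
  proof -
   have "rr ` ext Fs \<subseteq> PS p" unfolding PS_def using h(3) g(1) a(1) sub by force
   moreover have "finite (rr ` ext Fs)" using h(2) by simp
   ultimately have "\<exists>v. enc (n, v) \<in> W \<and> (\<forall>x\<in>rr ` ext Fs. cl v x)"
    using W(2)[unfolded ocov_def, THEN spec[of _ n], THEN spec[of _ "rr ` ext Fs"]] by simp
   then show ?thesis by simp
  qed
  then have "\<forall>n. \<forall>Fs\<in>U. finite (ext Fs) \<and> (\<forall>f\<in>ext Fs. fmod (rr f) (sec p (F \<alpha>)) \<or> (\<exists>\<beta>\<in>ext \<alpha>. fmod (rr f) (sec p (rr (ap g \<beta>))))) -->
   (\<exists>v. enc (n, v) \<in> W \<and> (\<forall>f\<in>ext Fs. cl v (rr f)))" by simp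
  from T[unfolded Task_def, THEN mp, OF this]
  obtain V where V: "V \<in> RR" "\<forall>k. enc (k, fn V k) \<in> W" and
   V34: "\<forall>\<beta>\<in>ext \<alpha>. \<forall>z\<in>RR. fmod z (sec p (rr (ap g \<beta>))) --> ev (\<lambda>k. cl (fn V k) z)"
   "\<forall>z\<in>RR. fs (sec p (F \<alpha>)) z \<and> fdj (sec p' (F \<alpha>)) z --> ev (\<lambda>k. cl (fn V k) z)"
   by (elim bexE conjE)
  note V = V V34(1)[THEN bspec, THEN bspec, THEN mp] V34(2)[THEN bspec, THEN mp, OF _ conjI]
  have "ev (\<lambda>k. cl (fn V k) z)" if z: "z \<in> PS p" for z
  proof -
   have zR: "z \<in> RR" using z PSR by blast
   obtain \<beta> where b: "\<beta> \<in> ext \<kappa>" "fmod z (sec p (F \<beta>))" using z unfolding PS_def by blast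
   consider "\<beta> \<in> ext \<alpha>" | "\<beta> = \<alpha>" | "\<alpha> \<in> ext \<beta>" using lin[OF a(1) b(1)] by blast
   then show ?thesis
   proof cases
    case 1 then show ?thesis using V(3)[OF 1 zR] g(1)[OF 1] b(2) by simp
   next
    case 2
    have "fdj (sec p' (F \<alpha>)) (sec p (F \<alpha>))" using dj[OF a(1)] p by (intro fdj_dj) auto
    then have "fdj (sec p' (F \<alpha>)) z" using fdj_mono fs_refl fmod_fs(1)[OF b(2)] 2 by blast
    then show ?thesis using V(4)[OF zR] fmod_fs(2)[OF b(2)] 2 by blast
   next
    case 3
    have "fs (sec p (F \<alpha>)) (sec p (F \<beta>)) \<and> fdj (sec p' (F \<alpha>)) (sec p (F \<beta>))"
    proof (cases "p = 0")
     case True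
     with p have "p' = 3" by simp
     have "fs (sec 0 (F \<alpha>)) (sec 0 (F \<beta>))" using fs_trans[OF fs_sub[OF dj(3)[OF a(1)]] inc(1)[OF b(1) 3]] .
     moreover have "fdj (sec 3 (F \<alpha>)) (sec 0 (F \<beta>))"
      by (rule fdj_mono[OF _ inc(2)[OF b(1) 3] fs_refl]) (use dj(1)[OF b(1)] in \<open>auto simp: fdj_def\<close>)
     ultimately show ?thesis using True \<open>p' = 3\<close> by simp
    next
     case False
     with p have "p = 1" "p' = 2" by auto
     have "fs (sec 1 (F \<alpha>)) (sec 1 (F \<beta>))" using fs_trans[OF fs_sub[OF dj(4)[OF a(1)]] inc(2)[OF b(1) 3]] .
     moreover have "fdj (sec 2 (F \<alpha>)) (sec 1 (F \<beta>))"
      by (rule fdj_mono[OF _ inc(1)[OF b(1) 3] fs_refl]) (use dj(1)[OF b(1)] in \<open>auto simp: fdj_def\<close>)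
     ultimately show ?thesis using \<open>p = 1\<close> \<open>p' = 2\<close> by simp
    qed
    then show ?thesis using V(4)[OF zR] fs_trans fmod_fs[OF b(2)] fdj_mono fs_refl by blast
   qed
  qed
  with V show "\<exists>V\<in>RR. (\<forall>k. enc (k, fn V k) \<in> W) \<and> (\<forall>z\<in>PS p. ev (\<lambda>k. cl (fn V k) z))" by blast
 qed
 \<comment> \<open>From its own stage on, a point is almost contained in one half of each pair. Two
   points thus have a common pair, whose union is co-infinite.\<close>
 have bound: "\<exists>\<beta>\<in>ext \<kappa>. \<forall>\<delta>\<in>ext \<kappa>. \<beta> = \<delta> \<or> \<beta> \<in> ext \<delta> --> (\<exists>B. \<forall>i. B \<le> i --> i \<in> z --> i \<in> sec 2 (F \<delta>) \<or> i \<in> sec 3 (F \<delta>))"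
  if z: "z \<in> PS 0 \<union> PS 1" for z
 proof -
  obtain \<beta> where b0: "\<beta> \<in> ext \<kappa>" "fmod z (sec 0 (F \<beta>)) \<or> fmod z (sec 1 (F \<beta>))"
   using z unfolding PS_def by blast
  have b: "\<beta> \<in> ext \<kappa>" "fs z (sec 2 (F \<beta>)) \<or> fs z (sec 3 (F \<beta>))"
   using b0 fs_trans[OF fmod_fs(1) fs_sub[OF dj(3)[OF b0(1)]]] fs_trans[OF fmod_fs(1) fs_sub[OF dj(4)[OF b0(1)]]] by auto
  have "fs z (sec 2 (F \<delta>)) \<or> fs z (sec 3 (F \<delta>))" if d: "\<delta> \<in> ext \<kappa>" "\<beta> = \<delta> \<or> \<beta> \<in> ext \<delta>" for \<delta>
  proof (cases "\<beta> = \<delta>")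
   case False
   then have "\<beta> \<in> ext \<delta>" using d by blast
   note 1 = fs_trans[OF inc(1)[OF d(1) this] fs_sub[OF dj(3)[OF d(1)]]] fs_trans[OF inc(2)[OF d(1) this] fs_sub[OF dj(4)[OF d(1)]]]
   show ?thesis using b(2) fs_trans[OF _ 1(1), of z] fs_trans[OF _ 1(2), of z] by auto
  qed (use b in simp)
  with b(1) show ?thesis unfolding fs_def by blast
 qed
 have C1: "\<exists>i. B \<le> i \<and> i \<notin> x \<and> i \<notin> y" if xy: "x \<in> PS 0 \<union> PS 1" "y \<in> PS 0 \<union> PS 1" for x y B
 proof -
  obtain \<beta> where b: "\<beta> \<in> ext \<kappa>" "\<And>\<delta>. \<delta> \<in> ext \<kappa> ==> \<beta> = \<delta> \<or> \<beta> \<in> ext \<delta> ==> \<exists>B. \<forall>i. B \<le> i --> i \<in> x --> i \<in> sec 2 (F \<delta>) \<or> i \<in> sec 3 (F \<delta>)"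
   using bound[OF xy(1)] by blast
  obtain \<gamma> where c: "\<gamma> \<in> ext \<kappa>" "\<And>\<delta>. \<delta> \<in> ext \<kappa> ==> \<gamma> = \<delta> \<or> \<gamma> \<in> ext \<delta> ==> \<exists>B. \<forall>i. B \<le> i --> i \<in> y --> i \<in> sec 2 (F \<delta>) \<or> i \<in> sec 3 (F \<delta>)"
   using bound[OF xy(2)] by blast
  obtain \<delta> where d: "\<delta> \<in> ext \<kappa>" "\<beta> = \<delta> \<or> \<beta> \<in> ext \<delta>" "\<gamma> = \<delta> \<or> \<gamma> \<in> ext \<delta>" using lin[OF b(1) c(1)] b(1) c(1) by blast
  obtain B1 where B1: "\<forall>i. B1 \<le> i --> i \<in> x --> i \<in> sec 2 (F \<delta>) \<or> i \<in> sec 3 (F \<delta>)" using b(2)[OF d(1,2)] by blast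
  obtain B2 where B2: "\<forall>i. B2 \<le> i --> i \<in> y --> i \<in> sec 2 (F \<delta>) \<or> i \<in> sec 3 (F \<delta>)" using c(2)[OF d(1,3)] by blast
  obtain i where i: "B + B1 + B2 \<le> i" "i \<notin> sec 2 (F \<delta>)" "i \<notin> sec 3 (F \<delta>)" using dj(5)[OF d(1)] unfolding coi_def by blast
  then have "B \<le> i" "B1 \<le> i" "B2 \<le> i" by linarith+
  with B1 B2 i(2,3) show ?thesis by blast
 qed
 have C2: "\<exists>x\<in>PS 0. \<exists>y\<in>PS 1. x \<inter> y = {} \<and> gap e x y" if e: "e \<in> RR" "\<forall>n. \<exists>m. enc (n, m) \<in> e" for e
 proof -
  text \<open>Two different codes of the same function occur at different stages; the gaps made at the
   earlier one survive at the later one.\<close>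
  define l where "l = (LEAST m. enc (0, m) \<in> e)"
  \<comment> \<open>Removing or adding the pair \<open>(0, Suc l)\<close> changes the code but not
    the function, whose value at 0 is the smaller \<open>l\<close>.\<close>
  define e1 where "e1 = {j. j \<in> e \<and> \<not> j = enc (0, Suc l)}"
  define e2 where "e2 = {j. j \<in> e \<or> j = enc (0, Suc l)}"
  have R: "e1 \<in> RR" "e2 \<in> RR" unfolding e1_def e2_def by (rule Collect_RR, intro dfs e)+
  have l: "enc (0, l) \<in> e" unfolding l_def by (rule LeastI_ex) (use e(2) in blast)
  have lm: "l \<le> m" if "enc (0, m) \<in> e" for m unfolding l_def using that by (rule Least_le)
  have f0: "fn e 0 = l" "fn e1 0 = l" "fn e2 0 = l"
   unfolding fn_def by (rule Least_equality; use l lm in \<open>auto simp: e1_def e2_def\<close>)+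
  have fS: "fn e1 n = fn e n" "fn e2 n = fn e n" for n
   by (cases "n = 0", simp add: f0, simp add: fn_def e1_def e2_def)+
  have ne: "e1 \<noteq> e2" unfolding e1_def e2_def by blast
  obtain a1 a2 where a: "a1 \<in> ext \<kappa>" "ap b a1 = rs e1" "a2 \<in> ext \<kappa>" "ap b a2 = rs e2" using kb(5)[OF R(1)] kb(5)[OF R(2)] by blast
  have "a1 \<noteq> a2" using a ne rs_inj[OF R] by auto
  have main: "\<exists>x\<in>PS 0. \<exists>y\<in>PS 1. x \<inter> y = {} \<and> gap e x y"
   if h: "\<alpha> \<in> ext \<kappa>" "\<beta> \<in> ext \<kappa>" "\<alpha> \<in> ext \<beta>" "ap b \<alpha> = rs e'" "e' \<in> RR" "\<And>n. fn e' n = fn e n" for \<alpha> \<beta> e'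
  proof (rule bexI[of _ "sec 0 (F \<beta>)"], rule bexI[of _ "sec 1 (F \<beta>)"], rule conjI)
   have "fmod x x" for x by (simp add: fmod_def)
   then show "sec 0 (F \<beta>) \<in> PS 0" "sec 1 (F \<beta>) \<in> PS 1" unfolding PS_def using h by blast+
   show "sec 0 (F \<beta>) \<inter> sec 1 (F \<beta>) = {}" by (rule dj[OF h(2)])
   have g: "gap e (sec 2 (F \<alpha>)) (sec 3 (F \<alpha>))" using dj(6)[OF h(1)] h(4,5,6) unfolding gap_def by simp
   obtain B1 where B1: "\<forall>i. B1 \<le> i --> i \<in> sec 2 (F \<alpha>) --> i \<in> sec 0 (F \<beta>)" using inc(1)[OF h(2,3)] unfolding fs_def by blast
   obtain B2 where B2: "\<forall>i. B2 \<le> i --> i \<in> sec 3 (F \<alpha>) --> i \<in> sec 1 (F \<beta>)" using inc(2)[OF h(2,3)] unfolding fs_def by blast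
   show "gap e (sec 0 (F \<beta>)) (sec 1 (F \<beta>))" unfolding gap_def
   proof
    fix B
    obtain n where n: "B + B1 + B2 \<le> n" "\<forall>i. n \<le> i \<and> i \<le> fn e n --> i \<in> sec 2 (F \<alpha>) \<or> i \<in> sec 3 (F \<alpha>)"
     using g unfolding gap_def by blast
    have "i \<in> sec 0 (F \<beta>) \<or> i \<in> sec 1 (F \<beta>)" if "n \<le> i \<and> i \<le> fn e n" for i
    proof -
     have "B1 \<le> i" "B2 \<le> i" using that n(1) by linarith+
     then show ?thesis using n(2) that B1 B2 by blast
    qed
    then show "\<exists>n. B \<le> n \<and> (\<forall>i. n \<le> i \<and> i \<le> fn e n --> i \<in> sec 0 (F \<beta>) \<or> i \<in> sec 1 (F \<beta>))" using n(1) by (intro exI[of _ n]) auto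
   qed
  qed
  from lin[OF a(1,3)] \<open>a1 \<noteq> a2\<close> consider "a1 \<in> ext a2" | "a2 \<in> ext a1" by blast
  then show ?thesis
  proof cases
   case 1 show ?thesis by (rule main[OF a(1,3) 1 a(2) R(1) fS(1)])
  next
   case 2 show ?thesis by (rule main[OF a(3,1) 2 a(4) R(2) fS(2)])
  qed
 qed
 have "gammaC (PS 0)" "gammaC (PS 1)" by (rule gam[of 0 3], simp, rule gam[of 1 2], simp)
 with PSR PSi C1 C2 show ?thesis
  by (intro exI[of _ "PS 0"] exI[of _ "PS 1"] conjI ballI allI impI) simp_all
qed

end

section \<open>Preservation in the Cohen extension\<close>

text \<open>S1(Omega, Gamma) and S1(Omega, Omega) for clopen covers coded in \<open>R\<close>; the
  parameter allows points of the ground model to be tested against covers of the extension.\<close>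

definition gamR :: "nat set set \<Rightarrow> nat set set \<Rightarrow> bool" where
 "gamR R X \<longleftrightarrow> (\<forall>W\<in>R. ocov W X --> (\<exists>V\<in>R. (\<forall>k. enc (k, fn V k) \<in> W) \<and> (\<forall>z\<in>X. ev (\<lambda>k. cl (fn V k) z))))"
definition rothR :: "nat set set \<Rightarrow> nat set set \<Rightarrow> bool" where
 "rothR R Z \<longleftrightarrow> (\<forall>W\<in>R. ocov W Z --> (\<exists>V\<in>R. (\<forall>k. enc (k, fn V k) \<in> W) \<and>
  (\<forall>F. finite F \<and> F \<subseteq> Z --> (\<exists>k. \<forall>x\<in>F. cl (fn V k) x))))"

lemma compat: assumes "agr q r" "agr q' r" shows "\<exists>q''. agr q'' r \<and> ql q'' q \<and> ql q'' q'"
 by (rule exI[of _ "mkq (max (qn q) (qn q')) r"]) (use assms in \<open>auto simp: agr_def ql_def\<close>)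

lemma cl_full: "cl (set_encode {mkq 0 {}}) x"
proof -
 have "mkq 0 {} \<in> set_decode (set_encode {mkq 0 {}})" by (subst set_encode_inverse) simp_all
 moreover have "agr (mkq 0 {}) x" by (simp add: agr_def)
 ultimately show ?thesis unfolding cl_def by blast
qed

lemma fn_graph2: "fn {j. p2 j = f (p1 j)} k = f k"
 unfolding fn_def by (rule Least_equality) auto

context cohen begin

lemma RR_N: assumes "x \<in> RR" shows "x \<in> N.RR" "N.rs x = rs x"
proof -
 have e: "N.ext (rs x) = N.num ` x" using ext_abs[OF rs_U[OF assms]] ext_rs[OF assms] N_num by simp
 have "rs x \<in> N" using rs_U[OF assms] M_N by blast
 with e show "x \<in> N.RR" "N.rs x = rs x" unfolding N.RR_def N.inU_def N.rs_def by (auto intro: N_set_of)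
qed

lemma image_rs_N: assumes "X \<subseteq> RR" "inU (rs ` X)" shows "N.inU (N.rs ` X)"
proof -
 have "N.rs ` X = rs ` X" using RR_N(2) assms(1) by (auto simp: image_iff subset_iff)
 moreover have "N.inU (rs ` X)" unfolding N.inU_def
  using set_of_U[OF assms(2)] ext_set_of[OF assms(2)] ext_abs M_N by (metis subsetD)
 ultimately show ?thesis by simp
qed

text \<open>That \<open>B\<close> is a cover sequence is forced by an initial segment
  \<open>q0\<close> of \<open>r\<close>: no string below it excludes a finite set of points from all
  members of a row. The finite subsets of \<open>Z\<close> lie in the ground model although
  \<open>B\<close> need not, and this makes the statement expressible there.\<close>

lemma ocov_forced:
 assumes B: "B \<in> N.RR" "ocov B Z" and Z: "Z \<subseteq> RR" "inU (rs ` Z)"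
 shows "\<exists>H\<in>RR. \<exists>r. \<exists>c\<in>N.RR. \<exists>q0. (\<forall>D\<in>RR. dense2 D --> (\<exists>q1 q2. enc (q1, q2) \<in> D \<and> agr q1 r \<and> agr q2 c)) \<and>
  (\<forall>b. b \<in> B \<longleftrightarrow> (\<exists>q. agr q r \<and> enc (b, q) \<in> H)) \<and> agr q0 r \<and>
  (\<forall>k F q. finite F --> F \<subseteq> Z --> ql q q0 --> (\<exists>q' v. ql q' q \<and> enc (enc (k, v), q') \<in> H \<and> (\<forall>x\<in>F. cl v x)))"
proof -
 obtain H r c where H: "H \<in> RR" "c \<in> N.RR"
  "\<forall>D\<in>RR. dense2 D --> (\<exists>q1 q2. enc (q1, q2) \<in> D \<and> agr q1 r \<and> agr q2 c)"
  "\<forall>b. b \<in> B \<longleftrightarrow> (\<exists>q. agr q r \<and> enc (b, q) \<in> H)"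
  "\<forall>b q q'. enc (b, q) \<in> H \<and> ql q' q --> enc (b, q') \<in> H"
  using cohen_name[OF B(1)] by (elim bexE exE conjE)
 \<comment> \<open>A bad string forces, for some row and some finite set of points, that no member
   of the row contains the set. \<open>D\<close> decides badness along \<open>r\<close>, and a bad
   initial segment of \<open>r\<close> would contradict the cover property of
   \<open>B\<close>.\<close>
 define Bad where "Bad = {q. \<exists>k. \<exists>F\<in>M. finite (ext F) \<and> (\<forall>f\<in>ext F. f \<in> rs ` Z) \<and>
  (\<forall>q' v. ql q' q \<and> enc (enc (k, v), q') \<in> H --> \<not> (\<forall>f\<in>ext F. cl v (rr f)))}"
 have BR: "Bad \<in> RR" unfolding Bad_def by (rule Collect_RR) (intro dfs df_finite df_inset Z df_ql H(1) df_cl dr_rr)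
 define D where "D = {d. p1 d \<in> Bad \<or> (\<forall>q'. ql q' (p1 d) --> q' \<notin> Bad)}"
 have DR: "D \<in> RR" unfolding D_def by (rule Collect_RR) (intro dfs df_ql BR)
 have "dense2 D" unfolding dense2_def
 proof (intro allI)
  fix q1 q2
  show "\<exists>q1' q2'. ql q1' q1 \<and> ql q2' q2 \<and> enc (q1', q2') \<in> D"
  proof (cases "\<exists>q'. ql q' q1 \<and> q' \<in> Bad")
   case True
   then obtain q' where "ql q' q1" "q' \<in> Bad" by blast
   then show ?thesis by (intro exI[of _ q'] exI[of _ q2]) (simp add: D_def)
  next
   case False
   then show ?thesis by (intro exI[of _ q1] exI[of _ q2]) (simp add: D_def)
  qed
 qed
 with H(3) DR obtain q0 q2 where q0: "enc (q0, q2) \<in> D" "agr q0 r" by blast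
 have "q0 \<notin> Bad"
 proof
  assume "q0 \<in> Bad"
  then obtain k F where F: "finite (ext F)" "\<forall>f\<in>ext F. f \<in> rs ` Z"
   "\<forall>q' v. ql q' q0 \<and> enc (enc (k, v), q') \<in> H --> \<not> (\<forall>f\<in>ext F. cl v (rr f))" unfolding Bad_def by blast
  have "rr ` ext F \<subseteq> Z" using F(2) Z(1) by (force simp: subset_iff)
  then obtain v where v: "enc (k, v) \<in> B" "\<forall>x\<in>rr ` ext F. cl v x"
   using B(2)[unfolded ocov_def, THEN spec[of _ k], THEN spec[of _ "rr ` ext F"]] F(1) by auto
  obtain q where q: "agr q r" "enc (enc (k, v), q) \<in> H" using v(1) H(4) by blast
  obtain q'' where "ql q'' q" "ql q'' q0" using compat[OF q(1) q0(2)] by blast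
  then show False using F(3) H(5) q(2) v(2) by blast
 qed
 with q0(1) have nb: "q' \<notin> Bad" if "ql q' q0" for q' using that unfolding D_def by simp
 show ?thesis
 proof (rule bexI[OF _ H(1)], rule exI[of _ r], rule bexI[OF _ H(2)], rule exI[of _ q0], intro conjI H(3,4) q0(2) allI impI)
  fix k F q assume F: "finite F" "F \<subseteq> Z" "ql q q0"
  have i: "inU (rs ` F)" using F Z(1) rs_U by (intro inU_finite) auto
  have e: "ext (set_of (rs ` F)) = rs ` F" by (rule ext_set_of[OF i])
  have "\<not> (\<forall>q' v. ql q' q \<and> enc (enc (k, v), q') \<in> H --> \<not> (\<forall>f\<in>rs ` F. cl v (rr f)))"
  proof
   assume "\<forall>q' v. ql q' q \<and> enc (enc (k, v), q') \<in> H --> \<not> (\<forall>f\<in>rs ` F. cl v (rr f))"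
   then have "q \<in> Bad" unfolding Bad_def mem_Collect_eq
    by (intro exI[of _ k] bexI[of _ "set_of (rs ` F)"] set_of_U[OF i]) (use F in \<open>auto simp: e\<close>)
   with nb[OF F(3)] show False by simp
  qed
  then obtain q' v where q': "ql q' q" "enc (enc (k, v), q') \<in> H" "\<forall>f\<in>rs ` F. cl v (rr f)" by blast
  moreover have "cl v x" if "x \<in> F" for x using q'(3) that F(2) Z(1) by (auto simp: subset_iff)
  ultimately show "\<exists>q' v. ql q' q \<and> enc (enc (k, v), q') \<in> H \<and> (\<forall>x\<in>F. cl v x)" by blast
 qed
qed

text \<open>Position \<open>enc (q, l)\<close> of the ground-model sequence \<open>W\<close> asks
  for a clopen set that some extension of \<open>q\<close> forces into row \<open>l\<close>. The
  gamma property yields one choice for each position. By genericity some \<open>q\<close> gives a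
  choice that really is in row \<open>l\<close> of \<open>B\<close>, and since
  \<open>enc (q, l)\<close> is at least \<open>l\<close>, the choices still converge.\<close>

lemma gamma_pres: assumes X: "X \<subseteq> RR" "inU (rs ` X)" "gammaC X" shows "gamR N.RR X"
 unfolding gamR_def
proof (intro ballI impI)
 fix B assume B: "B \<in> N.RR" "ocov B X"
 obtain H r c q0 where H: "H \<in> RR" "c \<in> N.RR"
  and gen': "\<forall>D\<in>RR. dense2 D --> (\<exists>q1 q2. enc (q1, q2) \<in> D \<and> agr q1 r \<and> agr q2 c)"
  and Bi': "\<forall>b. b \<in> B \<longleftrightarrow> (\<exists>q. agr q r \<and> enc (b, q) \<in> H)" and q0: "agr q0 r"
  and fo': "\<forall>k F q. finite F --> F \<subseteq> X --> ql q q0 --> (\<exists>q' v. ql q' q \<and> enc (enc (k, v), q') \<in> H \<and> (\<forall>x\<in>F. cl v x))"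
  using ocov_forced[OF B X(1,2)] by (elim bexE exE conjE)
 note gen = gen'[THEN bspec, THEN mp] and Bi = Bi'[THEN spec] and fo = fo'[rule_format]
 \<comment> \<open>Positions whose string does not extend \<open>q0\<close> carry no constraint, so
   that all rows of \<open>W\<close> cover.\<close>
 define W where "W = {j. ql (p1 (p1 j)) q0 --> (\<exists>q'. ql q' (p1 (p1 j)) \<and> enc (enc (p2 (p1 j), p2 j), q') \<in> H)}"
 have WR: "W \<in> RR" unfolding W_def by (rule Collect_RR) (intro dfs df_ql H)
 have "ocov W X" unfolding ocov_def
 proof (intro allI impI)
  fix n F assume F: "finite F \<and> F \<subseteq> X"
  show "\<exists>v. enc (n, v) \<in> W \<and> (\<forall>x\<in>F. cl v x)"
  proof (cases "ql (p1 n) q0")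
   case True
   then obtain q' v where "ql q' (p1 n)" "enc (enc (p2 n, v), q') \<in> H" "\<forall>x\<in>F. cl v x" using fo[of F "p1 n" "p2 n"] F by blast
   then show ?thesis by (intro exI[of _ v]) (auto simp: W_def)
  next
   case False
   then show ?thesis using cl_full by (intro exI[of _ "set_encode {mkq 0 {}}"]) (simp add: W_def)
  qed
 qed
 with X(3) WR obtain V where V: "V \<in> RR" "\<forall>k. enc (k, fn V k) \<in> W" "\<forall>z\<in>X. ev (\<lambda>k. cl (fn V k) z)" unfolding gammaC_def by blast
 have ex: "\<exists>q. enc (l, fn V (enc (q, l))) \<in> B" for l
 proof -
  \<comment> \<open>The first alternative, incompatibility with \<open>q0\<close>, makes
    \<open>D\<close> dense; along \<open>r\<close> it is excluded by \<open>compat\<close>.\<close>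
  define D where "D = {d. (\<forall>q. ql q (p1 d) --> \<not> ql q q0) \<or> (\<exists>q. enc (enc (l, fn V (enc (q, l))), p1 d) \<in> H)}"
  have DR: "D \<in> RR" unfolding D_def by (rule Collect_RR) (intro dfs df_ql H dn_fn V)
  have "dense2 D" unfolding dense2_def
  proof (intro allI)
   fix q1 q2
   show "\<exists>q1' q2'. ql q1' q1 \<and> ql q2' q2 \<and> enc (q1', q2') \<in> D"
   proof (cases "\<exists>q. ql q q1 \<and> ql q q0")
    case True
    then obtain q where q: "ql q q1" "ql q q0" by blast
    obtain q' where q': "ql q' q" "enc (enc (l, fn V (enc (q, l))), q') \<in> H"
     using V(2)[THEN spec[of _ "enc (q, l)"]] q(2) unfolding W_def by auto
    have "enc (q', q2) \<in> D" unfolding D_def using q'(2) by auto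
    then show ?thesis using q' q ql_trans ql_refl by blast
   next
    case False
    then show ?thesis by (intro exI[of _ q1] exI[of _ q2]) (auto simp: D_def)
   qed
  qed
  from gen[OF DR this] obtain q1 q2 where q: "enc (q1, q2) \<in> D" "agr q1 r" by blast
  have "\<exists>q. ql q q1 \<and> ql q q0" using compat[OF q(2) q0] by blast
  with q(1) obtain q where "enc (enc (l, fn V (enc (q, l))), q1) \<in> H" unfolding D_def by auto
  then show ?thesis using Bi q(2) by blast
 qed
 \<comment> \<open>The least suitable \<open>q\<close> is taken in the extension, where
   \<open>B\<close> is available.\<close>
 define g where "g l = fn V (enc (LEAST q. enc (l, fn V (enc (q, l))) \<in> B, l))" for l
 have gB: "enc (l, g l) \<in> B" for l unfolding g_def by (rule LeastI_ex[OF ex])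
 define V' where "V' = {j. p2 j = g (p1 j)}"
 have "V' \<in> N.RR" unfolding V'_def g_def by (rule N.Collect_RR) (intro N.dfs N.dn_fn RR_N V B)
 moreover have f: "fn V' k = g k" for k unfolding V'_def by (rule fn_graph2)
 moreover have "ev (\<lambda>k. cl (g k) z)" if z: "z \<in> X" for z
 proof -
  obtain K where K: "\<forall>k. K \<le> k --> cl (fn V k) z" using V(3) z unfolding ev_def by blast
  show ?thesis unfolding ev_def g_def using K le_prod_encode_2 le_trans by blast
 qed
 ultimately show "\<exists>V\<in>N.RR. (\<forall>k. enc (k, fn V k) \<in> B) \<and> (\<forall>z\<in>X. ev (\<lambda>k. cl (fn V k) z))"
  using gB by (intro bexI[of _ V']) auto
qed

text \<open>The second Cohen real is the selector: in row \<open>n\<close> it proposes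
  \<open>fn c n\<close>, which is accepted if it is in the row of \<open>B\<close>. Given a finite
  set of points, the string for \<open>r\<close> is extended so as to force a suitable
  \<open>v\<close> into a fresh row, and the string for \<open>c\<close> so as to propose
  \<open>v\<close> there.\<close>

lemma roth_N: assumes Z: "Z \<subseteq> RR" "inU (rs ` Z)" shows "rothR N.RR Z"
 unfolding rothR_def
proof (intro ballI impI)
 fix B assume B: "B \<in> N.RR" "ocov B Z"
 obtain H r c q0 where H: "H \<in> RR" "c \<in> N.RR"
  and gen': "\<forall>D\<in>RR. dense2 D --> (\<exists>q1 q2. enc (q1, q2) \<in> D \<and> agr q1 r \<and> agr q2 c)"
  and Bi': "\<forall>b. b \<in> B \<longleftrightarrow> (\<exists>q. agr q r \<and> enc (b, q) \<in> H)" and q0: "agr q0 r"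
  and fo': "\<forall>k F q. finite F --> F \<subseteq> Z --> ql q q0 --> (\<exists>q' v. ql q' q \<and> enc (enc (k, v), q') \<in> H \<and> (\<forall>x\<in>F. cl v x))"
  using ocov_forced[OF B Z] by (elim bexE exE conjE)
 note gen = gen'[THEN bspec, THEN mp] and Bi = Bi'[THEN spec] and fo = fo'[rule_format]
 define g where "g n = (if enc (n, fn c n) \<in> B then fn c n else fn B n)" for n
 have "\<exists>v. enc (n, v) \<in> B" for n using B(2)[unfolded ocov_def, THEN spec[of _ n], THEN spec[of _ "{}"]] by auto
 then have gB: "enc (n, g n) \<in> B" for n unfolding g_def fn_def[of B] by (auto intro: LeastI_ex)
 define V' where "V' = {j. p2 j = g (p1 j)}"
 have 1: "(m = g n) = ((enc (n, fn c n) \<in> B \<and> m = fn c n) \<or> (enc (n, fn c n) \<notin> B \<and> m = fn B n))" for m n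
  unfolding g_def by auto
 have "V' \<in> N.RR" unfolding V'_def 1 by (rule N.Collect_RR) (intro N.dfs N.dn_fn H(2) B)
 moreover have f: "fn V' k = g k" for k unfolding V'_def by (rule fn_graph2)
 moreover have "\<exists>k. \<forall>x\<in>F. cl (g k) x" if F: "finite F" "F \<subseteq> Z" for F
 proof -
  have i: "inU (rs ` F)" using F Z(1) rs_U by (intro inU_finite) auto
  have e: "ext (set_of (rs ` F)) = rs ` F" by (rule ext_set_of[OF i])
  have rF: "(\<forall>f\<in>rs ` F. cl v (rr f)) = (\<forall>x\<in>F. cl v x)" for v using F(2) Z(1) by (auto simp: subset_iff)
  define D where "D = {d. (\<forall>q. ql q (p1 d) --> \<not> ql q q0) \<or> (\<exists>n v. enc (enc (n, v), p1 d) \<in> H \<and>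
   (\<forall>f\<in>ext (set_of (rs ` F)). cl v (rr f)) \<and> enc (n, v) \<in> qs (p2 d) \<and> enc (n, v) < qn (p2 d) \<and>
   (\<forall>m. m < v --> enc (n, m) \<notin> qs (p2 d) \<and> enc (n, m) < qn (p2 d)))}"
  have DR: "D \<in> RR" unfolding D_def by (rule Collect_RR) (intro dfs df_ql H(1) df_cl dr_rr df_qs dn_qn set_of_U[OF i])
  have "dense2 D" unfolding dense2_def
  proof (intro allI)
   fix q1 q2
   show "\<exists>q1' q2'. ql q1' q1 \<and> ql q2' q2 \<and> enc (q1', q2') \<in> D"
   proof (cases "\<exists>q. ql q q1 \<and> ql q q0")
    case True
    then obtain q where q: "ql q q1" "ql q q0" by blast
    \<comment> \<open>The number \<open>q2\<close> is itself a fresh row: \<open>enc (q2, m)\<close>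
      is at least \<open>q2\<close>, hence at least the length of the string \<open>q2\<close>,
      which therefore says nothing about that row.\<close>
    let ?n = q2
    obtain q' v where q': "ql q' q" "enc (enc (?n, v), q') \<in> H" "\<forall>x\<in>F. cl v x" using fo[OF F q(2), of ?n] by blast
    \<comment> \<open>The new string has to decide \<open>enc (q2, m)\<close> for all
      \<open>m\<close> up to \<open>v\<close>, so that \<open>v\<close> is the least
      proposal.\<close>
    let ?L = "Suc (\<Sum>m\<le>v. enc (?n, m))"
    let ?q2 = "mkq (?L + qn q2) (qs q2 \<inter> {..<qn q2} \<union> {enc (?n, v)})"
    have le: "enc (?n, m) < ?L" if "m \<le> v" for m
     using member_le_sum[of m "{..v}" "\<lambda>m. enc (?n, m)"] that by simp
    have ge: "qn q2 \<le> enc (?n, m)" for m using qn_le[of q2] le_prod_encode_1[of q2 m] by linarith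
    have le2: "enc (?n, m) < ?L + qn q2" if "m \<le> v" for m using le[OF that] by linarith
    have gn: "\<not> enc (?n, m) < qn q2" for m using ge[of m] by linarith
    have "k \<noteq> enc (?n, v)" if "k < qn q2" for k using that ge[of v] by linarith
    then have "ql ?q2 q2" by (auto simp: ql_def)
    moreover have "enc (q', ?q2) \<in> D" unfolding D_def mem_Collect_eq e rF
     by (rule disjI2, rule exI[of _ ?n], rule exI[of _ v]) (use q'(2,3) le2 gn in auto)
    ultimately show ?thesis using ql_trans[OF q'(1) q(1)] by blast
   next
    case False
    then show ?thesis by (intro exI[of _ q1] exI[of _ q2]) (auto simp: D_def)
   qed
  qed
  from gen[OF DR this] obtain q1 q2 where q: "enc (q1, q2) \<in> D" "agr q1 r" "agr q2 c" by blast
  have "\<exists>q. ql q q1 \<and> ql q q0" using compat[OF q(2) q0] by blast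
  with q(1) obtain n v where v: "enc (enc (n, v), q1) \<in> H" "\<forall>x\<in>F. cl v x"
   "enc (n, v) \<in> qs q2" "enc (n, v) < qn q2"
   "\<forall>m. m < v --> enc (n, m) \<notin> qs q2 \<and> enc (n, m) < qn q2" unfolding D_def e rF by auto
  have "fn c n = v" unfolding fn_def
  proof (rule Least_equality)
   show "enc (n, v) \<in> c" using v(3,4) q(3) unfolding agr_def by blast
   show "v \<le> m" if "enc (n, m) \<in> c" for m using v(5) q(3) that unfolding agr_def by (meson not_le)
  qed
  moreover have "enc (n, v) \<in> B" using Bi v(1) q(2) by blast
  ultimately have "g n = v" unfolding g_def by simp
  with v(2) show ?thesis by blast
 qed
 ultimately show "\<exists>V\<in>N.RR. (\<forall>k. enc (k, fn V k) \<in> B) \<and> (\<forall>F. finite F \<and> F \<subseteq> Z --> (\<exists>k. \<forall>x\<in>F. cl (fn V k) x))"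
  using gB by (intro bexI[of _ V']) auto
qed

text \<open>Cohen forcing adds no function dominating the ground model, and \<open>e\<close> makes
  this concrete: its row \<open>n\<close> bounds, for each of the finitely many strings up to
  \<open>n\<close> that extend \<open>q0\<close>, a value which some extension forces into row
  \<open>n\<close> of \<open>B\<close>. Genericity turns gaps of a ground-model pair for
  \<open>e\<close> into gaps for \<open>B\<close>.\<close>

lemma gap_N:
 assumes X: "X \<subseteq> RR" "Y \<subseteq> RR" and XY: "\<forall>e\<in>RR. (\<forall>n. \<exists>m. enc (n, m) \<in> e) --> (\<exists>x\<in>X. \<exists>y\<in>Y. x \<inter> y = {} \<and> gap e x y)"
  and B: "B \<in> N.RR" "\<And>n. \<exists>m. enc (n, m) \<in> B"
 shows "\<exists>x\<in>X. \<exists>y\<in>Y. x \<inter> y = {} \<and> gap B x y"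
proof -
 \<comment> \<open>Totality of \<open>B\<close> is the cover property for the empty set of points,
   so \<open>ocov_forced\<close> applies.\<close>
 have o: "ocov B {}" unfolding ocov_def using B(2) by simp
 have i0: "{} \<subseteq> RR" "inU (rs ` {})" using inU_empty by auto
 obtain H r c q0 where H: "H \<in> RR" "c \<in> N.RR"
  and gen': "\<forall>D\<in>RR. dense2 D --> (\<exists>q1 q2. enc (q1, q2) \<in> D \<and> agr q1 r \<and> agr q2 c)"
  and Bi': "\<forall>b. b \<in> B \<longleftrightarrow> (\<exists>q. agr q r \<and> enc (b, q) \<in> H)" and q0: "agr q0 r"
  and fo': "\<forall>k F q. finite F --> F \<subseteq> {} --> ql q q0 --> (\<exists>q' v. ql q' q \<and> enc (enc (k, v), q') \<in> H \<and> (\<forall>x\<in>F. cl v x))"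
  using ocov_forced[OF B(1) o i0] by (elim bexE exE conjE)
 note gen = gen'[THEN bspec, THEN mp] and Bi = Bi'[THEN spec] and fo = fo'[rule_format]
 define e where "e = {t. \<forall>j. j \<le> p1 t \<and> ql j q0 --> (\<exists>v q. v \<le> p2 t \<and> ql q j \<and> enc (enc (p1 t, v), q) \<in> H)}"
 have ei: "enc (n, m) \<in> e \<longleftrightarrow> (\<forall>j. j \<le> n \<and> ql j q0 --> (\<exists>v q. v \<le> m \<and> ql q j \<and> enc (enc (n, v), q) \<in> H))" for n m
  unfolding e_def by simp
 have eR: "e \<in> RR" unfolding e_def by (rule Collect_RR) (intro dfs df_ql H)
 have tot: "\<exists>m. enc (n, m) \<in> e" for n
 proof -
  have "\<forall>j. \<exists>v. ql j q0 --> (\<exists>q. ql q j \<and> enc (enc (n, v), q) \<in> H)" using fo[of "{}" _ n] by blast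
  then obtain f where f: "\<And>j. ql j q0 ==> \<exists>q. ql q j \<and> enc (enc (n, f j), q) \<in> H" by metis
  have "enc (n, \<Sum>j\<le>n. f j) \<in> e" unfolding e_def mem_Collect_eq
  proof (intro allI impI, simp only: prod_encode_inverse fst_conv snd_conv, elim conjE)
   fix j assume "j \<le> n" "ql j q0"
   then show "\<exists>v q. v \<le> (\<Sum>j\<le>n. f j) \<and> ql q j \<and> enc (enc (n, v), q) \<in> H"
    using f[of j] member_le_sum[of j "{..n}" f] by auto
  qed
  then show ?thesis by blast
 qed
 then have fne: "enc (n, fn e n) \<in> e" for n unfolding fn_def by (rule LeastI_ex)
 obtain x y where xy: "x \<in> X" "y \<in> Y" "x \<inter> y = {}" "gap e x y" using XY eR tot by blast
 have "gap B x y" unfolding gap_def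
 proof
  fix k
  define D where "D = {d. (\<forall>q. ql q (p1 d) --> \<not> ql q q0) \<or> (\<exists>n v. k \<le> n \<and> (\<forall>i. n \<le> i \<and> i \<le> v --> i \<in> x \<or> i \<in> y) \<and>
   enc (enc (n, v), p1 d) \<in> H)}"
  have "x \<in> RR" "y \<in> RR" using X xy by blast+
  then have DR: "D \<in> RR" unfolding D_def by (intro Collect_RR dfs df_ql H)
  have "dense2 D" unfolding dense2_def
  proof (intro allI)
   fix q1 q2
   show "\<exists>q1' q2'. ql q1' q1 \<and> ql q2' q2 \<and> enc (q1', q2') \<in> D"
   proof (cases "\<exists>q. ql q q1 \<and> ql q q0")
    case True
    then obtain j where q: "ql j q1" "ql j q0" by blast
    \<comment> \<open>\<open>n\<close> is at least \<open>j\<close>, so that row \<open>n\<close> of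
      \<open>e\<close> takes the string \<open>j\<close> into account.\<close>
    obtain n where n: "k + j \<le> n" "\<forall>i. n \<le> i \<and> i \<le> fn e n --> i \<in> x \<or> i \<in> y" using xy(4) unfolding gap_def by blast
    obtain v q' where v: "v \<le> fn e n" "ql q' j" "enc (enc (n, v), q') \<in> H"
     using fne[unfolded ei, of n] n(1) q(2) by (meson add_leD2)
    have "enc (q', q2) \<in> D" unfolding D_def mem_Collect_eq
     by (rule disjI2, rule exI[of _ n], rule exI[of _ v]) (use v n in auto)
    then show ?thesis using ql_trans[OF v(2) q(1)] ql_refl by blast
   next
    case False
    then show ?thesis by (intro exI[of _ q1] exI[of _ q2]) (auto simp: D_def)
   qed
  qed
  from gen[OF DR this] obtain q1 q2 where q: "enc (q1, q2) \<in> D" "agr q1 r" by blast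
  have "\<exists>q. ql q q1 \<and> ql q q0" using compat[OF q(2) q0] by blast
  with q(1) obtain n v where v: "k \<le> n" "\<forall>i. n \<le> i \<and> i \<le> v --> i \<in> x \<or> i \<in> y" "enc (enc (n, v), q1) \<in> H"
   unfolding D_def by auto
  have "enc (n, v) \<in> B" using Bi v(3) q(2) by blast
  then have "fn B n \<le> v" unfolding fn_def by (rule Least_le)
  with v show "\<exists>n\<ge>k. \<forall>i. n \<le> i \<and> i \<le> fn B n --> i \<in> x \<or> i \<in> y" by (intro exI[of _ n]) auto
 qed
 with xy show ?thesis by blast
qed

theorem N_pair:
 assumes CH
 shows "\<exists>X Y. X \<subseteq> N.RR \<and> Y \<subseteq> N.RR \<and> N.inU (N.rs ` X) \<and> N.inU (N.rs ` Y) \<and> gamR N.RR X \<and> gamR N.RR Y \<and> rothR N.RR (X \<union> Y) \<and>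
  (\<forall>x\<in>X \<union> Y. \<forall>y\<in>X \<union> Y. \<forall>B. \<exists>i. B \<le> i \<and> i \<notin> x \<and> i \<notin> y) \<and>
  (\<forall>e\<in>N.RR. (\<forall>n. \<exists>m. enc (n, m) \<in> e) --> (\<exists>x\<in>X. \<exists>y\<in>Y. x \<inter> y = {} \<and> gap e x y))"
proof -
 obtain X Y where XY: "X \<subseteq> RR" "Y \<subseteq> RR" "inU (rs ` X)" "inU (rs ` Y)" "gammaC X" "gammaC Y"
  "\<forall>x\<in>X \<union> Y. \<forall>y\<in>X \<union> Y. \<forall>B. \<exists>i. B \<le> i \<and> i \<notin> x \<and> i \<notin> y"
  "\<forall>e\<in>RR. (\<forall>n. \<exists>m. enc (n, m) \<in> e) --> (\<exists>x\<in>X. \<exists>y\<in>Y. x \<inter> y = {} \<and> gap e x y)"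
  using CH_pair[OF assms] by (elim exE conjE)
 have 1: "X \<union> Y \<subseteq> RR" "inU (rs ` (X \<union> Y))" using XY(1-4) by (auto simp: image_Un intro: inU_Un)
 show ?thesis
  by (rule exI[of _ X], rule exI[of _ Y], intro conjI image_rs_N XY gamma_pres roth_N 1 ballI impI gap_N)
   (use XY RR_N(1) in auto)
qed

end

section \<open>The real line of a structure\<close>

text \<open>Rationals are coded triples \<open>(a, (b, c))\<close> with value (a - b) / (c + 1).
  Order, sum and product then reduce to arithmetic on natural numbers, which is definable.\<close>

definition qq :: "nat \<Rightarrow> real" where "qq k = (real (p1 k) - real (p1 (p2 k))) / (real (p2 (p2 k)) + 1)"
definition qadd :: "nat \<Rightarrow> nat \<Rightarrow> nat" where
 "qadd i j = enc (p1 i * Suc (p2 (p2 j)) + p1 j * Suc (p2 (p2 i)), prod_encode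
  (p1 (p2 i) * Suc (p2 (p2 j)) + p1 (p2 j) * Suc (p2 (p2 i)), p2 (p2 i) * p2 (p2 j) + p2 (p2 i) + p2 (p2 j)))"
definition qmul :: "nat \<Rightarrow> nat \<Rightarrow> nat" where
 "qmul i j = enc (p1 i * p1 j + p1 (p2 i) * p1 (p2 j), prod_encode
  (p1 i * p1 (p2 j) + p1 (p2 i) * p1 j, p2 (p2 i) * p2 (p2 j) + p2 (p2 i) + p2 (p2 j)))"

lemma qq_add: "qq (qadd i j) = qq i + qq j"
proof -
 have *: "(a * (c' + 1) + a' * (c + 1) - (b * (c' + 1) + b' * (c + 1))) / (c * c' + c + c' + 1) = (a - b) / (c + 1) + (a' - b') / (c' + 1)"
  if "c \<ge> 0" "c' \<ge> 0" for a a' b b' c c' :: real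
 proof -
  have "c * c' + c + c' + 1 = (c + 1) * (c' + 1)" by (simp add: algebra_simps)
  then show ?thesis using that by (simp add: add_divide_distrib diff_divide_distrib)
 qed
 show ?thesis unfolding qq_def qadd_def prod_encode_inverse fst_conv snd_conv
  using *[where a="real (p1 i)" and a'="real (p1 j)" and b="real (p1 (p2 i))" and b'="real (p1 (p2 j))" and c="real (p2 (p2 i))" and c'="real (p2 (p2 j))"] by (simp add: algebra_simps)
qed
lemma qq_mul: "qq (qmul i j) = qq i * qq j"
proof -
 have *: "(a * a' + b * b' - (a * b' + b * a')) / (c * c' + c + c' + 1) = (a - b) / (c + 1) * ((a' - b') / (c' + 1))"
  for a a' b b' c c' :: real
 proof -
  have "c * c' + c + c' + 1 = (c + 1) * (c' + 1)" "a * a' + b * b' - (a * b' + b * a') = (a - b) * (a' - b')" by (simp_all add: algebra_simps)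
  then show ?thesis by simp
 qed
 show ?thesis unfolding qq_def qmul_def prod_encode_inverse fst_conv snd_conv
  using *[where a="real (p1 i)" and a'="real (p1 j)" and b="real (p1 (p2 i))" and b'="real (p1 (p2 j))" and c="real (p2 (p2 i))" and c'="real (p2 (p2 j))"] by simp
qed
lemma qq_less_iff: "qq i < qq j \<longleftrightarrow> p1 i * Suc (p2 (p2 j)) + p1 (p2 j) * Suc (p2 (p2 i)) < p1 j * Suc (p2 (p2 i)) + p1 (p2 i) * Suc (p2 (p2 j))"
proof -
 have *: "(a - b) / (c + 1) < (a' - b') / (c' + 1) \<longleftrightarrow> a * (c' + 1) + b' * (c + 1) < a' * (c + 1) + b * (c' + 1)"
  if "c \<ge> 0" "c' \<ge> 0" for a a' b b' c c' :: real
  using that by (simp add: divide_simps) (simp add: algebra_simps)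
 have "real (x * Suc y + z * Suc w) = real x * (real y + 1) + real z * (real w + 1)" for x y z w by (simp add: algebra_simps)
 then show ?thesis unfolding qq_def by (subst *) (simp_all only: of_nat_0_le_iff of_nat_less_iff[symmetric, where 'a=real])
qed
lemma qq0: "qq 0 = 0"
proof -
 have "prod_decode 0 = (0, 0)" by (simp add: prod_decode_def prod_decode_aux.simps)
 then show ?thesis by (simp add: qq_def)
qed
lemma qq_dense: assumes "x < y" shows "\<exists>k. x < qq k \<and> qq k < y"
proof -
 obtain r where r: "r \<in> \<rat>" "x < r" "r < y" using Rats_dense_in_real[OF assms] by blast
 obtain m n :: nat where mn: "n \<noteq> 0" "\<bar>r\<bar> = real m / real n" using Rats_abs_nat_div_natE[OF r(1)] by metis
 have "real (n - 1) + 1 = real n" using mn(1) by (simp add: of_nat_diff)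
 then have "qq (enc (m, enc (0, n - 1))) = real m / real n" "qq (enc (0, enc (m, n - 1))) = - (real m / real n)"
  unfolding qq_def by simp_all
 moreover have "r = real m / real n \<or> r = - (real m / real n)" using mn(2) by (auto simp: abs_if split: if_splits)
 ultimately show ?thesis using r by metis
qed

definition DD :: "real \<Rightarrow> nat set" where "DD x = {k. qq k < x}"
lemma DD_iff [simp]: "k \<in> DD x \<longleftrightarrow> qq k < x" by (simp add: DD_def)
lemma DD_sub: "DD x \<subseteq> DD y \<longleftrightarrow> x \<le> y"
 using qq_dense[of y x] by (force simp: DD_def not_le[symmetric])
lemma DD_inj: "DD x = DD y \<longleftrightarrow> x = y"
 using DD_sub[of x y] DD_sub[of y x] by auto

text \<open>The first-order description of lower Dedekind cuts without greatest element, by which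
  separation forms the set of reals.\<close>

definition cutp :: "nat set \<Rightarrow> bool" where
 "cutp c \<longleftrightarrow> (\<exists>k. k \<in> c) \<and> (\<exists>k. k \<notin> c) \<and> (\<forall>i j. i \<in> c \<and> \<not> qq i < qq j --> j \<in> c) \<and> (\<forall>i. i \<in> c --> (\<exists>j. j \<in> c \<and> qq i < qq j))"

lemma cutp_DD: "cutp (DD x)"
proof -
 obtain i j where "qq i < x" "x < qq j" using qq_dense[of "x - 1" x] qq_dense[of x "x + 1"] by auto
 then show ?thesis unfolding cutp_def DD_iff using qq_dense[of _ x] by (intro conjI exI[of _ i] exI[of _ j]) (auto simp: not_less)
qed

lemma cutpE: assumes "cutp c" shows "\<exists>x. c = DD x"
proof -
 obtain k0 where k0: "k0 \<notin> c" using assms unfolding cutp_def by blast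
 have ne: "c \<noteq> {}" using assms unfolding cutp_def by blast
 have dn: "j \<in> c" if "i \<in> c" "\<not> qq i < qq j" for i j using assms that unfolding cutp_def by blast
 have up: "\<exists>j. j \<in> c \<and> qq i < qq j" if "i \<in> c" for i using assms that unfolding cutp_def by blast
 have "qq i \<le> qq k0" if "i \<in> c" for i using dn[OF that, of k0] k0 by (meson less_imp_le)
 then have bd: "bdd_above (qq ` c)" by (intro bdd_aboveI[of _ "qq k0"]) auto
 have *: "k \<in> c \<longleftrightarrow> qq k < Sup (qq ` c)" for k
 proof
  assume "k \<in> c"
  then obtain j where "j \<in> c" "qq k < qq j" using up by blast
  then show "qq k < Sup (qq ` c)" using cSup_upper[OF imageI bd] by (meson less_le_trans)
 next
  assume "qq k < Sup (qq ` c)"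
  then obtain i where "i \<in> c" "qq k < qq i" using less_cSup_iff[OF _ bd] ne by auto
  then show "k \<in> c" using dn[of i k] by auto
 qed
 show ?thesis by (rule exI[of _ "Sup (qq ` c)"], rule Set.set_eqI) (unfold DD_iff, rule *)
qed

definition addc :: "nat set \<Rightarrow> nat set \<Rightarrow> nat set" where
 "addc c d = {k. \<exists>i j. i \<in> c \<and> j \<in> d \<and> qq k < qq (qadd i j)}"
text \<open>A product of cuts without distinction of signs: a rectangle of rationals around the
  point (x, y) is tested at its corners, where a bilinear function attains its minimum.\<close>

definition mulc :: "nat set \<Rightarrow> nat set \<Rightarrow> nat set" where
 "mulc c d = {k. \<exists>i i' j j'. i \<in> c \<and> i' \<notin> c \<and> j \<in> d \<and> j' \<notin> d \<and>
  qq k < qq (qmul i j) \<and> qq k < qq (qmul i j') \<and> qq k < qq (qmul i' j) \<and> qq k < qq (qmul i' j')}"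

lemma addc: "addc (DD x) (DD y) = DD (x + y)"
proof -
 have "\<exists>i j. qq i < x \<and> qq j < y \<and> qq k < qq i + qq j" if "qq k < x + y" for k
 proof -
  have d: "x - (x + y - qq k) / 2 < x" "y - (x + y - qq k) / 2 < y" using that by simp_all
  obtain i j where "x - (x + y - qq k) / 2 < qq i" "qq i < x" "y - (x + y - qq k) / 2 < qq j" "qq j < y"
   using qq_dense[OF d(1)] qq_dense[OF d(2)] by blast
  then show ?thesis by (intro exI[of _ i] exI[of _ j]) (simp add: field_simps)
 qed
 then show ?thesis unfolding addc_def qq_add DD_def by fastforce
qed

lemma mulc: "mulc (DD x) (DD y) = DD (x * y)"
proof -
 \<comment> \<open>A linear function above \<open>q\<close> at both ends of an interval is above
   \<open>q\<close> in between.\<close>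
 have bil: "q < a * t" if "s < t" "t \<le> s'" "q < a * s" "q < a * s'" for q a s s' t :: real
 proof (cases "a \<ge> 0")
  case True then show ?thesis using mult_left_mono[of s t a] that by linarith
 next
  case False then show ?thesis using mult_left_mono_neg[of t s' a] that by linarith
 qed
 have "\<exists>i i' j j'. qq i < x \<and> \<not> qq i' < x \<and> qq j < y \<and> \<not> qq j' < y \<and>
  q < qq i * qq j \<and> q < qq i * qq j' \<and> q < qq i' * qq j \<and> q < qq i' * qq j'" if q: "q < x * y" for q
 proof -
  let ?B = "\<bar>x\<bar> + \<bar>y\<bar> + 1"
  \<comment> \<open>If factors are within \<delta> of \<open>x\<close> and \<open>y\<close>, their
    product falls short of \<open>x * y\<close> by at most \<open>\<delta> * ?B\<close>. The bound 1
    on \<delta> controls the quadratic term, and the factor 2 makes the estimate strict.\<close>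
  define \<delta> where "\<delta> = min 1 ((x * y - q) / (2 * ?B))"
  have d: "0 < \<delta>" "\<delta> \<le> 1" "\<delta> * ?B < x * y - q"
  proof -
   show "0 < \<delta>" "\<delta> \<le> 1" unfolding \<delta>_def using q by (auto simp: add_nonneg_pos)
   have "\<delta> * ?B \<le> (x * y - q) / (2 * ?B) * ?B" unfolding \<delta>_def by (intro mult_right_mono) auto
   also have "\<dots> = (x * y - q) / 2" by (simp add: field_simps add_nonneg_pos)
   also have "\<dots> < x * y - q" using q by simp
   finally show "\<delta> * ?B < x * y - q" .
  qed
  have key: "q < a * b" if "\<bar>a - x\<bar> < \<delta>" "\<bar>b - y\<bar> < \<delta>" for a b
  proof -
   have 1: "x * y - a * b = - ((a - x) * y + (b - y) * x + (a - x) * (b - y))" by (simp add: algebra_simps)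
   have "\<bar>(a - x) * y\<bar> \<le> \<delta> * \<bar>y\<bar>" "\<bar>(b - y) * x\<bar> \<le> \<delta> * \<bar>x\<bar>" "\<bar>(a - x) * (b - y)\<bar> \<le> \<delta> * 1"
    unfolding abs_mult using that d by (intro mult_mono; simp)+
   then have "x * y - a * b \<le> \<delta> * ?B" unfolding 1 by (simp add: algebra_simps abs_le_iff)
   with d(3) show ?thesis by linarith
  qed
  obtain i where i: "x - \<delta> < qq i" "qq i < x" using qq_dense[of "x - \<delta>" x] d by auto
  obtain i' where i': "x < qq i'" "qq i' < x + \<delta>" using qq_dense[of x "x + \<delta>"] d by auto
  obtain j where j: "y - \<delta> < qq j" "qq j < y" using qq_dense[of "y - \<delta>" y] d by auto
  obtain j' where j': "y < qq j'" "qq j' < y + \<delta>" using qq_dense[of y "y + \<delta>"] d by auto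
  have "\<bar>qq i - x\<bar> < \<delta>" "\<bar>qq i' - x\<bar> < \<delta>" "\<bar>qq j - y\<bar> < \<delta>" "\<bar>qq j' - y\<bar> < \<delta>" using i i' j j' by linarith+
  then show ?thesis using key i i' j j' by (intro exI[of _ i] exI[of _ i'] exI[of _ j] exI[of _ j'] conjI) auto
 qed
 moreover have "q < x * y" if h: "qq i < x" "\<not> qq i' < x" "qq j < y" "\<not> qq j' < y"
  "q < qq i * qq j" "q < qq i * qq j'" "q < qq i' * qq j" "q < qq i' * qq j'" for q i i' j j'
 proof -
  have "q < qq i * y" "q < qq i' * y" using bil[of "qq j" y "qq j'" q "qq i"] bil[of "qq j" y "qq j'" q "qq i'"] h by auto
  then show ?thesis using bil[of "qq i" x "qq i'" q y] h by (simp add: mult.commute)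
 qed
 ultimately show ?thesis unfolding mulc_def qq_mul DD_iff by (intro Set.set_eqI iffI) (auto simp only: mem_Collect_eq DD_iff)
qed

lemma DD_neg: "DD (- x) = {k. \<exists>b. b \<notin> DD x \<and> qq (qadd k b) < qq 0}"
proof -
 have "\<exists>b. x \<le> qq b \<and> qq k + qq b < 0" if "qq k < - x" for k
  using qq_dense[of x "- qq k"] that by (smt (verit))
 then show ?thesis unfolding qq_add qq0 DD_def by (force simp: not_less)
qed

lemma DD_inv: assumes "x > 0" shows "DD (1 / x) = {k. \<exists>b. b \<notin> DD x \<and> qq (qmul k b) < qq (enc (1, 0))}"
proof -
 have z: "p1 0 = 0" "p2 0 = 0" by (simp_all add: prod_decode_def prod_decode_aux.simps)
 have one: "qq (enc (1, 0)) = 1" by (simp add: qq_def z)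
 have "qq k < 1 / x \<longleftrightarrow> (\<exists>b. x \<le> qq b \<and> qq k * qq b < 1)" for k
 proof
  assume k: "qq k < 1 / x"
  show "\<exists>b. x \<le> qq b \<and> qq k * qq b < 1"
  proof (cases "qq k \<le> 0")
   case True
   obtain b where "x < qq b" using qq_dense[of x "x + 1"] by auto
   moreover have "qq k * qq b \<le> 0" using True \<open>x < qq b\<close> assms by (intro mult_nonpos_nonneg) auto
   ultimately show ?thesis by (intro exI[of _ b]) auto
  next
   case False
   then have "x < 1 / qq k" using k assms by (simp add: field_simps)
   then obtain b where "x < qq b" "qq b < 1 / qq k" using qq_dense by blast
   then show ?thesis using False by (intro exI[of _ b]) (simp add: field_simps)
  qed
 next
  assume "\<exists>b. x \<le> qq b \<and> qq k * qq b < 1"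
  then obtain b where b: "x \<le> qq b" "qq k * qq b < 1" by blast
  show "qq k < 1 / x"
  proof (cases "qq k \<le> 0")
   case True
   have "0 < 1 / x" using assms by simp
   with True show ?thesis by linarith
  next
   case False
   then have "qq k * x \<le> qq k * qq b" using b by (intro mult_left_mono) auto
   then show ?thesis using b assms by (simp add: field_simps)
  qed
 qed
 then show ?thesis unfolding qq_mul one DD_def by (auto simp: not_less)
qed

text \<open>The map \<open>rho\<close> embeds the Cantor space into the reals; \<open>phi x\<close> is the Dedekind cut of \<open>rho x\<close>.\<close>

definition rho :: "nat set \<Rightarrow> real" where "rho x = (\<Sum>i. if i \<in> x then (1 / 3) ^ Suc i else 0)"
definition chi :: "nat set \<Rightarrow> nat \<Rightarrow> nat" where "chi x i = (if i \<in> x then 1 else 0)"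
text \<open>The n-th partial sum of \<open>rho x\<close>, multiplied by \<open>3 ^ n\<close>, so
  that \<open>phi\<close> is defined by arithmetic alone.\<close>

definition sumN :: "nat set \<Rightarrow> nat \<Rightarrow> nat" where "sumN x n = rec_nat 0 (\<lambda>i a. 3 * a + chi x i) n"
definition phi :: "nat set \<Rightarrow> nat set" where
 "phi x = {k. \<exists>n. p1 k * 3 ^ n < sumN x n * Suc (p2 (p2 k)) + p1 (p2 k) * 3 ^ n}"

lemma rho_summable: "summable (\<lambda>i. if i \<in> x then (1 / 3 :: real) ^ Suc i else 0)"
proof (rule summable_comparison_test')
 show "summable (\<lambda>i. (1 / 3 :: real) ^ i)" by (rule summable_geometric) simp
qed auto

lemma rho_bounds: "0 \<le> rho x" "rho x \<le> 1 / 2"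
proof -
 show "0 \<le> rho x" unfolding rho_def by (rule suminf_nonneg[OF rho_summable]) auto
 have s: "(\<lambda>i. 1 / 3 * (1 / 3 :: real) ^ i) sums (1 / 3 * (1 / (1 - 1 / 3)))" by (intro sums_mult geometric_sums) simp
 have "rho x \<le> (\<Sum>i. 1 / 3 * (1 / 3 :: real) ^ i)" unfolding rho_def
  by (rule suminf_le[OF _ rho_summable sums_summable[OF s]]) auto
 then show "rho x \<le> 1 / 2" using sums_unique[OF s] by simp
qed

lemma rho_rec: "rho x = ((if 0 \<in> x then 1 else 0) + rho (tl1 x)) / 3"
proof -
 have "rho x = (if 0 \<in> x then 1 / 3 else 0) + (\<Sum>i. if Suc i \<in> x then (1 / 3) ^ Suc (Suc i) else 0)"
  unfolding rho_def using suminf_split_head[OF rho_summable[of x]] by simp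
 also have "(\<Sum>i. if Suc i \<in> x then (1 / 3 :: real) ^ Suc (Suc i) else 0) = (\<Sum>i. 1 / 3 * (if i \<in> tl1 x then (1 / 3) ^ Suc i else 0))"
  by (intro suminf_cong) (simp add: tl1_def)
 also have "\<dots> = 1 / 3 * rho (tl1 x)" unfolding rho_def by (rule suminf_mult[OF rho_summable])
 finally show ?thesis by simp
qed

lemma rho_close: "(\<And>i. i < m ==> i \<in> x \<longleftrightarrow> i \<in> y) ==> \<bar>rho x - rho y\<bar> \<le> (1 / 3) ^ m"
proof (induction m arbitrary: x y)
 case 0
 then show ?case using rho_bounds[of x] rho_bounds[of y] by simp
next
 case (Suc m)
 have d: "\<bar>rho (tl1 x) - rho (tl1 y)\<bar> \<le> (1 / 3) ^ m" by (rule Suc.IH) (use Suc.prems in \<open>auto simp: tl1_def\<close>)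
 have "0 \<in> x \<longleftrightarrow> 0 \<in> y" using Suc.prems[of 0] by simp
 then have e: "rho x - rho y = (rho (tl1 x) - rho (tl1 y)) / 3" by (subst rho_rec[of x], subst rho_rec[of y]) (auto simp: field_simps)
 show ?case unfolding e using d by (simp add: abs_divide)
qed

text \<open>Digits 0 and 1 in base 3 leave room: the tails lie between 0 and 1/2 by
  \<open>rho_bounds\<close>, so sequences with different first digit are mapped at least 1/6
  apart.\<close>

lemma rho_far: "\<bar>rho x - rho y\<bar> < (1 / 3) ^ m / 2 ==> i < m ==> i \<in> x \<longleftrightarrow> i \<in> y"
proof (induction m arbitrary: x y i)
 case (Suc m)
 have b: "(1 / 3 :: real) ^ m \<le> 1" by (simp add: power_le_one)
 have lt: "\<bar>(if 0 \<in> x then 1 else 0) + rho (tl1 x) - ((if 0 \<in> y then 1 else 0) + rho (tl1 y))\<bar> < (1 / 3) ^ m / 2"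
  using Suc.prems(1) by (subst (asm) (1 2) rho_rec) (simp add: abs_if field_simps split: if_splits)
 have 0: "0 \<in> x \<longleftrightarrow> 0 \<in> y"
  using lt b rho_bounds[of "tl1 x"] rho_bounds[of "tl1 y"] by (auto simp: abs_if split: if_splits)
 with lt have "\<bar>rho (tl1 x) - rho (tl1 y)\<bar> < (1 / 3) ^ m / 2" by simp
 from Suc.IH[OF this, of "i - 1"] 0 Suc.prems(2) show ?case by (cases i) (auto simp: tl1_def)
qed simp

lemma phi: "phi x = DD (rho x)"
proof -
 let ?f = "\<lambda>i. if i \<in> x then (1 / 3 :: real) ^ Suc i else 0"
 have S: "sum ?f {..<n} = real (sumN x n) / 3 ^ n" for n
  by (induction n) (auto simp: sumN_def chi_def field_simps power_divide)
 have "qq k < real (sumN x n) / 3 ^ n \<longleftrightarrow> p1 k * 3 ^ n < sumN x n * Suc (p2 (p2 k)) + p1 (p2 k) * 3 ^ n" for k n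
 proof -
  have "qq k < real (sumN x n) / 3 ^ n \<longleftrightarrow> real (p1 k * 3 ^ n) < real (sumN x n * Suc (p2 (p2 k)) + p1 (p2 k) * 3 ^ n)"
   unfolding qq_def by (simp add: divide_simps add_nonneg_pos) (simp add: algebra_simps)
  then show ?thesis by (simp only: of_nat_less_iff)
 qed
 then have 1: "phi x = {k. \<exists>n. qq k < sum ?f {..<n}}" unfolding phi_def S by simp
 have le: "sum ?f {..<n} \<le> rho x" for n unfolding rho_def by (rule sum_le_suminf[OF rho_summable]) auto
 have lim: "(\<lambda>n. sum ?f {..<n}) \<longlonglongrightarrow> rho x" unfolding rho_def by (rule summable_LIMSEQ[OF rho_summable])
 have "\<exists>n. q < sum ?f {..<n}" if "q < rho x" for q
  using order_tendstoD(1)[OF lim that] eventually_happens'[OF sequentially_bot] by blast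
 then show ?thesis unfolding 1 DD_def using le by (auto intro: less_le_trans)
qed

context zc begin

lemma dn_qadd: "dn s ==> dn t ==> dn (\<lambda>e. qadd (s e) (t e))" unfolding qadd_def by (intro dfs)
lemma dn_qmul: "dn s ==> dn t ==> dn (\<lambda>e. qmul (s e) (t e))" unfolding qmul_def by (intro dfs)
lemma df_qlt: "dn s ==> dn t ==> df (\<lambda>e. qq (s e) < qq (t e))" unfolding qq_less_iff by (intro dfs)
lemmas dq = dfs dn_qadd dn_qmul df_qlt

lemma dr_addc: "dr (\<lambda>e. addc (rr (e i)) (rr (e j)))" unfolding addc_def by (intro dq)
lemma dr_mulc: "dr (\<lambda>e. mulc (rr (e i)) (rr (e j)))" unfolding mulc_def by (intro dq)
lemma df_cutp: "df (\<lambda>e. cutp (rr (e i)))" unfolding cutp_def by (intro dq)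

lemma dr_phi: assumes "dr s" shows "dr (\<lambda>e. phi (s e))"
proof (rule dr_lift1[of phi, OF _ assms])
 fix i
 have 1: "(m = chi x k) = (if k \<in> x then m = 1 else m = 0)" for m x k by (simp add: chi_def)
 have c: "dn (\<lambda>e. chi (rr (e i)) (nn (e j)))" for i j by (rule dnI) (unfold 1, intro dfs)
 have s: "dn (\<lambda>e. sumN (rr (e i)) (nn (e j)))" for i j unfolding sumN_def
  by (rule dn_rec[of "\<lambda>_. 0" "\<lambda>e k a. 3 * a + chi (rr (e i)) k" "\<lambda>e. nn (e j)"]) (intro dfs c)+
 show "dr (\<lambda>e. phi (rr (e i)))" unfolding phi_def by (intro dfs s)
qed

text \<open>The reals of the structure are identified with those reals of the metatheory whose lower
  cut the structure contains. Field laws and order are inherited; what remains is closure under the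
  operations and membership of their graphs.\<close>

definition RU :: "real set" where "RU = {x. DD x \<in> RR}"
definition pt :: "real \<Rightarrow> 'a" where "pt x = rs (DD x)"

lemma RU_qq: "qq k \<in> RU" unfolding RU_def DD_def mem_Collect_eq by (rule Collect_RR) (intro dq)
lemma RR_lift2: assumes "\<And>i j. dr (\<lambda>e. f (rr (e i)) (rr (e j)))" "x \<in> RR" "y \<in> RR" shows "f x y \<in> RR"
proof -
 have "range (case_nat (rs x) (\<lambda>_. rs y)) \<subseteq> U" using rs_U assms(2,3) by (auto simp: range_case_nat)
 then have "f (rr (case_nat (rs x) (\<lambda>_. rs y) 0)) (rr (case_nat (rs x) (\<lambda>_. rs y) (Suc 0))) \<in> RR" using assms(1)[of 0 "Suc 0"] unfolding dr_def by blast
 then show ?thesis using assms(2,3) by simp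
qed
lemma RU_add: "x \<in> RU ==> y \<in> RU ==> x + y \<in> RU" using RR_lift2[of addc "DD x" "DD y", OF dr_addc] unfolding RU_def addc by simp
lemma RU_mul: "x \<in> RU ==> y \<in> RU ==> x * y \<in> RU" using RR_lift2[of mulc "DD x" "DD y", OF dr_mulc] unfolding RU_def mulc by simp
lemma RU_neg: "x \<in> RU ==> - x \<in> RU" unfolding RU_def mem_Collect_eq DD_neg by (rule Collect_RR) (intro dq)
lemma RU_inv: assumes "x \<in> RU" "x \<noteq> 0" shows "1 / x \<in> RU"
proof -
 have p: "1 / y \<in> RU" if "y \<in> RU" "y > 0" for y
  using that(1) unfolding RU_def mem_Collect_eq DD_inv[OF that(2)] by (intro Collect_RR dq)
 show ?thesis
 proof (cases "x > 0")
  case False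
  then have "1 / (- x) \<in> RU" using assms by (intro p RU_neg) auto
  from RU_neg[OF this] show ?thesis by simp
 qed (use p assms in auto)
qed
lemma RU_0: "0 \<in> RU" using RU_qq[of 0] qq0 by simp
lemma RU_1: "1 \<in> RU"
proof -
 have "p1 0 = 0" "p2 0 = 0" by (simp_all add: prod_decode_def prod_decode_aux.simps)
 then have "qq (enc (1, 0)) = 1" by (simp add: qq_def)
 then show ?thesis using RU_qq by metis
qed
lemma RU_rho: "x \<in> RR ==> rho x \<in> RU"
 using RR_lift2[of "\<lambda>x y. phi x" x x] dr_phi[OF dr_var] unfolding RU_def by (simp add: phi)

lemma pt_U: "x \<in> RU ==> pt x \<in> U" and rr_pt: "x \<in> RU ==> rr (pt x) = DD x"
 by (simp_all add: RU_def pt_def rs_U)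
lemma pt_inj: "x \<in> RU ==> y \<in> RU ==> pt x = pt y \<longleftrightarrow> x = y"
 unfolding RU_def pt_def by (simp add: rs_inj DD_inj)

lemma inU_RU: "inU (pt ` RU)"
proof (rule inU_subI[OF inU_ext[OF power_U[OF omega_U]], where Q="\<lambda>z. cutp (rr z)"])
 show "pt ` RU \<subseteq> ext (power omega)" by (auto simp: ext_power omega_U rs_U pt_def RU_def ext_rs ext_omega)
 show "df (\<lambda>e. cutp (rr (e 0)))" by (rule df_cutp)
 fix z assume "z \<in> ext (power omega)"
 then have z: "z \<in> U" "rs (rr z) = z" using rs_rr by (auto simp: ext_power omega_U)
 show "(z \<in> pt ` RU) = cutp (rr z)"
 proof
  assume "cutp (rr z)"
  then obtain x where "rr z = DD x" using cutpE by blast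
  then have "z = pt x" "x \<in> RU" using z rr_RR[OF z(1)] by (simp_all add: pt_def RU_def)
  then show "z \<in> pt ` RU" by blast
 qed (auto simp: rr_pt cutp_DD)
qed

end

context zcc begin

lemma bin_fun:
 assumes R: "R \<in> U" "ext R = pt ` RU" and f: "\<And>i j. dr (\<lambda>e. f (rr (e i)) (rr (e j)))"
  and F: "\<And>x y. x \<in> RU ==> y \<in> RU ==> F x y \<in> RU" "\<And>x y. f (DD x) (DD y) = DD (F x y)"
 shows "\<exists>t\<in>U. is_fun t (times R R) R \<and> (\<forall>x\<in>RU. \<forall>y\<in>RU. app2 t (pt x) (pt y) = pt (F x y))"
proof -
 let ?Q = "\<lambda>z w. \<exists>u\<in>ext R. \<exists>v\<in>ext R. z = pair u v \<and> w = rs (f (rr u) (rr v))"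
 have "\<exists>t\<in>U. is_fun t (times R R) R \<and> (\<forall>z\<in>ext (times R R). ap t z \<in> ext R \<and> ?Q z (ap t z) \<and> app t z = ap t z)"
 proof (rule AC[OF times_U[OF R(1) R(1)] R(1), of ?Q])
  show "df (\<lambda>e. ?Q (e 0) (e (Suc 0)))" by (intro dfs f R(1))
  fix z assume "z \<in> ext (times R R)"
  then obtain x y where xy: "z = pair (pt x) (pt y)" "x \<in> RU" "y \<in> RU" unfolding ext_times[OF R(1) R(1)] R(2) by blast
  have "pt (F x y) = rs (f (rr (pt x)) (rr (pt y)))" using xy F(2) rr_pt by (simp add: pt_def)
  then have "?Q z (pt (F x y))" unfolding R(2) using xy by blast
  then show "\<exists>w\<in>ext R. ?Q z w" using F(1)[OF xy(2,3)] R(2) by blast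
 qed
 then obtain t where t: "t \<in> U" "is_fun t (times R R) R" "\<And>z. z \<in> ext (times R R) ==> ?Q z (app t z)" by auto
 have "app2 t (pt x) (pt y) = pt (F x y)" if xy: "x \<in> RU" "y \<in> RU" for x y
 proof -
  have "pair (pt x) (pt y) \<in> ext (times R R)" unfolding ext_times[OF R(1) R(1)] R(2) using xy by blast
  from t(3)[OF this] obtain u v where uv: "u \<in> pt ` RU" "v \<in> pt ` RU" "pair (pt x) (pt y) = pair u v" "app t (pair (pt x) (pt y)) = rs (f (rr u) (rr v))"
   unfolding R(2) by blast
  then have "u = pt x" "v = pt y" using pair_iff pt_U xy by auto
  then show ?thesis using uv(4) xy F(2) rr_pt by (simp add: app2_def pt_def)
 qed
 with t show ?thesis by blast
qed

text \<open>Completeness comes from separation: the cut of a supremum is the union of the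
  cuts.\<close>

lemma reals:
 "\<exists>R\<in>U. \<exists>A\<in>U. \<exists>T\<in>U. \<exists>L\<in>U. real_field R A T L \<and> ext R = pt ` RU \<and> (\<forall>x\<in>RU. \<forall>y\<in>RU. le L (pt x) (pt y) \<longleftrightarrow> x \<le> y)"
proof -
 define R where "R = set_of (pt ` RU)"
 have R: "R \<in> U" "ext R = pt ` RU" unfolding R_def using inU_RU set_of_U ext_set_of by auto
 obtain A where A: "A \<in> U" "is_fun A (times R R) R" "\<And>x y. x \<in> RU ==> y \<in> RU ==> app2 A (pt x) (pt y) = pt (x + y)"
  using bin_fun[OF R, of addc "(+)", OF dr_addc RU_add addc] by auto
 obtain T where T: "T \<in> U" "is_fun T (times R R) R" "\<And>x y. x \<in> RU ==> y \<in> RU ==> app2 T (pt x) (pt y) = pt (x * y)"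
  using bin_fun[OF R, of mulc "(*)", OF dr_mulc RU_mul mulc] by auto
 let ?Q = "\<lambda>z. \<exists>u\<in>ext R. \<exists>v\<in>ext R. z = pair u v \<and> (\<forall>k. k \<in> rr u --> k \<in> rr v)"
 have iL: "inU {z \<in> ext (times R R). ?Q z}"
  by (rule sepI[OF inU_ext[OF times_U[OF R(1) R(1)]]]) (intro dfs R(1))
 define L where "L = set_of {z \<in> ext (times R R). ?Q z}"
 have L: "L \<in> U" "ext L = {z \<in> ext (times R R). ?Q z}" unfolding L_def using iL set_of_U ext_set_of by auto
 have le: "le L (pt x) (pt y) \<longleftrightarrow> x \<le> y" if xy: "x \<in> RU" "y \<in> RU" for x y
 proof -
  have m: "pair (pt x) (pt y) \<in> ext (times R R)" unfolding ext_times[OF R(1) R(1)] R(2) using xy by blast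
  have pe: "pt x = u \<and> pt y = v" if "pair (pt x) (pt y) = pair u v" "u \<in> pt ` RU" "v \<in> pt ` RU" for u v
   using that pair_iff pt_U xy by auto
  have "le L (pt x) (pt y) \<longleftrightarrow> (\<exists>u\<in>pt ` RU. \<exists>v\<in>pt ` RU. pair (pt x) (pt y) = pair u v \<and> (\<forall>k. k \<in> rr u --> k \<in> rr v))"
   unfolding le_def L(2) R(2) using m by simp
  also have "\<dots> \<longleftrightarrow> (\<forall>k. k \<in> rr (pt x) --> k \<in> rr (pt y))"
  proof
   assume "\<exists>u\<in>pt ` RU. \<exists>v\<in>pt ` RU. pair (pt x) (pt y) = pair u v \<and> (\<forall>k. k \<in> rr u --> k \<in> rr v)"
   then obtain u v where "u \<in> pt ` RU" "v \<in> pt ` RU" "pair (pt x) (pt y) = pair u v" "\<forall>k. k \<in> rr u --> k \<in> rr v" by (elim bexE conjE)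
   then show "\<forall>k. k \<in> rr (pt x) --> k \<in> rr (pt y)" using pe[of u v] by simp
  next
   assume "\<forall>k. k \<in> rr (pt x) --> k \<in> rr (pt y)"
   then show "\<exists>u\<in>pt ` RU. \<exists>v\<in>pt ` RU. pair (pt x) (pt y) = pair u v \<and> (\<forall>k. k \<in> rr u --> k \<in> rr v)"
    by (intro bexI[where x="pt x"] bexI[where x="pt y"] conjI refl imageI xy)
  qed
  finally have "le L (pt x) (pt y) \<longleftrightarrow> (\<forall>k. k \<in> rr (pt x) --> k \<in> rr (pt y))" .
  then show ?thesis using DD_sub[of x y] rr_pt xy by (simp add: subset_iff)
 qed
 define K where "K = \<lparr>carrier = ext R, monoid.mult = app2 T, one = pt 1, zero = pt 0, add = app2 A\<rparr>"
 have cr: "cring K"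
 proof (rule cringI)
  show "abelian_group K"
  proof (rule abelian_groupI)
   fix x assume "x \<in> carrier K"
   then obtain a where a: "x = pt a" "a \<in> RU" by (auto simp: K_def R(2))
   then show "\<exists>y\<in>carrier K. y \<oplus>\<^bsub>K\<^esub> x = \<zero>\<^bsub>K\<^esub>"
    by (intro bexI[of _ "pt (- a)"]) (simp_all add: K_def R(2) A(3) RU_neg)
  qed (auto simp: K_def R(2) A(3) RU_add RU_0 algebra_simps)
  show "comm_monoid K" by (rule comm_monoidI) (auto simp: K_def R(2) T(3) RU_mul RU_1 algebra_simps)
 qed (auto simp: K_def R(2) A(3) T(3) RU_mul RU_add algebra_simps)
 have fld: "field K"
 proof (rule cring.cring_fieldI[OF cr])
  have "pt a \<in> Units K \<longleftrightarrow> a \<noteq> 0" if a: "a \<in> RU" for a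
  proof
   assume "pt a \<in> Units K"
   then obtain b where "b \<in> RU" "pt (b * a) = pt 1" unfolding Units_def using a by (auto simp: K_def R(2) T(3))
   then show "a \<noteq> 0" using pt_inj[OF RU_mul RU_1] a RU_0 pt_inj by auto
  next
   assume "a \<noteq> 0"
   then show "pt a \<in> Units K" unfolding Units_def using a RU_inv[OF a]
    by (auto simp: K_def R(2) T(3) intro!: bexI[of _ "1 / a"])
  qed
  moreover have "Units K \<subseteq> pt ` RU" unfolding Units_def by (auto simp: K_def R(2))
  moreover have "\<zero>\<^bsub>K\<^esub> = pt 0" "carrier K = pt ` RU" by (simp_all add: K_def R(2))
  ultimately show "Units K = carrier K - {\<zero>\<^bsub>K\<^esub>}" using pt_inj RU_0 by auto
 qed
 have sup: "\<exists>b\<in>ext R. (\<forall>s\<in>ext S. le L s b) \<and> (\<forall>c\<in>ext R. (\<forall>s\<in>ext S. le L s c) --> le L b c)"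
  if S: "S \<in> U" "ext S \<subseteq> ext R" "ext S \<noteq> {}" "b0 \<in> ext R" "\<forall>s\<in>ext S. le L s b0" for S b0
 proof -
  define B where "B = {x \<in> RU. pt x \<in> ext S}"
  have SB: "ext S = pt ` B" unfolding B_def using S(2) R(2) by auto
  have BR: "x \<in> RU" if "x \<in> B" for x using that by (simp add: B_def)
  obtain \<beta> where b: "b0 = pt \<beta>" "\<beta> \<in> RU" using S(4) R(2) by blast
  have ub: "x \<le> \<beta>" if "x \<in> B" for x using S(5) that BR le b SB by auto
  have bd: "bdd_above B" by (rule bdd_aboveI[OF ub])
  have ne: "B \<noteq> {}" using S(3) SB by auto
  have "DD (Sup B) = {k. \<exists>s\<in>ext S. k \<in> rr s}" unfolding SB using less_cSup_iff[OF ne bd] rr_pt BR by auto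
  also have "\<dots> \<in> RR" by (rule Collect_RR) (intro dfs S(1))
  finally have sR: "Sup B \<in> RU" by (simp add: RU_def)
  show ?thesis
   by (rule bexI[of _ "pt (Sup B)"]) (use sR BR cSup_upper[OF _ bd] cSup_least[OF ne] le in \<open>auto simp: SB R(2)\<close>)
 qed
 have "real_field R A T L" unfolding real_field_def
 proof (intro conjI)
  show "\<exists>o'\<in>ext R. \<exists>z'\<in>ext R. field \<lparr>carrier = ext R, monoid.mult = app2 T, one = o', zero = z', add = app2 A\<rparr> \<and>
    (\<forall>x\<in>ext R. \<forall>y\<in>ext R. le L z' x \<and> le L z' y --> le L z' (app2 T x y))"
   by (rule bexI[of _ "pt 1"], rule bexI[of _ "pt 0"])
    (use fld[unfolded K_def] in \<open>auto simp: R(2) RU_0 RU_1 le T(3) RU_mul\<close>)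
  show "\<forall>S\<in>U. ext S \<subseteq> ext R \<and> ext S \<noteq> {} \<and> (\<exists>b\<in>ext R. \<forall>s\<in>ext S. le L s b) -->
    (\<exists>b\<in>ext R. (\<forall>s\<in>ext S. le L s b) \<and> (\<forall>c\<in>ext R. (\<forall>s\<in>ext S. le L s c) --> le L b c))"
   by (intro ballI impI, elim conjE bexE, rule sup)
 qed (use A(2) T(2) L(2) in \<open>auto simp: R(2) le A(3) RU_add pt_inj\<close>)
 then show ?thesis
  by (intro bexI[OF _ R(1)] bexI[OF _ A(1)] bexI[OF _ T(1)] bexI[OF _ L(1)] conjI ballI R(2) le)
qed

end

section \<open>The selection principles of the union\<close>

lemma finite_ev: "finite A ==> (\<And>a. a \<in> A ==> ev (P a)) ==> ev (\<lambda>k. \<forall>a\<in>A. P a k)"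
proof (induction rule: finite_induct)
 case (insert a A)
 then obtain K K' where "\<forall>k. K \<le> k --> P a k" "\<forall>k. K' \<le> k --> (\<forall>a\<in>A. P a k)" unfolding ev_def by blast
 then show ?case unfolding ev_def by (intro exI[of _ "max K K'"]) auto
qed (simp add: ev_def)

lemma evD: "ev P ==> \<exists>k. N \<le> k \<and> P k"
 unfolding ev_def by (metis nat_le_linear)

text \<open>The properties of the pair in the form in which the topology uses them:
  \<open>gXY\<close> and \<open>rZ\<close> serve the selection principles, \<open>co\<close> and
  \<open>gp\<close> the square.\<close>

locale zspace = zcc U E for U :: "'a set" and E :: "'a \<Rightarrow> 'a \<Rightarrow> bool" +
 fixes X Y :: "nat set set" and R L :: 'a
 assumes XR: "X \<subseteq> RR" "Y \<subseteq> RR" and iXY: "inU (rs ` X)" "inU (rs ` Y)" and gXY: "gamR RR X" "gamR RR Y" and rZ: "rothR RR (X \<union> Y)"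
  and co: "\<And>x y B. x \<in> X \<union> Y ==> y \<in> X \<union> Y ==> \<exists>i. B \<le> i \<and> i \<notin> x \<and> i \<notin> y"
  and gp: "\<And>e. e \<in> RR ==> (\<And>n. \<exists>m. enc (n, m) \<in> e) ==> \<exists>x\<in>X. \<exists>y\<in>Y. x \<inter> y = {} \<and> gap e x y"
  and RL: "R \<in> U" "L \<in> U" "ext R = pt ` RU" and leL: "\<And>x y. x \<in> RU ==> y \<in> RU ==> le L (pt x) (pt y) \<longleftrightarrow> x \<le> y"
begin

definition Z :: "nat set set" where "Z = X \<union> Y"
definition pi :: "nat set \<Rightarrow> 'a" where "pi x = rs (phi x)"
definition Zs :: 'a where "Zs = set_of (rs ` Z)"
definition Xs :: 'a where "Xs = set_of (pi ` Z)"
definition tau :: 'a where "tau = subspace_topology (real_topology R L) Xs"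

lemma ZR: "x \<in> Z ==> x \<in> RR" using XR by (auto simp: Z_def)
lemma Zs: "Zs \<in> U" "ext Zs = rs ` Z"
proof -
 have "inU (rs ` Z)" unfolding Z_def image_Un by (rule inU_Un[OF iXY])
 then show "Zs \<in> U" "ext Zs = rs ` Z" unfolding Zs_def by (simp_all add: set_of_U ext_set_of)
qed
lemma ex_Zs: "(\<exists>z\<in>ext Zs. P (rr z)) \<longleftrightarrow> (\<exists>x\<in>Z. P x)" and all_Zs: "(\<forall>z\<in>ext Zs. P (rr z)) \<longleftrightarrow> (\<forall>x\<in>Z. P x)"
 unfolding Zs using ZR by auto
lemma pi_pt: "x \<in> Z ==> pi x = pt (rho x)" by (simp add: pi_def pt_def phi)
lemma rhoU: "x \<in> Z ==> rho x \<in> RU" using RU_rho ZR by blast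
lemma pi_U: "x \<in> Z ==> pi x \<in> U" using pi_pt rhoU pt_U by simp
lemma pi_R: "x \<in> Z ==> pi x \<in> ext R" using pi_pt rhoU RL by auto
lemma pi_inj: assumes "x \<in> Z" "y \<in> Z" shows "pi x = pi y \<longleftrightarrow> x = y"
proof
 assume "pi x = pi y"
 then have "rho x = rho y" using pi_pt pt_inj rhoU assms by metis
 then have "\<bar>rho x - rho y\<bar> < (1 / 3) ^ m / 2" for m by simp
 then have "i \<in> x \<longleftrightarrow> i \<in> y" for i using rho_far[of x y "Suc i" i] by blast
 then show "x = y" by blast
qed simp

lemma Xs: "Xs \<in> U" "ext Xs = pi ` Z"
proof -
 have "inU (pi ` Z)"
 proof (rule inU_subI[OF inU_ext[OF RL(1)], where Q="\<lambda>u. \<exists>z\<in>ext Zs. u = rs (phi (rr z))"])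
  show "df (\<lambda>e. \<exists>z\<in>ext Zs. e 0 = rs (phi (rr z)))" by (intro dfs Zs dr_phi)
  show "(u \<in> pi ` Z) = (\<exists>z\<in>ext Zs. u = rs (phi (rr z)))" for u unfolding ex_Zs[of "\<lambda>x. u = rs (phi x)"] pi_def by blast
 qed (use pi_R in blast)
 then show "Xs \<in> U" "ext Xs = pi ` Z" unfolding Xs_def by (simp_all add: set_of_U ext_set_of)
qed

lemma less_pt: "x \<in> RU ==> y \<in> RU ==> less L (pt x) (pt y) \<longleftrightarrow> x < y"
 by (auto simp: less_def leL pt_inj)
lemma df_lessL: "dt s ==> dt t ==> df (\<lambda>e. less L (s e) (t e))"
 unfolding less_def le_def by (intro dfs RL)

lemma RT: "real_topology R L \<in> U" "ext (real_topology R L) = {V \<in> U. ext V \<subseteq> ext R \<and> (\<forall>x\<in>ext V. \<exists>a\<in>ext R. \<exists>b\<in>ext R. less L a x \<and> less L x b \<and>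
    (\<forall>y\<in>ext R. less L a y \<and> less L y b --> y \<in> ext V))}" (is "_ = ?S")
proof -
 have "inU ?S"
  by (rule inU_subI[OF inU_ext[OF power_U[OF RL(1)]], where Q="\<lambda>V. \<forall>x\<in>ext V. \<exists>a\<in>ext R. \<exists>b\<in>ext R. less L a x \<and> less L x b \<and>
    (\<forall>y\<in>ext R. less L a y \<and> less L y b --> y \<in> ext V)"]) (auto simp: ext_power RL(1) intro!: dfs RL df_lessL)
 then show "real_topology R L \<in> U" "ext (real_topology R L) = ?S" unfolding real_topology_def by (simp_all add: set_of_U ext_set_of)
qed

lemma tau0: "tau \<in> U" "ext tau = {V \<in> U. \<exists>W\<in>ext (real_topology R L). ext V = ext W \<inter> ext Xs}" (is "_ = ?S")
proof -
 have "inU ?S"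
 proof (rule inU_subI[OF inU_ext[OF power_U[OF Xs(1)]], where Q="\<lambda>V. \<exists>W\<in>ext (real_topology R L). \<forall>u\<in>ext Xs. u \<in> ext V \<longleftrightarrow> u \<in> ext W"])
  show "df (\<lambda>e. \<exists>W\<in>ext (real_topology R L). \<forall>u\<in>ext Xs. (u \<in> ext (e 0)) = (u \<in> ext W))" by (intro dfs RT(1) Xs(1))
  fix V assume "V \<in> ext (power Xs)"
  then have V: "V \<in> U" "ext V \<subseteq> ext Xs" by (auto simp: ext_power Xs(1))
  have "ext V = ext W \<inter> ext Xs \<longleftrightarrow> (\<forall>u\<in>ext Xs. u \<in> ext V \<longleftrightarrow> u \<in> ext W)" for W using V(2) by blast
  then show "(V \<in> ?S) = (\<exists>W\<in>ext (real_topology R L). \<forall>u\<in>ext Xs. u \<in> ext V \<longleftrightarrow> u \<in> ext W)" using V(1) by simp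
 qed (auto simp: ext_power Xs(1))
 then show "tau \<in> U" "ext tau = ?S" unfolding tau_def subspace_topology_def by (simp_all add: set_of_U ext_set_of)
qed

text \<open>\<open>nb x K\<close> makes \<open>K\<close> a neighbourhood of \<open>x\<close> in the
  Cantor topology on \<open>Z\<close>; \<open>tv V\<close> is the preimage of \<open>V\<close> under
  the embedding \<open>pi\<close>.\<close>

definition nb :: "nat set \<Rightarrow> nat set set \<Rightarrow> bool" where
 "nb x K \<longleftrightarrow> (\<exists>m. \<forall>y\<in>Z. (\<forall>i<m. i \<in> x \<longleftrightarrow> i \<in> y) --> y \<in> K)"
definition tv :: "'a \<Rightarrow> nat set set" where "tv V = {x \<in> Z. pi x \<in> ext V}"

text \<open>The embedding is a homeomorphism onto its image: \<open>rho_close\<close> gives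
  continuity and \<open>rho_far\<close> continuity of the inverse. All later topology can thus take
  place on \<open>Z\<close>.\<close>

lemma tau_iff: "V \<in> ext tau \<longleftrightarrow> V \<in> U \<and> ext V \<subseteq> pi ` Z \<and> (\<forall>x\<in>tv V. nb x (tv V))"
proof (intro iffI conjI ballI)
 assume "V \<in> ext tau"
 then obtain W where W: "V \<in> U" "W \<in> ext (real_topology R L)" "ext V = ext W \<inter> pi ` Z" unfolding tau0 Xs by blast
 then show "V \<in> U" "ext V \<subseteq> pi ` Z" by auto
 fix x assume "x \<in> tv V"
 then have x: "x \<in> Z" "pi x \<in> ext W" using W(3) by (auto simp: tv_def)
 obtain a b where ab: "a \<in> RU" "b \<in> RU" "less L (pt a) (pi x)" "less L (pi x) (pt b)"
   "\<forall>y\<in>ext R. less L (pt a) y \<and> less L y (pt b) --> y \<in> ext W" using W(2) x(2) unfolding RT RL(3) by blast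
 have lt: "a < rho x" "rho x < b" using ab less_pt rhoU x pi_pt by simp_all
 obtain m where m: "(1 / 3 :: real) ^ m < min (rho x - a) (b - rho x)" using real_arch_pow_inv[of "min (rho x - a) (b - rho x)" "1 / 3"] lt by auto
 have "y \<in> tv V" if y: "y \<in> Z" "\<forall>i<m. i \<in> x \<longleftrightarrow> i \<in> y" for y
 proof -
  have "\<bar>rho x - rho y\<bar> \<le> (1 / 3) ^ m" by (rule rho_close) (use y in blast)
  then have "a < rho y" "rho y < b" using m by linarith+
  then have "less L (pt a) (pi y)" "less L (pi y) (pt b)" using less_pt ab rhoU y pi_pt by simp_all
  then have "pi y \<in> ext W" using ab(5) pi_R[OF y(1)] by blast
  then show ?thesis using W(3) y(1) by (simp add: tv_def)
 qed
 then show "nb x (tv V)" unfolding nb_def by blast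
next
 assume V: "V \<in> U \<and> ext V \<subseteq> pi ` Z \<and> (\<forall>x\<in>tv V. nb x (tv V))"
 \<comment> \<open>\<open>W\<close> is the largest open set of the line whose trace is contained in
   \<open>V\<close>, a union of intervals.\<close>
 let ?Q = "\<lambda>u. \<exists>a\<in>ext R. \<exists>b\<in>ext R. less L a u \<and> less L u b \<and> (\<forall>y\<in>ext Xs. less L a y \<and> less L y b --> y \<in> ext V)"
 have i: "inU {u \<in> ext R. ?Q u}" by (rule sepI[OF inU_ext[OF RL(1)]]) (intro dfs RL df_lessL Xs conjunct1[OF V])
 define W where "W = set_of {u \<in> ext R. ?Q u}"
 have W: "W \<in> U" "ext W = {u \<in> ext R. ?Q u}" unfolding W_def using set_of_U[OF i] ext_set_of[OF i] by auto
 have "W \<in> ext (real_topology R L)" unfolding RT mem_Collect_eq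
 proof (intro conjI ballI)
  fix x assume "x \<in> ext W"
  then obtain a b where ab: "a \<in> ext R" "b \<in> ext R" "less L a x" "less L x b" "\<forall>y\<in>ext Xs. less L a y \<and> less L y b --> y \<in> ext V" unfolding W(2) by blast
  then have "\<forall>y\<in>ext R. less L a y \<and> less L y b --> y \<in> ext W" unfolding W(2) by blast
  with ab show "\<exists>a\<in>ext R. \<exists>b\<in>ext R. less L a x \<and> less L x b \<and> (\<forall>y\<in>ext R. less L a y \<and> less L y b --> y \<in> ext W)" by blast
 qed (use W in auto)
 moreover have "pi x \<in> ext W \<longleftrightarrow> pi x \<in> ext V" if x: "x \<in> Z" for x
 proof
  assume "pi x \<in> ext W"
  then show "pi x \<in> ext V" unfolding W(2) Xs(2) using x by blast
 next
  assume "pi x \<in> ext V"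
  then obtain m where m: "\<forall>y\<in>Z. (\<forall>i<m. i \<in> x \<longleftrightarrow> i \<in> y) --> y \<in> tv V" using V x unfolding nb_def tv_def by blast
  let ?d = "(1 / 3 :: real) ^ m / 2"
  have d: "rho x - ?d < rho x" "rho x < rho x + ?d" by simp_all
  obtain k l where kl: "rho x - ?d < qq k" "qq k < rho x" "rho x < qq l" "qq l < rho x + ?d" using qq_dense[OF d(1)] qq_dense[OF d(2)] by blast
  have "pi y \<in> ext V" if y: "y \<in> Z" "less L (pt (qq k)) (pi y)" "less L (pi y) (pt (qq l))" for y
  proof -
   have "qq k < rho y" "rho y < qq l" using y less_pt RU_qq rhoU pi_pt by simp_all
   then have "\<bar>rho x - rho y\<bar> < ?d" using kl by linarith
   then have "\<forall>i<m. i \<in> x \<longleftrightarrow> i \<in> y" using rho_far by blast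
   then show ?thesis using m y(1) by (simp add: tv_def)
  qed
  then show "pi x \<in> ext W" unfolding W(2) mem_Collect_eq
   by (intro conjI pi_R[OF x] bexI[of _ "pt (qq k)"] bexI[of _ "pt (qq l)"])
    (use kl x less_pt RU_qq rhoU pi_pt RL(3) in \<open>auto simp: Xs(2)\<close>)
 qed
 ultimately have "\<exists>W\<in>ext (real_topology R L). ext V = ext W \<inter> pi ` Z" using V by (intro bexI[of _ W]) auto
 then show "V \<in> ext tau" unfolding tau0 Xs using V by blast
qed

lemma clopen_cover: assumes F: "finite F" and K: "\<And>x. x \<in> F ==> nb x K"
 shows "\<exists>v. (\<forall>x\<in>F. cl v x) \<and> (\<forall>y\<in>Z. cl v y --> y \<in> K)"
proof -
 obtain m where m: "\<And>x y. x \<in> F ==> y \<in> Z ==> (\<forall>i<m x. i \<in> x \<longleftrightarrow> i \<in> y) ==> y \<in> K" using K unfolding nb_def by metis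
 let ?v = "set_encode ((\<lambda>x. mkq (m x) x) ` F)"
 have v: "q \<in> set_decode ?v \<longleftrightarrow> (\<exists>x\<in>F. q = mkq (m x) x)" for q by (subst set_encode_inverse) (use F in auto)
 have "agr (mkq (m x) x) x" for x by (simp add: agr_def)
 then have "cl ?v x" if "x \<in> F" for x unfolding cl_def v using that by blast
 moreover have "y \<in> K" if y: "y \<in> Z" "cl ?v y" for y
 proof -
  obtain x where "x \<in> F" "agr (mkq (m x) x) y" using y(2) unfolding cl_def v by blast
  then show ?thesis using m[of x y] y(1) by (auto simp: agr_def)
 qed
 ultimately show ?thesis by blast
qed

definition inc :: "nat \<Rightarrow> 'a \<Rightarrow> bool" where "inc v V \<longleftrightarrow> (\<forall>y\<in>Z. cl v y --> y \<in> tv V)"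

lemma inc_alt: "inc v V = (\<forall>z\<in>ext Zs. cl v (rr z) --> rs (phi (rr z)) \<in> ext V)"
 unfolding all_Zs[of "\<lambda>x. cl v x --> rs (phi x) \<in> ext V"] inc_def tv_def pi_def by blast
lemma df_inc: assumes "dn s" "dt t" shows "df (\<lambda>e. inc (s e) (t e))"
proof -
 have "df (\<lambda>e. inc (nn (e i)) (e j))" for i j unfolding inc_alt by (intro dfs Zs df_cl dr_phi)
 from df_lift2[of "\<lambda>x y. inc (nn x) y", OF this dn_dt[OF assms(1)] assms(2)] show ?thesis by simp
qed
lemma opn_clopen: assumes "V \<in> ext tau" "finite F" "F \<subseteq> tv V" shows "\<exists>v. (\<forall>x\<in>F. cl v x) \<and> inc v V"
 unfolding inc_def by (rule clopen_cover[OF assms(2)]) (use assms(1,3) in \<open>auto simp: tau_iff\<close>)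

lemma seqsD: "s \<in> seqs ==> s \<in> U \<and> (\<forall>n. app s (num n) = ap s (num n))"
 unfolding seqs_def using is_fun_ap by (auto simp: ext_omega)

lemma inU_range: assumes "t \<in> U" "is_fun t omega a" "a \<in> U"
 shows "inU {app t n | n. n \<in> ext omega}" "{app t n | n. n \<in> ext omega} = range (\<lambda>n. ap t (num n))"
proof -
 have a: "app t (num n) = ap t (num n)" "ap t (num n) \<in> ext a" for n using is_fun_ap[OF assms(2) _ assms(3)] by (auto simp: ext_omega)
 show 1: "{app t n | n. n \<in> ext omega} = range (\<lambda>n. ap t (num n))" 
 proof -
  have "{app t n | n. n \<in> ext omega} = app t ` range num" by (auto simp: ext_omega)
  then show ?thesis by (simp add: image_image a(1))
 qed
 have "range (\<lambda>n. ap t (num n)) = {y \<in> ext a. \<exists>n. y = ap t (num n)}" using a(2) by auto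
 then show "inU {app t n | n. n \<in> ext omega}" unfolding 1
  using sepI[OF inU_ext[OF assms(3)], of "\<lambda>y. \<exists>n. y = ap t (num n)"] by (simp add: dfs dt_ap assms(1))
qed

text \<open>Turns definable requirements on the members to be selected into a sequence that is an
  element of the structure.\<close>

lemma select:
 assumes s: "s \<in> U" "\<And>n. ap s (num n) \<in> Op Xs tau" and P: "df (\<lambda>e. P (nn (e 0)) (e (Suc 0)))" and ex: "\<And>n. \<exists>V\<in>ext (ap s (num n)). P n V"
 shows "\<exists>t\<in>seqs. (\<forall>n. app t (num n) = ap t (num n) \<and> ap t (num n) \<in> ext (ap s (num n)) \<and> P n (ap t (num n))) \<and>
  inU {app t n | n. n \<in> ext omega} \<and> {app t n | n. n \<in> ext omega} = range (\<lambda>n. ap t (num n))"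
proof -
 have "\<exists>t\<in>U. is_fun t omega tau \<and> (\<forall>x\<in>ext omega. ap t x \<in> ext tau \<and> (ap t x \<in> ext (ap s x) \<and> P (nn x) (ap t x)) \<and> app t x = ap t x)"
 proof (rule AC[OF omega_U tau0(1), of "\<lambda>x y. y \<in> ext (ap s x) \<and> P (nn x) y"])
  show "df (\<lambda>e. e (Suc 0) \<in> ext (ap s (e 0)) \<and> P (nn (e 0)) (e (Suc 0)))" by (intro dfs dt_ap s(1) P)
  fix x assume "x \<in> ext omega"
  then obtain n where n: "x = num n" by (auto simp: ext_omega)
  have "ext (ap s (num n)) \<subseteq> ext tau" using s(2)[of n] by (auto simp: Op_def)
  then show "\<exists>y\<in>ext tau. y \<in> ext (ap s x) \<and> P (nn x) y" using ex[of n] n by auto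
 qed
 then obtain t where t: "t \<in> U" "is_fun t omega tau" "\<forall>x\<in>ext omega. ap t x \<in> ext tau \<and> (ap t x \<in> ext (ap s x) \<and> P (nn x) (ap t x)) \<and> app t x = ap t x" by blast
 have "t \<in> seqs" unfolding seqs_def using t tau0(1) by blast
 then show ?thesis using inU_range[OF t(1,2) tau0(1)] t(3) by (intro bexI[of _ t]) (auto simp: ext_omega)
qed

lemma Op_range:
 assumes s: "\<And>n. ap s (num n) \<in> Op Xs tau" and t: "\<And>n. f n \<in> ext (ap s (num n))" "inU (range f)" and c: "\<And>x. x \<in> Z ==> \<exists>n. pi x \<in> ext (f n)"
 shows "set_of (range f) \<in> Op Xs tau" "ext (set_of (range f)) = range f"
proof -
 show e: "ext (set_of (range f)) = range f" by (rule ext_set_of[OF t(2)])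
 have ft: "f n \<in> ext tau" and fX: "\<not> ext Xs \<subseteq> ext (f n)" for n using s[of n] t(1)[of n] by (auto simp: Op_def cover_def)
 have "ext (f n) \<subseteq> ext Xs" for n using ft[of n] Xs tau_iff by auto
 moreover have "u \<in> (\<Union>n. ext (f n))" if "u \<in> ext Xs" for u using that c unfolding Xs by auto
 ultimately have "ext Xs = (\<Union>n. ext (f n))" by blast
 then show "set_of (range f) \<in> Op Xs tau" unfolding Op_def cover_def using ft fX set_of_U[OF t(2)] e by auto
qed

text \<open>The clopen sets contained in members of the n-th cover form row \<open>n\<close> of a
  coded cover sequence; the codes selected by \<open>rZ\<close> are then turned back into
  members.\<close>

theorem Omega_Omega: "S1 (Omega Xs tau) (Omega Xs tau)"
 unfolding S1_def
proof (intro ballI impI)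
 fix s assume s: "s \<in> seqs" and sO: "\<forall>n\<in>ext omega. app s n \<in> Omega Xs tau"
 have sU: "s \<in> U" "\<And>n. app s (num n) = ap s (num n)" using seqsD[OF s] by auto
 have O: "ap s (num n) \<in> Omega Xs tau" for n using sO sU(2) by (auto simp: ext_omega)
 then have Op: "ap s (num n) \<in> Op Xs tau" for n unfolding Omega_def by blast
 define B where "B = {j. \<exists>V\<in>ext (ap s (num (p1 j))). inc (p2 j) V}"
 have BR: "B \<in> RR" unfolding B_def by (rule Collect_RR) (intro dfs dt_ap sU df_inc)
 have "ocov B Z" unfolding ocov_def
 proof (intro allI impI)
  fix n F assume F: "finite F \<and> F \<subseteq> Z"
  have i: "inU (pi ` F)" by (rule inU_finite) (use F pi_U in auto)
  have "set_of (pi ` F) \<in> U" "ext (set_of (pi ` F)) = pi ` F" using set_of_U[OF i] ext_set_of[OF i] by auto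
  moreover have "fin (set_of (pi ` F))" using fin_iff F calculation by simp
  moreover have "pi ` F \<subseteq> ext Xs" using F Xs by blast
  moreover have "\<forall>A\<in>U. ext A \<subseteq> ext Xs \<and> fin A --> (\<exists>V\<in>ext (ap s (num n)). ext A \<subseteq> ext V)" using O[of n] unfolding Omega_def by simp
  ultimately obtain V where V: "V \<in> ext (ap s (num n))" "pi ` F \<subseteq> ext V" by (metis (no_types))
  have "V \<in> ext tau" using Op[of n] V(1) unfolding Op_def by blast
  then obtain v where "\<forall>x\<in>F. cl v x" "inc v V" using opn_clopen[of V F] F V(2) by (auto simp: tv_def)
  then show "\<exists>v. enc (n, v) \<in> B \<and> (\<forall>x\<in>F. cl v x)" unfolding B_def using V(1) by auto
 qed
 then obtain W where W: "W \<in> RR" "\<forall>k. enc (k, fn W k) \<in> B" "\<forall>F. finite F \<and> F \<subseteq> Z --> (\<exists>k. \<forall>x\<in>F. cl (fn W k) x)"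
  using rZ BR unfolding rothR_def Z_def by blast
 have "\<exists>V\<in>ext (ap s (num n)). inc (fn W n) V" for n using W(2) unfolding B_def by auto
 then have "\<exists>t\<in>seqs. (\<forall>n. app t (num n) = ap t (num n) \<and> ap t (num n) \<in> ext (ap s (num n)) \<and> inc (fn W n) (ap t (num n))) \<and>
  inU {app t n | n. n \<in> ext omega} \<and> {app t n | n. n \<in> ext omega} = range (\<lambda>n. ap t (num n))"
  by (intro select[of s "\<lambda>n V. inc (fn W n) V", OF sU(1) Op] dfs df_inc dn_fn W(1))
 then obtain t where t: "t \<in> seqs"
  "\<forall>n. app t (num n) = ap t (num n) \<and> ap t (num n) \<in> ext (ap s (num n)) \<and> inc (fn W n) (ap t (num n))"
  "inU {app t n | n. n \<in> ext omega}" "{app t n | n. n \<in> ext omega} = range (\<lambda>n. ap t (num n))"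
  by (elim bexE conjE)
 have cov: "\<exists>n. \<forall>x\<in>F. pi x \<in> ext (ap t (num n))" if F: "finite F" "F \<subseteq> Z" for F
 proof -
  obtain k where "\<forall>x\<in>F. cl (fn W k) x" using W(3) F by blast
  then show ?thesis using t(2)[THEN spec[of _ k]] F(2) unfolding inc_def tv_def by blast
 qed
 have cov1: "\<exists>n. pi x \<in> ext (ap t (num n))" if "x \<in> Z" for x using cov[of "{x}"] that by simp
 have C: "set_of (range (\<lambda>n. ap t (num n))) \<in> Op Xs tau" "ext (set_of (range (\<lambda>n. ap t (num n)))) = range (\<lambda>n. ap t (num n))"
  by (rule Op_range[of s "\<lambda>n. ap t (num n)", OF Op conjunct1[OF conjunct2[OF spec[OF t(2)]]] t(3)[unfolded t(4)]], erule cov1)+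
 have "set_of (range (\<lambda>n. ap t (num n))) \<in> Omega Xs tau" unfolding Omega_def mem_Collect_eq
 proof (intro conjI ballI impI)
  show "set_of (range (\<lambda>n. ap t (num n))) \<in> Op Xs tau" by (rule C(1))
  fix A assume A: "A \<in> U" "ext A \<subseteq> ext Xs \<and> fin A"
  let ?F = "{x \<in> Z. pi x \<in> ext A}"
  have "inj_on pi ?F" using pi_inj by (auto simp: inj_on_def)
  moreover have "pi ` ?F \<subseteq> ext A" "finite (ext A)" using fin_iff A by auto
  ultimately have "finite ?F" using finite_imageD finite_subset by blast
  then obtain n where n: "\<forall>x\<in>?F. pi x \<in> ext (ap t (num n))" using cov[of ?F] by blast
  then have "ext A \<subseteq> ext (ap t (num n))" using A(2) unfolding Xs by blast
  then show "\<exists>V\<in>ext (set_of (range (\<lambda>n. ap t (num n)))). ext A \<subseteq> ext V"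
   unfolding C(2) by (rule bexI[of _ "ap t (num n)"]) simp
 qed
 then show "\<exists>t\<in>seqs. (\<forall>n\<in>ext omega. app t n \<in> ext (app s n)) \<and> set_of {app t n |n. n \<in> ext omega} \<in> Omega Xs tau"
  unfolding t(4)[symmetric] using t(2) sU(2) by (intro bexI[OF _ t(1)] conjI) (auto simp: ext_omega)
qed

text \<open>The gamma property for indexed open sets: \<open>u\<close> is the index to be selected
  in row \<open>n\<close>, \<open>Ph\<close> holds the admissible indices, and \<open>I\<close> the
  clopen sets inside the open set with a given index. A clopen code is selected first, and the least
  index that it fits is recovered from it.\<close>

lemma pick:
 assumes g: "gamR RR X'" and I: "I \<in> RR" "Ph \<in> RR"
  and ex: "\<And>n F. finite F ==> F \<subseteq> X' ==> \<exists>u v. enc (n, u) \<in> Ph \<and> enc (enc (n, u), v) \<in> I \<and> (\<forall>x\<in>F. cl v x)"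
 shows "\<exists>W\<in>RR. (\<forall>n. enc (n, fn W n) \<in> Ph) \<and> (\<forall>z\<in>X'. ev (\<lambda>n. \<exists>v. enc (enc (n, fn W n), v) \<in> I \<and> cl v z))"
proof -
 define B where "B = {j. \<exists>u. enc (p1 j, u) \<in> Ph \<and> enc (enc (p1 j, u), p2 j) \<in> I}"
 have "B \<in> RR" unfolding B_def by (rule Collect_RR) (intro dfs I)
 moreover have "ocov B X'" unfolding ocov_def
 proof (intro allI impI)
  fix n F assume F: "finite F \<and> F \<subseteq> X'"
  then obtain u v where "enc (n, u) \<in> Ph" "enc (enc (n, u), v) \<in> I" "\<forall>x\<in>F. cl v x" using ex[of F n] by blast
  then show "\<exists>v. enc (n, v) \<in> B \<and> (\<forall>x\<in>F. cl v x)" unfolding B_def by auto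
 qed
 ultimately obtain V where V: "V \<in> RR" "\<forall>k. enc (k, fn V k) \<in> B" "\<forall>z\<in>X'. ev (\<lambda>k. cl (fn V k) z)" using g unfolding gamR_def by blast
 define g where "g n = (LEAST u. enc (n, u) \<in> Ph \<and> enc (enc (n, u), fn V n) \<in> I)" for n
 have gp: "enc (n, g n) \<in> Ph \<and> enc (enc (n, g n), fn V n) \<in> I" for n
  unfolding g_def by (rule LeastI_ex) (use V(2) in \<open>auto simp: B_def\<close>)
 define W where "W = {j. p2 j = g (p1 j)}"
 have "W \<in> RR" unfolding W_def g_def by (rule Collect_RR) (intro dfs dn_fn I V)
 moreover have "fn W n = g n" for n unfolding W_def by (rule fn_graph2)
 moreover have "ev (\<lambda>n. \<exists>v. enc (enc (n, g n), v) \<in> I \<and> cl v z)" if "z \<in> X'" for z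
  using V(3) that gp unfolding ev_def by blast
 ultimately show ?thesis using gp by (intro bexI[of _ W]) auto
qed

end

section \<open>From tau-covers to gamma-covers on the union\<close>

context zspace begin

lemma Z_ne: "X \<noteq> {}" "Y \<noteq> {}"
proof -
 have "{j. j = j} \<in> RR" by (rule Collect_RR) (intro dfs)
 then have "\<exists>x\<in>X. \<exists>y\<in>Y. x \<inter> y = {} \<and> gap {j. j = j} x y" by (rule gp) simp
 then show "X \<noteq> {}" "Y \<noteq> {}" by blast+
qed

lemma TauD:
 assumes C: "C \<in> Tau Xs tau"
 shows "x \<in> Z ==> infinite {V \<in> ext C. x \<in> tv V}"
  and "x \<in> Z ==> z \<in> Z ==> finite {V \<in> ext C. x \<in> tv V \<and> z \<notin> tv V} \<or> finite {V \<in> ext C. z \<in> tv V \<and> x \<notin> tv V}"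
proof -
 have CU: "C \<in> U" using C by (simp add: Tau_def Op_def)
 have i1: "fin (set_of {V \<in> ext C. pi x \<in> ext V}) \<longleftrightarrow> finite {V \<in> ext C. pi x \<in> ext V}" if "x \<in> Z" for x
 proof -
  have i: "inU {V \<in> ext C. pi x \<in> ext V}" by (rule sepI[OF inU_ext[OF CU]]) (intro dfs pi_U that)
  show ?thesis using fin_iff[OF set_of_U[OF i]] unfolding ext_set_of[OF i] .
 qed
 have i2: "fin (set_of {V \<in> ext C. \<not> (pi x \<in> ext V --> pi z \<in> ext V)}) \<longleftrightarrow> finite {V \<in> ext C. \<not> (pi x \<in> ext V --> pi z \<in> ext V)}" if "x \<in> Z" "z \<in> Z" for x z
 proof -
  have i: "inU {V \<in> ext C. \<not> (pi x \<in> ext V --> pi z \<in> ext V)}" by (rule sepI[OF inU_ext[OF CU]]) (intro dfs pi_U that)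
  show ?thesis using fin_iff[OF set_of_U[OF i]] unfolding ext_set_of[OF i] .
 qed
 have t: "\<forall>x\<in>ext Xs. \<not> fin (set_of {V \<in> ext C. x \<in> ext V})"
  "\<forall>x\<in>ext Xs. \<forall>y\<in>ext Xs. fin (set_of {V \<in> ext C. \<not> (x \<in> ext V --> y \<in> ext V)}) \<or> fin (set_of {V \<in> ext C. \<not> (y \<in> ext V --> x \<in> ext V)})"
  using C unfolding Tau_def by simp_all
 show "infinite {V \<in> ext C. x \<in> tv V}" if "x \<in> Z" using t(1) i1[OF that] that by (simp add: Xs(2) tv_def)
 show "finite {V \<in> ext C. x \<in> tv V \<and> z \<notin> tv V} \<or> finite {V \<in> ext C. z \<in> tv V \<and> x \<notin> tv V}" if h: "x \<in> Z" "z \<in> Z"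
  using t(2)[THEN bspec, THEN bspec, of "pi x" "pi z"] i2[OF h] i2[OF h(2,1)] h by (simp add: Xs(2) tv_def)
qed

text \<open>On a finite set of points the preorder of the tau-cover has a least element
  \<open>x\<close>. Infinitely many members contain \<open>x\<close>, and all but finitely many of
  these contain the other points.\<close>

lemma Tau_omega: assumes C: "C \<in> Tau Xs tau" and F: "finite F" "F \<subseteq> Z" shows "\<exists>V\<in>ext C. F \<subseteq> tv V"
proof -
 have main: "\<exists>V\<in>ext C. F \<subseteq> tv V" if F: "finite F" "F \<noteq> {}" "F \<subseteq> Z" for F
 proof -
  let ?S = "\<lambda>x y. {V \<in> ext C. x \<in> tv V \<and> y \<notin> tv V}"
  have "\<exists>x\<in>F. \<forall>y\<in>F. finite (?S x y)" using F
  proof (induction rule: finite_ne_induct)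
   case (insert y F)
   then obtain x where x: "x \<in> F" "\<forall>y\<in>F. finite (?S x y)" by auto
   show ?case
   proof (cases "finite (?S x y)")
    case True with x show ?thesis by (intro bexI[of _ x]) auto
   next
    case False
    then have f: "finite (?S y x)" using TauD(2)[OF C, of x y] insert.prems x(1) by blast
    have "finite (?S y z)" if "z \<in> F" for z
     by (rule finite_subset[OF _ finite_UnI[OF f x(2)[THEN bspec, OF that]]]) blast
    then show ?thesis by (intro bexI[of _ y]) auto
   qed
  qed auto
  then obtain x where x: "x \<in> F" "\<forall>y\<in>F. finite (?S x y)" by blast
  have "finite (\<Union>y\<in>F. ?S x y)" using x(2) F(1) by blast
  moreover have "infinite {V \<in> ext C. x \<in> tv V}" using TauD(1)[OF C] x(1) F(3) by blast
  ultimately have "\<not> {V \<in> ext C. x \<in> tv V} \<subseteq> (\<Union>y\<in>F. ?S x y)" using finite_subset by blast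
  then show ?thesis by blast
 qed
 obtain x where "x \<in> Z" using Z_ne by (auto simp: Z_def)
 then show ?thesis using main[of "insert x F"] F by auto
qed

theorem Tau_Gamma: "S1 (Tau Xs tau) (Gamma Xs tau)"
 unfolding S1_def
proof (intro ballI impI)
 fix s assume s: "s \<in> seqs" and sO: "\<forall>n\<in>ext omega. app s n \<in> Tau Xs tau"
 have sU: "s \<in> U" "\<And>n. app s (num n) = ap s (num n)" using seqsD[OF s] by auto
 have Ta: "ap s (num n) \<in> Tau Xs tau" for n using sO sU(2) by (auto simp: ext_omega)
 then have Op: "ap s (num n) \<in> Op Xs tau" for n unfolding Tau_def by blast
 have st: "V \<in> ext tau" and sX: "\<exists>z\<in>Z. z \<notin> tv V" if "V \<in> ext (ap s (num n))" for V n
  using Op[of n] that Xs(2) by (auto simp: Op_def cover_def tv_def)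
 text \<open>A countable subfamily of each cover, indexed by codes of clopen sets.\<close>
 let ?Q = "\<lambda>x y. y \<in> ext (ap s (num (p1 (nn x)))) \<and> ((\<exists>V\<in>ext (ap s (num (p1 (nn x)))). inc (p2 (nn x)) V) --> inc (p2 (nn x)) y)"
 have "\<exists>c\<in>U. is_fun c omega tau \<and> (\<forall>x\<in>ext omega. ap c x \<in> ext tau \<and> ?Q x (ap c x) \<and> app c x = ap c x)"
 proof (rule AC[OF omega_U tau0(1), of ?Q])
  show "df (\<lambda>e. ?Q (e 0) (e (Suc 0)))" by (intro dfs dt_ap sU df_inc)
  fix x assume "x \<in> ext omega"
  obtain V where V: "V \<in> ext (ap s (num (p1 (nn x))))" using Tau_omega[OF Ta, of "{}"] by auto
  show "\<exists>y\<in>ext tau. ?Q x y"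
  proof (cases "\<exists>V\<in>ext (ap s (num (p1 (nn x)))). inc (p2 (nn x)) V")
   case True then show ?thesis using st by blast
  next
   case False then show ?thesis using V st by blast
  qed
 qed
 then obtain c where c: "c \<in> U" "\<And>x. x \<in> ext omega ==> ?Q x (ap c x)" by blast
 define cc where "cc i u = ap c (num (enc (i, u)))" for i u
 have ccs: "cc i u \<in> ext (ap s (num i))" and cci: "\<And>V. V \<in> ext (ap s (num i)) ==> inc u V ==> inc u (cc i u)" for i u
  using c(2)[of "num (enc (i, u))"] unfolding cc_def by (auto simp: ext_omega)
 \<comment> \<open>First occurrences only: on \<open>LC\<close> the map from codes to members is
   injective, so that a statement about all but finitely many members becomes one about all but
   finitely many codes.\<close>
 define LC where "LC = {j. inc (p2 j) (cc (p1 j) (p2 j)) \<and> (\<forall>u. u < p2 j --> inc u (cc (p1 j) u) --> cc (p1 j) u \<noteq> cc (p1 j) (p2 j))}"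
 have LCR: "LC \<in> RR" unfolding LC_def cc_def by (rule Collect_RR) (intro dfs df_inc dt_ap c(1))
 have LCi: "enc (i, u) \<in> LC \<longleftrightarrow> inc u (cc i u) \<and> (\<forall>u'. u' < u --> inc u' (cc i u') --> cc i u' \<noteq> cc i u)" for i u
  unfolding LC_def by simp
 have LCinj: "u = u'" if h: "enc (i, u) \<in> LC" "enc (i, u') \<in> LC" "cc i u = cc i u'" for i u u'
  using h unfolding LCi by (metis linorder_neqE_nat)
 have freq: "\<exists>u\<ge>N. enc (i, u) \<in> LC \<and> F \<subseteq> tv (cc i u)" if F: "finite F" "F \<subseteq> Z" for F N i
 proof -
  obtain z where z: "\<And>u. z u \<in> Z \<and> z u \<notin> tv (cc i u)" using sX[OF ccs] by metis
  \<comment> \<open>The added points lie outside the members with codes below \<open>N\<close>;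
    covering them forces the code to be at least \<open>N\<close>.\<close>
  let ?F = "F \<union> z ` {..<N}"
  have F': "finite ?F" "?F \<subseteq> Z" using F z by auto
  obtain V where V: "V \<in> ext (ap s (num i))" "?F \<subseteq> tv V" using Tau_omega[OF Ta F'] by blast
  obtain v where v: "\<forall>x\<in>?F. cl v x" "inc v V" using opn_clopen[OF st[OF V(1)] F'(1) V(2)] by blast
  have iv: "inc v (cc i v)" by (rule cci[OF V(1) v(2)])
  define u where "u = (LEAST u. inc u (cc i u) \<and> cc i u = cc i v)"
  have u: "inc u (cc i u) \<and> cc i u = cc i v" unfolding u_def by (rule LeastI[of _ v]) (use iv in simp)
  have "enc (i, u) \<in> LC" unfolding LCi
  proof (intro conjI allI impI)
   fix u' assume h: "u' < u" "inc u' (cc i u')"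
   have "\<not> (inc u' (cc i u') \<and> cc i u' = cc i v)" using not_less_Least[of u' "\<lambda>u. inc u (cc i u) \<and> cc i u = cc i v"] h(1) unfolding u_def by simp
   then show "cc i u' \<noteq> cc i u" using u h(2) by auto
  qed (rule conjunct1[OF u])
  moreover have sub: "?F \<subseteq> tv (cc i u)" using iv v(1) F'(2) u unfolding inc_def by auto
  moreover have "N \<le> u"
  proof (rule ccontr)
   assume "\<not> N \<le> u"
   then have "z u \<in> ?F" by simp
   then show False using sub z by blast
  qed
  ultimately show ?thesis by blast
 qed
 \<comment> \<open>The preorder that cover \<open>i\<close> induces on the points, restricted to the
   codes in \<open>LC\<close>. The tau-property makes it total.\<close>
 define LE where "LE i x z \<longleftrightarrow> (\<exists>K. \<forall>u. K \<le> u --> enc (i, u) \<in> LC --> pi x \<in> ext (cc i u) --> pi z \<in> ext (cc i u))" for i x z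
 have LEtot: "LE i x z \<or> LE i z x" if xz: "x \<in> Z" "z \<in> Z" for i x z
 proof -
  have "LE i x z" if f: "finite {V \<in> ext (ap s (num i)). x \<in> tv V \<and> z \<notin> tv V}" and xz: "x \<in> Z" "z \<in> Z" for x z
  proof -
   let ?A = "{u. enc (i, u) \<in> LC \<and> x \<in> tv (cc i u) \<and> z \<notin> tv (cc i u)}"
   have "inj_on (cc i) ?A" using LCinj by (auto simp: inj_on_def)
   moreover have "cc i ` ?A \<subseteq> {V \<in> ext (ap s (num i)). x \<in> tv V \<and> z \<notin> tv V}" using ccs by auto
   ultimately have "finite ?A" using f finite_imageD finite_subset by blast
   then obtain K where K: "\<forall>u\<in>?A. u < K" using finite_nat_set_iff_bounded by blast
   have "pi z \<in> ext (cc i u)" if "K \<le> u" "enc (i, u) \<in> LC" "pi x \<in> ext (cc i u)" for u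
   proof (rule ccontr)
    assume "pi z \<notin> ext (cc i u)"
    then have "u \<in> ?A" using that xz by (simp add: tv_def)
    then show False using K that(1) by (meson not_le)
   qed
   then show ?thesis unfolding LE_def by blast
  qed
  then show ?thesis using TauD(2)[OF Ta[of i] xz] xz by blast
 qed
 define I0 where "I0 = {j. inc (p2 j) (ap c (num (p1 j)))}"
 have I0R: "I0 \<in> RR" unfolding I0_def by (rule Collect_RR) (intro dfs df_inc dt_ap c(1))
 have I0: "enc (enc (i, u), v) \<in> I0 \<longleftrightarrow> inc v (cc i u)" for i u v unfolding I0_def cc_def by simp
 have nbc: "nb x (tv (cc i u))" if "x \<in> tv (cc i u)" for x i u using st[OF ccs] that unfolding tau_iff by blast
 \<comment> \<open>A position codes a cover \<open>i\<close> and a number \<open>m\<close>.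
   Requiring the selected code to be at least \<open>m\<close> sends the codes to infinity, as is
   needed to apply \<open>LE\<close>, which ignores finitely many of them.\<close>
 define I1 where "I1 = {j. enc (enc (p1 (p1 (p1 j)), p2 (p1 j)), p2 j) \<in> I0}"
 define P1 where "P1 = {j. enc (p1 (p1 j), p2 j) \<in> LC \<and> p2 (p1 j) \<le> p2 j}"
 have R1: "I1 \<in> RR" "P1 \<in> RR" unfolding I1_def P1_def by (rule Collect_RR, intro dfs I0R LCR)+
 have half: "\<exists>W\<in>RR. (\<forall>i m. enc (i, fn W (enc (i, m))) \<in> LC \<and> m \<le> fn W (enc (i, m))) \<and>
  (\<forall>z\<in>X'. \<forall>i. ev (\<lambda>m. z \<in> tv (cc i (fn W (enc (i, m))))))" if X': "gamR RR X'" "X' \<subseteq> Z" for X'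
 proof -
  have "\<exists>W\<in>RR. (\<forall>n. enc (n, fn W n) \<in> P1) \<and> (\<forall>z\<in>X'. ev (\<lambda>n. \<exists>v. enc (enc (n, fn W n), v) \<in> I1 \<and> cl v z))"
  proof (rule pick[OF X'(1) R1])
   fix n F assume F: "finite F" "F \<subseteq> X'"
   then have FZ: "F \<subseteq> Z" using X'(2) by blast
   obtain u where u: "p2 n \<le> u" "enc (p1 n, u) \<in> LC" "F \<subseteq> tv (cc (p1 n) u)" using freq[OF F(1) FZ] by blast
   obtain v where v: "\<forall>x\<in>F. cl v x" "inc v (cc (p1 n) u)" using opn_clopen[OF st[OF ccs] F(1) u(3)] by blast
   show "\<exists>u v. enc (n, u) \<in> P1 \<and> enc (enc (n, u), v) \<in> I1 \<and> (\<forall>x\<in>F. cl v x)"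
    by (rule exI[of _ u], rule exI[of _ v]) (use u v in \<open>simp add: P1_def I1_def I0\<close>)
  qed
  then obtain W where W: "W \<in> RR" "\<forall>n. enc (n, fn W n) \<in> P1"
   "\<forall>z\<in>X'. ev (\<lambda>n. \<exists>v. enc (enc (n, fn W n), v) \<in> I1 \<and> cl v z)" by (elim bexE conjE)
  have "ev (\<lambda>m. z \<in> tv (cc i (fn W (enc (i, m)))))" if z: "z \<in> X'" for z i
  proof -
   obtain K where K: "\<forall>n. K \<le> n --> (\<exists>v. enc (enc (n, fn W n), v) \<in> I1 \<and> cl v z)" using W(3) z unfolding ev_def by blast
   have "z \<in> tv (cc i (fn W (enc (i, m))))" if "K \<le> m" for m
   proof -
    have "K \<le> enc (i, m)" using that le_prod_encode_2 le_trans by blast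
    with K obtain v where "enc (enc (enc (i, m), fn W (enc (i, m))), v) \<in> I1" "cl v z" by blast
    then show ?thesis using z X'(2) unfolding I1_def by (auto simp: I0 inc_def)
   qed
   then show ?thesis unfolding ev_def by blast
  qed
  moreover have "enc (i, fn W (enc (i, m))) \<in> LC \<and> m \<le> fn W (enc (i, m))" for i m
   using W(2)[THEN spec[of _ "enc (i, m)"]] unfolding P1_def by simp
  ultimately show ?thesis by (intro bexI[OF _ W(1)] conjI) auto
 qed
 have XZ: "X \<subseteq> Z" "Y \<subseteq> Z" by (auto simp: Z_def)
 obtain VX where VX: "VX \<in> RR" "\<forall>i m. enc (i, fn VX (enc (i, m))) \<in> LC \<and> m \<le> fn VX (enc (i, m))"
  "\<forall>z\<in>X. \<forall>i. ev (\<lambda>m. z \<in> tv (cc i (fn VX (enc (i, m)))))" using half[OF gXY(1) XZ(1)] by (elim bexE conjE)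
 obtain VY where VY: "VY \<in> RR" "\<forall>i m. enc (i, fn VY (enc (i, m))) \<in> LC \<and> m \<le> fn VY (enc (i, m))"
  "\<forall>z\<in>Y. \<forall>i. ev (\<lambda>m. z \<in> tv (cc i (fn VY (enc (i, m)))))" using half[OF gXY(2) XZ(2)] by (elim bexE conjE)
 \<comment> \<open>\<open>PX\<close> collects the covers for which \<open>X\<close> is coinitial.
   For any other cover some point is not above any point of \<open>X\<close>; it lies in
   \<open>Y\<close>, and by totality it is below every point of \<open>X\<close>, so
   \<open>Y\<close> is coinitial.\<close>
 define PX where "PX = {i. \<forall>z\<in>ext Zs. \<exists>x\<in>ext (set_of (rs ` X)). LE i (rr x) (rr z)}"
 have PXR: "PX \<in> RR" unfolding PX_def LE_def pi_def cc_def by (rule Collect_RR) (intro dfs dr_phi dt_ap c(1) LCR Zs(1) set_of_U iXY)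
 have PX: "i \<in> PX \<longleftrightarrow> (\<forall>z\<in>Z. \<exists>x\<in>X. LE i x z)" for i
  unfolding PX_def ext_set_of[OF iXY(1)] mem_Collect_eq Zs(2) using XR ZR by (auto simp: subset_iff)
 define Wd where "Wd = {j. p2 j = (if p1 (p1 j) \<in> PX then fn VX (p1 j) else fn VY (p1 j))}"
 have WdR: "Wd \<in> RR"
 proof -
  have 1: "(m = (if b then x else y)) = (if b then m = x else m = y)" for b and m x y :: nat by simp
  show ?thesis unfolding Wd_def 1 by (rule Collect_RR) (intro dfs dn_fn VX(1) VY(1) PXR)
 qed
 define W where "W i m = fn Wd (enc (i, m))" for i m
 have Wif: "W i m = (if i \<in> PX then fn VX (enc (i, m)) else fn VY (enc (i, m)))" for i m
  unfolding W_def Wd_def fn_graph2[of "\<lambda>n. if p1 n \<in> PX then fn VX n else fn VY n"] by simp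
 have WL: "enc (i, W i m) \<in> LC" "m \<le> W i m" for i m unfolding Wif using VX(2) VY(2) by auto
 have gam: "ev (\<lambda>m. z \<in> tv (cc i (W i m)))" if z: "z \<in> Z" for z i
 proof -
  have "\<exists>x\<in>Z. LE i x z \<and> ev (\<lambda>m. x \<in> tv (cc i (W i m)))"
  proof (cases "i \<in> PX")
   case True
   then obtain x where x: "x \<in> X" "LE i x z" using PX z by blast
   have "ev (\<lambda>m. x \<in> tv (cc i (W i m)))" unfolding Wif using True VX(3) x(1) by simp
   then show ?thesis using x XZ by blast
  next
   case False
   then obtain z0 where z0: "z0 \<in> Z" "\<forall>x\<in>X. \<not> LE i x z0" using PX by blast
   have refl: "LE i x x" for x unfolding LE_def by blast
   then have "z0 \<in> Y" using z0 by (auto simp: Z_def)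
   have "\<exists>y\<in>Y. LE i y z"
   proof (cases "z \<in> Y")
    case True then show ?thesis using refl by blast
   next
    case False
    then have "z \<in> X" using z by (auto simp: Z_def)
    then show ?thesis using z0 LEtot[OF z z0(1)] \<open>z0 \<in> Y\<close> by blast
   qed
   then obtain y where y: "y \<in> Y" "LE i y z" by blast
   have "ev (\<lambda>m. y \<in> tv (cc i (W i m)))" unfolding Wif using False VY(3) y(1) by simp
   then show ?thesis using y XZ by blast
  qed
  then obtain x K K' where x: "x \<in> Z" "\<forall>u. K \<le> u --> enc (i, u) \<in> LC --> pi x \<in> ext (cc i u) --> pi z \<in> ext (cc i u)"
   "\<forall>m. K' \<le> m --> x \<in> tv (cc i (W i m))" unfolding LE_def ev_def by (elim bexE conjE exE)
  have "z \<in> tv (cc i (W i m))" if m: "max K K' \<le> m" for m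
  proof -
   have "K \<le> W i m" using WL(2)[of m i] m by simp
   moreover have "pi x \<in> ext (cc i (W i m))" using x(3) m by (simp add: tv_def)
   ultimately show ?thesis using x(2) WL(1) z by (simp add: tv_def)
  qed
  then show ?thesis unfolding ev_def by blast
 qed
 \<comment> \<open>Each cover now has a sequence converging on all of \<open>Z\<close>, and one
   member of each must be selected. The gamma property of \<open>X\<close> gives \<open>Q\<close>
   such that a point of \<open>X\<close> is, for almost all \<open>n\<close>, in the members at
   \<open>Q n\<close> of all covers up to \<open>n\<close> at once. That of \<open>Y\<close> then
   gives \<open>T\<close>, and cover \<open>i\<close> contributes its member at
   \<open>Q (T i)\<close>. Since \<open>i \<le> T i\<close>, the points of \<open>X\<close> are not
   lost.\<close>
 define P2 where "P2 = {j. p1 j \<le> p2 j}"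
 define I2 where "I2 = {j. \<forall>i. i \<le> p1 (p1 j) --> enc (enc (i, fn Wd (enc (i, p2 (p1 j)))), p2 j) \<in> I0}"
 have R2: "I2 \<in> RR" "P2 \<in> RR" unfolding I2_def P2_def by (rule Collect_RR, intro dfs I0R dn_fn WdR)+
 have I2: "enc (enc (n, u), v) \<in> I2 \<longleftrightarrow> (\<forall>i\<le>n. inc v (cc i (W i u)))" for n u v unfolding I2_def W_def by (simp add: I0)
 have "\<exists>Q\<in>RR. (\<forall>n. enc (n, fn Q n) \<in> P2) \<and> (\<forall>z\<in>X. ev (\<lambda>n. \<exists>v. enc (enc (n, fn Q n), v) \<in> I2 \<and> cl v z))"
 proof (rule pick[OF gXY(1) R2])
  fix n F assume F: "finite F" "F \<subseteq> X"
  have "ev (\<lambda>m. \<forall>a\<in>F \<times> {..n}. fst a \<in> tv (cc (snd a) (W (snd a) m)))"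
   by (rule finite_ev) (use F XZ gam in auto)
  then obtain m where m: "n \<le> m" "\<forall>a\<in>F \<times> {..n}. fst a \<in> tv (cc (snd a) (W (snd a) m))" using evD by blast
  have "\<exists>v. (\<forall>x\<in>F. cl v x) \<and> (\<forall>y\<in>Z. cl v y --> y \<in> (\<Inter>i\<le>n. tv (cc i (W i m))))"
  proof (rule clopen_cover[OF F(1)])
   fix x assume x: "x \<in> F"
   have "\<forall>i. \<exists>k. i \<le> n --> (\<forall>y\<in>Z. (\<forall>j<k. j \<in> x \<longleftrightarrow> j \<in> y) --> y \<in> tv (cc i (W i m)))" using m(2) x nbc unfolding nb_def by force
   then obtain k where k: "\<And>i. i \<le> n ==> \<forall>y\<in>Z. (\<forall>j<k i. j \<in> x \<longleftrightarrow> j \<in> y) --> y \<in> tv (cc i (W i m))" by metis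
   have le: "k i \<le> (\<Sum>i\<le>n. k i)" if "i \<le> n" for i using member_le_sum[of i "{..n}" k] that by simp
   show "nb x (\<Inter>i\<le>n. tv (cc i (W i m)))" unfolding nb_def
   proof (rule exI[of _ "\<Sum>i\<le>n. k i"], intro ballI impI INT_I)
    fix y i assume y: "y \<in> Z" "\<forall>j<\<Sum>i\<le>n. k i. j \<in> x \<longleftrightarrow> j \<in> y" "i \<in> {..n}"
    then have "\<forall>j<k i. j \<in> x \<longleftrightarrow> j \<in> y" using le[of i] by auto
    then show "y \<in> tv (cc i (W i m))" using k[of i] y by auto
   qed
  qed
  then obtain v where v: "\<forall>x\<in>F. cl v x" "\<forall>y\<in>Z. cl v y --> y \<in> (\<Inter>i\<le>n. tv (cc i (W i m)))" by blast
  show "\<exists>u v. enc (n, u) \<in> P2 \<and> enc (enc (n, u), v) \<in> I2 \<and> (\<forall>x\<in>F. cl v x)"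
   by (rule exI[of _ m], rule exI[of _ v]) (use m v in \<open>auto simp: P2_def I2 inc_def\<close>)
 qed
 then obtain Q where Q: "Q \<in> RR" "\<forall>n. enc (n, fn Q n) \<in> P2"
  "\<forall>z\<in>X. ev (\<lambda>n. \<exists>v. enc (enc (n, fn Q n), v) \<in> I2 \<and> cl v z)" by (elim bexE conjE)
 have Qle: "n \<le> fn Q n" for n using Q(2) unfolding P2_def by simp
 define I3 where "I3 = {j. enc (enc (p1 (p1 j), fn Wd (enc (p1 (p1 j), fn Q (p2 (p1 j))))), p2 j) \<in> I0}"
 have R3: "I3 \<in> RR" unfolding I3_def by (rule Collect_RR) (intro dfs I0R dn_fn WdR Q(1))
 have I3: "enc (enc (i, u), v) \<in> I3 \<longleftrightarrow> inc v (cc i (W i (fn Q u)))" for i u v unfolding I3_def W_def by (simp add: I0)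
 have "\<exists>T\<in>RR. (\<forall>n. enc (n, fn T n) \<in> P2) \<and> (\<forall>z\<in>Y. ev (\<lambda>n. \<exists>v. enc (enc (n, fn T n), v) \<in> I3 \<and> cl v z))"
 proof (rule pick[OF gXY(2) R3 R2(2)])
  fix i F assume F: "finite F" "F \<subseteq> Y"
  have "ev (\<lambda>m. \<forall>a\<in>F. a \<in> tv (cc i (W i m)))" by (rule finite_ev) (use F XZ gam in auto)
  then obtain K where K: "\<forall>m. K \<le> m --> F \<subseteq> tv (cc i (W i m))" unfolding ev_def by blast
  have sub: "F \<subseteq> tv (cc i (W i (fn Q (i + K))))" using K Qle[of "i + K"] by simp
  obtain v where v: "\<forall>x\<in>F. cl v x" "inc v (cc i (W i (fn Q (i + K))))" using opn_clopen[OF st[OF ccs] F(1) sub] by blast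
  show "\<exists>u v. enc (i, u) \<in> P2 \<and> enc (enc (i, u), v) \<in> I3 \<and> (\<forall>x\<in>F. cl v x)"
   by (rule exI[of _ "i + K"], rule exI[of _ v]) (use v in \<open>simp add: P2_def I3\<close>)
 qed
 then obtain T where T: "T \<in> RR" "\<forall>n. enc (n, fn T n) \<in> P2"
  "\<forall>z\<in>Y. ev (\<lambda>n. \<exists>v. enc (enc (n, fn T n), v) \<in> I3 \<and> cl v z)" by (elim bexE conjE)
 have Tle: "n \<le> fn T n" for n using T(2) unfolding P2_def by simp
 let ?P = "\<lambda>i V. V = ap c (num (enc (i, fn Wd (enc (i, fn Q (fn T i))))))"
 have "\<exists>t\<in>seqs. (\<forall>n. app t (num n) = ap t (num n) \<and> ap t (num n) \<in> ext (ap s (num n)) \<and> ?P n (ap t (num n))) \<and>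
  inU {app t n | n. n \<in> ext omega} \<and> {app t n | n. n \<in> ext omega} = range (\<lambda>n. ap t (num n))"
 proof (rule select[of s ?P, OF sU(1) Op])
  show "df (\<lambda>e. ?P (nn (e 0)) (e (Suc 0)))" by (intro dfs dt_ap c(1) dn_fn WdR Q(1) T(1))
  show "\<exists>V\<in>ext (ap s (num n)). ?P n V" for n using ccs unfolding cc_def by blast
 qed
 then obtain t where t: "t \<in> seqs"
  "\<forall>n. app t (num n) = ap t (num n) \<and> ap t (num n) \<in> ext (ap s (num n)) \<and> ?P n (ap t (num n))"
  "inU {app t n | n. n \<in> ext omega}" "{app t n | n. n \<in> ext omega} = range (\<lambda>n. ap t (num n))" by (elim bexE conjE)
 define f where "f n = ap t (num n)" for n
 have f: "f n \<in> ext (ap s (num n))" "f n = cc n (W n (fn Q (fn T n)))" for n using t(2)[THEN spec[of _ n]] unfolding f_def cc_def W_def by auto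
 have conv: "ev (\<lambda>n. z \<in> tv (f n))" if z: "z \<in> Z" for z
 proof (cases "z \<in> X")
  case True
  then obtain K where K: "\<forall>n. K \<le> n --> (\<exists>v. enc (enc (n, fn Q n), v) \<in> I2 \<and> cl v z)" using Q(3) unfolding ev_def by blast
  have "z \<in> tv (f n)" if "K \<le> n" for n
  proof -
   have "K \<le> fn T n" using that Tle[of n] by simp
   then obtain v where v: "enc (enc (fn T n, fn Q (fn T n)), v) \<in> I2" "cl v z" using K by blast
   then have "inc v (f n)" using Tle[of n] unfolding I2 f by blast
   then show ?thesis using v(2) z unfolding inc_def by blast
  qed
  then show ?thesis unfolding ev_def by blast
 next
  case False
  then have "z \<in> Y" using z by (auto simp: Z_def)
  then obtain K where K: "\<forall>n. K \<le> n --> (\<exists>v. enc (enc (n, fn T n), v) \<in> I3 \<and> cl v z)" using T(3) unfolding ev_def by blast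
  have "z \<in> tv (f n)" if kn: "K \<le> n" for n
  proof -
   obtain v where v: "enc (enc (n, fn T n), v) \<in> I3" "cl v z" using K kn by blast
   then show ?thesis using z unfolding I3 f inc_def by blast
  qed
  then show ?thesis unfolding ev_def by blast
 qed
 have iR: "inU (range f)" using t(3) unfolding t(4) f_def .
 have cov1: "\<exists>n. pi x \<in> ext (f n)" if "x \<in> Z" for x using evD[OF conv[OF that]] unfolding tv_def by blast
 have C: "set_of (range f) \<in> Op Xs tau" "ext (set_of (range f)) = range f"
  by (rule Op_range[of s f, OF Op f(1) iR], erule cov1)+
 \<comment> \<open>With a finite range, choose a point outside each member; some late member would
   contain all these points, its own among them.\<close>
 have "infinite (range f)"
 proof
  assume fin: "finite (range f)"
  obtain x where x: "\<And>V. V \<in> range f ==> x V \<in> Z \<and> x V \<notin> tv V" using sX f(1) by (metis rangeE)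
  have "ev (\<lambda>n. \<forall>V\<in>range f. x V \<in> tv (f n))" by (rule finite_ev[OF fin]) (use conv x in blast)
  then obtain n where "\<forall>V\<in>range f. x V \<in> tv (f n)" using evD by blast
  then show False using x[of "f n"] by blast
 qed
 then have nf: "\<not> fin (set_of (range f))" using fin_iff[OF set_of_U[OF iR]] C(2) by simp
 have "fin (set_of {V \<in> ext (set_of (range f)). u \<notin> ext V})" if u: "u \<in> ext Xs" for u
 proof -
  have "u \<in> U" using u ext_U by blast
  then have i: "inU {V \<in> ext (set_of (range f)). u \<notin> ext V}" by (intro sepI inU_ext set_of_U iR dfs)
  obtain z where z: "z \<in> Z" "u = pi z" using u Xs by blast
  then obtain K where K: "\<forall>n. K \<le> n --> z \<in> tv (f n)" using conv unfolding ev_def by blast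
  have "{V \<in> range f. u \<notin> ext V} \<subseteq> f ` {..<K}"
  proof
   fix V assume "V \<in> {V \<in> range f. u \<notin> ext V}"
   then obtain n where n: "V = f n" "pi z \<notin> ext (f n)" using z by blast
   then have "n < K" using K by (auto simp: tv_def not_le[symmetric])
   then show "V \<in> f ` {..<K}" using n by blast
  qed
  then have "finite {V \<in> range f. u \<notin> ext V}" using finite_subset by blast
  then show ?thesis using fin_iff[OF set_of_U[OF i]] ext_set_of[OF i] C(2) by simp
 qed
 moreover have ts: "\<forall>n\<in>ext omega. app t n \<in> ext (app s n)"
 proof
  fix x assume "x \<in> ext omega"
  then obtain n where "x = num n" by (auto simp: ext_omega)
  then show "app t x \<in> ext (app s x)" using f(1)[of n] t(2)[THEN spec[of _ n]] sU(2)[of n] unfolding f_def by simp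
 qed
 ultimately have "set_of (range f) \<in> Gamma Xs tau" unfolding Gamma_def using C(1) nf by blast
 then show "\<exists>t\<in>seqs. (\<forall>n\<in>ext omega. app t n \<in> ext (app s n)) \<and> set_of {app t n |n. n \<in> ext omega} \<in> Gamma Xs tau"
  using ts unfolding f_def t(4)[symmetric] by (intro bexI[OF _ t(1)] conjI)
qed

end

section \<open>The square and the gaps\<close>

context zspace begin

definition pp :: "nat set \<Rightarrow> nat set \<Rightarrow> 'a" where "pp x y = pair (pi x) (pi y)"
definition PP :: 'a where "PP = times Xs Xs"
definition sq :: 'a where "sq = square_topology Xs tau"

lemma PP: "PP \<in> U" "ext PP = {pp x y | x y. x \<in> Z \<and> y \<in> Z}"
 unfolding PP_def ext_times[OF Xs(1) Xs(1)] Xs(2) pp_def using times_U Xs(1) by auto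
lemma PPI: "x \<in> Z ==> y \<in> Z ==> pp x y \<in> ext PP" unfolding PP by blast
lemma pp_U: "x \<in> Z ==> y \<in> Z ==> pp x y \<in> U" using PPI ext_U by blast
lemma pp_inj: assumes "x \<in> Z" "y \<in> Z" "x' \<in> Z" "y' \<in> Z" shows "pp x y = pp x' y' \<longleftrightarrow> x = x' \<and> y = y'"
 unfolding pp_def using pair_iff[of "pi x" "pi y" "pi x'" "pi y'"] pi_U pi_inj assms by simp

lemma sq: "sq \<in> U" "ext sq = {W \<in> U. ext W \<subseteq> ext PP \<and> (\<forall>x y. pair x y \<in> ext W \<and> x \<in> ext Xs \<and> y \<in> ext Xs -->
    (\<exists>A\<in>ext tau. \<exists>B\<in>ext tau. x \<in> ext A \<and> y \<in> ext B \<and> ext (times A B) \<subseteq> ext W))}" (is "_ = ?S")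
proof -
 let ?Q = "\<lambda>W. \<forall>x\<in>ext Xs. \<forall>y\<in>ext Xs. pair x y \<in> ext W -->
  (\<exists>A\<in>ext tau. \<exists>B\<in>ext tau. x \<in> ext A \<and> y \<in> ext B \<and> (\<forall>a\<in>ext A. \<forall>b\<in>ext B. pair a b \<in> ext W))"
 have e: "ext (times A B) \<subseteq> ext W \<longleftrightarrow> (\<forall>a\<in>ext A. \<forall>b\<in>ext B. pair a b \<in> ext W)" if "A \<in> ext tau" "B \<in> ext tau" for A B W
 proof -
  have "A \<in> U" "B \<in> U" using that ext_U by blast+
  then show ?thesis by (auto simp: ext_times)
 qed
 have "inU ?S"
 proof (rule inU_subI[OF inU_ext[OF power_U[OF PP(1)]], where Q="?Q"])
  show "?S \<subseteq> ext (power PP)" by (auto simp: ext_power PP(1))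
  show "df (\<lambda>e. ?Q (e 0))" by (intro dfs Xs(1) tau0(1))
  fix W assume "W \<in> ext (power PP)"
  then have "W \<in> U" "ext W \<subseteq> ext PP" by (simp_all add: ext_power PP(1))
  then show "(W \<in> ?S) = ?Q W" using e by (simp add: Ball_def Bex_def cong: conj_cong) blast
 qed
 then show "sq \<in> U" "ext sq = ?S" unfolding sq_def square_topology_def PP_def by (simp_all add: set_of_U ext_set_of)
qed

definition Ob :: "nat \<Rightarrow> nat \<Rightarrow> 'a" where
 "Ob n k = set_of {u \<in> ext PP. \<exists>x\<in>ext Zs. \<exists>y\<in>ext Zs. u = pair (rs (phi (rr x))) (rs (phi (rr y))) \<and> (\<exists>i. n \<le> i \<and> i \<le> k \<and> (i \<in> rr x \<longleftrightarrow> i \<in> rr y))}"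

lemma Ob_in: "inU {u \<in> ext PP. \<exists>x\<in>ext Zs. \<exists>y\<in>ext Zs. u = pair (rs (phi (rr x))) (rs (phi (rr y))) \<and> (\<exists>i. n \<le> i \<and> i \<le> k \<and> (i \<in> rr x \<longleftrightarrow> i \<in> rr y))}"
 by (rule sepI[OF inU_ext[OF PP(1)]]) (intro dfs Zs(1) dr_phi)
lemma Ob: "Ob n k \<in> U" "ext (Ob n k) \<subseteq> ext PP"
  "x \<in> Z ==> y \<in> Z ==> pp x y \<in> ext (Ob n k) \<longleftrightarrow> (\<exists>i. n \<le> i \<and> i \<le> k \<and> (i \<in> x \<longleftrightarrow> i \<in> y))"
proof -
 show "Ob n k \<in> U" "ext (Ob n k) \<subseteq> ext PP" unfolding Ob_def ext_set_of[OF Ob_in] using set_of_U[OF Ob_in] by blast+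
 assume xy: "x \<in> Z" "y \<in> Z"
 have "pp x y \<in> ext (Ob n k) \<longleftrightarrow> (\<exists>x'\<in>Z. \<exists>y'\<in>Z. pp x y = pp x' y' \<and> (\<exists>i. n \<le> i \<and> i \<le> k \<and> (i \<in> x' \<longleftrightarrow> i \<in> y')))"
  unfolding Ob_def unfolding ext_set_of[OF Ob_in] unfolding mem_Collect_eq Zs(2) using PPI[OF xy] ZR by (simp add: pp_def pi_def)
 also have "\<dots> \<longleftrightarrow> (\<exists>i. n \<le> i \<and> i \<le> k \<and> (i \<in> x \<longleftrightarrow> i \<in> y))"
 proof
  assume "\<exists>x'\<in>Z. \<exists>y'\<in>Z. pp x y = pp x' y' \<and> (\<exists>i. n \<le> i \<and> i \<le> k \<and> (i \<in> x' \<longleftrightarrow> i \<in> y'))"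
  then obtain x' y' where h: "x' \<in> Z" "y' \<in> Z" "pp x y = pp x' y'" "\<exists>i. n \<le> i \<and> i \<le> k \<and> (i \<in> x' \<longleftrightarrow> i \<in> y')" by (elim bexE conjE)
  then have "x = x'" "y = y'" using pp_inj[OF xy h(1,2)] by simp_all
  then show "\<exists>i. n \<le> i \<and> i \<le> k \<and> (i \<in> x \<longleftrightarrow> i \<in> y)" using h(4) by simp
 next
  assume "\<exists>i. n \<le> i \<and> i \<le> k \<and> (i \<in> x \<longleftrightarrow> i \<in> y)"
  then show "\<exists>x'\<in>Z. \<exists>y'\<in>Z. pp x y = pp x' y' \<and> (\<exists>i. n \<le> i \<and> i \<le> k \<and> (i \<in> x' \<longleftrightarrow> i \<in> y'))"
   by (intro bexI[OF _ xy(1)] bexI[OF _ xy(2)] conjI refl)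
 qed
 finally show "pp x y \<in> ext (Ob n k) \<longleftrightarrow> (\<exists>i. n \<le> i \<and> i \<le> k \<and> (i \<in> x \<longleftrightarrow> i \<in> y))" .
qed

lemma dt_Ob: assumes "dn s" "dn t" shows "dt (\<lambda>e. Ob (s e) (t e))"
proof -
 have "dt (\<lambda>e. Ob (nn (e i)) (nn (e j)))" for i j unfolding Ob_def
  by (rule dt_set_of_eq, rule Ob_in, unfold mem_Collect_eq) (intro dfs Zs(1) PP(1) dr_phi)
 from dt_lift2[of "\<lambda>x y. Ob (nn x) (nn y)", OF this dn_dt[OF assms(1)] dn_dt[OF assms(2)]] show ?thesis by simp
qed

lemma cylinder: "\<exists>A\<in>ext tau. \<forall>z\<in>Z. pi z \<in> ext A \<longleftrightarrow> (i \<in> z \<longleftrightarrow> b)"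
proof -
 have iA: "inU {u \<in> ext Xs. \<exists>z\<in>ext Zs. u = rs (phi (rr z)) \<and> (i \<in> rr z \<longleftrightarrow> b)}"
  by (rule sepI[OF inU_ext[OF Xs(1)]]) (intro dfs Zs(1) dr_phi)
 let ?A = "set_of {u \<in> ext Xs. \<exists>z\<in>ext Zs. u = rs (phi (rr z)) \<and> (i \<in> rr z \<longleftrightarrow> b)}"
 have m: "pi z \<in> ext ?A \<longleftrightarrow> (i \<in> z \<longleftrightarrow> b)" if z: "z \<in> Z" for z
 proof -
  have "pi z \<in> ext ?A \<longleftrightarrow> (\<exists>x\<in>Z. pi z = pi x \<and> (i \<in> x \<longleftrightarrow> b))"
   unfolding ext_set_of[OF iA] unfolding mem_Collect_eq Zs(2) Xs(2) using z ZR by (simp add: pi_def)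
  also have "\<dots> \<longleftrightarrow> (i \<in> z \<longleftrightarrow> b)" using pi_inj z by (metis (no_types))
  finally show ?thesis .
 qed
 have "?A \<in> ext tau" unfolding tau_iff
 proof (intro conjI ballI)
  show "?A \<in> U" by (rule set_of_U[OF iA])
  show "ext ?A \<subseteq> pi ` Z" unfolding ext_set_of[OF iA] unfolding Xs(2) by blast
  fix x assume "x \<in> tv ?A"
  then have x: "x \<in> Z" "i \<in> x \<longleftrightarrow> b" using m by (auto simp: tv_def)
  show "nb x (tv ?A)" unfolding nb_def
  proof (rule exI[of _ "Suc i"], intro ballI impI)
   fix y assume y: "y \<in> Z" "\<forall>j<Suc i. j \<in> x \<longleftrightarrow> j \<in> y"
   then have "i \<in> y \<longleftrightarrow> b" using x by blast
   then show "y \<in> tv ?A" using m[OF y(1)] y(1) unfolding tv_def by blast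
  qed
 qed
 with m show ?thesis by blast
qed

lemma Ob_open: "Ob n k \<in> ext sq"
 unfolding sq mem_Collect_eq
proof (intro conjI allI impI Ob)
 fix u v assume h: "pair u v \<in> ext (Ob n k) \<and> u \<in> ext Xs \<and> v \<in> ext Xs"
 then obtain x y where xy: "x \<in> Z" "y \<in> Z" "u = pi x" "v = pi y" unfolding Xs by blast
 then obtain i where i: "n \<le> i" "i \<le> k" "i \<in> x \<longleftrightarrow> i \<in> y" using h Ob(3)[of x y] unfolding pp_def by blast
 \<comment> \<open>One coordinate on which the two points agree, together with its common value
   there, gives an open box inside the set.\<close>
 obtain A where A: "A \<in> ext tau" "\<And>z. z \<in> Z ==> pi z \<in> ext A \<longleftrightarrow> (i \<in> z \<longleftrightarrow> i \<in> x)" using cylinder[of i "i \<in> x"] by blast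
 have AU: "A \<in> U" "ext A \<subseteq> pi ` Z" using A(1) tau_iff by blast+
 have "ext (times A A) \<subseteq> ext (Ob n k)"
 proof
  fix w assume "w \<in> ext (times A A)"
  then obtain a b where ab: "w = pair a b" "a \<in> ext A" "b \<in> ext A" unfolding ext_times[OF AU(1) AU(1)] by blast
  then obtain a' b' where "a = pi a'" "a' \<in> Z" "b = pi b'" "b' \<in> Z" using AU(2) by blast
  then show "w \<in> ext (Ob n k)" using ab A(2) Ob(3)[of a' b'] i(1,2) unfolding pp_def by blast
 qed
 moreover have "u \<in> ext A" "v \<in> ext A" using A(2)[OF xy(1)] A(2)[OF xy(2)] i(3) xy(3,4) by blast+
 ultimately show "\<exists>A\<in>ext tau. \<exists>B\<in>ext tau. u \<in> ext A \<and> v \<in> ext B \<and> ext (times A B) \<subseteq> ext (Ob n k)" using A(1) by blast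
qed

lemma disj_gap: "x \<inter> y = {} ==> \<forall>i. n \<le> i \<and> i \<le> k --> i \<in> x \<or> i \<in> y ==> \<not> (\<exists>i. n \<le> i \<and> i \<le> k \<and> (i \<in> x \<longleftrightarrow> i \<in> y))"
 by blast

lemma fn_mem: "(\<exists>m. enc (n, m) \<in> e) ==> enc (n, fn e n) \<in> e"
 unfolding fn_def by (rule LeastI_ex)

text \<open>If every \<open>n\<close> had a \<open>k\<close> for which \<open>Ob n k\<close> is the
  whole square, these values would bound a function, and a pair with a gap for it would be missed by
  one of these sets. Beyond the exceptional \<open>n0\<close> the property persists, since
  \<open>Ob n k\<close> shrinks as \<open>n\<close> grows.\<close>

lemma no_finite_subcover: "\<exists>n0. \<forall>n\<ge>n0. \<forall>k. \<exists>x\<in>Z. \<exists>y\<in>Z. pp x y \<notin> ext (Ob n k)"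
proof -
 have sub: "x \<in> Z" "y \<in> Z" if "x \<in> X" "y \<in> Y" for x y using that by (auto simp: Z_def)
 define e where "e = {j. \<forall>u\<in>ext PP. u \<in> ext (Ob (p1 j) (p2 j))}"
 have eR: "e \<in> RR" unfolding e_def by (rule Collect_RR) (intro dfs PP(1) dt_Ob)
 have "\<exists>n. \<forall>k. enc (n, k) \<notin> e"
 proof (rule ccontr)
  assume "\<not> ?thesis"
  then have tot: "\<exists>m. enc (n, m) \<in> e" for n by blast
  obtain x y where xy: "x \<in> X" "y \<in> Y" "x \<inter> y = {}" "gap e x y" using gp[OF eR tot] by blast
  obtain n where n: "\<forall>i. n \<le> i \<and> i \<le> fn e n --> i \<in> x \<or> i \<in> y" using xy(4) unfolding gap_def by blast
  have "pp x y \<in> ext (Ob n (fn e n))" using fn_mem[OF tot[of n]] PPI[OF sub[OF xy(1,2)]] unfolding e_def by simp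
  then show False using Ob(3)[OF sub[OF xy(1,2)]] disj_gap[OF xy(3) n] by simp
 qed
 then obtain n0 where n0: "\<And>k. enc (n0, k) \<notin> e" by blast
 have "\<exists>x\<in>Z. \<exists>y\<in>Z. pp x y \<notin> ext (Ob n k)" if n: "n0 \<le> n" for n k
 proof -
  obtain u where "u \<in> ext PP" "u \<notin> ext (Ob n0 k)" using n0[of k] unfolding e_def by auto
  then obtain x y where xy: "x \<in> Z" "y \<in> Z" "pp x y \<notin> ext (Ob n0 k)" unfolding PP by blast
  then have "pp x y \<notin> ext (Ob n k)" using Ob(3)[OF xy(1,2)] n le_trans by metis
  with xy show ?thesis by blast
 qed
 then show ?thesis by blast
qed

lemma Ob_mono: assumes "j \<le> k" shows "ext (Ob n j) \<subseteq> ext (Ob n k)"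
proof
 fix u assume u: "u \<in> ext (Ob n j)"
 then obtain x y where xy: "u = pp x y" "x \<in> Z" "y \<in> Z" using Ob(2) unfolding PP by blast
 then show "u \<in> ext (Ob n k)" using u Ob(3)[OF xy(2,3)] assms le_trans by metis
qed

text \<open>The sets grow with \<open>k\<close>, so a finite union of them lies in a single
  one.\<close>

lemma Ob_finite: assumes "finite A" "A \<subseteq> range (Ob n)" shows "\<exists>k. (\<Union>V\<in>A. ext V) \<subseteq> ext (Ob n k)"
proof -
 obtain K where K: "finite K" "A = Ob n ` K" using finite_subset_image[OF assms] by blast
 obtain k where "\<forall>j\<in>K. j \<le> k" using K(1) finite_nat_set_iff_bounded_le by blast
 then show ?thesis using Ob_mono K(2) by (intro exI[of _ k]) blast
qed

theorem not_Ufin: "\<not> Ufin_O_Gamma PP sq"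
proof
 assume U0: "Ufin_O_Gamma PP sq"
 obtain n0 where n0: "\<And>n k. n0 \<le> n ==> \<exists>x\<in>Z. \<exists>y\<in>Z. pp x y \<notin> ext (Ob n k)" using no_finite_subcover by blast
 let ?p = "power (power PP)"
 have pU: "power PP \<in> U" "?p \<in> U" using power_U PP(1) by auto
 have Op: "Ob n k \<in> ext (power PP)" for n k using Ob(1,2) by (simp add: ext_power PP(1))
 \<comment> \<open>The covers start at index \<open>n0\<close>, from which on no single
   \<open>Ob n k\<close>, and hence no finite union of them, is the whole square.\<close>
 define F where "F x = set_of {W \<in> ext (power PP). \<exists>k. W = Ob (n0 + nn x) k}" for x
 have iF: "inU {W \<in> ext (power PP). \<exists>k. W = Ob (n0 + nn x) k}" for x
 proof -
  have "inU {W \<in> ext (power PP). \<exists>k. W = Ob m k}" for m by (rule sepI[OF inU_ext[OF pU(1)]]) (intro dfs dt_Ob)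
  then show ?thesis .
 qed
 have FU: "F x \<in> U" "ext (F x) = range (Ob (n0 + nn x))" for x
  unfolding F_def ext_set_of[OF iF] using set_of_U[OF iF] Op by auto
 have dF: "df (\<lambda>e. e 0 = F (e (Suc 0)))" unfolding F_def
  by (intro df_eq dt_var, rule dt_set_of_eq, rule iF, unfold mem_Collect_eq) (intro dfs pU dt_Ob)
 have "F x \<in> ext ?p" for x using FU Op by (auto simp: ext_power pU(1))
 then obtain s where s: "s \<in> U" "is_fun s omega ?p" "\<forall>x\<in>ext omega. app s x = F x \<and> ap s x = F x"
  using graph_fun[OF omega_U pU(2) dF] by blast
 have sn: "app s (num n) \<in> U" "ext (app s (num n)) = range (Ob (n0 + n))" for n using s(3) FU[of "num n"] by (auto simp: ext_omega)
 have cov: "ext PP = (\<Union>V\<in>range (Ob n). ext V)" for n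
 proof
  show "ext PP \<subseteq> (\<Union>V\<in>range (Ob n). ext V)"
  proof
   fix u assume "u \<in> ext PP"
   then obtain x y where xy: "u = pp x y" "x \<in> Z" "y \<in> Z" unfolding PP by blast
   obtain i where "n \<le> i" "i \<notin> x" "i \<notin> y" using co[of x y n] xy(2,3) unfolding Z_def by blast
   then have "u \<in> ext (Ob n i)" using Ob(3)[OF xy(2,3)] xy(1) by blast
   then show "u \<in> (\<Union>V\<in>range (Ob n). ext V)" by blast
  qed
 qed (use Ob(2) in blast)
 have "\<exists>t\<in>seqs. (\<forall>n\<in>ext omega. fin (app t n) \<and> ext (app t n) \<subseteq> ext (app s n)) \<and>
    set_of {set_of (\<Union>V\<in>ext (app t n). ext V) | n. n \<in> ext omega} \<in> Gamma PP sq"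
 proof (rule U0[unfolded Ufin_O_Gamma_def, THEN bspec, THEN mp])
  show "s \<in> seqs" unfolding seqs_def using s pU by blast
  show "\<forall>n\<in>ext omega. app s n \<in> Op PP sq \<and> \<not> (\<exists>F\<in>U. ext F \<subseteq> ext (app s n) \<and> fin F \<and> cover PP F)"
  proof
   fix x assume "x \<in> ext omega"
   then obtain n where n: "x = num n" by (auto simp: ext_omega)
   have bad: "\<not> ext PP \<subseteq> ext (Ob (n0 + n) k)" for k using n0[of "n0 + n" k] PPI by auto
   have "app s x \<in> Op PP sq" unfolding Op_def cover_def n mem_Collect_eq sn(2)
    using sn(1) cov[of "n0 + n"] bad Ob_open by auto
   moreover have False if F: "F \<in> U" "ext F \<subseteq> ext (app s x)" "fin F" "cover PP F" for F
   proof -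
    obtain k where k: "(\<Union>V\<in>ext F. ext V) \<subseteq> ext (Ob (n0 + n) k)" using Ob_finite[of "ext F" "n0 + n"] F(2,3) fin_iff[OF F(1)] unfolding n sn(2) by blast
    have "ext PP = (\<Union>V\<in>ext F. ext V)" using F(4) unfolding cover_def by (rule conjunct1)
    with k bad[of k] show False by simp
   qed
   ultimately show "app s x \<in> Op PP sq \<and> \<not> (\<exists>F\<in>U. ext F \<subseteq> ext (app s x) \<and> fin F \<and> cover PP F)" by blast
  qed
 qed
 then obtain t where t: "t \<in> seqs" "\<forall>n\<in>ext omega. fin (app t n) \<and> ext (app t n) \<subseteq> ext (app s n)"
  "set_of {set_of (\<Union>V\<in>ext (app t n). ext V) | n. n \<in> ext omega} \<in> Gamma PP sq" by blast
 have tU: "t \<in> U" "\<And>n. app t (num n) = ap t (num n)" using seqsD[OF t(1)] by auto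
 define G where "G n = set_of (\<Union>V\<in>ext (ap t (num n)). ext V)" for n
 have iG: "inU (\<Union>V\<in>ext (ap t x). ext V)" for x by (rule inU_UN[OF inU_ext[OF ap_U]])
 have G: "G n \<in> U" "ext (G n) = (\<Union>V\<in>ext (ap t (num n)). ext V)" for n unfolding G_def using set_of_U[OF iG] ext_set_of[OF iG] by auto
 have dG: "dt (\<lambda>e. G (u e))" if "dn u" for u
 proof -
  have "dt (\<lambda>e. G (nn (e i)))" for i unfolding G_def
   by (rule dt_set_of_eq, rule iG, unfold UN_iff) (intro dfs dt_ap tU(1))
  from dt_lift1[of "\<lambda>x. G (nn x)", OF this dn_dt[OF that]] show ?thesis by simp
 qed
 have Gk: "\<exists>k. ext (G n) \<subseteq> ext (Ob (n0 + n) k)" for n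
 proof -
  have "fin (app t (num n))" "ext (app t (num n)) \<subseteq> range (Ob (n0 + n))" using t(2) sn(2) by (auto simp: ext_omega)
  then show ?thesis using Ob_finite[of "ext (ap t (num n))" "n0 + n"] fin_iff[OF ap_U] unfolding tU(2) G(2) by blast
 qed
 then have GP: "G n \<in> ext (power PP)" for n using G(1) Ob(2) by (simp add: ext_power PP(1)) (meson order_trans)
 have "{set_of (\<Union>V\<in>ext (app t n). ext V) | n. n \<in> ext omega} = (\<lambda>n. set_of (\<Union>V\<in>ext (app t n). ext V)) ` range num" by (auto simp: ext_omega)
 then have rG: "{set_of (\<Union>V\<in>ext (app t n). ext V) | n. n \<in> ext omega} = range G" by (simp add: image_image tU(2) G_def)
 have iR: "inU (range G)"
  by (rule inU_subI[OF inU_ext[OF pU(1)], where Q="\<lambda>w. \<exists>n. w = G n"]) (use GP in \<open>auto intro!: dfs dG\<close>)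
 have C: "\<not> fin (set_of (range G))" "\<forall>x\<in>ext PP. fin (set_of {V \<in> range G. x \<notin> ext V})"
  using t(3) unfolding rG Gamma_def mem_Collect_eq ext_set_of[OF iR] by auto
 have inf: "infinite (range G)" using C(1) fin_iff[OF set_of_U[OF iR]] ext_set_of[OF iR] by simp
 text \<open>The bound at \<open>n\<close> refers to a later index at which a new member of the cover occurs.\<close>
 define e where "e = {j. \<exists>l. p1 j \<le> l \<and> (\<forall>m. m < p1 j --> G m \<noteq> G l) \<and> (\<forall>u\<in>ext (G l). u \<in> ext (Ob (n0 + l) (p2 j)))}"
 have eR: "e \<in> RR" unfolding e_def by (rule Collect_RR) (intro dfs dG dt_Ob)
 have tot: "\<exists>k. enc (n, k) \<in> e" for n
 proof -
  have "\<not> range G \<subseteq> G ` {..<n}" using inf finite_subset by blast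
  then obtain l where l: "G l \<notin> G ` {..<n}" by blast
  then have "n \<le> l" by (metis imageI lessThan_iff not_le)
  have new: "\<forall>m. m < n --> G m \<noteq> G l" using l by (metis imageI lessThan_iff)
  obtain k where k: "ext (G l) \<subseteq> ext (Ob (n0 + l) k)" using Gk by blast
  have "enc (n, k) \<in> e" unfolding e_def mem_Collect_eq prod_encode_inverse fst_conv snd_conv
   by (rule exI[of _ l]) (use \<open>n \<le> l\<close> new k in blast)
  then show ?thesis by blast
 qed
 obtain x y where xy: "x \<in> X" "y \<in> Y" "x \<inter> y = {}" "gap e x y" using gp[OF eR tot] by blast
 have xyZ: "x \<in> Z" "y \<in> Z" using xy by (auto simp: Z_def)
 let ?B = "{V \<in> range G. pp x y \<notin> ext V}"
 have iB: "inU ?B" by (rule sepI[OF iR]) (intro dfs pp_U xyZ)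
 have fB: "finite ?B" using C(2)[THEN bspec, OF PPI[OF xyZ]] fin_iff[OF set_of_U[OF iB]] ext_set_of[OF iB] by simp
 have sB: "?B \<subseteq> range G" by blast
 obtain M where M: "finite M" "?B = G ` M" using finite_subset_image[OF fB sB] by (elim exE conjE)
 obtain B where B: "\<forall>m\<in>M. m < B" using M(1) finite_nat_set_iff_bounded by blast
 obtain n where n: "B \<le> n" "\<forall>i. n \<le> i \<and> i \<le> fn e n --> i \<in> x \<or> i \<in> y" using xy(4) unfolding gap_def by blast
 obtain l where l: "n \<le> l" "\<forall>m. m < n --> G m \<noteq> G l" "\<forall>u\<in>ext (G l). u \<in> ext (Ob (n0 + l) (fn e n))"
  using fn_mem[OF tot[of n]] unfolding e_def by auto
 \<comment> \<open>As \<open>l\<close> is at least \<open>n\<close>, the interval from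
   \<open>n0 + l\<close> to \<open>fn e n\<close> is part of the gap, so the pair is missing from
   \<open>G l\<close>.\<close>
 have "\<forall>i. n0 + l \<le> i \<and> i \<le> fn e n --> i \<in> x \<or> i \<in> y" using n(2) l(1) by auto
 then have "pp x y \<notin> ext (Ob (n0 + l) (fn e n))" using Ob(3)[OF xyZ] disj_gap[OF xy(3)] by simp
 \<comment> \<open>Each member that misses the point is some \<open>G m\<close> with
   \<open>m\<close> below \<open>B\<close>, whereas \<open>G l\<close> differs from all
   \<open>G m\<close> with \<open>m\<close> below \<open>n\<close>, and \<open>n\<close> is at least
   \<open>B\<close>.\<close>
 then have "G l \<in> ?B" using l(3) by blast
 then obtain m where "m \<in> M" "G l = G m" using M(2) by blast
 then show False using B n(1) l(2) by (metis less_le_trans)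
qed

end

theorem theorem6p5:
  fixes E :: "'a \<Rightarrow> 'a \<Rightarrow> bool" and M G N :: "'a set" and I :: 'a
  assumes "set_structure.ZFC M E" and "set_structure.CH M E"
    and "I \<in> M" and "\<not> set_structure.ctbl M E I"
    and "set_structure.generic_filter M E (set_structure.cohen_forcing M E I) G"
    and "generic_extension E M G N"
  shows "\<exists>R\<in>N. \<exists>A\<in>N. \<exists>T\<in>N. \<exists>L\<in>N. set_structure.real_field N E R A T L \<and>
    (\<exists>X\<in>N. set_structure.ext N E X \<subseteq> set_structure.ext N E R \<and>
      (let \<tau> = set_structure.subspace_topology N E (set_structure.real_topology N E R L) X in
        set_structure.S1 N E (set_structure.Tau N E X \<tau>) (set_structure.Gamma N E X \<tau>) \<and>
        set_structure.S1 N E (set_structure.Omega N E X \<tau>) (set_structure.Omega N E X \<tau>) \<and>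
        \<not> set_structure.Ufin_O_Gamma N E (set_structure.times N E X X)
            (set_structure.square_topology N E X \<tau>)))"
proof -
 note z = assms(1)[unfolded set_structure.ZFC_def] and ge = assms(6)[unfolded generic_extension_def]
 \<comment> \<open>Well-foundedness in the metatheory is inherited from the extension; the internal
   axiom of foundation would not give it.\<close>
 have wf: "wfp_on M E" by (rule wfp_on_subset[OF conjunct1[OF ge] conjunct1[OF conjunct2[OF conjunct2[OF ge]]]])
 have ax: "set_structure.extensionality M E" "set_structure.pairing M E" "set_structure.union_axiom M E" "set_structure.powerset M E"
  "set_structure.infinity M E" "set_structure.choice M E" "set_structure.separation M E" "set_structure.replacement M E"
  using z by simp_all
 interpret cohen M E I G N
  by unfold_locales (rule wf ax assms)+
 obtain X Y where XY: "X \<subseteq> N.RR" "Y \<subseteq> N.RR" "N.inU (N.rs ` X)" "N.inU (N.rs ` Y)" "gamR N.RR X" "gamR N.RR Y" "rothR N.RR (X \<union> Y)"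
  "\<forall>x\<in>X \<union> Y. \<forall>y\<in>X \<union> Y. \<forall>B. \<exists>i. B \<le> i \<and> i \<notin> x \<and> i \<notin> y"
  "\<forall>e\<in>N.RR. (\<forall>n. \<exists>m. enc (n, m) \<in> e) --> (\<exists>x\<in>X. \<exists>y\<in>Y. x \<inter> y = {} \<and> gap e x y)"
  using N_pair[OF assms(2)] by (elim exE conjE)
 obtain R A T L where R: "R \<in> N" "A \<in> N" "T \<in> N" "L \<in> N" "N.real_field R A T L" "N.ext R = N.pt ` N.RU"
  "\<forall>x\<in>N.RU. \<forall>y\<in>N.RU. N.le L (N.pt x) (N.pt y) \<longleftrightarrow> x \<le> y" using N.reals by (elim bexE conjE)
 interpret S: zspace N E X Y R L
  by unfold_locales (rule XY(1-7) XY(8,9)[rule_format] R(1,4,6) R(7)[rule_format] | assumption)+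
 have sub: "N.ext S.Xs \<subseteq> N.ext R" unfolding S.Xs(2) using S.pi_R by blast
 show ?thesis unfolding Let_def
  by (rule bexI[OF _ R(1)], rule bexI[OF _ R(2)], rule bexI[OF _ R(3)], rule bexI[OF _ R(4)], rule conjI[OF R(5)],
    rule bexI[OF _ S.Xs(1)], intro conjI)
   (rule sub S.Tau_Gamma[unfolded S.tau_def] S.Omega_Omega[unfolded S.tau_def] S.not_Ufin[unfolded S.PP_def S.sq_def S.tau_def])+
qed

end
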